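(* Let $T>0$, let $N\ge 1$ be an integer, let $p>1$ be an integer, put $q=\frac{p}{p-1}$, and let $\frac1p<\alpha\le 1$ and $a,b>0$. Let $V\in C([0,T],\mathbb{R})$ with $V_\infty:=\min_{t\in[0,T]}V(t)>0$, and put $V^\infty:=\max_{t\in[0,T]}V(t)$. Let $F:[0,T]\times\mathbb{R}^N\to\mathbb{R}$ satisfy: (H0) there is $\delta>0$ such that, for a.e. $t\in[0,T]$, $x\mapsto F(t,x)$ is continuously differentiable on $\{|x|\le\delta\}$; $t\mapsto F(t,x)$ is measurable for every $x$ with $|x|\le\delta$; and there exist $h\in C(\mathbb{R}^+,\mathbb{R}^+)$ and $g\in L^1([0,T];\mathbb{R}^+)$ with $|F(t,x)|\le h(|x|)g(t)$ and $|\nabla F(t,x)|\le h(|x|)g(t)$ for all $|x|\le\delta$ and a.e. $t\in[0,T]$; (H1) there exist constants $q_1>p^2$, $q_2\in(p^2,q_1)$, $M_1>0$, $M_2>0$ such that $M_1|x|^{q_1}\le F(t,x)\le M_2|x|^{q_2}$ for all $x\in\mathbb{R}^N$ with $|x|\le\delta$ and a.e. $t\in[0,T]$; (H2) there is $\beta>p^2$ such that $0\le\beta F(t,x)\le(\nabla F(t,x),x)$ for all $x\in\mathbb{R}^N$ with $|x|\le\delta$ and a.e. $t\in[0,T]$. Put $\theta=\min\{\beta,q_2\}$ and define the constants $$D=\begin{cases}\left(\frac{T^{p+1}}{\pi^{p+1}}\cdot\frac{2(p-1)!!}{p!!}\right)^{1/p}, & p\text{ odd},\\[1mm] \left(\frac{T^{p+1}}{\pi^{p}}\cdot\frac{(p-1)!!}{p!!}\right)^{1/p},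 & p\text{ even},\end{cases}\qquad G=\left(\frac{T^{p+1-p\alpha}}{[\Gamma(2-\alpha)]^p(p+1-p\alpha)}\right)^{1/p},$$ $$G_0=\frac{T^{\alpha-\frac1p}}{\Gamma(\alpha)(\alpha q-q+1)^{1/q}}\,G,$$ $$C_*=\left(\frac{1}{p(M_1q_1)^{\frac{p}{q_1-p}}}-\frac{M_1}{(M_1q_1)^{\frac{q_1}{q_1-p}}}\right)\left(\frac{[\max\{1,V^\infty\}]^{1/p}(D^p+G^p)^{1/p}}{T^{\frac1{q_1}-\frac1p}D}\right)^{\frac{pq_1}{q_1-p}},$$ $$\Lambda_1=\max\left\{\frac{V_\infty a^{p-1}\big(\Gamma(\alpha)(\alpha q-q+1)^{\frac1q}G_0\big)^{q_2-p}}{2p^2M_2T^{(\alpha-\frac1p)(q_2-p)}(\delta\min\{1,V_\infty\}D)^{q_2-p}},\ \frac{\frac{1}{bp^2}\Big(a+\frac{b\delta^p}{G_0^p}\max\{1,V^\infty\}(D^p+G^p)\Big)^p}{M_1\frac{\delta^{q_1}}{G_0^{q_1}}T^{1-\frac{q_1}{p}}D^{q_1}}\right\},$$ $$\Lambda_2=\left[a+b[\max\{1,V^\infty\}]^p\frac{\delta^p}{G_0^p}(D^p+G^p)\right]^{q_1(p-1)},$$ $$\Lambda_3=\left(\frac{T^{p\alpha-1}}{[\Gamma(\alpha)(\alpha q-q+1)^{1/q}]^p}\cdot\frac{p^2\theta C_*}{a^{p-1}(\theta-p^2)}\cdot\frac{2^p}{\delta^p}\right)^{\frac{q_1-p}{p-1}}.$$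 Then for every $\lambda>\lambda^*:=\max\{\Lambda_1,\Lambda_2,\Lambda_3\}$ the problem $$\begin{cases}\Big[a+b\int_0^T\big(|{}_0D_t^\alpha u(t)|^p+V(t)|u(t)|^p\big)dt\Big]^{p-1}\big[{}_tD_T^\alpha\phi_p({}_0D_t^\alpha u(t))+V(t)\phi_p(u(t))\big]=\lambda\nabla F(t,u(t)),& \text{a.e. } t\in[0,T],\\ u(0)=u(T)=0\end{cases}$$ has at least one nontrivial weak solution $u_\lambda$, and $$\|u_\lambda\|_V^p\le\frac{p^2\theta}{a^{p-1}(\theta-p^2)}C_*\lambda^{-\frac{p-1}{q_1-p}}\le\frac{p^2\theta}{a^{p-1}(\theta-p^2)}C_*\max\{\Lambda_1,\Lambda_2,\Lambda_3\}^{-\frac{p-1}{q_1-p}},$$ $$\|u_\lambda\|_\infty\le\frac{T^{\alpha-\frac1p}}{\Gamma(\alpha)(\alpha q-q+1)^{1/q}}\left(\frac{p^2\theta}{a^{p-1}(\theta-p^2)}C_*\lambda^{-\frac{p-1}{q_1-p}}\right)^{1/p}\le\frac{T^{\alpha-\frac1p}}{\Gamma(\alpha)(\alpha q-q+1)^{1/q}}\left(\frac{p^2\theta}{a^{p-1}(\theta-p^2)}C_*\max\{\Lambda_1,\Lambda_2,\Lambda_3\}^{-\frac{p-1}{q_1-p}}\right)^{1/p},$$ and $\lim_{\lambda\to\infty}\|u_\lambda\|_V=0=\lim_{\lambda\to\infty}\|u_\lambda\|_\infty$.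
   Context: $\Gamma(z)=\int_0^\infty t^{z-1}e^{-t}dt$. For $0<\gamma<1$ and $f$ on $[0,T]$, the left and right Riemann–Liouville fractional derivatives are ${}_0D_t^\gamma f(t)=\frac{1}{\Gamma(1-\gamma)}\frac{d}{dt}\int_0^t(t-s)^{-\gamma}f(s)ds$ and ${}_tD_T^\gamma f(t)=\frac{-1}{\Gamma(1-\gamma)}\frac{d}{dt}\int_t^T(s-t)^{-\gamma}f(s)ds$; for $\gamma=1$ they are $\frac{d}{dt}$ and $-\frac{d}{dt}$ (applied componentwise to vector functions). $\phi_p(s)=|s|^{p-2}s$ (applied to vectors $y\in\mathbb{R}^N$ as $|y|^{p-2}y$). $E_0^{\alpha,p}$ is the closure of $C_0^\infty([0,T],\mathbb{R}^N)$ under the norm $\|u\|=\big(\int_0^T|{}_0D_t^\alpha u|^pdt+\int_0^T|u|^pdt\big)^{1/p}$. On $E_0^{\alpha,p}$, $\|u\|_V=\big(\int_0^T|{}_0D_t^\alpha u(t)|^pdt+\int_0^TV(t)|u(t)|^pdt\big)^{1/p}$ (an equivalent norm) and $\|u\|_\infty=\max_{t\in[0,T]}|u(t)|$. $\nabla F$ is the gradient in $x$ and $(\cdot,\cdot)$ the Euclidean inner product. A weak solution is $u\in E_0^{\alpha,p}$ (with $|u(t)|\le\delta$ so that the right side is defined) such that for all $v\in E_0^{\alpha,p}$: $(a+b\|u\|_V^p)^{p-1}\int_0^T\big[|{}_0D_t^\alpha u|^{p-2}({}_0D_t^\alpha u,{}_0D_t^\alpha v)+V(t)|u|^{p-2}(u,v)\big]dt=\lambda\int_0^T(\nabla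 F(t,u(t)),v(t))dt$, i.e. a critical point of $I_\lambda(u)=\frac{1}{bp^2}(a+b\|u\|_V^p)^p-\lambda\int_0^TF(t,u)dt-\frac{a^p}{bp^2}$. *)

theory Defs
  imports "HOL-Analysis.Analysis"
begin

fun dfact :: "nat \<Rightarrow> nat" where
  "dfact 0 = 1"
| "dfact (Suc 0) = 1"
| "dfact (Suc (Suc n)) = Suc (Suc n) * dfact n"

fun vderiv_iter :: "nat \<Rightarrow> (real \<Rightarrow> 'a::real_normed_vector) \<Rightarrow> real \<Rightarrow> 'a" where
  "vderiv_iter 0 f = f"
| "vderiv_iter (Suc k) f = (\<lambda>t. vector_derivative (vderiv_iter k f) (at t))"

definition smooth_fun :: "(real \<Rightarrow> 'a::real_normed_vector) \<Rightarrow> bool" where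
  "smooth_fun f \<longleftrightarrow>
     (\<forall>k t. (vderiv_iter k f has_vector_derivative vderiv_iter (Suc k) f t) (at t))"

definition C0inf :: "real \<Rightarrow> (real \<Rightarrow> 'a::real_normed_vector) \<Rightarrow> bool" where
  "C0inf T \<phi> \<longleftrightarrow> smooth_fun \<phi> \<and> \<phi> 0 = 0 \<and> \<phi> T = 0"

definition left_RL :: "real \<Rightarrow> real \<Rightarrow> (real \<Rightarrow> 'a::euclidean_space) \<Rightarrow> real \<Rightarrow> 'a" where
  "left_RL T \<gamma> f t =
     (if \<gamma> = 1 then vector_derivative f (at t within {0..T})
      else (1 / Gamma (1 - \<gamma>)) *\<^sub>R
        vector_derivative (\<lambda>s. integral {0..s} (\<lambda>\<tau>. (s - \<tau>) powr (- \<gamma>) *\<^sub>R f \<tau>))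
          (at t within {0..T}))"

text \<open>in_E T alpha p u w: u belongs to the closure E_0^{alpha,p} of C_0^infinity([0,T],R^N)
  under the norm (int |D u|^p + int |u|^p)^(1/p), and w is (a representative of) its
  left RL fractional derivative of order alpha (the L^p limit of the derivatives of the
  approximating smooth functions).\<close>
definition in_E :: "real \<Rightarrow> real \<Rightarrow> nat \<Rightarrow> (real \<Rightarrow> 'a::euclidean_space) \<Rightarrow> (real \<Rightarrow> 'a) \<Rightarrow> bool" where
  "in_E T \<alpha> p u w \<longleftrightarrow>
     u \<in> borel_measurable (lebesgue_on {0..T}) \<and> w \<in> borel_measurable (lebesgue_on {0..T}) \<and>
     (\<lambda>t. norm (u t) ^ p) integrable_on {0..T} \<and> (\<lambda>t. norm (w t) ^ p) integrable_on {0..T} \<and>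
     (\<exists>\<phi> :: nat \<Rightarrow> real \<Rightarrow> 'a.
        (\<forall>k. C0inf T (\<phi> k)) \<and>
        (\<forall>k. (\<lambda>t. norm (\<phi> k t - u t) ^ p) integrable_on {0..T}) \<and>
        (\<forall>k. (\<lambda>t. norm (left_RL T \<alpha> (\<phi> k) t - w t) ^ p) integrable_on {0..T}) \<and>
        (\<lambda>k. integral {0..T} (\<lambda>t. norm (\<phi> k t - u t) ^ p)) \<longlonglongrightarrow> 0 \<and>
        (\<lambda>k. integral {0..T} (\<lambda>t. norm (left_RL T \<alpha> (\<phi> k) t - w t) ^ p)) \<longlonglongrightarrow> 0)"

text \<open>norm_V^p with w the fractional derivative of u\<close>
definition normVp :: "real \<Rightarrow> (real \<Rightarrow> real) \<Rightarrow> nat \<Rightarrow> (real \<Rightarrow> 'a::euclidean_space) \<Rightarrow> (real \<Rightarrow> 'a) \<Rightarrow> real" where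
  "normVp T V p u w = integral {0..T} (\<lambda>t. norm (w t) ^ p) + integral {0..T} (\<lambda>t. V t * norm (u t) ^ p)"

definition normV :: "real \<Rightarrow> (real \<Rightarrow> real) \<Rightarrow> nat \<Rightarrow> (real \<Rightarrow> 'a::euclidean_space) \<Rightarrow> (real \<Rightarrow> 'a) \<Rightarrow> real" where
  "normV T V p u w = normVp T V p u w powr (1 / real p)"

definition sup_norm :: "real \<Rightarrow> (real \<Rightarrow> 'a::real_normed_vector) \<Rightarrow> real" where
  "sup_norm T u = Sup ((\<lambda>t. norm (u t)) ` {0..T})"

definition weak_sol ::
  "real \<Rightarrow> real \<Rightarrow> nat \<Rightarrow> real \<Rightarrow> real \<Rightarrow> (real \<Rightarrow> real) \<Rightarrow> (real \<Rightarrow> 'a \<Rightarrow> 'a) \<Rightarrow> real \<Rightarrow> real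
     \<Rightarrow> (real \<Rightarrow> 'a::euclidean_space) \<Rightarrow> (real \<Rightarrow> 'a) \<Rightarrow> bool" where
  "weak_sol T \<alpha> p a b V gradF \<delta> lam u w \<longleftrightarrow>
     in_E T \<alpha> p u w \<and> (\<forall>t\<in>{0..T}. norm (u t) \<le> \<delta>) \<and>
     (\<forall>v wv. in_E T \<alpha> p v wv \<longrightarrow>
        (a + b * normVp T V p u w) ^ (p - 1) *
          integral {0..T} (\<lambda>t. norm (w t) ^ (p - 2) * (w t \<bullet> wv t)
                               + V t * norm (u t) ^ (p - 2) * (u t \<bullet> v t))
        = lam * integral {0..T} (\<lambda>t. gradF t (u t) \<bullet> v t))"

definition q_conj :: "nat \<Rightarrow> real" where "q_conj p = real p / (real p - 1)"

definition Dc :: "real \<Rightarrow> nat \<Rightarrow> real" where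
  "Dc T p = (if odd p
     then (T powr (p + 1) / pi powr (p + 1) * (2 * real (dfact (p - 1)) / real (dfact p))) powr (1 / p)
     else (T powr (p + 1) / pi powr p * (real (dfact (p - 1)) / real (dfact p))) powr (1 / p))"

definition Gc :: "real \<Rightarrow> nat \<Rightarrow> real \<Rightarrow> real" where
  "Gc T p \<alpha> = (T powr (p + 1 - p * \<alpha>) / ((Gamma (2 - \<alpha>)) powr p * (p + 1 - p * \<alpha>))) powr (1 / p)"

text \<open>The embedding constant T^(alpha - 1/p) / (Gamma(alpha) (alpha q - q + 1)^(1/q))\<close>
definition Kc :: "real \<Rightarrow> nat \<Rightarrow> real \<Rightarrow> real" where
  "Kc T p \<alpha> = T powr (\<alpha> - 1 / p) / (Gamma \<alpha> * (\<alpha> * q_conj p - q_conj p + 1) powr (1 / q_conj p))"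

definition G0c :: "real \<Rightarrow> nat \<Rightarrow> real \<Rightarrow> real" where
  "G0c T p \<alpha> = Kc T p \<alpha> * Gc T p \<alpha>"

definition Cstar :: "real \<Rightarrow> nat \<Rightarrow> real \<Rightarrow> real \<Rightarrow> real \<Rightarrow> real \<Rightarrow> real" where
  "Cstar T p \<alpha> M1 q1 Vsup =
     (1 / (p * (M1 * q1) powr (p / (q1 - p))) - M1 / (M1 * q1) powr (q1 / (q1 - p)))
     * ((max 1 Vsup) powr (1 / p) * (Dc T p ^ p + Gc T p \<alpha> ^ p) powr (1 / p)
          / (T powr (1 / q1 - 1 / p) * Dc T p)) powr (p * q1 / (q1 - p))"

definition Lambda1 :: "real \<Rightarrow> nat \<Rightarrow> real \<Rightarrow> real \<Rightarrow> real \<Rightarrow> real \<Rightarrow> real \<Rightarrow> real \<Rightarrow> real \<Rightarrow> real \<Rightarrow> real \<Rightarrow> real \<Rightarrow> real" where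
  "Lambda1 T p \<alpha> a b \<delta> M1 M2 q1 q2 Vinf Vsup =
     max (Vinf * a ^ (p - 1) * (Gamma \<alpha> * (\<alpha> * q_conj p - q_conj p + 1) powr (1 / q_conj p) * G0c T p \<alpha>) powr (q2 - p)
            / (2 * p\<^sup>2 * M2 * T powr ((\<alpha> - 1 / p) * (q2 - p)) * (\<delta> * min 1 Vinf * Dc T p) powr (q2 - p)))
         ((1 / (b * p\<^sup>2)) * (a + b * \<delta> ^ p / G0c T p \<alpha> ^ p * max 1 Vsup * (Dc T p ^ p + Gc T p \<alpha> ^ p)) ^ p
            / (M1 * (\<delta> powr q1 / G0c T p \<alpha> powr q1) * T powr (1 - q1 / p) * Dc T p powr q1))"

definition Lambda2 :: "real \<Rightarrow> nat \<Rightarrow> real \<Rightarrow> real \<Rightarrow> real \<Rightarrow> real \<Rightarrow> real \<Rightarrow> real \<Rightarrow> real" where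
  "Lambda2 T p \<alpha> a b \<delta> q1 Vsup =
     (a + b * (max 1 Vsup) ^ p * (\<delta> ^ p / G0c T p \<alpha> ^ p) * (Dc T p ^ p + Gc T p \<alpha> ^ p)) powr (q1 * (p - 1))"

definition Lambda3 :: "real \<Rightarrow> nat \<Rightarrow> real \<Rightarrow> real \<Rightarrow> real \<Rightarrow> real \<Rightarrow> real \<Rightarrow> real \<Rightarrow> real" where
  "Lambda3 T p \<alpha> a \<delta> q1 \<theta> Cs =
     (T powr (p * \<alpha> - 1) / (Gamma \<alpha> * (\<alpha> * q_conj p - q_conj p + 1) powr (1 / q_conj p)) ^ p
       * (p\<^sup>2 * \<theta> * Cs / (a ^ (p - 1) * (\<theta> - p\<^sup>2))) * (2 ^ p / \<delta> ^ p)) powr ((q1 - p) / (p - 1))"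

end

theory Submission
  imports Defs "HOL-Complex_Analysis.Great_Picard" "HOL-Library.Function_Algebras"
begin

text \<open>
  The smooth functions vanishing at the end points form an incomplete normed space under
  \<open>N u = norm of D u in L^p\<close>, and \<open>u = I^\<alpha> D u\<close> with Hoelder's inequality bounds \<open>u\<close> and its
  modulus of continuity by \<open>N u\<close>. Outside the ball of radius \<open>\<delta>\<close> the nonlinearity is replaced by
  \<open>M2 |x|^q2\<close>, so that growth and superlinearity conditions hold globally, with \<open>\<theta> = min \<beta> q2\<close>.

  The energy has the mountain pass geometry: it is positive on a small sphere, and along the ray
  spanned by a sine function it reaches a negative value (\<open>\<lambda> > \<Lambda>1\<close>) without exceeding
  \<open>C_* \<lambda>^(-(p-1)/(q1-p))\<close> (\<open>\<lambda> > \<Lambda>2\<close>). Since the derivative of the energy is uniformly continuous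
  on bounded sets, finitely many explicit deformations of the ray produce almost critical points
  between these two levels; neither completeness nor a gradient flow is needed.
  Superlinearity bounds them; by compactness they converge uniformly along a subsequence, and
  strong monotonicity of the p-Laplacian makes their fractional derivatives Cauchy in \<open>L^p\<close>. The limit
  is a critical point in the completion, and \<open>\<lambda> > \<Lambda>3\<close> forces \<open>|u| \<le> \<delta>/2\<close>, where the modified and
  original nonlinearities agree.
\<close>

section \<open>Mountain passes in incomplete normed spaces\<close>

text \<open>An element of \<open>E_0^{\<alpha>,p}\<close> is only given as a limit: a function
  together with an \<open>L^p\<close> limit of derivatives, which the pointwise operator
  \<open>left_RL\<close> need not return for a nonsmooth function. Hence the variational argument is
  carried out on smooth functions, whose fractional derivative is an honest continuous function, and
  the completion is entered only when limits are taken. The price is that the estimates must be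
  uniform on balls.

  The hypotheses on F hold only for |x| <= \<delta>. They suffice because the level of the pass is
  at most a constant times \<lambda>^(-(p-1)/(q1-p)) and superlinearity turns a small level into a
  small norm. This exponent comes from maximising A s^p/p - B s^q1 with A of order \<lambda>^(1/q1)
  and B of order \<lambda>: \<open>Lambda2\<close> is made to bound the Kirchhoff coefficient on the
  ray by \<lambda>^(1/q1). The threshold p^2 for \<beta> and q2 reflects that the energy grows like
  the p-th power of ||u||_V^p.\<close>

instantiation "fun" :: (type, real_vector) real_vector
begin

definition scaleR_fun :: "real \<Rightarrow> ('a \<Rightarrow> 'b) \<Rightarrow> 'a \<Rightarrow> 'b" where
  "scaleR_fun c f = (\<lambda>x. c *\<^sub>R f x)"

instance
  by standard (simp_all add: scaleR_fun_def fun_eq_iff scaleR_add_right scaleR_add_left)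

end

lemma scaleR_fun_apply [simp]: "(c *\<^sub>R f) x = c *\<^sub>R f x"
  by (simp add: scaleR_fun_def)

text \<open>In the application \<open>S\<close> consists of smooth functions and \<open>N\<close> is
  only a seminorm: it does not see values outside [0,T]. Continuity is required uniformly on balls
  because neither compactness nor completeness of \<open>S\<close> is available to upgrade pointwise
  statements. \<open>J_diff\<close> is one-sided since a descent argument needs only upper bounds on
  \<open>J\<close>.\<close>

locale smooth_functional =
  fixes S :: "'v::real_vector set" and N :: "'v \<Rightarrow> real"
    and J :: "'v \<Rightarrow> real" and J' :: "'v \<Rightarrow> 'v \<Rightarrow> real"
  assumes S: "subspace S"
    and N_tri: "\<And>x y. x \<in> S \<Longrightarrow> y \<in> S \<Longrightarrow> N (x + y) \<le> N x + N y"
    and N_scale: "\<And>x c. x \<in> S \<Longrightarrow> N (c *\<^sub>R x) = \<bar>c\<bar> * N x"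
    and J'_add: "\<And>u x y. u \<in> S \<Longrightarrow> x \<in> S \<Longrightarrow> y \<in> S \<Longrightarrow> J' u (x + y) = J' u x + J' u y"
    and J'_scale: "\<And>u x c. u \<in> S \<Longrightarrow> x \<in> S \<Longrightarrow> J' u (c *\<^sub>R x) = c * J' u x"
    and J_ucont: "\<And>R \<epsilon>. 0 < \<epsilon> \<Longrightarrow> \<exists>\<eta>>0. \<forall>u\<in>S. \<forall>u'\<in>S. N u \<le> R \<longrightarrow> N u' \<le> R \<longrightarrow> N (u - u') \<le> \<eta>
                    \<longrightarrow> \<bar>J u - J u'\<bar> \<le> \<epsilon>"
    and J'_ucont: "\<And>R \<epsilon>. 0 < \<epsilon> \<Longrightarrow> \<exists>\<eta>>0. \<forall>u\<in>S. \<forall>u'\<in>S. \<forall>v\<in>S. N u \<le> R \<longrightarrow> N u' \<le> R \<longrightarrow> N (u - u') \<le> \<eta>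
                    \<longrightarrow> \<bar>J' u v - J' u' v\<bar> \<le> \<epsilon> * N v"
    and J_diff: "\<And>R \<epsilon>. 0 < \<epsilon> \<Longrightarrow> \<exists>\<eta>>0. \<forall>u\<in>S. \<forall>v\<in>S. N u \<le> R \<longrightarrow> N v \<le> \<eta>
                    \<longrightarrow> J (u + v) \<le> J u + J' u v + \<epsilon> * N v"
begin

lemma N_zero [simp]: "N 0 = 0"
  using N_scale[of 0 0] subspace_0[OF S] by simp

lemma N_nonneg: "x \<in> S \<Longrightarrow> 0 \<le> N x"
  using N_tri[of x "(-1) *\<^sub>R x"] N_scale[of x "-1"] subspace_scale[OF S, of x "-1"] by simp

lemma N_sum: "finite I \<Longrightarrow> (\<And>i. i \<in> I \<Longrightarrow> f i \<in> S) \<Longrightarrow> N (\<Sum>i\<in>I. f i) \<le> (\<Sum>i\<in>I. N (f i))"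
proof (induction I rule: finite_induct)
  case (insert i I)
  have "N (f i + (\<Sum>i\<in>I. f i)) \<le> N (f i) + N (\<Sum>i\<in>I. f i)"
    using insert by (intro N_tri subspace_sum[OF S]) auto
  then show ?case using insert by auto
qed simp

lemma J'_zero: "u \<in> S \<Longrightarrow> J' u 0 = 0"
  using J'_scale[of u 0 0] subspace_0[OF S] by simp

lemma J'_sum: "finite I \<Longrightarrow> u \<in> S \<Longrightarrow> (\<And>i. i \<in> I \<Longrightarrow> f i \<in> S) \<Longrightarrow> J' u (\<Sum>i\<in>I. f i) = (\<Sum>i\<in>I. J' u (f i))"
proof (induction I rule: finite_induct)
  case (insert i I)
  have "J' u (f i + (\<Sum>i\<in>I. f i)) = J' u (f i) + J' u (\<Sum>i\<in>I. f i)"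
    using insert by (intro J'_add subspace_sum[OF S]) auto
  then show ?case using insert by auto
qed (simp add: J'_zero)

text \<open>Continuity is spelled out through \<open>N\<close>, since a mere real vector space
  carries no topology.\<close>

definition upath :: "(real \<Rightarrow> 'v) \<Rightarrow> bool" where
  "upath \<gamma> \<longleftrightarrow> (\<forall>s\<in>{0..1}. \<gamma> s \<in> S) \<and>
     (\<forall>e>0. \<exists>d>0. \<forall>s\<in>{0..1}. \<forall>s'\<in>{0..1}. \<bar>s - s'\<bar> < d \<longrightarrow> N (\<gamma> s - \<gamma> s') < e)"

lemma upath_segment:
  assumes "e \<in> S" shows "upath (\<lambda>s. s *\<^sub>R e)"
  unfolding upath_def
proof (intro conjI ballI allI impI)
  fix \<epsilon> :: real assume "0 < \<epsilon>"
  have "N (s *\<^sub>R e - s' *\<^sub>R e) < \<epsilon>" if "\<bar>s - s'\<bar> < \<epsilon> / (N e + 1)" for s s'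
  proof -
    have "N (s *\<^sub>R e - s' *\<^sub>R e) = \<bar>s - s'\<bar> * N e"
      using N_scale[OF assms] by (simp flip: scaleR_diff_left)
    also have "\<dots> \<le> \<bar>s - s'\<bar> * (N e + 1)" by (simp add: mult_left_mono)
    also have "\<dots> < \<epsilon>" using that N_nonneg[OF assms] by (simp add: pos_less_divide_eq)
    finally show ?thesis .
  qed
  then show "\<exists>d>0. \<forall>s\<in>{0..1}. \<forall>s'\<in>{0..1}. \<bar>s - s'\<bar> < d \<longrightarrow> N (s *\<^sub>R e - s' *\<^sub>R e) < \<epsilon>"
    using \<open>0 < \<epsilon>\<close> N_nonneg[OF assms] by (intro exI[of _ "\<epsilon> / (N e + 1)"]) auto
qed (use assms S subspace_scale in auto)

lemma N_cont_on:
  assumes "upath \<gamma>" shows "continuous_on {0..1} (\<lambda>s. N (\<gamma> s))"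
  unfolding continuous_on_iff
proof (intro ballI allI impI)
  fix s e :: real assume s: "s \<in> {0..1}" and e: "0 < e"
  obtain d where d: "d > 0" "\<And>s s'. s \<in> {0..1} \<Longrightarrow> s' \<in> {0..1} \<Longrightarrow> \<bar>s - s'\<bar> < d \<Longrightarrow> N (\<gamma> s - \<gamma> s') < e"
    using assms e unfolding upath_def by blast
  have "dist (N (\<gamma> s')) (N (\<gamma> s)) < e" if "s' \<in> {0..1}" "dist s' s < d" for s'
  proof -
    have in': "\<gamma> s \<in> S" "\<gamma> s' \<in> S" using assms s that by (auto simp: upath_def)
    have *: "N (x - y) < e \<Longrightarrow> x \<in> S \<Longrightarrow> y \<in> S \<Longrightarrow> N x < N y + e" for x y
      using N_tri[of "x - y" y] subspace_diff[OF S] by force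
    have "N (\<gamma> s - \<gamma> s') < e" "N (\<gamma> s' - \<gamma> s) < e"
      using d(2)[OF s that(1)] d(2)[OF that(1) s] that(2) by (auto simp: dist_real_def)
    with *[of "\<gamma> s" "\<gamma> s'"] *[of "\<gamma> s'" "\<gamma> s"] in' show ?thesis by (auto simp: dist_real_def)
  qed
  then show "\<exists>d>0. \<forall>x'\<in>{0..1}. dist x' s < d \<longrightarrow> dist (N (\<gamma> x')) (N (\<gamma> s)) < e" using d(1) by blast
qed

end

section \<open>A piecewise linear partition of unity on the unit interval\<close>

definition ramp :: "real \<Rightarrow> real" where "ramp y = max 0 (min 1 y)"

text \<open>The tent with peak at i/n and half-width 1/n, written as a difference of two shifted
  ramps so that the sum over i telescopes.\<close>

definition hat :: "nat \<Rightarrow> nat \<Rightarrow> real \<Rightarrow> real" where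
  "hat n i s = ramp (real n * s - real i + 1) - ramp (real n * s - real i)"

lemma hat_nonneg: "0 \<le> hat n i s"
  by (auto simp: hat_def ramp_def)

lemma hat_support: "hat n i s \<noteq> 0 \<Longrightarrow> \<bar>real n * s - real i\<bar> < 1"
  by (auto simp: hat_def ramp_def split: if_splits)

lemma hat_sum: assumes "s \<in> {0..1}" shows "(\<Sum>i\<le>n. hat n i s) = 1"
proof -
  have "(\<Sum>i\<le>m. hat n i s) = ramp (real n * s + 1) - ramp (real n * s - real m)" for m
    by (induction m) (auto simp: hat_def algebra_simps)
  moreover have "real n * s \<le> real n * 1" using assms by (intro mult_left_mono) auto
  ultimately show ?thesis using assms by (auto simp: ramp_def)
qed

lemma hat_lipschitz: "\<bar>hat n i s - hat n i s'\<bar> \<le> 2 * real n * \<bar>s - s'\<bar>"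
proof -
  have "\<bar>ramp x - ramp y\<bar> \<le> \<bar>x - y\<bar>" for x y by (auto simp: ramp_def)
  from this[of "real n * s - real i + 1" "real n * s' - real i + 1"] this[of "real n * s - real i" "real n * s' - real i"]
  have "\<bar>hat n i s - hat n i s'\<bar> \<le> 2 * \<bar>real n * s - real n * s'\<bar>"
    unfolding hat_def by (simp only: abs_le_iff) argo
  also have "\<bar>real n * s - real n * s'\<bar> = real n * \<bar>s - s'\<bar>"
    by (simp add: abs_mult flip: right_diff_distrib)
  finally show ?thesis by simp
qed

context smooth_functional
begin

text \<open>Descent directions are chosen at finitely many nodes of the path and glued with hat functions;
  by uniform continuity of \<open>J'\<close> they remain descent directions between the nodes.\<close>

lemma deformation_step:
  assumes \<gamma>: "upath \<gamma>" and R: "\<And>s. s \<in> {0..1} \<Longrightarrow> N (\<gamma> s) \<le> R"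
    and c: "\<And>s. s \<in> {0..1} \<Longrightarrow> J (\<gamma> s) \<le> c" "c \<le> C"
    and steep: "\<And>u. u \<in> S \<Longrightarrow> N u \<le> R \<Longrightarrow> \<rho>1 \<le> J u \<Longrightarrow> J u \<le> C \<Longrightarrow> \<exists>v\<in>S. N v \<le> 1 \<and> J' u v \<le> - \<epsilon>"
    and \<epsilon>: "0 < \<epsilon>" and \<rho>: "\<rho>1 < \<rho>2" and \<eta>: "0 < \<eta>"
    and diff: "\<And>u v. u \<in> S \<Longrightarrow> v \<in> S \<Longrightarrow> N u \<le> R \<Longrightarrow> N v \<le> \<eta> \<Longrightarrow> J (u + v) \<le> J u + J' u v + \<epsilon> / 4 * N v"
    and ends: "J (\<gamma> 0) < \<rho>1" "J (\<gamma> 1) < \<rho>1"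
  shows "\<exists>\<gamma>'. upath \<gamma>' \<and> \<gamma>' 0 = \<gamma> 0 \<and> \<gamma>' 1 = \<gamma> 1 \<and>
           (\<forall>s\<in>{0..1}. N (\<gamma>' s) \<le> N (\<gamma> s) + \<eta> \<and> J (\<gamma>' s) \<le> max \<rho>2 (c - \<eta> * \<epsilon> / 2))"
proof -
  have \<gamma>S: "\<gamma> s \<in> S" if "s \<in> {0..1}" for s using \<gamma> that by (auto simp: upath_def)
  obtain d1 where d1: "d1 > 0" "\<And>u u' v. u \<in> S \<Longrightarrow> u' \<in> S \<Longrightarrow> v \<in> S \<Longrightarrow> N u \<le> R \<Longrightarrow> N u' \<le> R \<Longrightarrow> N (u - u') \<le> d1
      \<Longrightarrow> \<bar>J' u v - J' u' v\<bar> \<le> \<epsilon> / 4 * N v"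
    using J'_ucont[of "\<epsilon> / 4" R] \<epsilon> by auto
  obtain d2 where d2: "d2 > 0" "\<And>u u'. u \<in> S \<Longrightarrow> u' \<in> S \<Longrightarrow> N u \<le> R \<Longrightarrow> N u' \<le> R \<Longrightarrow> N (u - u') \<le> d2
      \<Longrightarrow> \<bar>J u - J u'\<bar> \<le> \<rho>2 - \<rho>1"
    using J_ucont[of "\<rho>2 - \<rho>1" R] \<rho> by auto
  obtain d where d: "d > 0" "\<And>s s'. s \<in> {0..1} \<Longrightarrow> s' \<in> {0..1} \<Longrightarrow> \<bar>s - s'\<bar> < d \<Longrightarrow> N (\<gamma> s - \<gamma> s') < min d1 d2"
    using \<gamma> d1(1) d2(1) unfolding upath_def by (metis min_less_iff_conj)
  obtain n :: nat where n: "n > 0" "1 / real n < d"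
    by (metis d(1) nat_approx_posE zero_less_Suc)
  define p where "p i = real i / real n" for i
  have p01: "p i \<in> {0..1}" if "i \<le> n" for i using that n by (auto simp: p_def)
  \<comment> \<open>At nodes below \<open>\<rho>1\<close> nothing is known about steepness and
    nothing has to be lowered, so these nodes get the zero direction.\<close>
  define act where "act i = (if \<rho>1 \<le> J (\<gamma> (p i)) then 1 else 0::real)" for i
  have "\<exists>v. v \<in> S \<and> N v \<le> act i \<and> J' (\<gamma> (p i)) v \<le> - \<epsilon> * act i \<and> (act i = 0 \<longrightarrow> v = 0)" if "i \<le> n" for i
  proof (cases "\<rho>1 \<le> J (\<gamma> (p i))")
    case True
    then show ?thesis
      using steep[of "\<gamma> (p i)"] \<gamma>S[OF p01[OF that]] R[OF p01[OF that]] c(1)[OF p01[OF that]] c(2) by (auto simp: act_def)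
  next
    case False
    then show ?thesis using subspace_0[OF S] J'_zero[OF \<gamma>S[OF p01[OF that]]]
      by (intro exI[of _ 0]) (auto simp: act_def)
  qed
  then obtain vv where vv: "\<And>i. i \<le> n \<Longrightarrow> vv i \<in> S" "\<And>i. i \<le> n \<Longrightarrow> N (vv i) \<le> act i"
      "\<And>i. i \<le> n \<Longrightarrow> J' (\<gamma> (p i)) (vv i) \<le> - \<epsilon> * act i"
      "\<And>i. i \<le> n \<Longrightarrow> act i = 0 \<Longrightarrow> vv i = 0" by metis
  define v where "v s = (\<Sum>i\<le>n. hat n i s *\<^sub>R vv i)" for s
  \<comment> \<open>The total hat weight of the active nodes: it bounds \<open>N (v s)\<close> from
    above and measures the guaranteed descent.\<close>
  define \<mu> where "\<mu> s = (\<Sum>i\<le>n. hat n i s * act i)" for s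
  have close: "\<bar>s - p i\<bar> < d" if "hat n i s \<noteq> 0" for i s
  proof -
    have "real n * (s - p i) = real n * s - real i"
      using n by (simp add: p_def right_diff_distrib)
    then have "real n * \<bar>s - p i\<bar> = \<bar>real n * s - real i\<bar>"
      by (metis abs_mult abs_of_nat)
    also have "\<dots> < 1" using hat_support[OF that] .
    finally have "\<bar>s - p i\<bar> < 1 / real n" using n(1) by (simp add: field_simps)
    then show ?thesis using n(2) by simp
  qed
  have vS: "v s \<in> S" for s unfolding v_def
    using vv(1) by (intro subspace_sum[OF S] subspace_scale[OF S]) auto
  have Nv: "N (v s) \<le> \<mu> s" for s
  proof -
    have "N (v s) \<le> (\<Sum>i\<le>n. N (hat n i s *\<^sub>R vv i))"
      unfolding v_def using vv(1) by (intro N_sum subspace_scale[OF S]) auto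
    also have "\<dots> = (\<Sum>i\<le>n. hat n i s * N (vv i))"
      using vv(1) by (intro sum.cong) (auto simp: N_scale hat_nonneg)
    also have "\<dots> \<le> \<mu> s" unfolding \<mu>_def using vv(2) hat_nonneg by (intro sum_mono mult_left_mono) auto
    finally show ?thesis .
  qed
  have \<mu>1: "\<mu> s \<le> 1" if "s \<in> {0..1}" for s
  proof -
    have "\<mu> s \<le> (\<Sum>i\<le>n. hat n i s * 1)"
      unfolding \<mu>_def by (intro sum_mono mult_left_mono) (auto simp: hat_nonneg act_def)
    then show ?thesis using hat_sum[OF that] by simp
  qed
  have \<mu>0: "0 \<le> \<mu> s" for s unfolding \<mu>_def by (intro sum_nonneg) (auto simp: hat_nonneg act_def)
  \<comment> \<open>Passing from a node to \<open>s\<close> costs \<epsilon>/4 of the slope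
    \<epsilon>; the remainder in \<open>diff\<close> costs another \<epsilon>/4, which leaves the
    \<epsilon>/2 of the claim.\<close>
  have J'v: "J' (\<gamma> s) (v s) \<le> - (3 / 4 * \<epsilon>) * \<mu> s" if s: "s \<in> {0..1}" for s
  proof -
    have "J' (\<gamma> s) (v s) = (\<Sum>i\<le>n. hat n i s * J' (\<gamma> s) (vv i))"
      unfolding v_def using vv(1) \<gamma>S[OF s]
      by (subst J'_sum) (auto intro!: sum.cong subspace_scale[OF S] simp: J'_scale)
    also have "\<dots> \<le> (\<Sum>i\<le>n. hat n i s * (- (3 / 4 * \<epsilon>) * act i))"
    proof (intro sum_mono)
      fix i assume "i \<in> {..n}" then have i: "i \<le> n" by simp
      show "hat n i s * J' (\<gamma> s) (vv i) \<le> hat n i s * (- (3 / 4 * \<epsilon>) * act i)"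
      proof (cases "hat n i s = 0")
        case False
        have "N (\<gamma> s - \<gamma> (p i)) \<le> d1" using d(2)[OF s p01[OF i] close[OF False]] by simp
        then have "\<bar>J' (\<gamma> s) (vv i) - J' (\<gamma> (p i)) (vv i)\<bar> \<le> \<epsilon> / 4 * N (vv i)"
          by (intro d1(2)) (use i s p01 \<gamma>S R vv in auto)
        also have "\<dots> \<le> \<epsilon> / 4 * act i" using vv(2)[OF i] \<epsilon> by (intro mult_left_mono) auto
        finally have "J' (\<gamma> s) (vv i) \<le> - (3 / 4 * \<epsilon>) * act i" using vv(3)[OF i] by linarith
        then show ?thesis by (intro mult_left_mono hat_nonneg)
      qed simp
    qed
    also have "\<dots> = - (3 / 4 * \<epsilon>) * \<mu> s" unfolding \<mu>_def sum_distrib_left by (intro sum.cong) auto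
    finally show ?thesis .
  qed
  define \<gamma>' where "\<gamma>' s = \<gamma> s + \<eta> *\<^sub>R v s" for s
  have N\<gamma>': "N (\<gamma>' s) \<le> N (\<gamma> s) + \<eta>" if s: "s \<in> {0..1}" for s
  proof -
    have "N (\<gamma>' s) \<le> N (\<gamma> s) + \<eta> * N (v s)"
      unfolding \<gamma>'_def using N_tri[OF \<gamma>S[OF s] subspace_scale[OF S vS[of s]], of \<eta>] N_scale[OF vS] \<eta> by simp
    moreover have "\<eta> * N (v s) \<le> \<eta> * 1" using Nv[of s] \<mu>1[OF s] \<eta> by (intro mult_left_mono) auto
    ultimately show ?thesis by simp
  qed
  have J\<gamma>': "J (\<gamma>' s) \<le> J (\<gamma> s) - \<eta> * \<epsilon> / 2 * \<mu> s" if s: "s \<in> {0..1}" for s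
  proof -
    have "N (\<eta> *\<^sub>R v s) = \<eta> * N (v s)" using N_scale[OF vS] \<eta> by simp
    moreover have "\<eta> * N (v s) \<le> \<eta> * \<mu> s" using Nv[of s] \<eta> by (intro mult_left_mono) auto
    moreover have "\<eta> * \<mu> s \<le> \<eta> * 1" using \<mu>1[OF s] \<eta> by (intro mult_left_mono) auto
    ultimately have Nn: "N (\<eta> *\<^sub>R v s) \<le> \<eta> * \<mu> s" "N (\<eta> *\<^sub>R v s) \<le> \<eta>" by auto
    have "J (\<gamma>' s) \<le> J (\<gamma> s) + J' (\<gamma> s) (\<eta> *\<^sub>R v s) + \<epsilon> / 4 * N (\<eta> *\<^sub>R v s)"
      unfolding \<gamma>'_def by (intro diff \<gamma>S s subspace_scale[OF S] vS R Nn)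
    also have "J' (\<gamma> s) (\<eta> *\<^sub>R v s) = \<eta> * J' (\<gamma> s) (v s)" by (intro J'_scale \<gamma>S s vS)
    also have "\<eta> * J' (\<gamma> s) (v s) \<le> \<eta> * (- (3 / 4 * \<epsilon>) * \<mu> s)" using J'v[OF s] \<eta> by (intro mult_left_mono) auto
    also have "\<epsilon> / 4 * N (\<eta> *\<^sub>R v s) \<le> \<epsilon> / 4 * (\<eta> * \<mu> s)" using Nn \<epsilon> by (intro mult_left_mono) auto
    finally show ?thesis by (simp add: algebra_simps)
  qed
  \<comment> \<open>Either all nodes contributing at \<open>s\<close> are active, so that
    \<open>\<mu> s = 1\<close> and the full descent is realised, or one of them lies below
    \<open>\<rho>1\<close> and uniform continuity keeps \<open>J (\<gamma> s)\<close> below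
    \<open>\<rho>2\<close>.\<close>
  have main: "J (\<gamma>' s) \<le> max \<rho>2 (c - \<eta> * \<epsilon> / 2)" if s: "s \<in> {0..1}" for s
  proof (cases "\<forall>i\<le>n. hat n i s \<noteq> 0 \<longrightarrow> act i = 1")
    case True
    have "\<mu> s = (\<Sum>i\<le>n. hat n i s)" unfolding \<mu>_def using True by (intro sum.cong) auto
    then have "\<mu> s = 1" using hat_sum[OF s] by simp
    then show ?thesis using J\<gamma>'[OF s] c(1)[OF s] by simp
  next
    case False
    then obtain i where i: "i \<le> n" "hat n i s \<noteq> 0" "J (\<gamma> (p i)) < \<rho>1" by (auto simp: act_def split: if_splits)
    have "N (\<gamma> s - \<gamma> (p i)) \<le> d2" using d(2)[OF s p01[OF i(1)] close[OF i(2)]] by simp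
    then have "\<bar>J (\<gamma> s) - J (\<gamma> (p i))\<bar> \<le> \<rho>2 - \<rho>1"
      by (intro d2(2)) (use i s p01 \<gamma>S R in auto)
    then have "J (\<gamma> s) \<le> \<rho>2" using i(3) by linarith
    moreover have "0 \<le> \<eta> * \<epsilon> / 2 * \<mu> s" using \<eta> \<epsilon> \<mu>0 by simp
    ultimately show ?thesis using J\<gamma>'[OF s] by linarith
  qed
  \<comment> \<open>The end points are themselves nodes, inactive by \<open>ends\<close>, and all
    other hats vanish there; hence the deformation fixes them.\<close>
  have e0: "v 0 = 0" unfolding v_def
  proof (intro sum.neutral ballI)
    fix i assume "i \<in> {..n}"
    show "hat n i 0 *\<^sub>R vv i = 0"
      using vv(4)[of 0] ends(1) by (cases "i = 0") (auto simp: hat_def ramp_def act_def p_def)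
  qed
  have e1: "v 1 = 0" unfolding v_def
  proof (intro sum.neutral ballI)
    fix i assume i: "i \<in> {..n}"
    have "hat n i 1 = 0" if "i < n"
    proof -
      have "real i + 1 \<le> real n" using that by linarith
      then show ?thesis by (auto simp: hat_def ramp_def)
    qed
    moreover have "vv n = 0" using vv(4)[of n] ends(2) n by (auto simp: act_def p_def)
    ultimately show "hat n i 1 *\<^sub>R vv i = 0" using i by (cases "i = n") auto
  qed
  have "upath \<gamma>'" unfolding upath_def
  proof (intro conjI ballI allI impI)
    show "\<gamma>' s \<in> S" if "s \<in> {0..1}" for s
      unfolding \<gamma>'_def by (intro subspace_add[OF S] subspace_scale[OF S] \<gamma>S vS that)
  next
    fix e :: real assume e: "0 < e"
    obtain d where d: "d > 0" "\<And>s s'. s \<in> {0..1} \<Longrightarrow> s' \<in> {0..1} \<Longrightarrow> \<bar>s - s'\<bar> < d \<Longrightarrow> N (\<gamma> s - \<gamma> s') < e / 2"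
      using \<gamma> e unfolding upath_def by (meson half_gt_zero)
    \<comment> \<open>A crude Lipschitz constant of the displacement: each hat is 2n-Lipschitz and
      each \<open>vv i\<close> has norm at most 1.\<close>
    define L where "L = \<eta> * (\<Sum>i\<le>n. 2 * real n)"
    have L: "L \<ge> 0" unfolding L_def using \<eta> by simp
    have "N (\<gamma>' s - \<gamma>' s') < e" if s: "s \<in> {0..1}" "s' \<in> {0..1}" "\<bar>s - s'\<bar> < min d (e / (2 * (L + 1)))" for s s'
    proof -
      have "v s - v s' = (\<Sum>i\<le>n. (hat n i s - hat n i s') *\<^sub>R vv i)"
        unfolding v_def by (simp add: sum_subtractf scaleR_diff_left)
      then have "N (v s - v s') \<le> (\<Sum>i\<le>n. N ((hat n i s - hat n i s') *\<^sub>R vv i))"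
        using vv(1) by (auto intro!: N_sum subspace_scale[OF S])
      also have "\<dots> = (\<Sum>i\<le>n. \<bar>hat n i s - hat n i s'\<bar> * N (vv i))"
        using vv(1) by (intro sum.cong) (auto simp: N_scale)
      also have "\<dots> \<le> (\<Sum>i\<le>n. (2 * real n * \<bar>s - s'\<bar>) * 1)"
      proof (intro sum_mono mult_mono hat_lipschitz)
        show "N (vv i) \<le> 1" if "i \<in> {..n}" for i
          using vv(2)[of i] that by (auto simp: act_def split: if_splits)
      qed (use vv(1) N_nonneg in auto)
      also have "\<dots> = (\<Sum>i\<le>n. 2 * real n) * \<bar>s - s'\<bar>" by (simp add: sum_distrib_right)
      finally have "\<eta> * N (v s - v s') \<le> L * \<bar>s - s'\<bar>"
        using \<eta> unfolding L_def by (simp add: mult.assoc)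
      also have "\<dots> \<le> (L + 1) * \<bar>s - s'\<bar>" by (simp add: mult_right_mono)
      also have "\<dots> < e / 2" using s(3) L by (simp add: field_simps)
      finally have A: "\<eta> * N (v s - v s') < e / 2" .
      have eq: "\<gamma>' s - \<gamma>' s' = (\<gamma> s - \<gamma> s') + \<eta> *\<^sub>R (v s - v s')"
        unfolding \<gamma>'_def by (simp add: algebra_simps)
      have "N (\<gamma>' s - \<gamma>' s') \<le> N (\<gamma> s - \<gamma> s') + N (\<eta> *\<^sub>R (v s - v s'))"
        unfolding eq by (intro N_tri subspace_diff[OF S] subspace_scale[OF S] \<gamma>S vS s)
      also have "N (\<eta> *\<^sub>R (v s - v s')) = \<eta> * N (v s - v s')"
        using N_scale[OF subspace_diff[OF S vS vS]] \<eta> by simp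
      finally show ?thesis using A d(2)[OF s(1,2)] s(3) by simp
    qed
    then show "\<exists>d>0. \<forall>s\<in>{0..1}. \<forall>s'\<in>{0..1}. \<bar>s - s'\<bar> < d \<longrightarrow> N (\<gamma>' s - \<gamma>' s') < e"
      using d(1) e L by (intro exI[of _ "min d (e / (2 * (L + 1)))"]) auto
  qed
  moreover have "\<gamma>' 0 = \<gamma> 0" "\<gamma>' 1 = \<gamma> 1" using e0 e1 by (auto simp: \<gamma>'_def)
  ultimately show ?thesis using N\<gamma>' main by blast
qed

text \<open>The vector is rescaled by \<epsilon> / |J' u v| and not by 1 / N v, because
  \<open>N v\<close> may vanish. The slope becomes exactly -\<epsilon>, and the strict inequality
  bounds the new norm by 1.\<close>

lemma steep_direction:
  assumes u: "u \<in> S" and v: "v \<in> S" "\<bar>J' u v\<bar> > \<epsilon> * N v" and \<epsilon>: "0 < \<epsilon>"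
  shows "\<exists>v\<in>S. N v \<le> 1 \<and> J' u v \<le> - \<epsilon>"
proof -
  define m where "m = \<bar>J' u v\<bar>"
  have m: "m > 0" using v(2) \<epsilon> N_nonneg[OF v(1)] unfolding m_def
    by (meson less_le_trans not_less mult_nonneg_nonneg less_imp_le order_le_less_trans)
  define c where "c = - sgn (J' u v) * (\<epsilon> / m)"
  have "\<bar>c\<bar> = \<epsilon> / m" using m \<epsilon> unfolding c_def m_def by (auto simp: abs_mult abs_sgn_eq)
  then have "N (c *\<^sub>R v) = \<epsilon> / m * N v" using N_scale[OF v(1)] by simp
  also have "\<dots> \<le> 1" using m v(2) by (simp add: m_def field_simps)
  finally have "N (c *\<^sub>R v) \<le> 1" .
  moreover have "J' u (c *\<^sub>R v) = - \<epsilon>"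
    using m unfolding J'_scale[OF u v(1)] by (auto simp: c_def m_def sgn_if)
  ultimately show ?thesis using subspace_scale[OF S v(1)] by force
qed

text \<open>Were there no such \<open>u\<close>, finitely many deformation steps would push the segment
  from \<open>0\<close> to \<open>e\<close> below the level \<open>\<rho>\<close>, although every path must cross the sphere \<open>N u = r\<close>.\<close>

theorem mountain_pass:
  assumes e: "e \<in> S" "J e \<le> 0" and J0: "J 0 \<le> 0"
    and r: "0 < r" "r < N e" "\<And>u. u \<in> S \<Longrightarrow> N u = r \<Longrightarrow> \<rho> \<le> J u" and \<rho>: "0 < \<rho>"
    and C: "\<And>s. s \<in> {0..1} \<Longrightarrow> J (s *\<^sub>R e) \<le> C" and \<epsilon>: "0 < \<epsilon>"
  shows "\<exists>u\<in>S. \<rho> / 3 \<le> J u \<and> J u \<le> C \<and> (\<forall>v\<in>S. \<bar>J' u v\<bar> \<le> \<epsilon> * N v)"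
proof (rule ccontr)
  assume neg: "\<not> ?thesis"
  have steep: "\<exists>v\<in>S. N v \<le> 1 \<and> J' u v \<le> - \<epsilon>" if "u \<in> S" "\<rho> / 3 \<le> J u" "J u \<le> C" for u
    using neg that steep_direction[OF \<open>u \<in> S\<close> _ _ \<epsilon>] by (meson not_le)
  have \<rho>C: "\<rho> \<le> C"
  proof -
    have "r / N e \<in> {0..1}" using r by auto
    moreover have "N ((r / N e) *\<^sub>R e) = r" using N_scale[OF e(1)] r by simp
    ultimately show ?thesis using C[of "r / N e"] r(3)[of "(r / N e) *\<^sub>R e"] subspace_scale[OF S e(1)] by force
  qed
  \<comment> \<open>\<open>R\<close> has to be fixed before the step size \<open>\<eta>\<close>,
    which depends on it. This is possible because about 2C/(\<epsilon>\<eta>) steps of length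
    \<open>\<eta>\<close> suffice, a total displacement of about 2C/\<epsilon> whatever
    \<open>\<eta>\<close> is.\<close>
  define R where "R = N e + 2 * C / \<epsilon> + 2"
  obtain \<eta>0 where \<eta>0: "\<eta>0 > 0" "\<And>u v. u \<in> S \<Longrightarrow> v \<in> S \<Longrightarrow> N u \<le> R \<Longrightarrow> N v \<le> \<eta>0 \<Longrightarrow> J (u + v) \<le> J u + J' u v + \<epsilon> / 4 * N v"
    using J_diff[of "\<epsilon> / 4" R] \<epsilon> by auto
  define \<eta> where "\<eta> = min \<eta>0 1"
  have \<eta>: "0 < \<eta>" "\<eta> \<le> \<eta>0" "\<eta> \<le> 1" using \<eta>0 by (auto simp: \<eta>_def)
  have path: "\<exists>\<gamma>. upath \<gamma> \<and> \<gamma> 0 = 0 \<and> \<gamma> 1 = e \<and>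
      (\<forall>s\<in>{0..1}. N (\<gamma> s) \<le> N e + real k * \<eta> \<and> J (\<gamma> s) \<le> max (\<rho> / 2) (C - real k * (\<eta> * \<epsilon> / 2)))"
    if "real k * \<eta> \<le> 2 * C / \<epsilon> + 2" for k
    using that
  proof (induction k)
    case 0
    have "N (s *\<^sub>R e) \<le> N e" if "s \<in> {0..1}" for s
      using N_scale[OF e(1), of s] that N_nonneg[OF e(1)] by (simp add: mult_left_le_one_le)
    then show ?case using upath_segment[OF e(1)] C
      by (intro exI[of _ "\<lambda>s. s *\<^sub>R e"]) (auto simp: le_max_iff_disj)
  next
    case (Suc k)
    have "real k * \<eta> \<le> real (Suc k) * \<eta>" using \<eta> by (simp add: algebra_simps)
    then have "real k * \<eta> \<le> 2 * C / \<epsilon> + 2" using Suc.prems by linarith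
    then obtain \<gamma> where \<gamma>: "upath \<gamma>" "\<gamma> 0 = 0" "\<gamma> 1 = e"
      "\<And>s. s \<in> {0..1} \<Longrightarrow> N (\<gamma> s) \<le> N e + real k * \<eta>"
      "\<And>s. s \<in> {0..1} \<Longrightarrow> J (\<gamma> s) \<le> max (\<rho> / 2) (C - real k * (\<eta> * \<epsilon> / 2))"
      using Suc.IH by blast
    have pos: "0 \<le> real k * (\<eta> * \<epsilon> / 2)" using \<eta> \<epsilon> by simp
    have mC: "max (\<rho> / 2) (C - real k * (\<eta> * \<epsilon> / 2)) \<le> C" using pos \<rho> \<rho>C by auto
    have "\<exists>\<gamma>'. upath \<gamma>' \<and> \<gamma>' 0 = \<gamma> 0 \<and> \<gamma>' 1 = \<gamma> 1 \<and>
         (\<forall>s\<in>{0..1}. N (\<gamma>' s) \<le> N (\<gamma> s) + \<eta> \<and> J (\<gamma>' s) \<le> max (\<rho> / 2) (max (\<rho> / 2) (C - real k * (\<eta> * \<epsilon> / 2)) - \<eta> * \<epsilon> / 2))"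
    proof (rule deformation_step[OF \<gamma>(1) _ \<gamma>(5) mC])
      show "N (\<gamma> s) \<le> R" if "s \<in> {0..1}" for s
        using \<gamma>(4)[OF that] \<open>real k * \<eta> \<le> 2 * C / \<epsilon> + 2\<close> unfolding R_def by linarith
      \<comment> \<open>Three levels are kept apart: steepness is used above \<rho>/3, paths are
        pushed down to \<rho>/2, and the sphere carries values of at least \<rho>.\<close>
      show "\<rho> / 3 < \<rho> / 2" using \<rho> by simp
      show "J (\<gamma> 0) < \<rho> / 3" "J (\<gamma> 1) < \<rho> / 3" using \<gamma> e J0 \<rho> by auto
      show "\<And>u v. u \<in> S \<Longrightarrow> v \<in> S \<Longrightarrow> N u \<le> R \<Longrightarrow> N v \<le> \<eta> \<Longrightarrow> J (u + v) \<le> J u + J' u v + \<epsilon> / 4 * N v"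
        using \<eta>0(2) \<eta> by force
    qed (use steep \<epsilon> \<eta> in auto)
    then obtain \<gamma>' where \<gamma>': "upath \<gamma>'" "\<gamma>' 0 = \<gamma> 0" "\<gamma>' 1 = \<gamma> 1"
      "\<And>s. s \<in> {0..1} \<Longrightarrow> N (\<gamma>' s) \<le> N (\<gamma> s) + \<eta>"
      "\<And>s. s \<in> {0..1} \<Longrightarrow> J (\<gamma>' s) \<le> max (\<rho> / 2) (max (\<rho> / 2) (C - real k * (\<eta> * \<epsilon> / 2)) - \<eta> * \<epsilon> / 2)"
      by blast
    have "max (\<rho> / 2) (max (\<rho> / 2) (C - real k * (\<eta> * \<epsilon> / 2)) - \<eta> * \<epsilon> / 2) \<le> max (\<rho> / 2) (C - real (Suc k) * (\<eta> * \<epsilon> / 2))"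
    proof -
      have "real (Suc k) * (\<eta> * \<epsilon> / 2) = real k * (\<eta> * \<epsilon> / 2) + \<eta> * \<epsilon> / 2" by (simp add: algebra_simps)
      moreover have "0 < \<eta> * \<epsilon> / 2" using \<eta> \<epsilon> by simp
      ultimately show ?thesis by linarith
    qed
    moreover have "N e + real k * \<eta> + \<eta> = N e + real (Suc k) * \<eta>" by (simp add: algebra_simps)
    ultimately have "N (\<gamma>' s) \<le> N e + real (Suc k) * \<eta> \<and> J (\<gamma>' s) \<le> max (\<rho> / 2) (C - real (Suc k) * (\<eta> * \<epsilon> / 2))"
      if "s \<in> {0..1}" for s
      using \<gamma>'(4,5)[OF that] \<gamma>(4)[OF that] by linarith
    then show ?case using \<gamma>'(1-3) \<gamma>(2,3) by auto
  qed
  define k where "k = nat \<lceil>2 * C / (\<epsilon> * \<eta>)\<rceil>"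
  have k: "2 * C / (\<epsilon> * \<eta>) \<le> real k" "real k \<le> 2 * C / (\<epsilon> * \<eta>) + 1"
    using \<rho> \<rho>C \<epsilon> \<eta> unfolding k_def by (simp_all add: real_nat_ceiling_ge of_nat_ceiling) 
  have "real k * \<eta> \<le> (2 * C / (\<epsilon> * \<eta>) + 1) * \<eta>" using k(2) \<eta> by (intro mult_right_mono) auto
  also have "\<dots> = 2 * C / \<epsilon> + \<eta>" using \<eta> \<epsilon> by (simp add: field_simps)
  finally have "real k * \<eta> \<le> 2 * C / \<epsilon> + 2" using \<eta> by linarith
  then obtain \<gamma> where \<gamma>: "upath \<gamma>" "\<gamma> 0 = 0" "\<gamma> 1 = e"
      "\<And>s. s \<in> {0..1} \<Longrightarrow> J (\<gamma> s) \<le> max (\<rho> / 2) (C - real k * (\<eta> * \<epsilon> / 2))"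
    using path by blast
  have "C \<le> real k * (\<eta> * \<epsilon> / 2)" using k(1) \<eta> \<epsilon> by (simp add: field_simps)
  then have low: "J (\<gamma> s) \<le> \<rho> / 2" if "s \<in> {0..1}" for s using \<gamma>(4)[OF that] \<rho> by auto
  have "\<exists>s\<ge>0. s \<le> 1 \<and> N (\<gamma> s) = r"
    using r \<gamma> N_cont_on[OF \<gamma>(1)] by (intro IVT') auto
  then obtain s where s: "s \<in> {0..1}" "N (\<gamma> s) = r" by auto
  have "\<gamma> s \<in> S" using \<gamma>(1) s by (simp add: upath_def)
  then have "\<rho> \<le> J (\<gamma> s)" using r(3) s by simp
  then show False using low[OF s(1)] \<rho> by linarith
qed

end

section \<open>The duality map and Lebesgue spaces\<close>

lemma continuous_on_Icc_bounded:
  fixes f :: "real \<Rightarrow> 'a::real_normed_vector"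
  assumes "continuous_on {a..b} f"
  obtains B where "0 \<le> B" "\<And>s. s \<in> {a..b} \<Longrightarrow> norm (f s) \<le> B"
proof -
  obtain B where "\<forall>y\<in>f ` {a..b}. norm y \<le> B"
    using compact_imp_bounded[OF compact_continuous_image[OF assms compact_Icc]] unfolding bounded_iff by blast
  then show ?thesis using that[of "max B 0"] by (simp add: le_max_iff_disj)
qed

text \<open>The map phi_p on vectors. An integer p > 1 is at least 2, so the natural-number exponent
  p - 2 is not truncated and there is no singularity at 0.\<close>

definition jp :: "nat \<Rightarrow> 'a::real_inner \<Rightarrow> 'a" where
  "jp p x = norm x ^ (p - 2) *\<^sub>R x"

lemma power_split2: "2 \<le> p \<Longrightarrow> (x::real) ^ p = x ^ (p - 2) * x * x"
  by (metis le_add_diff_inverse2 power_add power2_eq_square mult.assoc)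

lemma jp_inner_self: "2 \<le> p \<Longrightarrow> jp p x \<bullet> x = norm x ^ p"
  by (simp add: jp_def power_split2 dot_square_norm power2_eq_square)

lemma norm_jp: "2 \<le> p \<Longrightarrow> norm (jp p x) = norm x ^ (p - 1)"
proof -
  assume "2 \<le> p"
  then have "p - 1 = Suc (p - 2)" by simp
  then show ?thesis by (simp add: jp_def)
qed

text \<open>With m = p - 2, polarisation writes the right side as half of (|x|^m + |y|^m) |x - y|^2
  plus half of (|x|^m - |y|^m) (|x|^2 - |y|^2). The second product is nonnegative by monotonicity of
  powers, and |x - y| <= 2 max(|x|, |y|) handles the first.\<close>

lemma jp_strongly_monotone:
  assumes "2 \<le> p"
  shows "norm (x - y) ^ p / 2 ^ (p - 1) \<le> (jp p x - jp p y) \<bullet> (x - y)"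
proof -
  define m where "m = p - 2"
  have p: "p = m + 2" "p - 1 = m + 1" using assms by (auto simp: m_def)
  define a b where "a = norm x ^ m" and "b = norm y ^ m"
  have ab: "0 \<le> a" "0 \<le> b" by (auto simp: a_def b_def)
  have eq: "(jp p x - jp p y) \<bullet> (x - y)
      = (a + b) / 2 * norm (x - y) ^ 2 + (a - b) * (norm x ^ 2 - norm y ^ 2) / 2"
    unfolding jp_def m_def[symmetric] a_def[symmetric] b_def[symmetric]
    by (simp add: power2_norm_eq_inner inner_diff_left inner_diff_right inner_commute algebra_simps divide_simps)
  have "0 \<le> (a - b) * (norm x ^ 2 - norm y ^ 2)"
  proof (cases "norm x \<le> norm y")
    case True
    then have "a \<le> b" "norm x ^ 2 \<le> norm y ^ 2" unfolding a_def b_def by (auto intro: power_mono)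
    then show ?thesis by (intro mult_nonpos_nonpos) auto
  next
    case False
    then have "b \<le> a" "norm y ^ 2 \<le> norm x ^ 2" unfolding a_def b_def by (auto intro: power_mono)
    then show ?thesis by (intro mult_nonneg_nonneg) auto
  qed
  moreover have "norm (x - y) ^ m \<le> 2 ^ m * (a + b)"
  proof -
    have "norm (x - y) \<le> 2 * max (norm x) (norm y)"
      using norm_triangle_ineq4[of x y] by auto
    then have "norm (x - y) ^ m \<le> (2 * max (norm x) (norm y)) ^ m" by (intro power_mono) auto
    also have "\<dots> = 2 ^ m * max (norm x) (norm y) ^ m" by (simp add: power_mult_distrib)
    also have "max (norm x) (norm y) ^ m \<le> a + b" using ab by (auto simp: max_def a_def b_def)
    finally show ?thesis by simp
  qed
  then have "norm (x - y) ^ m * norm (x - y) ^ 2 \<le> 2 ^ m * (a + b) * norm (x - y) ^ 2"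
    by (intro mult_right_mono) auto
  then have "norm (x - y) ^ p / 2 ^ (p - 1) \<le> (a + b) / 2 * norm (x - y) ^ 2"
    unfolding p by (simp add: power_add field_simps power2_eq_square)
  ultimately show ?thesis unfolding eq by linarith
qed

text \<open>The factor \<open>b\<close> on the left allows the exponent m on the right, so that no
  exponent m - 1 occurs. The induction runs with the symmetric factor \<open>a + b\<close>.\<close>

lemma abs_power_diff_le:
  fixes a b :: real assumes "0 \<le> a" "0 \<le> b"
  shows "\<bar>a ^ m - b ^ m\<bar> * b \<le> real m * (a + b) ^ m * \<bar>a - b\<bar>"
proof -
  have "\<bar>a ^ m - b ^ m\<bar> * (a + b) \<le> real m * (a + b) ^ m * \<bar>a - b\<bar>"
  proof (induction m)
    case (Suc m)
    have "\<bar>a ^ Suc m - b ^ Suc m\<bar> = \<bar>a * (a ^ m - b ^ m) + b ^ m * (a - b)\<bar>" by (simp add: algebra_simps)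
    also have "\<dots> \<le> a * \<bar>a ^ m - b ^ m\<bar> + b ^ m * \<bar>a - b\<bar>"
      using assms abs_triangle_ineq[of "a * (a ^ m - b ^ m)" "b ^ m * (a - b)"] by (simp add: abs_mult)
    also have "\<dots> \<le> (a + b) * \<bar>a ^ m - b ^ m\<bar> + (a + b) ^ m * \<bar>a - b\<bar>"
      using assms by (intro add_mono mult_right_mono power_mono) auto
    finally have "\<bar>a ^ Suc m - b ^ Suc m\<bar> * (a + b) \<le> ((a + b) * \<bar>a ^ m - b ^ m\<bar> + (a + b) ^ m * \<bar>a - b\<bar>) * (a + b)"
      using assms by (intro mult_right_mono) auto
    also have "\<dots> = (a + b) * (\<bar>a ^ m - b ^ m\<bar> * (a + b)) + (a + b) ^ Suc m * \<bar>a - b\<bar>" by (simp add: algebra_simps)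
    also have "\<dots> \<le> (a + b) * (real m * (a + b) ^ m * \<bar>a - b\<bar>) + (a + b) ^ Suc m * \<bar>a - b\<bar>"
      using Suc assms by (intro add_mono mult_left_mono) auto
    also have "\<dots> = real (Suc m) * (a + b) ^ Suc m * \<bar>a - b\<bar>" by (simp add: algebra_simps)
    finally show ?case .
  qed simp
  moreover have "\<bar>a ^ m - b ^ m\<bar> * b \<le> \<bar>a ^ m - b ^ m\<bar> * (a + b)" using assms by (intro mult_left_mono) auto
  ultimately show ?thesis by linarith
qed

lemma jp_lipschitz:
  assumes "2 \<le> p"
  shows "norm (jp p x - jp p y) \<le> real (p - 1) * (norm x + norm y) ^ (p - 2) * norm (x - y)"
proof -
  define m where "m = p - 2"
  have "jp p x - jp p y = norm x ^ m *\<^sub>R (x - y) + (norm x ^ m - norm y ^ m) *\<^sub>R y"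
    unfolding jp_def m_def by (simp add: algebra_simps)
  then have "norm (jp p x - jp p y) \<le> norm x ^ m * norm (x - y) + \<bar>norm x ^ m - norm y ^ m\<bar> * norm y"
    using norm_triangle_ineq[of "norm x ^ m *\<^sub>R (x - y)" "(norm x ^ m - norm y ^ m) *\<^sub>R y"] by simp
  also have "\<dots> \<le> (norm x + norm y) ^ m * norm (x - y) + real m * (norm x + norm y) ^ m * \<bar>norm x - norm y\<bar>"
    by (intro add_mono mult_right_mono power_mono abs_power_diff_le) auto
  also have "\<dots> \<le> (norm x + norm y) ^ m * norm (x - y) + real m * (norm x + norm y) ^ m * norm (x - y)"
    by (intro add_mono mult_left_mono norm_triangle_ineq3) auto
  also have "\<dots> = (real m + 1) * (norm x + norm y) ^ m * norm (x - y)" by (simp add: algebra_simps)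
  also have "real m + 1 = real (p - 1)" using assms by (simp add: m_def of_nat_diff)
  finally show ?thesis by (simp add: m_def)
qed

text \<open>Bernoulli's inequality for the ratio \<open>b / a\<close>, multiplied by
  \<open>a ^ n\<close>. It serves as convexity of the n-th power for \<open>jp\<close>, for
  Minkowski's inequality and for the outer function of the energy.\<close>

lemma power_tangent:
  fixes a b :: real assumes "0 \<le> a" "0 \<le> b" "1 \<le> n"
  shows "a ^ n + real n * a ^ (n - 1) * (b - a) \<le> b ^ n"
proof (cases "a = 0")
  case True
  then show ?thesis using assms by (cases "n = 1") (auto simp: power_0_left)
next
  case False
  then have a: "a > 0" using assms by simp
  have "1 + real n * (b / a - 1) \<le> (1 + (b / a - 1)) ^ n"
    using a assms by (intro Bernoulli_inequality) auto
  then have "(1 + real n * (b / a - 1)) * a ^ n \<le> (b / a) ^ n * a ^ n" using a by (intro mult_right_mono) auto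
  moreover have "(b / a) ^ n * a ^ n = b ^ n" using a by (simp add: power_divide)
  moreover have "(b / a - 1) * a ^ n = a ^ (n - 1) * (b - a)"
    using a assms(3) by (cases n) (auto simp: field_simps)
  moreover have "(1 + real n * (b / a - 1)) * a ^ n = a ^ n + real n * ((b / a - 1) * a ^ n)"
    by (simp only: algebra_simps)
  ultimately show ?thesis by (simp only: mult.assoc)
qed

text \<open>Cauchy-Schwarz reduces the claim to the scalar tangent inequality between the two
  norms.\<close>

lemma jp_tangent:
  assumes "2 \<le> p"
  shows "norm x ^ p + real p * (jp p x \<bullet> (y - x)) \<le> norm y ^ p"
proof -
  have "jp p x \<bullet> y \<le> norm x ^ (p - 1) * norm y"
    using norm_cauchy_schwarz[of "jp p x" y] norm_jp[OF assms, of x] by simp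
  moreover have "norm x ^ p = norm x ^ (p - 1) * norm x"
    using assms by (metis One_nat_def Suc_1 Suc_leD Suc_pred' less_eq_Suc_le power_Suc2)
  ultimately have "jp p x \<bullet> (y - x) \<le> norm x ^ (p - 1) * (norm y - norm x)"
    using jp_inner_self[OF assms, of x] by (simp add: inner_diff_right algebra_simps)
  then have "real p * (jp p x \<bullet> (y - x)) \<le> real p * (norm x ^ (p - 1) * (norm y - norm x))"
    by (intro mult_left_mono) auto
  moreover have "norm x ^ p + real p * norm x ^ (p - 1) * (norm y - norm x) \<le> norm y ^ p"
    using power_tangent[of "norm x" "norm y" p] assms by simp
  ultimately show ?thesis by (simp only: mult.assoc)
qed

lemma power_add_le_max:
  fixes a b :: real assumes "0 \<le> a" "0 \<le> b"
  shows "(a + b) ^ p \<le> 2 ^ p * (a ^ p + b ^ p)"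
proof -
  have "(a + b) ^ p \<le> (2 * max a b) ^ p" using assms by (intro power_mono) auto
  also have "\<dots> = 2 ^ p * max a b ^ p" by (simp add: power_mult_distrib)
  also have "\<dots> \<le> 2 ^ p * (a ^ p + b ^ p)" using assms by (intro mult_left_mono) (auto simp: max_def)
  finally show ?thesis .
qed

section \<open>Hoelder, Minkowski and completeness for integer exponents\<close>

definition memLp :: "'b measure \<Rightarrow> nat \<Rightarrow> ('b \<Rightarrow> 'a::euclidean_space) \<Rightarrow> bool" where
  "memLp M p f \<longleftrightarrow> f \<in> borel_measurable M \<and> integrable M (\<lambda>x. norm (f x) ^ p)"

definition normLp :: "'b measure \<Rightarrow> nat \<Rightarrow> ('b \<Rightarrow> 'a::euclidean_space) \<Rightarrow> real" where
  "normLp M p f = root p (\<integral>x. norm (f x) ^ p \<partial>M)"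

lemma memLp_meas: "memLp M p f \<Longrightarrow> f \<in> borel_measurable M"
  by (simp add: memLp_def)

lemma memLp_int: "memLp M p f \<Longrightarrow> integrable M (\<lambda>x. norm (f x) ^ p)"
  by (simp add: memLp_def)

lemma normLp_nonneg: "0 \<le> normLp M p f"
  unfolding normLp_def by (cases "p = 0") (auto intro!: real_root_ge_zero integral_nonneg_AE)

lemma normLp_power: "0 < p \<Longrightarrow> normLp M p f ^ p = (\<integral>x. norm (f x) ^ p \<partial>M)"
  unfolding normLp_def by (intro real_root_pow_pos2 integral_nonneg_AE) auto

lemma memLp_add:
  assumes "memLp M p f" "memLp M p g" shows "memLp M p (\<lambda>x. f x + g x)"
proof -
  note [measurable] = memLp_meas[OF assms(1)] memLp_meas[OF assms(2)]
  have "integrable M (\<lambda>x. norm (f x + g x) ^ p)"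
  proof (rule Bochner_Integration.integrable_bound)
    show "integrable M (\<lambda>x. 2 ^ p * (norm (f x) ^ p + norm (g x) ^ p))"
      using assms by (auto simp: memLp_def)
    have "norm (f x + g x) ^ p \<le> 2 ^ p * (norm (f x) ^ p + norm (g x) ^ p)" for x
      using power_mono[OF norm_triangle_ineq[of "f x" "g x"], of p] power_add_le_max[of "norm (f x)" "norm (g x)" p] by auto
    then show "AE x in M. norm (norm (f x + g x) ^ p) \<le> norm (2 ^ p * (norm (f x) ^ p + norm (g x) ^ p))"
      by (intro AE_I2) auto
  qed measurable
  then show ?thesis unfolding memLp_def by simp
qed

lemma memLp_scale: "memLp M p f \<Longrightarrow> memLp M p (\<lambda>x. c *\<^sub>R f x)"
  by (auto simp: memLp_def power_mult_distrib)

lemma memLp_diff: "memLp M p f \<Longrightarrow> memLp M p g \<Longrightarrow> memLp M p (\<lambda>x. f x - g x)"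
  using memLp_add[of M p f "\<lambda>x. (-1) *\<^sub>R g x"] memLp_scale[of M p g "-1"] by simp

lemma memLp_norm: "memLp M p f \<Longrightarrow> memLp M p (\<lambda>x. norm (f x))"
  by (auto simp: memLp_def)

lemma normLp_norm: "normLp M p (\<lambda>x. norm (f x)) = normLp M p f"
  by (simp add: normLp_def)

lemma normLp_scale: "0 < p \<Longrightarrow> normLp M p (\<lambda>x. c *\<^sub>R f x) = \<bar>c\<bar> * normLp M p f"
  by (simp add: normLp_def power_mult_distrib real_root_mult real_root_power_cancel)

lemma normLp_minus_commute: "normLp M p (\<lambda>x. f x - g x) = normLp M p (\<lambda>x. g x - f x)"
  by (simp add: normLp_def norm_minus_commute)

text \<open>Norm inequalities are proved below with every norm enlarged by e > 0, so that division
  by it is always possible and vanishing norms need no separate case.\<close>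

lemma le_at_zero_limit:
  fixes f :: "real \<Rightarrow> real"
  assumes "\<And>e. 0 < e \<Longrightarrow> x \<le> f e" "isCont f 0" shows "x \<le> f 0"
proof (rule tendsto_lowerbound)
  show "(f \<longlongrightarrow> f 0) (at_right 0)"
    using assms(2) by (simp add: isCont_def filterlim_at_split)
  show "eventually (\<lambda>e. x \<le> f e) (at_right 0)"
    using assms(1) by (auto simp: eventually_at_filter)
qed simp

text \<open>For normalised functions this is the pointwise bound a^(p-2) b c <= a^p + b^p + c^p,
  seen by comparing with the maximum of the three numbers. The resulting factor 3 is harmless, as
  only integrability and continuity estimates are drawn from it.\<close>

lemma hoelder3:
  assumes p: "2 \<le> p" and f: "memLp M p f" and g: "memLp M p g" and h: "memLp M p h"
  shows "integrable M (\<lambda>x. norm (f x) ^ (p - 2) * norm (g x) * norm (h x))" (is "integrable M ?k")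
    and "(\<integral>x. norm (f x) ^ (p - 2) * norm (g x) * norm (h x) \<partial>M)
          \<le> 3 * normLp M p f ^ (p - 2) * normLp M p g * normLp M p h"
proof -
  note [measurable] = memLp_meas[OF f] memLp_meas[OF g] memLp_meas[OF h]
  have pw: "a ^ (p - 2) * b * c \<le> a ^ p + b ^ p + c ^ p" if "0 \<le> a" "0 \<le> b" "0 \<le> c" for a b c :: real
  proof -
    define m where "m = max a (max b c)"
    have "a ^ (p - 2) * b * c \<le> m ^ (p - 2) * m * m"
      using that by (intro mult_mono power_mono) (auto simp: m_def)
    also have "\<dots> = m ^ p" using power_split2[OF p] by simp
    also have "\<dots> \<le> a ^ p + b ^ p + c ^ p" using that unfolding m_def by (auto simp: max_def)
    finally show ?thesis .
  qed
  have int: "integrable M (\<lambda>x. norm (f x) ^ p + norm (g x) ^ p + norm (h x) ^ p)"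
    using f g h by (auto simp: memLp_def)
  show int': "integrable M ?k"
    by (rule Bochner_Integration.integrable_bound[OF int]) (use pw in \<open>auto intro!: AE_I2\<close>)
  have p0: "0 < p" using p by simp
  have bd: "(\<integral>x. ?k x \<partial>M) \<le> 3 * (normLp M p f + e) ^ (p - 2) * (normLp M p g + e) * (normLp M p h + e)" if "0 < e" for e
  proof -
    define F G H where "F = normLp M p f + e" and "G = normLp M p g + e" and "H = normLp M p h + e"
    have pos: "0 < F" "0 < G" "0 < H" unfolding F_def G_def H_def by (intro add_nonneg_pos normLp_nonneg that)+
    have le: "(\<integral>x. norm (f x) ^ p \<partial>M) \<le> F ^ p" "(\<integral>x. norm (g x) ^ p \<partial>M) \<le> G ^ p" "(\<integral>x. norm (h x) ^ p \<partial>M) \<le> H ^ p"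
      unfolding normLp_power[OF p0, symmetric] F_def G_def H_def using that by (auto intro!: power_mono normLp_nonneg)
    have "(\<integral>x. ?k x \<partial>M) \<le> (\<integral>x. F ^ (p - 2) * G * H * (norm (f x) ^ p / F ^ p + norm (g x) ^ p / G ^ p + norm (h x) ^ p / H ^ p) \<partial>M)"
    proof (rule integral_mono[OF int'])
      show "integrable M (\<lambda>x. F ^ (p - 2) * G * H * (norm (f x) ^ p / F ^ p + norm (g x) ^ p / G ^ p + norm (h x) ^ p / H ^ p))"
        using f g h by (auto simp: memLp_def)
      fix x
      have "?k x = F ^ (p - 2) * G * H * ((norm (f x) / F) ^ (p - 2) * (norm (g x) / G) * (norm (h x) / H))"
        using pos by (simp add: power_divide field_simps)
      also have "\<dots> \<le> F ^ (p - 2) * G * H * ((norm (f x) / F) ^ p + (norm (g x) / G) ^ p + (norm (h x) / H) ^ p)"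
        using pos by (intro mult_left_mono pw) auto
      finally show "?k x \<le> F ^ (p - 2) * G * H * (norm (f x) ^ p / F ^ p + norm (g x) ^ p / G ^ p + norm (h x) ^ p / H ^ p)"
        by (simp add: power_divide)
    qed
    also have "\<dots> = F ^ (p - 2) * G * H * ((\<integral>x. norm (f x) ^ p \<partial>M) / F ^ p + (\<integral>x. norm (g x) ^ p \<partial>M) / G ^ p + (\<integral>x. norm (h x) ^ p \<partial>M) / H ^ p)"
      using f g h by (simp add: memLp_def)
    also have "\<dots> \<le> F ^ (p - 2) * G * H * (1 + 1 + 1)"
      using pos le by (intro mult_left_mono add_mono) (auto simp: divide_le_eq_1)
    finally show ?thesis by (simp add: F_def G_def H_def mult_ac)
  qed
  have "(\<integral>x. ?k x \<partial>M) \<le> 3 * (normLp M p f + 0) ^ (p - 2) * (normLp M p g + 0) * (normLp M p h + 0)"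
    by (rule le_at_zero_limit) (use bd in \<open>auto intro!: continuous_intros\<close>)
  then show "(\<integral>x. ?k x \<partial>M) \<le> 3 * normLp M p f ^ (p - 2) * normLp M p g * normLp M p h" by simp
qed

text \<open>The tangent inequalities at the convex combination are averaged; their linear parts
  cancel.\<close>

lemma convex_power_nonneg:
  fixes a b t :: real assumes "0 \<le> a" "0 \<le> b" "0 \<le> t" "t \<le> 1"
  shows "((1 - t) * a + t * b) ^ n \<le> (1 - t) * a ^ n + t * b ^ n"
proof (cases "n = 0")
  case False
  define c where "c = (1 - t) * a + t * b"
  have c: "0 \<le> c" using assms by (simp add: c_def)
  have "(1 - t) * (c ^ n + real n * c ^ (n - 1) * (a - c)) + t * (c ^ n + real n * c ^ (n - 1) * (b - c)) \<le> (1 - t) * a ^ n + t * b ^ n"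
    using assms False c by (intro add_mono mult_left_mono power_tangent) auto
  moreover have "(1 - t) * (c ^ n + real n * c ^ (n - 1) * (a - c)) + t * (c ^ n + real n * c ^ (n - 1) * (b - c))
      = c ^ n + real n * c ^ (n - 1) * ((1 - t) * a + t * b - c)" by (simp add: algebra_simps)
  ultimately show ?thesis by (simp add: c_def)
qed (use assms in auto)

text \<open>(f + g) / (F + G) is bounded by the convex combination of |f| / F and |g| / G with
  weights F / (F + G) and G / (F + G); convexity of the p-th power does the rest.\<close>

lemma minkowski:
  assumes p: "0 < p" and f: "memLp M p f" and g: "memLp M p g"
  shows "normLp M p (\<lambda>x. f x + g x) \<le> normLp M p f + normLp M p g"
proof -
  have bd: "normLp M p (\<lambda>x. f x + g x) \<le> (normLp M p f + e) + (normLp M p g + e)" if "0 < e" for e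
  proof -
    define F G where "F = normLp M p f + e" and "G = normLp M p g + e"
    have pos: "0 < F" "0 < G" unfolding F_def G_def by (intro add_nonneg_pos normLp_nonneg that)+
    have le: "(\<integral>x. norm (f x) ^ p \<partial>M) \<le> F ^ p" "(\<integral>x. norm (g x) ^ p \<partial>M) \<le> G ^ p"
      unfolding normLp_power[OF p, symmetric] F_def G_def using that by (auto intro!: power_mono normLp_nonneg)
    define t where "t = G / (F + G)"
    have t: "0 \<le> t" "t \<le> 1" "1 - t = F / (F + G)" using pos by (auto simp: t_def field_simps)
    have "(\<integral>x. norm (f x + g x) ^ p \<partial>M) \<le> (\<integral>x. (F + G) ^ p * ((1 - t) * (norm (f x) ^ p / F ^ p) + t * (norm (g x) ^ p / G ^ p)) \<partial>M)"
    proof (rule integral_mono)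
      show "integrable M (\<lambda>x. norm (f x + g x) ^ p)" using memLp_int[OF memLp_add[OF f g]] .
      show "integrable M (\<lambda>x. (F + G) ^ p * ((1 - t) * (norm (f x) ^ p / F ^ p) + t * (norm (g x) ^ p / G ^ p)))"
        using f g by (auto simp: memLp_def)
      fix x
      have "(1 - t) * (norm (f x) / F) = norm (f x) / (F + G)" "t * (norm (g x) / G) = norm (g x) / (F + G)"
        using pos unfolding t(3) by (auto simp: t_def)
      then have "norm (f x) + norm (g x) = (F + G) * ((1 - t) * (norm (f x) / F) + t * (norm (g x) / G))"
        using pos by (simp only: distrib_left[symmetric] add_divide_distrib[symmetric]) simp
      then have "norm (f x + g x) ^ p \<le> ((F + G) * ((1 - t) * (norm (f x) / F) + t * (norm (g x) / G))) ^ p"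
        by (metis norm_triangle_ineq norm_ge_zero power_mono)
      also have "\<dots> = (F + G) ^ p * ((1 - t) * (norm (f x) / F) + t * (norm (g x) / G)) ^ p" by (simp add: power_mult_distrib)
      also have "\<dots> \<le> (F + G) ^ p * ((1 - t) * (norm (f x) / F) ^ p + t * (norm (g x) / G) ^ p)"
        using pos t by (intro mult_left_mono convex_power_nonneg) auto
      finally show "norm (f x + g x) ^ p \<le> (F + G) ^ p * ((1 - t) * (norm (f x) ^ p / F ^ p) + t * (norm (g x) ^ p / G ^ p))"
        by (simp add: power_divide)
    qed
    also have "\<dots> = (F + G) ^ p * ((1 - t) * ((\<integral>x. norm (f x) ^ p \<partial>M) / F ^ p) + t * ((\<integral>x. norm (g x) ^ p \<partial>M) / G ^ p))"
      using f g by (simp add: memLp_def)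
    also have "\<dots> \<le> (F + G) ^ p * ((1 - t) * 1 + t * 1)"
      using pos le t by (intro mult_left_mono add_mono) (auto simp: divide_le_eq_1)
    finally have "normLp M p (\<lambda>x. f x + g x) ^ p \<le> (F + G) ^ p" by (simp add: normLp_power[OF p])
    then show ?thesis using pos p unfolding F_def G_def by (simp add: power_mono_iff normLp_nonneg)
  qed
  have "normLp M p (\<lambda>x. f x + g x) \<le> (normLp M p f + 0) + (normLp M p g + 0)"
    by (rule le_at_zero_limit) (use bd in \<open>auto intro!: continuous_intros\<close>)
  then show ?thesis by simp
qed

lemma normLp_triangle3:
  assumes p: "0 < p" and f: "memLp M p f" and g: "memLp M p g"
  shows "\<bar>normLp M p f - normLp M p g\<bar> \<le> normLp M p (\<lambda>x. f x - g x)"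
  using minkowski[OF p memLp_diff[OF f g] g] minkowski[OF p memLp_diff[OF g f] f]
  by (simp add: normLp_minus_commute[of M p f g])

text \<open>Unlike \<open>hoelder3\<close> this needs the sharp constant, because the embedding
  constant \<open>Kc\<close> is derived from it; hence Young's inequality is applied to the
  normalised functions.\<close>

lemma hoelder:
  assumes p: "2 \<le> p" and q: "q = real p / (real p - 1)"
    and k[measurable]: "k \<in> borel_measurable M" and k0: "\<And>x. 0 \<le> k x" and kq: "integrable M (\<lambda>x. k x powr q)"
    and w: "memLp M p w"
  shows "integrable M (\<lambda>x. k x * norm (w x))"
    and "(\<integral>x. k x * norm (w x) \<partial>M) \<le> (\<integral>x. k x powr q \<partial>M) powr (1 / q) * normLp M p w"
proof -
  note [measurable] = memLp_meas[OF w]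
  have pq: "1 < real p" "1 < q" "1 / real p + 1 / q = 1" "q \<noteq> 0" using p unfolding q by (auto simp: field_simps)
  have young: "a * b \<le> a powr q / q + b ^ p / real p" if "0 \<le> a" "0 \<le> b" for a b
    using Youngs_inequality[of q "real p" a b] pq that p by (cases "b = 0") (auto simp: powr_realpow add.commute)
  have int: "integrable M (\<lambda>x. k x powr q / q + norm (w x) ^ p / real p)"
    using kq w by (auto simp: memLp_def)
  show int': "integrable M (\<lambda>x. k x * norm (w x))"
    by (rule Bochner_Integration.integrable_bound[OF int])
      (use young k0 pq in \<open>auto intro!: AE_I2 simp: abs_mult\<close>)
  define A0 where "A0 = (\<integral>x. k x powr q \<partial>M) powr (1 / q)"
  have A0: "0 \<le> A0" "A0 powr q = (\<integral>x. k x powr q \<partial>M)"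
    using pq by (auto simp: A0_def powr_powr intro!: integral_nonneg_AE)
  have p0: "0 < p" using p by simp
  have bd: "(\<integral>x. k x * norm (w x) \<partial>M) \<le> (A0 + e) * (normLp M p w + e)" if "0 < e" for e
  proof -
    define A B where "A = A0 + e" and "B = normLp M p w + e"
    have pos: "0 < A" "0 < B" unfolding A_def B_def by (intro add_nonneg_pos normLp_nonneg that A0(1))+
    have le: "(\<integral>x. k x powr q \<partial>M) \<le> A powr q" "(\<integral>x. norm (w x) ^ p \<partial>M) \<le> B ^ p"
      unfolding normLp_power[OF p0, symmetric] A0(2)[symmetric] A_def B_def
      using that A0(1) pq by (auto intro!: power_mono normLp_nonneg powr_mono2)
    have "(\<integral>x. k x * norm (w x) \<partial>M) \<le> (\<integral>x. A * B * (k x powr q / A powr q / q + norm (w x) ^ p / B ^ p / real p) \<partial>M)"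
    proof (rule integral_mono[OF int'])
      show "integrable M (\<lambda>x. A * B * (k x powr q / A powr q / q + norm (w x) ^ p / B ^ p / real p))"
        using kq w by (auto simp: memLp_def)
      fix x
      have "k x * norm (w x) = A * B * ((k x / A) * (norm (w x) / B))" using pos by simp
      also have "\<dots> \<le> A * B * ((k x / A) powr q / q + (norm (w x) / B) ^ p / real p)"
        using pos k0 by (intro mult_left_mono young) auto
      finally show "k x * norm (w x) \<le> A * B * (k x powr q / A powr q / q + norm (w x) ^ p / B ^ p / real p)"
        using pos k0 by (simp add: power_divide powr_divide)
    qed
    also have "\<dots> = A * B * ((\<integral>x. k x powr q \<partial>M) / A powr q / q + (\<integral>x. norm (w x) ^ p \<partial>M) / B ^ p / real p)"
      using kq w by (simp add: memLp_def)
    also have "\<dots> \<le> A * B * (1 / q + 1 / real p)"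
      using pos le pq by (intro mult_left_mono add_mono divide_right_mono) (auto simp: divide_le_eq_1)
    finally show ?thesis using pq by (simp add: A_def B_def add.commute)
  qed
  show "(\<integral>x. k x * norm (w x) \<partial>M) \<le> (\<integral>x. k x powr q \<partial>M) powr (1 / q) * normLp M p w"
  proof -
    have "(\<integral>x. k x * norm (w x) \<partial>M) \<le> (A0 + 0) * (normLp M p w + 0)"
      by (rule le_at_zero_limit) (use bd in \<open>auto intro!: continuous_intros\<close>)
    then show ?thesis by (simp add: A0_def)
  qed
qed

text \<open>Since the measure is finite, Hoelder against the constant 1 turns an \<open>L^p\<close>
  Cauchy sequence into an \<open>L^1\<close> one, which has an almost everywhere convergent
  subsequence. Fatou's lemma along it bounds the distance of each \<open>s n\<close> to the
  limit.\<close>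

lemma Lp_complete:
  fixes s :: "nat \<Rightarrow> 'b \<Rightarrow> 'a::euclidean_space"
  assumes fin: "finite_measure M" and p: "2 \<le> p" and s: "\<And>n. memLp M p (s n)"
    and cauchy: "\<And>e. 0 < e \<Longrightarrow> \<exists>n0. \<forall>i\<ge>n0. \<forall>j\<ge>n0. normLp M p (\<lambda>x. s i x - s j x) < e"
  obtains w where "memLp M p w" "(\<lambda>n. normLp M p (\<lambda>x. s n x - w x)) \<longlonglongrightarrow> 0"
proof -
  interpret finite_measure M by (rule fin)
  have p0: "0 < p" using p by simp
  define c where "c = (\<integral>x. 1 powr (real p / (real p - 1)) \<partial>M) powr (1 / (real p / (real p - 1)))"
  have c: "0 \<le> c" by (simp add: c_def)
  have L1: "integrable M (\<lambda>x. norm (w x))" "(\<integral>x. norm (w x) \<partial>M) \<le> c * normLp M p w"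
    if "memLp M p w" for w :: "'b \<Rightarrow> 'a"
    using hoelder[OF p refl _ _ _ that, of "\<lambda>_. 1"] by (auto simp: c_def)
  have sm[measurable]: "s n \<in> borel_measurable M" for n using memLp_meas[OF s] .
  have "\<exists>N. \<forall>i\<ge>N. \<forall>j\<ge>N. (\<integral>x. norm (s i x - s j x) \<partial>M) < e" if e: "0 < e" for e
  proof -
    obtain n0 where n0: "\<And>i j. i \<ge> n0 \<Longrightarrow> j \<ge> n0 \<Longrightarrow> normLp M p (\<lambda>x. s i x - s j x) < e / (c + 1)"
      using cauchy[of "e / (c + 1)"] e c by (auto simp: add_nonneg_pos)
    have "(\<integral>x. norm (s i x - s j x) \<partial>M) < e" if ij: "i \<ge> n0" "j \<ge> n0" for i j
    proof -
      have "(\<integral>x. norm (s i x - s j x) \<partial>M) \<le> c * normLp M p (\<lambda>x. s i x - s j x)"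
        by (intro L1 memLp_diff s)
      also have "\<dots> \<le> (c + 1) * normLp M p (\<lambda>x. s i x - s j x)" by (simp add: algebra_simps normLp_nonneg)
      also have "\<dots> < e" using n0[OF ij] c by (simp add: field_simps)
      finally show ?thesis .
    qed
    then show ?thesis by blast
  qed
  moreover have "integrable M (s n)" for n
    using L1(1)[OF s[of n]] sm by (rule integrable_norm_cancel)
  ultimately obtain r where r: "strict_mono r" "AE x in M. Cauchy (\<lambda>i. s (r i) x)"
    using cauchy_L1_AE_cauchy_subseq[of M s] by metis
  define w where "w x = lim (\<lambda>i. s (r i) x)" for x
  have w[measurable]: "w \<in> borel_measurable M"
    unfolding w_def by (intro borel_measurable_lim_metric) simp
  have lim: "AE x in M. (\<lambda>i. s (r i) x) \<longlonglongrightarrow> w x"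
    using r(2) by eventually_elim (simp add: w_def Cauchy_convergent_iff convergent_LIMSEQ_iff)
  have key: "integrable M (\<lambda>x. norm (s n x - w x) ^ p) \<and> (\<integral>x. norm (s n x - w x) ^ p \<partial>M) \<le> e ^ p"
    if e: "0 < e" and n: "\<And>j. j \<ge> n0 \<Longrightarrow> normLp M p (\<lambda>x. s n x - s j x) < e" for n n0 e
  proof -
    have "(\<integral>\<^sup>+x. ennreal (norm (s n x - w x) ^ p) \<partial>M) = (\<integral>\<^sup>+x. liminf (\<lambda>i. ennreal (norm (s n x - s (r i) x) ^ p)) \<partial>M)"
    proof (rule nn_integral_cong_AE)
      show "AE x in M. ennreal (norm (s n x - w x) ^ p) = liminf (\<lambda>i. ennreal (norm (s n x - s (r i) x) ^ p))"
        using lim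
      proof eventually_elim
        case (elim x)
        have "(\<lambda>i. ennreal (norm (s n x - s (r i) x) ^ p)) \<longlonglongrightarrow> ennreal (norm (s n x - w x) ^ p)"
          by (intro tendsto_intros tendsto_ennrealI elim)
        then show ?case using lim_imp_Liminf[OF sequentially_bot] by metis
      qed
    qed
    also have "\<dots> \<le> liminf (\<lambda>i. \<integral>\<^sup>+x. ennreal (norm (s n x - s (r i) x) ^ p) \<partial>M)"
      by (intro nn_integral_liminf) simp
    also have "\<dots> \<le> ennreal (e ^ p)"
    proof (rule order.trans[OF Liminf_mono[of _ "\<lambda>_. ennreal (e ^ p)"]])
      show "eventually (\<lambda>i. (\<integral>\<^sup>+x. ennreal (norm (s n x - s (r i) x) ^ p) \<partial>M) \<le> ennreal (e ^ p)) sequentially"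
        using eventually_ge_at_top[of n0]
      proof eventually_elim
        case (elim i)
        then have "normLp M p (\<lambda>x. s n x - s (r i) x) ^ p \<le> e ^ p"
          using n[of "r i"] seq_suble[OF r(1), of i] by (intro power_mono normLp_nonneg) auto
        then show ?case
          using memLp_int[OF memLp_diff[OF s[of n] s[of "r i"]]]
          by (subst nn_integral_eq_integral) (auto simp: normLp_power[OF p0] ennreal_leI)
      qed
    qed (simp add: Liminf_const)
    finally have bd: "(\<integral>\<^sup>+x. ennreal (norm (s n x - w x) ^ p) \<partial>M) \<le> ennreal (e ^ p)" .
    have "integrable M (\<lambda>x. norm (s n x - w x) ^ p)"
      using bd by (intro integrableI_bounded) (auto simp: le_less_trans ennreal_less_top top.not_eq_extremum)
    then show ?thesis using bd e by (subst (asm) nn_integral_eq_integral) (auto simp: ennreal_le_iff)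
  qed
  have "memLp M p w"
  proof -
    obtain n0 where "\<And>i j. i \<ge> n0 \<Longrightarrow> j \<ge> n0 \<Longrightarrow> normLp M p (\<lambda>x. s i x - s j x) < 1"
      using cauchy[of 1] by auto
    then have "memLp M p (\<lambda>x. s n0 x - w x)" using key[of 1 n0 n0] by (auto simp: memLp_def)
    from memLp_diff[OF s[of n0] this] show ?thesis by simp
  qed
  moreover have "(\<lambda>n. normLp M p (\<lambda>x. s n x - w x)) \<longlonglongrightarrow> 0"
  proof (rule LIMSEQ_I)
    fix e :: real assume e: "0 < e"
    obtain n0 where n0: "\<And>i j. i \<ge> n0 \<Longrightarrow> j \<ge> n0 \<Longrightarrow> normLp M p (\<lambda>x. s i x - s j x) < e / 2"
      using cauchy[of "e / 2"] e by auto
    have "normLp M p (\<lambda>x. s n x - w x) < e" if "n \<ge> n0" for n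
    proof -
      have "normLp M p (\<lambda>x. s n x - w x) ^ p \<le> (e / 2) ^ p"
        using key[of "e / 2" n0 n] n0 that e by (simp add: normLp_power[OF p0])
      then have "normLp M p (\<lambda>x. s n x - w x) \<le> e / 2" using e p0 by (simp add: power_mono_iff normLp_nonneg)
      then show ?thesis using e by simp
    qed
    then show "\<exists>n0. \<forall>n\<ge>n0. norm (normLp M p (\<lambda>x. s n x - w x) - 0) < e"
      by (auto simp: abs_of_nonneg normLp_nonneg)
  qed
  ultimately show ?thesis by (rule that)
qed

section \<open>Riemann--Liouville integrals\<close>

text \<open>No factor \<open>1 / Gamma a\<close> here, and the value is \<open>0\<close> where the integrand is not integrable.\<close>

definition rlk :: "real \<Rightarrow> (real \<Rightarrow> 'a::euclidean_space) \<Rightarrow> real \<Rightarrow> 'a" where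
  "rlk a f t = (\<integral>s. (indicator {0<..<t} s * (t - s) powr (a - 1)) *\<^sub>R f s \<partial>lborel)"

definition rl :: "real \<Rightarrow> (real \<Rightarrow> 'a::euclidean_space) \<Rightarrow> real \<Rightarrow> 'a" where
  "rl a f t = (1 / Gamma a) *\<^sub>R rlk a f t"

text \<open>The substitution s = \<tau> + (t - \<tau>) x leads to Euler's Beta integral. This is the
  inner integral when two fractional integrals are composed.\<close>

lemma beta_kernel:
  fixes a b \<tau> t :: real
  assumes a: "0 < a" and b: "0 < b" and \<tau>: "\<tau> < t"
  shows "has_bochner_integral lborel (\<lambda>s. indicator {\<tau><..<t} s * ((t - s) powr (a - 1) * (s - \<tau>) powr (b - 1)))
           (Beta a b * (t - \<tau>) powr (a + b - 1))"
proof -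
  have "has_bochner_integral lborel (\<lambda>x. indicator {0..1} x *\<^sub>R (x powr (b - 1) * (1 - x) powr (a - 1))) (Beta b a)"
    using integrable_Beta[OF b a] integral_unique[OF has_integral_Beta_real[OF b a]]
      set_borel_integral_eq_integral(2)[OF integrable_Beta[OF b a]]
    by (simp add: has_bochner_integral_iff set_integrable_def set_lebesgue_integral_def)
  then have "has_bochner_integral lborel (\<lambda>x. ((t - \<tau>) powr (a + b - 2)) * (indicator {0..1} x *\<^sub>R (x powr (b - 1) * (1 - x) powr (a - 1))))
      ((t - \<tau>) powr (a + b - 2) * Beta b a)"
    by (intro has_bochner_integral_mult_right)
  also have "(\<lambda>x. ((t - \<tau>) powr (a + b - 2)) * (indicator {0..1} x *\<^sub>R (x powr (b - 1) * (1 - x) powr (a - 1)))) =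
      (\<lambda>x. indicator {\<tau><..<t} (\<tau> + (t - \<tau>) * x) * ((t - (\<tau> + (t - \<tau>) * x)) powr (a - 1) * ((\<tau> + (t - \<tau>) * x) - \<tau>) powr (b - 1)))"
  proof
    fix x
    show "((t - \<tau>) powr (a + b - 2)) * (indicator {0..1} x *\<^sub>R (x powr (b - 1) * (1 - x) powr (a - 1))) =
      indicator {\<tau><..<t} (\<tau> + (t - \<tau>) * x) * ((t - (\<tau> + (t - \<tau>) * x)) powr (a - 1) * ((\<tau> + (t - \<tau>) * x) - \<tau>) powr (b - 1))"
    proof (cases "0 < x \<and> x < 1")
      case True
      have "(t - \<tau>) * x < t - \<tau>" "0 < (t - \<tau>) * x" using True \<tau> by simp_all
      then have "\<tau> + (t - \<tau>) * x \<in> {\<tau><..<t}" by (simp only: greaterThanLessThan_iff) linarith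
      then have "indicator {\<tau><..<t} (\<tau> + (t - \<tau>) * x) = (1::real)" by (rule indicator_eq_1_iff[THEN iffD2])
      moreover have "t - (\<tau> + (t - \<tau>) * x) = (t - \<tau>) * (1 - x)" by (simp add: algebra_simps)
      moreover have "(t - \<tau>) powr (a + b - 2) = (t - \<tau>) powr (a - 1) * (t - \<tau>) powr (b - 1)"
        using \<tau> by (simp flip: powr_add)
      ultimately show ?thesis using True \<tau> by (simp add: powr_mult)
    next
      case False
      then consider "x \<le> 0" | "1 \<le> x" by linarith
      then have "indicator {\<tau><..<t} (\<tau> + (t - \<tau>) * x) = (0::real)"
      proof cases
        case 1
        then have "(t - \<tau>) * x \<le> 0" using \<tau> by (simp add: mult_nonneg_nonpos)
        then show ?thesis by simp
      next
        case 2
        then have "(t - \<tau>) * 1 \<le> (t - \<tau>) * x" using \<tau> by (intro mult_left_mono) auto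
        then show ?thesis by simp
      qed
      then show ?thesis using False by (auto simp: indicator_def)
    qed
  qed
  also have "(t - \<tau>) powr (a + b - 2) * Beta b a = (Beta a b * (t - \<tau>) powr (a + b - 1)) /\<^sub>R \<bar>t - \<tau>\<bar>"
  proof -
    have "(t - \<tau>) powr (a + b - 1) = (t - \<tau>) powr (a + b - 2) * (t - \<tau>)"
      using \<tau> powr_mult_base[of "t - \<tau>" "a + b - 2"] by (simp add: mult.commute)
    then show ?thesis using \<tau> by (simp add: Beta_commute)
  qed
  finally show ?thesis
    using \<tau> by (subst lborel_has_bochner_integral_real_affine_iff[of "t - \<tau>" _ _ \<tau>]) auto
qed

text \<open>The case b = 1 and \<tau> = 0 of \<open>beta_kernel\<close>, with Beta a 1 =
  1/a.\<close>

lemma power_kernel: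
  fixes a t :: real
  assumes a: "0 < a" and t: "0 \<le> t"
  shows "has_bochner_integral lborel (\<lambda>s. indicator {0<..<t} s * (t - s) powr (a - 1)) (t powr a / a)"
proof (cases "t = 0")
  case False
  have "Gamma a \<noteq> 0" using Gamma_real_pos[OF a] by (rule less_imp_neq[symmetric])
  then have "Beta a 1 = 1 / a"
    using a Gamma_plus1[of a] by (simp add: Beta_def add.commute nonpos_Ints_def)
  moreover have "(\<lambda>s. indicator {0<..<t} s * ((t - s) powr (a - 1) * (s - 0) powr (1 - 1))) = (\<lambda>s. indicator {0<..<t} s * (t - s) powr (a - 1))"
    by (auto simp: indicator_def)
  ultimately show ?thesis using beta_kernel[of a 1 0 t] False t a by simp
qed (simp add: has_bochner_integral_zero)

lemma rlk_integrable:
  assumes a: "0 < a" and t: "0 \<le> t" and f[measurable]: "f \<in> borel_measurable borel"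
    and B: "\<And>s. 0 < s \<Longrightarrow> s < t \<Longrightarrow> norm (f s) \<le> B"
  shows "integrable lborel (\<lambda>s. (indicator {0<..<t} s * (t - s) powr (a - 1)) *\<^sub>R f s)"
    and "norm (rlk a f t) \<le> B * (t powr a / a)"
proof -
  note pk = power_kernel[OF a t, unfolded has_bochner_integral_iff]
  have int: "integrable lborel (\<lambda>s. B * (indicator {0<..<t} s * (t - s) powr (a - 1)))" using pk by auto
  have le: "norm ((indicator {0<..<t} s * (t - s) powr (a - 1)) *\<^sub>R f s) \<le> B * (indicator {0<..<t} s * (t - s) powr (a - 1))" for s
    using mult_right_mono[OF B[of s], of "(t - s) powr (a - 1)"] by (auto simp: indicator_def mult.commute)
  then have ae: "AE s in lborel. norm ((indicator {0<..<t} s * (t - s) powr (a - 1)) *\<^sub>R f s) \<le> norm (B * (indicator {0<..<t} s * (t - s) powr (a - 1)))"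
    by (intro AE_I2) (smt (verit) real_norm_def)
  show i: "integrable lborel (\<lambda>s. (indicator {0<..<t} s * (t - s) powr (a - 1)) *\<^sub>R f s)"
    by (rule Bochner_Integration.integrable_bound[OF int _ ae]) measurable
  have "norm (rlk a f t) \<le> (\<integral>s. B * (indicator {0<..<t} s * (t - s) powr (a - 1)) \<partial>lborel)"
    unfolding rlk_def by (rule order.trans[OF integral_norm_bound integral_mono[OF integrable_norm[OF i] int le]])
  then show "norm (rlk a f t) \<le> B * (t powr a / a)" using pk by simp
qed

text \<open>Fubini on the triangle 0 < \<tau> < s < t: for fixed \<tau> the integral in s is the
  Beta integral. Boundedness of \<open>f\<close> supplies the integrability.\<close>

lemma rlk_semigroup:
  fixes f :: "real \<Rightarrow> 'a::euclidean_space"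
  assumes a: "0 < a" and b: "0 < b" and t: "0 \<le> t" and f[measurable]: "f \<in> borel_measurable borel"
    and B: "\<And>s. 0 < s \<Longrightarrow> s < t \<Longrightarrow> norm (f s) \<le> B"
  shows "rlk a (rlk b f) t = Beta a b *\<^sub>R rlk (a + b) f t"
proof -
  define K where "K \<tau> s = indicator {0<..<t} \<tau> * (indicator {\<tau><..<t} s * ((t - s) powr (a - 1) * (s - \<tau>) powr (b - 1)))" for \<tau> s :: real
  have K0: "0 \<le> K \<tau> s" for \<tau> s by (auto simp: K_def)
  define G where "G = (\<lambda>(\<tau>, s). K \<tau> s *\<^sub>R f \<tau>)"
  have Kint: "has_bochner_integral lborel (K \<tau>) (Beta a b * (indicator {0<..<t} \<tau> * (t - \<tau>) powr (a + b - 1)))" for \<tau>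
  proof (cases "\<tau> \<in> {0<..<t}")
    case True
    then show ?thesis using beta_kernel[OF a b, of \<tau> t] unfolding K_def by simp
  next
    case False
    then show ?thesis unfolding K_def by (simp add: has_bochner_integral_zero)
  qed
  have ab: "0 < a + b" using a b by simp
  have G: "integrable (lborel \<Otimes>\<^sub>M lborel) G"
  proof (rule lborel_pair.Fubini_integrable)
    have "{x :: real \<times> real. fst x < snd x \<and> snd x < t} \<in> sets borel"
      by (intro borel_open open_Collect_conj open_Collect_less continuous_intros)
    moreover have "(indicator {fst x<..<t} (snd x)) = (indicator {x. fst x < snd x \<and> snd x < t} x :: real)" for x :: "real \<times> real"
      by (auto simp: indicator_def)
    ultimately show "G \<in> borel_measurable (lborel \<Otimes>\<^sub>M lborel)"
      unfolding G_def K_def case_prod_beta by (simp add: borel_prod[symmetric]) measurable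
    have "(\<lambda>\<tau>. \<integral>s. norm (G (\<tau>, s)) \<partial>lborel) = (\<lambda>\<tau>. Beta a b * norm ((indicator {0<..<t} \<tau> * (t - \<tau>) powr (a + b - 1)) *\<^sub>R f \<tau>))"
    proof
      fix \<tau>
      have "(\<integral>s. norm (G (\<tau>, s)) \<partial>lborel) = (\<integral>s. K \<tau> s * norm (f \<tau>) \<partial>lborel)"
        by (simp add: G_def K0)
      also have "\<dots> = Beta a b * (indicator {0<..<t} \<tau> * (t - \<tau>) powr (a + b - 1)) * norm (f \<tau>)"
        using Kint[of \<tau>] by (simp add: has_bochner_integral_iff)
      finally show "(\<integral>s. norm (G (\<tau>, s)) \<partial>lborel) = Beta a b * norm ((indicator {0<..<t} \<tau> * (t - \<tau>) powr (a + b - 1)) *\<^sub>R f \<tau>)"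
        by simp
    qed
    then show "integrable lborel (\<lambda>\<tau>. \<integral>s. norm (G (\<tau>, s)) \<partial>lborel)"
      using integrable_mult_right[OF integrable_norm[OF rlk_integrable(1)[OF ab t f B]]] by (simp only:)
    show "AE \<tau> in lborel. integrable lborel (\<lambda>s. G (\<tau>, s))"
      using Kint by (auto simp: G_def has_bochner_integral_iff)
  qed
  have "rlk a (rlk b f) t = (\<integral>s. (\<integral>\<tau>. K \<tau> s *\<^sub>R f \<tau> \<partial>lborel) \<partial>lborel)"
    unfolding rlk_def
  proof (intro Bochner_Integration.integral_cong refl)
    fix s
    have "(indicator {0<..<t} s * (t - s) powr (a - 1)) *\<^sub>R (\<integral>\<tau>. (indicator {0<..<s} \<tau> * (s - \<tau>) powr (b - 1)) *\<^sub>R f \<tau> \<partial>lborel)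
      = (\<integral>\<tau>. (indicator {0<..<t} s * (t - s) powr (a - 1)) *\<^sub>R ((indicator {0<..<s} \<tau> * (s - \<tau>) powr (b - 1)) *\<^sub>R f \<tau>) \<partial>lborel)"
      by (rule integral_scaleR_right[symmetric])
    also have "\<dots> = (\<integral>\<tau>. K \<tau> s *\<^sub>R f \<tau> \<partial>lborel)"
      unfolding K_def by (intro Bochner_Integration.integral_cong) (auto simp: indicator_def)
    finally show "(indicator {0<..<t} s * (t - s) powr (a - 1)) *\<^sub>R (\<integral>\<tau>. (indicator {0<..<s} \<tau> * (s - \<tau>) powr (b - 1)) *\<^sub>R f \<tau> \<partial>lborel)
      = (\<integral>\<tau>. K \<tau> s *\<^sub>R f \<tau> \<partial>lborel)" .
  qed
  also have "\<dots> = (\<integral>\<tau>. (\<integral>s. K \<tau> s *\<^sub>R f \<tau> \<partial>lborel) \<partial>lborel)"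
    using G unfolding G_def by (rule lborel_pair.Fubini_integral)
  also have "\<dots> = (\<integral>\<tau>. Beta a b *\<^sub>R ((indicator {0<..<t} \<tau> * (t - \<tau>) powr (a + b - 1)) *\<^sub>R f \<tau>) \<partial>lborel)"
    using Kint by (intro Bochner_Integration.integral_cong refl) (simp add: has_bochner_integral_iff)
  also have "\<dots> = Beta a b *\<^sub>R rlk (a + b) f t"
    unfolding rlk_def by (rule integral_scaleR_right)
  finally show ?thesis .
qed

lemma rlk_scaleR: "rlk a (\<lambda>s. c *\<^sub>R f s) t = c *\<^sub>R rlk a f t"
proof -
  have "(\<lambda>s. (indicator {0<..<t} s * (t - s) powr (a - 1)) *\<^sub>R c *\<^sub>R f s)
      = (\<lambda>s. c *\<^sub>R ((indicator {0<..<t} s * (t - s) powr (a - 1)) *\<^sub>R f s))"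
    by (intro ext scaleR_left_commute)
  then show ?thesis unfolding rlk_def by (simp only: integral_scaleR_right)
qed

lemma rl_semigroup:
  fixes f :: "real \<Rightarrow> 'a::euclidean_space"
  assumes a: "0 < a" and b: "0 < b" and t: "0 \<le> t" and f: "f \<in> borel_measurable borel"
    and B: "\<And>s. 0 < s \<Longrightarrow> s < t \<Longrightarrow> norm (f s) \<le> B"
  shows "rl a (rl b f) t = rl (a + b) f t"
proof -
  have "rl a (rl b f) t = (1 / Gamma a * (1 / Gamma b) * Beta a b) *\<^sub>R rlk (a + b) f t"
  proof -
    have "rl b f = (\<lambda>s. (1 / Gamma b) *\<^sub>R rlk b f s)" by (simp add: rl_def fun_eq_iff)
    then show ?thesis using rlk_semigroup[OF a b t f B] by (simp add: rl_def rlk_scaleR)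
  qed
  also have "1 / Gamma a * (1 / Gamma b) * Beta a b = 1 / Gamma (a + b)"
    using Gamma_real_pos[OF a] Gamma_real_pos[OF b] by (simp add: Beta_def)
  finally show ?thesis by (simp only: rl_def[of "a + b"])
qed

lemma rlk_cong: "(\<And>s. 0 < s \<Longrightarrow> s < t \<Longrightarrow> f s = g s) \<Longrightarrow> rlk a f t = rlk a g t"
  unfolding rlk_def by (intro Bochner_Integration.integral_cong) (auto simp: indicator_def)

lemma rl_cong: "(\<And>s. 0 < s \<Longrightarrow> s < t \<Longrightarrow> f s = g s) \<Longrightarrow> rl a f t = rl a g t"
  unfolding rl_def by (simp add: rlk_cong[of t f g])

lemma rlk_eq_integral:
  assumes int: "integrable lborel (\<lambda>s. (indicator {0<..<t} s * (t - s) powr (a - 1)) *\<^sub>R f s)"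
  shows "rlk a f t = integral {0..t} (\<lambda>s. (t - s) powr (a - 1) *\<^sub>R f s)"
  using set_borel_integral_eq_integral(2)[of "{0<..<t}" "\<lambda>s. (t - s) powr (a - 1) *\<^sub>R f s"] int
  by (simp add: set_integrable_def set_lebesgue_integral_def rlk_def integral_open_interval_real)

lemma rl_1:
  assumes f: "continuous_on {0..t} f" and m: "f \<in> borel_measurable borel" and t: "0 \<le> t"
  shows "rl 1 f t = integral {0..t} f"
proof -
  obtain B where B: "\<And>s. s \<in> {0..t} \<Longrightarrow> norm (f s) \<le> B"
    using continuous_on_Icc_bounded[OF f] by blast
  have "rlk 1 f t = integral {0..t} (\<lambda>s. (t - s) powr (1 - 1) *\<^sub>R f s)"
    by (intro rlk_eq_integral rlk_integrable(1)[where B=B]) (use m t B in auto)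
  \<comment> \<open>Since \<open>0 powr 0\<close> is \<open>0\<close>, the integrands differ at the
    end point s = t.\<close>
  also have "\<dots> = integral {0..t} f"
    by (rule integral_spike[of "{t}"]) auto
  finally show ?thesis by (simp add: rl_def)
qed

text \<open>For z = x and z = y one has z^q = z z^(q-1) <= z (x + y)^(q-1); the two bounds are
  added.\<close>

lemma powr_superadditive:
  fixes x y :: real assumes "0 \<le> x" "0 \<le> y" "1 \<le> q"
  shows "x powr q + y powr q \<le> (x + y) powr q"
proof (cases "x + y = 0")
  case False
  have *: "z powr q \<le> z * (x + y) powr (q - 1)" if "0 \<le> z" "z \<le> x + y" for z
  proof (cases "z = 0")
    case False
    then have "z powr q = z * z powr (q - 1)" using that by (simp add: powr_mult_base)
    also have "\<dots> \<le> z * (x + y) powr (q - 1)" using that assms by (intro mult_left_mono powr_mono2) auto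
    finally show ?thesis .
  qed (use assms in auto)
  have "x powr q + y powr q \<le> (x + y) * (x + y) powr (q - 1)"
    using *[of x] *[of y] assms by (simp add: algebra_simps)
  also have "\<dots> = (x + y) powr q" using False assms by (simp add: powr_mult_base)
  finally show ?thesis .
qed (use assms in \<open>simp add: add_nonneg_eq_0_iff\<close>)

section \<open>Powers and differences of the fractional kernels\<close>

definition rker :: "real \<Rightarrow> real \<Rightarrow> real \<Rightarrow> real" where
  "rker a t s = indicator {0<..<t} s * (t - s) powr (a - 1)"

lemma rker_nonneg: "0 \<le> rker a t s" by (simp add: rker_def)

lemma rker_measurable[measurable]: "rker a t \<in> borel_measurable borel"
  unfolding rker_def by measurable

text \<open>A power of a kernel is again a kernel, which makes its \<open>L^q\<close> norm
  explicit.\<close>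

lemma rker_powr: "rker a t s powr q = rker ((a - 1) * q + 1) t s"
  by (cases "s \<in> {0<..<t}") (simp_all add: rker_def powr_powr)

lemma rker_integral:
  assumes "0 < a" "0 \<le> t" shows "has_bochner_integral lborel (rker a t) (t powr a / a)"
  using power_kernel[OF assms] by (simp add: rker_def[abs_def])

text \<open>As a <= 1, the kernel values at a fixed r < s do not increase with the upper limit, and
  superadditivity of the q-th power gives |x - y|^q <= x^q - y^q for the kernel values x at s and y
  at t.\<close>

lemma rker_diff:
  assumes a: "a \<le> 1" and q: "1 \<le> q" and m: "m = (a - 1) * q + 1" "0 < m" and st: "0 \<le> s" "s \<le> t"
  shows "integrable lborel (\<lambda>r. \<bar>rker a t r - rker a s r\<bar> powr q)"
    and "(\<integral>r. \<bar>rker a t r - rker a s r\<bar> powr q \<partial>lborel) \<le> 2 * (t - s) powr m / m"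
proof -
  have t: "0 \<le> t" using st by simp
  define U where "U r = rker m s r - rker m t r + 2 * rker m (t - s) (r - s)" for r
  have ts: "has_bochner_integral lborel (\<lambda>r. rker m (t - s) (r - s)) ((t - s) powr m / m)"
    using lborel_has_bochner_integral_real_affine_iff[of 1 "rker m (t - s)" "(t - s) powr m / m" "- s"]
      rker_integral[OF m(2), of "t - s"] st by simp
  have U: "has_bochner_integral lborel U (s powr m / m - t powr m / m + 2 * ((t - s) powr m / m))"
    unfolding U_def by (intro has_bochner_integral_add has_bochner_integral_diff has_bochner_integral_mult_right rker_integral m ts st t)
  have pw: "\<bar>rker a t r - rker a s r\<bar> powr q \<le> U r" if "r \<noteq> s" for r
  proof (cases "0 < r \<and> r < t")
    case False
    then have "rker a t r = 0" "rker a s r = 0" "rker m t r = 0" "rker m s r = 0"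
      using st by (auto simp: rker_def)
    then show ?thesis by (simp add: U_def rker_nonneg)
  next
    case True
    show ?thesis
    proof (cases "r < s")
      case False
      then have "s < r" using that by simp
      then have "rker a s r = 0" "rker m s r = 0" "rker m (t - s) (r - s) = rker m t r"
        using True st by (auto simp: rker_def)
      then show ?thesis unfolding U_def using rker_powr[of a t r q] m(1) by (simp add: rker_nonneg abs_of_nonneg)
    next
      case r: True
      define x y where "x = rker a s r" and "y = rker a t r"
      have "(t - r) powr (a - 1) \<le> (s - r) powr (a - 1)" using r st a by (intro powr_mono2') auto
      then have xy: "0 \<le> y" "y \<le> x" using r True by (auto simp: x_def y_def rker_def)
      have "(x - y) powr q + y powr q \<le> (x - y + y) powr q" using xy q by (intro powr_superadditive) auto
      then have "\<bar>y - x\<bar> powr q \<le> x powr q - y powr q" using xy by (simp add: abs_minus_commute)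
      moreover have "rker m (t - s) (r - s) = 0" using r by (simp add: rker_def)
      ultimately show ?thesis unfolding U_def x_def y_def rker_powr m(1) by simp
    qed
  qed
  have ae: "AE r in lborel. \<bar>rker a t r - rker a s r\<bar> powr q \<le> U r"
    using AE_lborel_singleton[of s] by eventually_elim (use pw in auto)
  have Ui: "integrable lborel U" using U by (simp add: has_bochner_integral_iff)
  show int: "integrable lborel (\<lambda>r. \<bar>rker a t r - rker a s r\<bar> powr q)"
    by (rule Bochner_Integration.integrable_bound[OF Ui]) (use ae in \<open>auto elim!: eventually_mono\<close>)
  have "(\<integral>r. \<bar>rker a t r - rker a s r\<bar> powr q \<partial>lborel) \<le> s powr m / m - t powr m / m + 2 * ((t - s) powr m / m)"
    using integral_mono_AE[OF int Ui ae] U by (simp add: has_bochner_integral_iff)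
  also have "s powr m / m - t powr m / m \<le> 0"
    using st m by (simp add: divide_right_mono powr_mono2)
  finally show "(\<integral>r. \<bar>rker a t r - rker a s r\<bar> powr q \<partial>lborel) \<le> 2 * (t - s) powr m / m" by simp
qed

text \<open>For bounded \<open>f\<close> the case q = 1 of \<open>rker_diff\<close> suffices. It
  makes fractional derivatives of smooth functions continuous up to the end points.\<close>

lemma rlk_holder_continuous:
  fixes f :: "real \<Rightarrow> 'a::euclidean_space"
  assumes a: "0 < a" "a \<le> 1" and st: "0 \<le> s" "s \<le> t" and f[measurable]: "f \<in> borel_measurable borel"
    and B: "\<And>s. 0 < s \<Longrightarrow> s < t \<Longrightarrow> norm (f s) \<le> B" and B0: "0 \<le> B"
  shows "norm (rlk a f t - rlk a f s) \<le> B * (2 * (t - s) powr a / a)"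
proof -
  have t: "0 \<le> t" using st by simp
  have i: "integrable lborel (\<lambda>r. rker a t r *\<^sub>R f r)" "integrable lborel (\<lambda>r. rker a s r *\<^sub>R f r)"
    unfolding rker_def using rlk_integrable(1)[OF a(1) t f B] rlk_integrable(1)[OF a(1) st(1) f, of B] B st by auto
  have d: "integrable lborel (\<lambda>r. \<bar>rker a t r - rker a s r\<bar>)" "(\<integral>r. \<bar>rker a t r - rker a s r\<bar> \<partial>lborel) \<le> 2 * (t - s) powr a / a"
    using rker_diff[of a 1 a s t] a st by auto
  have "rlk a f t - rlk a f s = (\<integral>r. (rker a t r - rker a s r) *\<^sub>R f r \<partial>lborel)"
    unfolding rlk_def rker_def[symmetric] using i by (simp add: scaleR_diff_left)
  also have "norm \<dots> \<le> (\<integral>r. B * \<bar>rker a t r - rker a s r\<bar> \<partial>lborel)"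
  proof (rule order.trans[OF integral_norm_bound integral_mono])
    show "integrable lborel (\<lambda>r. norm ((rker a t r - rker a s r) *\<^sub>R f r))"
      by (rule integrable_norm) (use i in \<open>simp add: scaleR_diff_left\<close>)
    show "integrable lborel (\<lambda>r. B * \<bar>rker a t r - rker a s r\<bar>)" using d by simp
    fix r
    show "norm ((rker a t r - rker a s r) *\<^sub>R f r) \<le> B * \<bar>rker a t r - rker a s r\<bar>"
    proof (cases "0 < r \<and> r < t")
      case True
      then show ?thesis using mult_left_mono[OF B[of r], of "\<bar>rker a t r - rker a s r\<bar>"] by (simp add: mult.commute)
    next
      case False
      then have "rker a t r = 0" "rker a s r = 0" using st by (auto simp: rker_def)
      then show ?thesis by simp
    qed
  qed
  also have "\<dots> = B * (\<integral>r. \<bar>rker a t r - rker a s r\<bar> \<partial>lborel)" by simp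
  also have "\<dots> \<le> B * (2 * (t - s) powr a / a)" using d B0 by (intro mult_left_mono) auto
  finally show ?thesis .
qed

lemma rl_continuous_on:
  fixes f :: "real \<Rightarrow> 'a::euclidean_space"
  assumes a: "0 < a" "a \<le> 1" and f: "f \<in> borel_measurable borel"
    and B: "\<And>s. 0 < s \<Longrightarrow> s < T \<Longrightarrow> norm (f s) \<le> B" and B0: "0 \<le> B"
  shows "continuous_on {0..T} (rl a f)"
proof -
  have le: "norm (rlk a f x - rlk a f y) \<le> B * (2 * \<bar>x - y\<bar> powr a / a)" if "x \<in> {0..T}" "y \<in> {0..T}" for x y
    using rlk_holder_continuous[OF a _ _ f, of y x B] rlk_holder_continuous[OF a _ _ f, of x y B] that B B0
    by (cases "x \<le> y") (auto simp: norm_minus_commute abs_minus_commute)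
  have "continuous_on {0..T} (rlk a f)"
    unfolding continuous_on_def
  proof
    fix y assume y: "y \<in> {0..T}"
    have "((\<lambda>x. \<bar>x - y\<bar>) \<longlongrightarrow> \<bar>y - y\<bar>) (at y within {0..T})" by (intro tendsto_intros)
    then have "((\<lambda>x. \<bar>x - y\<bar> powr a) \<longlongrightarrow> 0) (at y within {0..T})"
      using a by (intro tendsto_zero_powrI[where b=a]) auto
    from tendsto_mult_left[OF this, of "B * 2 / a"]
    have "((\<lambda>x. B * (2 * \<bar>x - y\<bar> powr a / a)) \<longlongrightarrow> 0) (at y within {0..T})"
      by (simp add: mult_ac)
    then have "((\<lambda>x. rlk a f x - rlk a f y) \<longlongrightarrow> 0) (at y within {0..T})"
      by (rule Lim_null_comparison[rotated]) (use le[OF _ y] in \<open>auto simp: eventually_at intro!: exI[of _ 1]\<close>)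
    then show "(rlk a f \<longlongrightarrow> rlk a f y) (at y within {0..T})" by (simp add: LIM_zero_iff)
  qed
  then show ?thesis unfolding rl_def by (intro continuous_on_scaleR continuous_on_const)
qed

section \<open>The fractional norm on smooth functions\<close>

text \<open>Any sequence of successive derivatives may serve as witness; closure properties and
  explicit functions can then be treated without the iterates of
  \<open>vector_derivative\<close>.\<close>

lemma smooth_fun_iff:
  "smooth_fun f \<longleftrightarrow> (\<exists>G. G 0 = f \<and> (\<forall>k t. (G k has_vector_derivative G (Suc k) t) (at t)))"
proof
  assume "smooth_fun f"
  then show "\<exists>G. G 0 = f \<and> (\<forall>k t. (G k has_vector_derivative G (Suc k) t) (at t))"
    unfolding smooth_fun_def by (intro exI[of _ "\<lambda>k. vderiv_iter k f"]) auto
next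
  assume "\<exists>G. G 0 = f \<and> (\<forall>k t. (G k has_vector_derivative G (Suc k) t) (at t))"
  then obtain G where G: "G 0 = f" "\<And>k t. (G k has_vector_derivative G (Suc k) t) (at t)" by blast
  have "vderiv_iter k f = G k" for k
    by (induction k) (auto simp: G(1) vector_derivative_at[OF G(2)])
  then show "smooth_fun f" using G(2) unfolding smooth_fun_def by presburger
qed

lemma C0inf_subspace: "subspace {\<phi>::real \<Rightarrow> 'a::real_normed_vector. C0inf T \<phi>}"
proof (rule subspaceI)
  show "(0::real \<Rightarrow> 'a) \<in> {\<phi>. C0inf T \<phi>}"
    by (auto simp: C0inf_def smooth_fun_iff intro!: exI[of _ "\<lambda>k t. 0"])
next
  fix f g :: "real \<Rightarrow> 'a"
  assume "f \<in> {\<phi>. C0inf T \<phi>}" "g \<in> {\<phi>. C0inf T \<phi>}"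
  then obtain F G where "F 0 = f" "\<And>k t. (F k has_vector_derivative F (Suc k) t) (at t)"
    "G 0 = g" "\<And>k t. (G k has_vector_derivative G (Suc k) t) (at t)" and fg: "f 0 = 0" "f T = 0" "g 0 = 0" "g T = 0"
    unfolding C0inf_def smooth_fun_iff by auto
  then have "smooth_fun (f + g)" unfolding smooth_fun_iff
    by (intro exI[of _ "\<lambda>k t. F k t + G k t"]) (auto intro!: has_vector_derivative_add)
  then show "f + g \<in> {\<phi>. C0inf T \<phi>}" using fg by (simp add: C0inf_def)
next
  fix f :: "real \<Rightarrow> 'a" and c :: real
  assume "f \<in> {\<phi>. C0inf T \<phi>}"
  then obtain F where "F 0 = f" "\<And>k t. (F k has_vector_derivative F (Suc k) t) (at t)" and fg: "f 0 = 0" "f T = 0"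
    unfolding C0inf_def smooth_fun_iff by auto
  then have "smooth_fun (c *\<^sub>R f)" unfolding smooth_fun_iff
    by (intro exI[of _ "\<lambda>k t. c *\<^sub>R F k t"]) (auto intro!: bounded_linear.has_vector_derivative[OF bounded_linear_scaleR_right])
  then show "c *\<^sub>R f \<in> {\<phi>. C0inf T \<phi>}" using fg by (simp add: C0inf_def)
qed

lemma smooth_fun_deriv:
  assumes "smooth_fun f"
  obtains f' where "\<And>t. (f has_vector_derivative f' t) (at t)" "continuous_on UNIV f'" "continuous_on UNIV f"
proof -
  obtain G where G: "G 0 = f" "\<And>k t. (G k has_vector_derivative G (Suc k) t) (at t)"
    using assms unfolding smooth_fun_iff by blast
  have "continuous_on UNIV (G k)" for k
    by (auto intro!: continuous_at_imp_continuous_on has_vector_derivative_continuous[OF G(2)])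
  then show ?thesis using that[of "G 1"] G(2)[of 0] G(1) by auto
qed

section \<open>The seminormed space of smooth functions and its embeddings\<close>

locale frac =
  fixes T \<alpha> :: real and p :: nat
  assumes T: "0 < T" and p: "2 \<le> p" and \<alpha>: "1 / real p < \<alpha>" "\<alpha> \<le> 1"
begin

abbreviation M where "M \<equiv> lebesgue_on {0..T}"

text \<open>The q-th power of the kernel of order \<alpha> is the kernel of order \<open>m\<close>.
  Positivity of \<open>m\<close> is equivalent to \<alpha> > 1/p, which is where the embedding into
  bounded functions comes from.\<close>

definition m where "m = \<alpha> * q_conj p - q_conj p + 1"

lemma \<alpha>0: "0 < \<alpha>"
proof -
  have "0 < 1 / real p" using p by simp
  then show ?thesis using \<alpha> by linarith
qed

lemma q: "1 \<le> q_conj p" "1 < real p"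
  using p by (auto simp: q_conj_def field_simps)

lemma m: "m = (\<alpha> - 1) * q_conj p + 1" "0 < m" "m / q_conj p = \<alpha> - 1 / real p"
proof -
  show *: "m = (\<alpha> - 1) * q_conj p + 1" by (simp add: m_def algebra_simps)
  have iq: "1 / q_conj p = 1 - 1 / real p" using q by (simp add: q_conj_def field_simps)
  have "m / q_conj p = (\<alpha> - 1) + 1 / q_conj p" using q unfolding * by (simp add: field_simps)
  then show e: "m / q_conj p = \<alpha> - 1 / real p" using iq by simp
  have "0 < m / q_conj p" using e \<alpha> by simp
  then show "0 < m" using q by (simp add: zero_less_divide_iff)
qed

text \<open>Reads \<open>Kc\<close> as the \<open>L^q\<close> norm of the kernel
  \<open>rker \<alpha> T\<close> divided by \<open>Gamma \<alpha>\<close>.\<close>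

lemma Kc_eq: "Kc T p \<alpha> = (T powr m / m) powr (1 / q_conj p) / Gamma \<alpha>"
  using m T q by (simp add: Kc_def powr_divide powr_powr flip: m_def)

lemma Kc_pos: "0 < Kc T p \<alpha>"
  unfolding Kc_eq using m(2) T Gamma_real_pos[OF \<alpha>0] by simp

lemma finite_M: "finite_measure M"
  by (rule finite_measure_lebesgue_on) simp

text \<open>Kernel integrals are taken over \<open>lborel\<close>, where Fubini and substitution
  apply, whereas the problem is posed with Lebesgue measure on [0,T]; continuous functions can be
  moved between the two.\<close>

lemma lborel_eq_M:
  fixes f :: "real \<Rightarrow> 'b::{banach, second_countable_topology}"
  assumes "continuous_on {0..T} f"
  shows "integral\<^sup>L lborel (\<lambda>s. indicator {0..T} s *\<^sub>R f s) = integral\<^sup>L M f"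
    and "integrable M f" "integrable lborel (\<lambda>s. indicator {0..T} s *\<^sub>R f s)"
proof -
  have b: "(\<lambda>s. indicator {0..T} s *\<^sub>R f s) \<in> borel_measurable borel"
    using borel_measurable_continuous_on_indicator[OF _ assms] by simp
  show "integral\<^sup>L lborel (\<lambda>s. indicator {0..T} s *\<^sub>R f s) = integral\<^sup>L M f"
    using b by (subst integral_restrict_space) (auto simp: integral_completion)
  show i: "integrable lborel (\<lambda>s. indicator {0..T} s *\<^sub>R f s)"
    using borel_integrable_compact[OF compact_Icc assms] by simp
  show "integrable M f"
    using b i by (subst integrable_restrict_space) (auto simp: integrable_completion)
qed

lemma continuous_memLp:
  fixes f :: "real \<Rightarrow> 'a::euclidean_space"
  assumes "continuous_on {0..T} f" shows "memLp M p f"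
  unfolding memLp_def
  by (intro conjI lborel_eq_M(2) continuous_imp_measurable_on_sets_lebesgue continuous_intros assms) auto

lemma continuous_memLp_lborel:
  fixes f :: "real \<Rightarrow> 'a::euclidean_space"
  assumes f: "continuous_on {0..T} f"
  shows "memLp lborel p (\<lambda>s. indicator {0..T} s *\<^sub>R f s)"
    and "normLp lborel p (\<lambda>s. indicator {0..T} s *\<^sub>R f s) = normLp M p f"
proof -
  have "continuous_on {0..T} (\<lambda>s. norm (f s) ^ p)" by (intro continuous_intros f)
  note l = lborel_eq_M[OF this]
  have eq: "norm (indicator {0..T} s *\<^sub>R f s) ^ p = indicator {0..T} s *\<^sub>R norm (f s) ^ p" for s
    using p by (auto simp: indicator_def power_0_left)
  show "memLp lborel p (\<lambda>s. indicator {0..T} s *\<^sub>R f s)"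
    unfolding memLp_def eq using l(3) borel_measurable_continuous_on_indicator[OF _ f] by simp
  show "normLp lborel p (\<lambda>s. indicator {0..T} s *\<^sub>R f s) = normLp M p f"
    unfolding normLp_def eq using l(1) by simp
qed

definition S :: "(real \<Rightarrow> 'a::euclidean_space) set" where "S = {\<phi>. C0inf T \<phi>}"

abbreviation D :: "(real \<Rightarrow> 'a::euclidean_space) \<Rightarrow> real \<Rightarrow> 'a" where "D \<equiv> left_RL T \<alpha>"

text \<open>As \<open>\<phi> 0 = 0\<close>, the Riemann--Liouville derivative coincides with the Caputo derivative.\<close>

lemma D_eq:
  fixes \<phi> :: "real \<Rightarrow> 'a::euclidean_space"
  assumes \<phi>: "\<And>t. (\<phi> has_vector_derivative \<phi>' t) (at t)" "continuous_on UNIV \<phi>'" "\<phi> 0 = 0" and t: "t \<in> {0..T}"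
  shows "D \<phi> t = (if \<alpha> = 1 then \<phi>' t else rl (1 - \<alpha>) \<phi>' t)"
    and "\<phi> t = rl \<alpha> (\<lambda>s. indicator {0..T} s *\<^sub>R D \<phi> s) t"
    and "continuous_on {0..T} (D \<phi>)"
proof -
  have c\<phi>: "continuous_on UNIV \<phi>"
    by (auto intro!: continuous_at_imp_continuous_on has_vector_derivative_continuous[OF \<phi>(1)])
  have meas: "\<phi>' \<in> borel_measurable borel" "\<phi> \<in> borel_measurable borel"
    using \<phi>(2) c\<phi> by (auto intro: borel_measurable_continuous_onI)

  obtain B where B: "0 \<le> B" "\<And>s. s \<in> {0..T} \<Longrightarrow> norm (\<phi>' s) \<le> B"
    using continuous_on_Icc_bounded[OF continuous_on_subset[OF \<phi>(2) subset_UNIV]] by metis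
  obtain B2 where B2: "0 \<le> B2" "\<And>s. s \<in> {0..T} \<Longrightarrow> norm (\<phi> s) \<le> B2"
    using continuous_on_Icc_bounded[OF continuous_on_subset[OF c\<phi> subset_UNIV]] by metis
  have ftc: "rl 1 \<phi>' s = \<phi> s" if "0 \<le> s" for s
  proof -
    have "(\<phi>' has_integral (\<phi> s - \<phi> 0)) {0..s}"
      by (intro fundamental_theorem_of_calculus that has_vector_derivative_at_within[OF \<phi>(1)])
    then show ?thesis using rl_1[OF continuous_on_subset[OF \<phi>(2)] meas(1) that] \<phi>(3) by (simp add: integral_unique)
  qed
  define w where "w s = (if \<alpha> = 1 then \<phi>' s else rl (1 - \<alpha>) \<phi>' s)" for s
  have cw: "continuous_on {0..T} w"
  proof (cases "\<alpha> = 1")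
    case True
    then show ?thesis using continuous_on_subset[OF \<phi>(2)] by (simp add: w_def[abs_def])
  next
    case False
    then show ?thesis using \<alpha> \<alpha>0 rl_continuous_on[OF _ _ meas(1), of "1 - \<alpha>" T B] B by (simp add: w_def[abs_def])
  qed
  \<comment> \<open>Cut off outside [0,T] to obtain a globally Borel function; \<open>rl\<close> at
    times in [0,T] does not notice the change.\<close>
  define w' where "w' s = indicator {0..T} s *\<^sub>R w s" for s
  have mw': "w' \<in> borel_measurable borel"
    using borel_measurable_continuous_on_indicator[OF _ cw] by (simp add: w'_def[abs_def])

  have D: "D \<phi> t = w t" if t: "t \<in> {0..T}" for t
  proof (cases "\<alpha> = 1")
    case True
    then show ?thesis using vector_derivative_at_within_ivl[OF \<phi>(1), of 0 t T] t T by (simp add: left_RL_def w_def)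
  next
    case False
    then have a: "0 < 1 - \<alpha>" using \<alpha> by simp
    have "((\<lambda>s. integral {0..s} w) has_vector_derivative w t) (at t within {0..T})"
      by (rule integral_has_vector_derivative[OF cw t])
    then have "((\<lambda>s. Gamma (1 - \<alpha>) *\<^sub>R integral {0..s} w) has_vector_derivative Gamma (1 - \<alpha>) *\<^sub>R w t) (at t within {0..T})"
      by (rule bounded_linear.has_vector_derivative[OF bounded_linear_scaleR_right])
    \<comment> \<open>By the semigroup law the integral of I^(1-\<alpha>) \<phi>' is I^(1-\<alpha>)
      I^1 \<phi>' = I^(1-\<alpha>) \<phi>. So, up to the Gamma factor, the expression differentiated
      in the definition has derivative I^(1-\<alpha>) \<phi>'.\<close>
    moreover have "Gamma (1 - \<alpha>) *\<^sub>R integral {0..s} w = integral {0..s} (\<lambda>\<tau>. (s - \<tau>) powr (- \<alpha>) *\<^sub>R \<phi> \<tau>)"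
      if s: "s \<in> {0..T}" for s
    proof -
      have s0: "0 \<le> s" using s by simp
      have cws: "continuous_on {0..s} w'"
        using continuous_on_subset[OF cw, of "{0..s}"] s
        by (subst continuous_on_cong[OF refl, of _ _ w]) (auto simp: w'_def)
      have "integral {0..s} w = integral {0..s} w'" using s by (intro integral_cong) (auto simp: w'_def)
      also have "\<dots> = rl 1 w' s" using rl_1[OF cws mw' s0] by simp
      also have "\<dots> = rl 1 (rl (1 - \<alpha>) \<phi>') s" using s False by (intro rl_cong) (auto simp: w'_def w_def)
      also have "\<dots> = rl (1 + (1 - \<alpha>)) \<phi>' s" using B s by (intro rl_semigroup[where B=B] a s0 meas) auto
      also have "\<dots> = rl (1 - \<alpha>) (rl 1 \<phi>') s"
        using rl_semigroup[OF a zero_less_one s0 meas(1), of B] B s by (simp add: add.commute)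
      also have "\<dots> = rl (1 - \<alpha>) \<phi> s" using ftc by (intro rl_cong) auto
      finally have "Gamma (1 - \<alpha>) *\<^sub>R integral {0..s} w = rlk (1 - \<alpha>) \<phi> s"
        using Gamma_real_pos[OF a] by (simp add: rl_def)
      also have "\<dots> = integral {0..s} (\<lambda>\<tau>. (s - \<tau>) powr ((1 - \<alpha>) - 1) *\<^sub>R \<phi> \<tau>)"
        using B2 s by (intro rlk_eq_integral rlk_integrable(1)[where B=B2] a s0 meas) auto
      finally show ?thesis by simp
    qed
    ultimately have "((\<lambda>s. integral {0..s} (\<lambda>\<tau>. (s - \<tau>) powr (- \<alpha>) *\<^sub>R \<phi> \<tau>)) has_vector_derivative Gamma (1 - \<alpha>) *\<^sub>R w t) (at t within {0..T})"
      using t by (rule_tac has_vector_derivative_transform[where f="\<lambda>s. Gamma (1 - \<alpha>) *\<^sub>R integral {0..s} w"]) simp_all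
    then have "vector_derivative (\<lambda>s. integral {0..s} (\<lambda>\<tau>. (s - \<tau>) powr (- \<alpha>) *\<^sub>R \<phi> \<tau>)) (at t within {0..T}) = Gamma (1 - \<alpha>) *\<^sub>R w t"
      using t T by (intro vector_derivative_within_closed_interval[of 0 T]) auto
    then show ?thesis using False Gamma_real_pos[OF a] by (simp add: left_RL_def)
  qed
  show "D \<phi> t = (if \<alpha> = 1 then \<phi>' t else rl (1 - \<alpha>) \<phi>' t)" using D[OF t] by (simp add: w_def)
  show "continuous_on {0..T} (D \<phi>)" using cw by (subst continuous_on_cong[OF refl D]) auto
  have t0: "0 \<le> t" using t by simp
  have "rl \<alpha> (\<lambda>s. indicator {0..T} s *\<^sub>R D \<phi> s) t = rl \<alpha> w t"
    using t D by (intro rl_cong) auto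
  also have "\<dots> = \<phi> t"
  proof (cases "\<alpha> = 1")
    case True
    then have "w = \<phi>'" by (simp add: w_def[abs_def])
    then show ?thesis using ftc[OF t0] True by simp
  next
    case False
    then have a: "0 < 1 - \<alpha>" using \<alpha> by simp
    have "rl \<alpha> w t = rl \<alpha> (rl (1 - \<alpha>) \<phi>') t" using False by (simp add: w_def[abs_def])
    also have "\<dots> = rl 1 \<phi>' t" using rl_semigroup[OF \<alpha>0 a t0 meas(1), of B] B t by simp
    finally show ?thesis using ftc[OF t0] by simp
  qed
  finally show "\<phi> t = rl \<alpha> (\<lambda>s. indicator {0..T} s *\<^sub>R D \<phi> s) t" by simp
qed

lemma S_deriv:
  assumes "\<phi> \<in> S"
  obtains \<phi>' where "\<And>t. (\<phi> has_vector_derivative \<phi>' t) (at t)" "continuous_on UNIV \<phi>'" "\<phi> 0 = 0"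
  using assms smooth_fun_deriv[of \<phi>] unfolding S_def C0inf_def by blast

lemma S_continuous: "\<phi> \<in> S \<Longrightarrow> continuous_on A \<phi>"
  by (metis S_deriv continuous_at_imp_continuous_on has_vector_derivative_continuous)

lemma D_continuous: "\<phi> \<in> S \<Longrightarrow> continuous_on {0..T} (D \<phi>)"
  using D_eq(3) T by (metis S_deriv atLeastAtMost_iff less_imp_le order_refl)

lemma D_repr:
  assumes "\<phi> \<in> S" "t \<in> {0..T}"
  shows "\<phi> t = (1 / Gamma \<alpha>) *\<^sub>R (\<integral>s. rker \<alpha> t s *\<^sub>R indicator {0..T} s *\<^sub>R D \<phi> s \<partial>lborel)"
    "integrable lborel (\<lambda>s. rker \<alpha> t s *\<^sub>R indicator {0..T} s *\<^sub>R D \<phi> s)"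
proof -
  show "\<phi> t = (1 / Gamma \<alpha>) *\<^sub>R (\<integral>s. rker \<alpha> t s *\<^sub>R indicator {0..T} s *\<^sub>R D \<phi> s \<partial>lborel)"
    using S_deriv[OF assms(1)] D_eq(2)[OF _ _ _ assms(2), of \<phi>] unfolding rl_def rlk_def rker_def by metis
  obtain B where B: "\<And>s. s \<in> {0..T} \<Longrightarrow> norm (D \<phi> s) \<le> B"
    using continuous_on_Icc_bounded[OF D_continuous[OF assms(1)]] by blast
  show "integrable lborel (\<lambda>s. rker \<alpha> t s *\<^sub>R indicator {0..T} s *\<^sub>R D \<phi> s)"
    unfolding rker_def using assms(2) B borel_measurable_continuous_on_indicator[OF _ D_continuous[OF assms(1)]]
    by (intro rlk_integrable(1)[where B=B] \<alpha>0) auto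
qed

text \<open>Additivity is read off from the Caputo form, where it is additivity of integrals with a
  bounded factor.\<close>

lemma D_add:
  assumes f: "f \<in> S" and g: "g \<in> S" and t: "t \<in> {0..T}" shows "D (f + g) t = D f t + D g t"
proof -
  obtain f' where f': "\<And>t. (f has_vector_derivative f' t) (at t)" "continuous_on UNIV f'" "f 0 = 0" using S_deriv[OF f] by blast
  obtain g' where g': "\<And>t. (g has_vector_derivative g' t) (at t)" "continuous_on UNIV g'" "g 0 = 0" using S_deriv[OF g] by blast
  have "((f + g) has_vector_derivative f' t + g' t) (at t)" for t
    unfolding plus_fun_def by (intro has_vector_derivative_add f' g')
  moreover have "continuous_on UNIV (\<lambda>t. f' t + g' t)" by (intro continuous_intros f' g')
  ultimately have e: "D (f + g) t = (if \<alpha> = 1 then f' t + g' t else rl (1 - \<alpha>) (\<lambda>t. f' t + g' t) t)"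
    using D_eq(1)[of "f + g" "\<lambda>t. f' t + g' t" t] t f' g' by simp
  have i: "integrable lborel (\<lambda>s. (indicator {0<..<t} s * (t - s) powr ((1 - \<alpha>) - 1)) *\<^sub>R h s)"
    if h: "continuous_on UNIV h" and "\<alpha> < 1" for h :: "real \<Rightarrow> 'a"
  proof -
    obtain B where "\<And>s. s \<in> {0..T} \<Longrightarrow> norm (h s) \<le> B"
      using continuous_on_Icc_bounded[OF continuous_on_subset[OF h subset_UNIV]] by blast
    then show ?thesis using t that by (intro rlk_integrable(1)[where B=B] borel_measurable_continuous_onI) auto
  qed
  show ?thesis unfolding e D_eq(1)[OF f' t] D_eq(1)[OF g' t]
    using \<alpha> i[OF f'(2)] i[OF g'(2)] by (auto simp: rl_def rlk_def scaleR_add_right)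
qed

lemma D_scale:
  assumes f: "f \<in> S" and t: "t \<in> {0..T}" shows "D (c *\<^sub>R f) t = c *\<^sub>R D f t"
proof -
  obtain f' where f': "\<And>t. (f has_vector_derivative f' t) (at t)" "continuous_on UNIV f'" "f 0 = 0" using S_deriv[OF f] by blast
  have "((c *\<^sub>R f) has_vector_derivative c *\<^sub>R f' t) (at t)" for t
    unfolding scaleR_fun_def by (intro bounded_linear.has_vector_derivative[OF bounded_linear_scaleR_right] f')
  moreover have "continuous_on UNIV (\<lambda>t. c *\<^sub>R f' t)" by (intro continuous_intros f')
  ultimately have e: "D (c *\<^sub>R f) t = (if \<alpha> = 1 then c *\<^sub>R f' t else rl (1 - \<alpha>) (\<lambda>t. c *\<^sub>R f' t) t)"
    using D_eq(1)[of "c *\<^sub>R f" "\<lambda>t. c *\<^sub>R f' t" t] t f' by simp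
  show ?thesis unfolding e D_eq(1)[OF f' t] by (auto simp: rl_def rlk_scaleR)
qed

text \<open>Only the derivative enters. By \<open>sup_bound\<close> it already controls the function
  itself, so on \<open>S\<close> this is equivalent to the full norm.\<close>

definition N :: "(real \<Rightarrow> 'a::euclidean_space) \<Rightarrow> real" where "N \<phi> = normLp M p (D \<phi>)"

lemma S_subspace: "subspace (S :: (real \<Rightarrow> 'a::euclidean_space) set)"
  unfolding S_def by (rule C0inf_subspace)

lemma D_memLp: "\<phi> \<in> S \<Longrightarrow> memLp M p (D \<phi>)" by (intro continuous_memLp D_continuous)

lemma normLp_cong: "(\<And>t. t \<in> {0..T} \<Longrightarrow> f t = g t) \<Longrightarrow> normLp M p f = normLp M p g"
  unfolding normLp_def by (intro arg_cong[where f="root p"] Bochner_Integration.integral_cong) simp_all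

lemma N_tri: "f \<in> S \<Longrightarrow> g \<in> S \<Longrightarrow> N (f + g) \<le> N f + N g"
  using minkowski[of p M "D f" "D g"] D_memLp[of f] D_memLp[of g] p normLp_cong[OF D_add[of f g]] unfolding N_def by simp

lemma N_scale: "f \<in> S \<Longrightarrow> N (c *\<^sub>R f) = \<bar>c\<bar> * N f"
  using normLp_scale[of p M c "D f"] p normLp_cong[OF D_scale[of f _ c]] unfolding N_def by simp

lemma D_diff: "f \<in> S \<Longrightarrow> g \<in> S \<Longrightarrow> t \<in> {0..T} \<Longrightarrow> D (f - g) t = D f t - D g t"
  using D_add[of f "(-1) *\<^sub>R g" t] D_scale[of g t "-1"] subspace_scale[OF S_subspace, of g "-1"] by simp

lemma N_diff: "f \<in> S \<Longrightarrow> g \<in> S \<Longrightarrow> N (f - g) = normLp M p (\<lambda>t. D f t - D g t)"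
  unfolding N_def by (intro normLp_cong D_diff)

lemma N_nonneg: "0 \<le> N f" unfolding N_def by (rule normLp_nonneg)

text \<open>The kernel norm at t grows with t, and its value at T, divided by
  \<open>Gamma \<alpha>\<close>, is exactly \<open>Kc\<close>.\<close>

lemma sup_bound:
  assumes \<phi>: "\<phi> \<in> S" and t: "t \<in> {0..T}" shows "norm (\<phi> t) \<le> Kc T p \<alpha> * N \<phi>"
proof -
  define w where "w = (\<lambda>s. indicator {0..T} s *\<^sub>R D \<phi> s)"
  have ml: "memLp lborel p w" "normLp lborel p w = N \<phi>"
    unfolding w_def N_def by (rule continuous_memLp_lborel[OF D_continuous[OF \<phi>]])+
  have t0: "0 \<le> t" using t by simp
  have rk: "has_bochner_integral lborel (\<lambda>r. rker \<alpha> t r powr q_conj p) (t powr m / m)"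
    unfolding rker_powr m(1)[symmetric] using rker_integral[OF m(2) t0] by simp
  have h: "integrable lborel (\<lambda>r. rker \<alpha> t r * norm (w r))"
    "(\<integral>r. rker \<alpha> t r * norm (w r) \<partial>lborel) \<le> (t powr m / m) powr (1 / q_conj p) * N \<phi>"
    using hoelder[OF p q_conj_def, of "rker \<alpha> t" lborel w] rk ml rker_nonneg[of \<alpha> t]
    by (auto simp: has_bochner_integral_iff)
  have "norm (\<integral>s. rker \<alpha> t s *\<^sub>R w s \<partial>lborel) \<le> (\<integral>r. rker \<alpha> t r * norm (w r) \<partial>lborel)"
    using h(1) by (intro order.trans[OF integral_norm_bound]) (simp add: rker_nonneg)
  also note h(2)
  also have "(t powr m / m) powr (1 / q_conj p) * N \<phi> \<le> (T powr m / m) powr (1 / q_conj p) * N \<phi>"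
    using t m(2) q by (intro mult_right_mono powr_mono2 divide_right_mono N_nonneg) auto
  finally show ?thesis
    using D_repr(1)[OF \<phi> t] Gamma_real_pos[OF \<alpha>0] unfolding Kc_eq w_def by (simp add: divide_right_mono)
qed

lemma sup_bound_le:
  assumes "\<phi> \<in> S" "N \<phi> \<le> r" "t \<in> {0..T}"
  shows "norm (\<phi> t) \<le> Kc T p \<alpha> * r"
  using sup_bound[OF assms(1,3)] mult_left_mono[OF assms(2) less_imp_le[OF Kc_pos]] by linarith

text \<open>As for \<open>sup_bound\<close>, with the difference of two kernels in place of one; the
  exponent \<alpha> - 1/p is m/q.\<close>

lemma hoelder_bound:
  assumes \<phi>: "\<phi> \<in> S" and st: "0 \<le> s" "s \<le> t" "t \<le> T"
  shows "norm (\<phi> t - \<phi> s) \<le> (2 / m) powr (1 / q_conj p) / Gamma \<alpha> * (t - s) powr (\<alpha> - 1 / real p) * N \<phi>"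
proof -
  define w where "w = (\<lambda>s. indicator {0..T} s *\<^sub>R D \<phi> s)"
  have ml: "memLp lborel p w" "normLp lborel p w = N \<phi>"
    unfolding w_def N_def by (rule continuous_memLp_lborel[OF D_continuous[OF \<phi>]])+
  have st': "s \<in> {0..T}" "t \<in> {0..T}" using st by auto
  define k where "k r = \<bar>rker \<alpha> t r - rker \<alpha> s r\<bar>" for r
  note rd = rker_diff[OF \<alpha>(2) q(1) m(1,2) st(1,2), folded k_def]
  have k[measurable]: "k \<in> borel_measurable borel" unfolding k_def by measurable
  have h: "integrable lborel (\<lambda>r. k r * norm (w r))"
    "(\<integral>r. k r * norm (w r) \<partial>lborel) \<le> (\<integral>r. k r powr q_conj p \<partial>lborel) powr (1 / q_conj p) * N \<phi>"
    using hoelder[OF p q_conj_def, of k lborel w] rd ml by (auto simp: k_def)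
  have "\<phi> t - \<phi> s = (1 / Gamma \<alpha>) *\<^sub>R (\<integral>r. (rker \<alpha> t r - rker \<alpha> s r) *\<^sub>R w r \<partial>lborel)"
  proof -
    have i: "integrable lborel (\<lambda>r. rker \<alpha> x r *\<^sub>R w r)" "\<phi> x = (1 / Gamma \<alpha>) *\<^sub>R (\<integral>r. rker \<alpha> x r *\<^sub>R w r \<partial>lborel)"
      if "x \<in> {0..T}" for x
      unfolding w_def by (rule D_repr[OF \<phi> that])+
    have "(\<integral>r. (rker \<alpha> t r - rker \<alpha> s r) *\<^sub>R w r \<partial>lborel)
        = (\<integral>r. rker \<alpha> t r *\<^sub>R w r \<partial>lborel) - (\<integral>r. rker \<alpha> s r *\<^sub>R w r \<partial>lborel)"
      unfolding scaleR_diff_left by (intro Bochner_Integration.integral_diff i st')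
    then show ?thesis using i(2)[OF st'(1)] i(2)[OF st'(2)] by (simp only: scaleR_diff_right)
  qed
  then have "norm (\<phi> t - \<phi> s) = 1 / Gamma \<alpha> * norm (\<integral>r. (rker \<alpha> t r - rker \<alpha> s r) *\<^sub>R w r \<partial>lborel)"
    using Gamma_real_pos[OF \<alpha>0] by simp
  also have "\<dots> \<le> 1 / Gamma \<alpha> * (\<integral>r. k r * norm (w r) \<partial>lborel)"
    using h(1) Gamma_real_pos[OF \<alpha>0]
    by (intro mult_left_mono order.trans[OF integral_norm_bound]) (simp_all add: k_def)
  also have "\<dots> \<le> 1 / Gamma \<alpha> * ((2 * (t - s) powr m / m) powr (1 / q_conj p) * N \<phi>)"
    using rd Gamma_real_pos[OF \<alpha>0] q
    by (intro mult_left_mono order.trans[OF h(2)] mult_right_mono powr_mono2 N_nonneg) (auto intro!: integral_nonneg_AE)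
  also have "(2 * (t - s) powr m / m) powr (1 / q_conj p) = (2 / m) powr (1 / q_conj p) * (t - s) powr (\<alpha> - 1 / real p)"
    using m st by (simp add: powr_mult powr_divide powr_powr)
  finally show ?thesis by (simp add: mult_ac)
qed

lemma normLp_sup:
  fixes f :: "real \<Rightarrow> 'a::euclidean_space"
  assumes f: "memLp M p f" and B: "\<And>t. t \<in> {0..T} \<Longrightarrow> norm (f t) \<le> B" shows "normLp M p f \<le> root p T * B"
proof -
  have p0: "0 < p" using p by simp
  have B0: "0 \<le> B" using B[of 0] T by (metis atLeastAtMost_iff less_imp_le norm_ge_zero order_refl order_trans)
  have "normLp M p f ^ p \<le> (\<integral>t. B ^ p \<partial>M)"
    unfolding normLp_power[OF p0]
    by (intro integral_mono memLp_int f finite_measure.integrable_const finite_M power_mono) (use B in auto)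
  also have "\<dots> = (root p T * B) ^ p" using T p0 by (simp add: power_mult_distrib measure_restrict_space)
  finally show ?thesis using B0 T p0 by (simp add: power_mono_iff normLp_nonneg real_root_ge_zero)
qed

text \<open>The common Hoelder modulus gives the equicontinuity for Arzela-Ascoli. Nothing is
  claimed about the derivatives, whose convergence needs a separate argument.\<close>

lemma compact_embedding:
  fixes u :: "nat \<Rightarrow> real \<Rightarrow> 'a::euclidean_space"
  assumes u: "\<And>n. u n \<in> S" and R: "\<And>n. N (u n) \<le> R"
  obtains r v where "strict_mono r" "continuous_on {0..T} v" "uniform_limit {0..T} (\<lambda>n. u (r n)) v sequentially"
proof -
  define C where "C = (2 / m) powr (1 / q_conj p) / Gamma \<alpha>"
  have C: "0 \<le> C" using Gamma_real_pos[OF \<alpha>0] by (simp add: C_def)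
  have hb: "norm (u n x - u n y) \<le> C * R * \<bar>x - y\<bar> powr (\<alpha> - 1 / real p)" if "x \<in> {0..T}" "y \<in> {0..T}" for n x y
  proof -
    have *: "norm (u n x - u n y) \<le> C * \<bar>x - y\<bar> powr (\<alpha> - 1 / real p) * N (u n)"
      using hoelder_bound[OF u, of x y n] hoelder_bound[OF u, of y x n] that
      by (cases "x \<le> y") (auto simp: C_def norm_minus_commute abs_minus_commute)
    also have "\<dots> \<le> C * \<bar>x - y\<bar> powr (\<alpha> - 1 / real p) * R" using C R by (intro mult_left_mono) auto
    finally show ?thesis by (simp add: mult_ac)
  qed
  have lim: "((\<lambda>d. C * R * d powr (\<alpha> - 1 / real p)) \<longlongrightarrow> 0) (at_right 0)"
  proof -
    have "((\<lambda>d::real. d) \<longlongrightarrow> 0) (at_right 0)" by (rule tendsto_ident_at)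
    then have "((\<lambda>d. d powr (\<alpha> - 1 / real p)) \<longlongrightarrow> 0) (at_right 0)"
      using \<alpha> by (intro tendsto_zero_powrI[where b="\<alpha> - 1 / real p"])
        (auto simp: eventually_at_right_field intro!: exI[of _ 1])
    then show ?thesis by (rule tendsto_mult_right_zero)
  qed
  have eq: "\<exists>d. 0 < d \<and> (\<forall>n y. y \<in> {0..T} \<and> norm (x - y) < d \<longrightarrow> norm (u n x - u n y) < e)"
    if x: "x \<in> {0..T}" and e: "0 < e" for x e
  proof -
    have "eventually (\<lambda>d. C * R * d powr (\<alpha> - 1 / real p) < e) (at_right 0)"
      using lim e by (rule order_tendstoD)
    then obtain d where d: "0 < d" "\<And>y. 0 < y \<Longrightarrow> y < d \<Longrightarrow> C * R * y powr (\<alpha> - 1 / real p) < e"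
      unfolding eventually_at_right_field by auto
    have "norm (u n x - u n y) < e" if "y \<in> {0..T}" "norm (x - y) < d" for n y
    proof (cases "x = y")
      case False
      then show ?thesis using hb[OF x that(1), of n] d(2)[of "\<bar>x - y\<bar>"] that by force
    qed (use e in simp)
    then show ?thesis using d(1) by blast
  qed
  have bd: "norm (u n x) \<le> Kc T p \<alpha> * R" if "x \<in> {0..T}" for n x
    using sup_bound_le[OF u R that] .
  show ?thesis
  proof (rule Arzela_Ascoli[of "{0..T}" u "Kc T p \<alpha> * R"])
    fix v k
    assume v: "continuous_on {0..T} v" "strict_mono (k :: nat \<Rightarrow> nat)"
      "\<And>e. 0 < e \<Longrightarrow> \<exists>n0. \<forall>n x. n \<ge> n0 \<and> x \<in> {0..T} \<longrightarrow> norm (u (k n) x - v x) < e"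
    have "uniform_limit {0..T} (\<lambda>n. u (k n)) v sequentially"
      unfolding uniform_limit_sequentially_iff dist_norm
    proof (intro allI impI)
      fix e :: real assume "0 < e"
      from v(3)[OF this] show "\<exists>n0. \<forall>n\<ge>n0. \<forall>x\<in>{0..T}. norm (u (k n) x - v x) < e" by blast
    qed
    with v show thesis using that by blast
  qed (rule compact_Icc, erule bd, erule (1) eq)
qed

end

section \<open>Caratheodory integrands\<close>

text \<open>The conditions are imposed for every t in [0,T], not almost every; the truncation will
  achieve this by making both functions 0 on the exceptional null set.\<close>

locale caratheodory =
  fixes T :: real and H :: "real \<Rightarrow> 'a::euclidean_space \<Rightarrow> real" and f :: "real \<Rightarrow> 'a \<Rightarrow> 'a"
  assumes H_measurable: "\<And>x. (\<lambda>t. H t x) \<in> borel_measurable (lebesgue_on {0..T})"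
    and H_deriv: "\<And>t x. t \<in> {0..T} \<Longrightarrow> (H t has_derivative (\<lambda>y. f t x \<bullet> y)) (at x)"
    and f_cont: "\<And>t. t \<in> {0..T} \<Longrightarrow> continuous_on UNIV (f t)"
    and f_bound: "\<And>R. \<exists>k. integrable (lebesgue_on {0..T}) k \<and> (\<forall>t\<in>{0..T}. \<forall>x. norm x \<le> R \<longrightarrow> norm (f t x) \<le> k t)"
    and H_zero: "\<And>t. t \<in> {0..T} \<Longrightarrow> H t 0 = 0"
begin

lemma H_cont: "t \<in> {0..T} \<Longrightarrow> continuous_on UNIV (H t)"
  using H_deriv has_derivative_continuous by (blast intro: continuous_at_imp_continuous_on)

text \<open>\<open>u\<close> is frozen at the grid point to the left of t. A countable case
  distinction on that grid point gives measurability, and continuity of \<open>H t\<close> gives the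
  limit. Rounding down keeps the grid points in [0,T].\<close>

lemma H_comp_measurable:
  assumes u: "continuous_on {0..T} u"
  shows "(\<lambda>t. H t (u t)) \<in> borel_measurable (lebesgue_on {0..T})"
proof (rule borel_measurable_LIMSEQ_metric)
  fix n :: nat
  have "(\<lambda>t::real. \<lfloor>real (Suc n) * t\<rfloor>) \<in> measurable borel (count_space UNIV)" by measurable
  then have fl: "(\<lambda>t. \<lfloor>real (Suc n) * t\<rfloor>) \<in> measurable (lebesgue_on {0..T}) (count_space UNIV)"
    by (intro measurable_restrict_space1 measurable_completion) simp
  show "(\<lambda>t. H t (u (real_of_int \<lfloor>real (Suc n) * t\<rfloor> / real (Suc n)))) \<in> borel_measurable (lebesgue_on {0..T})"
    by (rule measurable_compose_countable[OF H_measurable fl])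
next
  fix t assume "t \<in> space (lebesgue_on {0..T})"
  then have t: "t \<in> {0..T}" by simp
  define s where "s n = real_of_int \<lfloor>real (Suc n) * t\<rfloor> / real (Suc n)" for n
  have s: "s n \<le> t" "t - 1 / real (Suc n) \<le> s n" "0 \<le> s n" for n
  proof -
    have "real_of_int \<lfloor>real (Suc n) * t\<rfloor> \<le> t * real (Suc n)"
      using of_int_floor_le[of "real (Suc n) * t"] by (simp only: mult.commute)
    then show "s n \<le> t" unfolding s_def by (simp add: pos_divide_le_eq del: of_nat_Suc)
    have "t * real (Suc n) - 1 \<le> real_of_int \<lfloor>real (Suc n) * t\<rfloor>"
      using real_of_int_floor_ge_diff_one[of "real (Suc n) * t"] by (simp only: mult.commute)
    then have "(t * real (Suc n) - 1) / real (Suc n) \<le> s n" unfolding s_def by (intro divide_right_mono) auto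
    then show "t - 1 / real (Suc n) \<le> s n" by (simp add: diff_divide_distrib del: of_nat_Suc)
    have "(0::int) \<le> \<lfloor>real (Suc n) * t\<rfloor>" using t by simp
    then show "0 \<le> s n" unfolding s_def by simp
  qed
  have "s \<longlonglongrightarrow> t"
  proof (rule tendsto_sandwich[of "\<lambda>n. t - 1 / real (Suc n)" _ _ "\<lambda>_. t"])
    show "(\<lambda>n. t - 1 / real (Suc n)) \<longlonglongrightarrow> t"
      using tendsto_diff[OF tendsto_const LIMSEQ_inverse_real_of_nat, of t] by (simp add: inverse_eq_divide)
  qed (use s in auto)
  moreover have "s n \<in> {0..T}" for n using s[of n] t by auto
  ultimately have "(\<lambda>n. u (s n)) \<longlonglongrightarrow> u t" using u t by (auto simp: continuous_on_sequentially o_def)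
  then have "(\<lambda>n. H t (u (s n))) \<longlonglongrightarrow> H t (u t)"
    using continuous_on_tendsto_compose[OF H_cont[OF t]] by auto
  then show "(\<lambda>n. H t (u (real_of_int \<lfloor>real (Suc n) * t\<rfloor> / real (Suc n)))) \<longlonglongrightarrow> H t (u t)" by (simp add: s_def)
qed

lemma H_line:
  assumes t: "t \<in> {0..T}"
  shows "((\<lambda>s. H t (x + s *\<^sub>R y)) has_real_derivative f t (x + s *\<^sub>R y) \<bullet> y) (at s)"
proof -
  have "((\<lambda>s. x + s *\<^sub>R y) has_derivative (\<lambda>h. h *\<^sub>R y)) (at s)"
    by (auto intro!: derivative_eq_intros)
  from has_derivative_compose[OF this H_deriv[OF t]]
  have "((\<lambda>s. H t (x + s *\<^sub>R y)) has_derivative (\<lambda>h. f t (x + s *\<^sub>R y) \<bullet> (h *\<^sub>R y))) (at s)" .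
  then show ?thesis unfolding has_field_derivative_def by (simp add: mult.commute[of _ "_ \<bullet> _"])
qed

text \<open>Measurability of \<open>f\<close> need not be assumed: \<open>f\<close> is a limit of difference quotients of \<open>H\<close>.\<close>

lemma f_comp_measurable:
  assumes u: "continuous_on {0..T} u"
  shows "(\<lambda>t. f t (u t)) \<in> borel_measurable (lebesgue_on {0..T})"
  unfolding borel_measurable_euclidean_space[of "\<lambda>t. f t (u t)"]
proof
  fix b :: 'a assume "b \<in> Basis"
  show "(\<lambda>t. f t (u t) \<bullet> b) \<in> borel_measurable (lebesgue_on {0..T})"
  proof (rule borel_measurable_LIMSEQ_metric)
    fix n :: nat
    have "continuous_on {0..T} (\<lambda>t. u t + (1 / real (Suc n)) *\<^sub>R b)" by (intro continuous_intros u)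
    then show "(\<lambda>t. (H t (u t + (1 / real (Suc n)) *\<^sub>R b) - H t (u t)) / (1 / real (Suc n))) \<in> borel_measurable (lebesgue_on {0..T})"
      by (intro borel_measurable_divide borel_measurable_diff H_comp_measurable u borel_measurable_const)
  next
    fix t assume "t \<in> space (lebesgue_on {0..T})"
    then have t: "t \<in> {0..T}" by simp
    have "((\<lambda>h. (H t (u t + (0 + h) *\<^sub>R b) - H t (u t + 0 *\<^sub>R b)) / h) \<longlongrightarrow> f t (u t + 0 *\<^sub>R b) \<bullet> b) (at 0)"
      using H_line[OF t, of "u t" b 0] unfolding DERIV_def .
    then have *: "((\<lambda>h. (H t (u t + h *\<^sub>R b) - H t (u t)) / h) \<longlongrightarrow> f t (u t) \<bullet> b) (at 0)" by simp
    have "filterlim (\<lambda>n. 1 / real (Suc n)) (at 0) sequentially"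
      unfolding filterlim_at using LIMSEQ_inverse_real_of_nat by (simp add: inverse_eq_divide)
    from filterlim_compose[OF * this]
    show "(\<lambda>n. (H t (u t + (1 / real (Suc n)) *\<^sub>R b) - H t (u t)) / (1 / real (Suc n))) \<longlonglongrightarrow> f t (u t) \<bullet> b" .
  qed
qed

lemma H_mvt:
  assumes t: "t \<in> {0..T}"
  obtains z where "0 < z" "z < 1" "H t (x + y) - H t x = f t (x + z *\<^sub>R y) \<bullet> y"
proof -
  have "\<exists>z. 0 < z \<and> z < 1 \<and> H t (x + 1 *\<^sub>R y) - H t (x + 0 *\<^sub>R y) = (1 - 0) * (f t (x + z *\<^sub>R y) \<bullet> y)"
    by (rule MVT2) (use H_line[OF t] in auto)
  then show ?thesis using that by auto
qed

lemma norm_segment_le: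
  assumes "norm x \<le> R" "norm (x + y) \<le> R" "0 < z" "z < (1::real)"
  shows "norm (x + z *\<^sub>R (y::'a)) \<le> R"
proof -
  have "x + z *\<^sub>R y = (1 - z) *\<^sub>R x + z *\<^sub>R (x + y)" by (simp add: algebra_simps)
  also have "norm \<dots> \<le> (1 - z) * norm x + z * norm (x + y)"
    using assms by (intro norm_triangle_le) simp
  also have "\<dots> \<le> (1 - z) * R + z * R" using assms by (intro add_mono mult_left_mono) auto
  finally show ?thesis by (simp add: algebra_simps)
qed

lemma H_lipschitz:
  assumes k: "\<And>x. norm x \<le> R \<Longrightarrow> norm (f t x) \<le> k" and t: "t \<in> {0..T}" and xy: "norm x \<le> R" "norm y \<le> R"
  shows "\<bar>H t y - H t x\<bar> \<le> k * norm (y - x)"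
proof -
  obtain z where z: "0 < z" "z < 1" "H t (x + (y - x)) - H t x = f t (x + z *\<^sub>R (y - x)) \<bullet> (y - x)"
    using H_mvt[OF t] by blast
  have "\<bar>H t y - H t x\<bar> \<le> norm (f t (x + z *\<^sub>R (y - x))) * norm (y - x)"
    using z(3) Cauchy_Schwarz_ineq2[of "f t (x + z *\<^sub>R (y - x))" "y - x"] by simp
  also have "\<dots> \<le> k * norm (y - x)"
    using norm_segment_le[of x R "y - x" z] xy z by (intro mult_right_mono k) auto
  finally show ?thesis .
qed

lemma H_comp_integrable:
  assumes u: "continuous_on {0..T} u"
  shows "integrable (lebesgue_on {0..T}) (\<lambda>t. H t (u t))"
proof -
  obtain R where R: "\<And>t. t \<in> {0..T} \<Longrightarrow> norm (u t) \<le> R" using continuous_on_Icc_bounded[OF u] by blast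
  obtain k where k: "integrable (lebesgue_on {0..T}) k" "\<And>t x. t \<in> {0..T} \<Longrightarrow> norm x \<le> R \<Longrightarrow> norm (f t x) \<le> k t"
    using f_bound[of R] by blast
  show ?thesis
  proof (rule Bochner_Integration.integrable_bound)
    show "integrable (lebesgue_on {0..T}) (\<lambda>t. k t * R)" using k by simp
    show "AE t in lebesgue_on {0..T}. norm (H t (u t)) \<le> norm (k t * R)"
    proof (rule AE_I2)
      fix t assume "t \<in> space (lebesgue_on {0..T})"
      then have t: "t \<in> {0..T}" by simp
      have R0: "0 \<le> R" using R[OF t] norm_ge_zero order_trans by blast
      have k0: "0 \<le> k t" using k(2)[OF t, of 0] R0 norm_ge_zero order_trans by (metis norm_zero)
      have "\<bar>H t (u t) - H t 0\<bar> \<le> k t * norm (u t - 0)" by (rule H_lipschitz) (use k(2) R R0 t in auto)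
      also have "\<dots> \<le> k t * R" using R[OF t] k0 by (intro mult_left_mono) auto
      finally show "norm (H t (u t)) \<le> norm (k t * R)" using t by (simp add: H_zero)
    qed
  qed (rule H_comp_measurable[OF u])
qed

lemma f_comp_integrable:
  assumes u: "continuous_on {0..T} u"
  shows "integrable (lebesgue_on {0..T}) (\<lambda>t. f t (u t))"
proof -
  obtain R where R: "\<And>t. t \<in> {0..T} \<Longrightarrow> norm (u t) \<le> R" using continuous_on_Icc_bounded[OF u] by blast
  obtain k where k: "integrable (lebesgue_on {0..T}) k" "\<And>t x. t \<in> {0..T} \<Longrightarrow> norm x \<le> R \<Longrightarrow> norm (f t x) \<le> k t"
    using f_bound[of R] by blast
  have "AE t in lebesgue_on {0..T}. norm (f t (u t)) \<le> norm (k t)"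
    using k(2) R by (intro AE_I2) (force intro: order_trans[OF _ abs_ge_self])
  then show ?thesis by (rule Bochner_Integration.integrable_bound[OF k(1) f_comp_measurable[OF u]])
qed

lemma f_comp_inner_integrable:
  assumes u: "continuous_on {0..T} u" and v: "continuous_on {0..T} v"
  shows "integrable (lebesgue_on {0..T}) (\<lambda>t. f t (u t) \<bullet> v t)"
proof -
  obtain R where R: "\<And>t. t \<in> {0..T} \<Longrightarrow> norm (v t) \<le> R" using continuous_on_Icc_bounded[OF v] by blast
  have mv: "v \<in> borel_measurable (lebesgue_on {0..T})"
    by (rule continuous_imp_measurable_on_sets_lebesgue[OF v]) simp
  show ?thesis
  proof (rule Bochner_Integration.integrable_bound)
    show "integrable (lebesgue_on {0..T}) (\<lambda>t. norm (f t (u t)) * R)"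
      using f_comp_integrable[OF u] by simp
    show "(\<lambda>t. f t (u t) \<bullet> v t) \<in> borel_measurable (lebesgue_on {0..T})"
      by (intro borel_measurable_inner f_comp_measurable[OF u] mv)
    show "AE t in lebesgue_on {0..T}. norm (f t (u t) \<bullet> v t) \<le> norm (norm (f t (u t)) * R)"
    proof (rule AE_I2)
      fix t assume "t \<in> space (lebesgue_on {0..T})"
      then have t: "t \<in> {0..T}" by simp
      have "\<bar>f t (u t) \<bullet> v t\<bar> \<le> norm (f t (u t)) * norm (v t)" by (rule Cauchy_Schwarz_ineq2)
      also have "\<dots> \<le> norm (f t (u t)) * R" using R[OF t] by (intro mult_left_mono) auto
      finally show "norm (f t (u t) \<bullet> v t) \<le> norm (norm (f t (u t)) * R)" by simp
    qed
  qed
qed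

text \<open>\<open>\<omega>\<close> is the oscillation of \<open>f t\<close> over a countable dense set of pairs at distance below \<open>1/n\<close>; its
  integral tends to \<open>0\<close> by dominated convergence.\<close>

lemma modulus:
  assumes \<epsilon>: "0 < \<epsilon>"
  obtains \<eta> \<omega> where "0 < \<eta>" "integrable (lebesgue_on {0..T}) \<omega>" "integral\<^sup>L (lebesgue_on {0..T}) \<omega> \<le> \<epsilon>"
    "\<And>t x y. t \<in> {0..T} \<Longrightarrow> norm x \<le> R \<Longrightarrow> norm y \<le> R \<Longrightarrow> norm (x - y) \<le> \<eta> \<Longrightarrow> norm (f t x - f t y) \<le> \<omega> t"
proof -
  obtain k where k: "integrable (lebesgue_on {0..T}) k" "\<And>t x. t \<in> {0..T} \<Longrightarrow> norm x \<le> max R 0 + 1 \<Longrightarrow> norm (f t x) \<le> k t"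
    using f_bound[of "max R 0 + 1"] by blast
  obtain D :: "'a set" where D: "countable D" "\<And>X. open X \<Longrightarrow> X \<noteq> {} \<Longrightarrow> \<exists>d\<in>D. d \<in> X"
    using countable_dense_exists by metis
  define I where "I n = insert (0, 0) {z \<in> D \<times> D. norm (fst z) \<le> max R 0 + 1 \<and> norm (snd z) \<le> max R 0 + 1 \<and> norm (fst z - snd z) < 1 / real (Suc n)}" for n
  have I: "countable (I n)" "I n \<noteq> {}" for n
    unfolding I_def using countable_subset[of _ "D \<times> D"] D(1) by auto
  define \<omega> where "\<omega> n t = (SUP z\<in>I n. norm (f t (fst z) - f t (snd z)))" for n t
  have le2k: "norm (f t (fst z) - f t (snd z)) \<le> 2 * k t" if "z \<in> I n" "t \<in> {0..T}" for n z t
  proof -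
    have "norm (f t (fst z)) \<le> k t" "norm (f t (snd z)) \<le> k t" using that k(2)[OF that(2)] by (auto simp: I_def)
    then show ?thesis using norm_triangle_ineq4[of "f t (fst z)" "f t (snd z)"] by linarith
  qed
  have bdd: "bdd_above ((\<lambda>z. norm (f t (fst z) - f t (snd z))) ` I n)" if "t \<in> {0..T}" for t n
    by (rule bdd_aboveI2[of _ _ "2 * k t"]) (rule le2k[OF _ that])
  have \<omega>up: "norm (f t (fst z) - f t (snd z)) \<le> \<omega> n t" if "z \<in> I n" "t \<in> {0..T}" for z n t
    unfolding \<omega>_def by (rule cSUP_upper[OF that(1) bdd[OF that(2)]])
  have \<omega>least: "\<omega> n t \<le> c" if "\<And>z. z \<in> I n \<Longrightarrow> norm (f t (fst z) - f t (snd z)) \<le> c" for n t c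
    unfolding \<omega>_def by (rule cSUP_least[OF I(2) that])
  have \<omega>0: "0 \<le> \<omega> n t" if "t \<in> {0..T}" for n t using \<omega>up[of "(0,0)" n t] that by (auto simp: I_def)
  have \<omega>m: "\<omega> n \<in> borel_measurable (lebesgue_on {0..T})" for n
  proof -
    have "(\<lambda>t. norm (f t a - f t b)) \<in> borel_measurable (lebesgue_on {0..T})" for a b
    proof -
      have [measurable]: "(\<lambda>t. f t c) \<in> borel_measurable (lebesgue_on {0..T})" for c
        by (rule f_comp_measurable[OF continuous_on_const])
      show ?thesis by measurable
    qed
    then show ?thesis unfolding \<omega>_def by (intro borel_measurable_cSUP I) (use bdd in auto)
  qed
  have tend: "(\<lambda>n. \<omega> n t) \<longlonglongrightarrow> 0" if t: "t \<in> {0..T}" for t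
  proof (rule LIMSEQ_I)
    fix e :: real assume e: "0 < e"
    have "uniformly_continuous_on (cball 0 (max R 0 + 1)) (f t)"
      by (intro compact_uniformly_continuous continuous_on_subset[OF f_cont[OF t]]) auto
    then obtain d where d: "d > 0" "\<And>x x'. x \<in> cball 0 (max R 0 + 1) \<Longrightarrow> x' \<in> cball 0 (max R 0 + 1) \<Longrightarrow> dist x' x < d \<Longrightarrow> dist (f t x') (f t x) < e / 2"
      unfolding uniformly_continuous_on_def using e by (meson half_gt_zero)
    obtain n0 where n0: "1 / real (Suc n0) < d" using d(1) nat_approx_posE by blast
    have "\<omega> n t \<le> e / 2" if n: "n \<ge> n0" for n
    proof (rule \<omega>least)
      fix z assume z: "z \<in> I n"
      have "1 / real (Suc n) \<le> 1 / real (Suc n0)" using n by (simp add: frac_le)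
      then have "norm (fst z - snd z) < d" using z n0 d(1) by (auto simp: I_def)
      then show "norm (f t (fst z) - f t (snd z)) \<le> e / 2"
        using d(2)[of "snd z" "fst z"] z by (auto simp: I_def dist_norm less_imp_le)
    qed
    then have "norm (\<omega> n t - 0) < e" if "n \<ge> n0" for n using \<omega>0[OF t, of n] e that by force
    then show "\<exists>n0. \<forall>n\<ge>n0. norm (\<omega> n t - 0) < e" by blast
  qed
  have dom: "AE t in lebesgue_on {0..T}. norm (\<omega> n t) \<le> 2 * k t" for n
    by (intro AE_I2) (use \<omega>0 \<omega>least le2k in \<open>auto simp: abs_of_nonneg\<close>)
  have "(\<lambda>n. integral\<^sup>L (lebesgue_on {0..T}) (\<omega> n)) \<longlonglongrightarrow> integral\<^sup>L (lebesgue_on {0..T}) (\<lambda>_. 0::real)"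
    by (rule integral_dominated_convergence[where w="\<lambda>t. 2 * k t"]) (use \<omega>m k tend dom in \<open>auto intro!: AE_I2\<close>)
  then have "(\<lambda>n. integral\<^sup>L (lebesgue_on {0..T}) (\<omega> n)) \<longlonglongrightarrow> 0" by simp
  from order_tendstoD(2)[OF this \<epsilon>]
  obtain n where "integral\<^sup>L (lebesgue_on {0..T}) (\<omega> n) < \<epsilon>"
    using eventually_happens'[OF sequentially_bot] by blast
  then have n: "integral\<^sup>L (lebesgue_on {0..T}) (\<omega> n) \<le> \<epsilon>" by simp
  have int: "integrable (lebesgue_on {0..T}) (\<omega> n)"
  proof (rule Bochner_Integration.integrable_bound[OF _ \<omega>m])
    show "integrable (lebesgue_on {0..T}) (\<lambda>t. 2 * k t)" using k(1) by simp
    show "AE t in lebesgue_on {0..T}. norm (\<omega> n t) \<le> norm (2 * k t)"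
      using dom[of n] by eventually_elim (simp only: real_norm_def)
  qed
  \<comment> \<open>The distance allowed here is half of the one defining \<open>I n\<close>, so
    that approximating pairs from the dense set eventually satisfy its strict bound.\<close>
  have main: "norm (f t x - f t y) \<le> \<omega> n t"
    if t: "t \<in> {0..T}" and xy: "norm x \<le> R" "norm y \<le> R" "norm (x - y) \<le> 1 / (2 * real (Suc n))" for t x y
  proof -
    have cl: "x \<in> closure D" for x
      unfolding closure_iff_nhds_not_empty
    proof (intro allI impI)
      fix A U assume "U \<subseteq> A" "open U" "x \<in> U"
      then show "D \<inter> A \<noteq> {}" using D(2)[of U] by blast
    qed
    obtain X where X: "\<And>i. X i \<in> D" "X \<longlonglongrightarrow> x" using cl[of x] by (auto simp: closure_sequential)
    obtain Y where Y: "\<And>i. Y i \<in> D" "Y \<longlonglongrightarrow> y" using cl[of y] by (auto simp: closure_sequential)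
    have lim: "(\<lambda>i. norm (f t (X i) - f t (Y i))) \<longlonglongrightarrow> norm (f t x - f t y)"
      using continuous_on_tendsto_compose[OF f_cont[OF t] X(2)] continuous_on_tendsto_compose[OF f_cont[OF t] Y(2)]
      by (intro tendsto_intros) auto
    have "1 / (2 * real (Suc n)) < 1 / real (Suc n)" by (simp add: field_simps)
    then have lt: "norm x < max R 0 + 1" "norm y < max R 0 + 1" "norm (x - y) < 1 / real (Suc n)"
      using xy by auto
    have "eventually (\<lambda>i. norm (X i) < max R 0 + 1) sequentially"
      by (rule order_tendstoD(2)[OF tendsto_norm[OF X(2)] lt(1)])
    moreover have "eventually (\<lambda>i. norm (Y i) < max R 0 + 1) sequentially"
      by (rule order_tendstoD(2)[OF tendsto_norm[OF Y(2)] lt(2)])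
    moreover have "eventually (\<lambda>i. norm (X i - Y i) < 1 / real (Suc n)) sequentially"
      by (rule order_tendstoD(2)[OF tendsto_norm[OF tendsto_diff[OF X(2) Y(2)]] lt(3)])
    ultimately have "eventually (\<lambda>i. norm (f t (X i) - f t (Y i)) \<le> \<omega> n t) sequentially"
    proof eventually_elim
      case (elim i)
      then have "(X i, Y i) \<in> I n" using X(1) Y(1) by (simp add: I_def)
      from \<omega>up[OF this t] show ?case by simp
    qed
    then show ?thesis by (rule tendsto_upperbound[OF lim]) simp
  qed
  show ?thesis by (rule that[OF _ int n main]) auto
qed

end

section \<open>Truncation of the nonlinearity\<close>

text \<open>A C^1 substitute for the positive part; the cutoff built from it needs just one
  continuous derivative.\<close>

definition sqp :: "real \<Rightarrow> real" where "sqp z = (max 0 z)\<^sup>2"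

lemma sqp_deriv: "(sqp has_real_derivative 2 * max 0 z) (at z)"
proof -
  consider "z < 0" | "z = 0" | "z > 0" by linarith
  then show ?thesis
  proof cases
    case 1
    have "((\<lambda>_. 0) has_real_derivative 0) (at z)" by simp
    then have "(sqp has_real_derivative 0) (at z)"
      by (rule has_field_derivative_transform_within_open[where S="{..<0}"]) (use 1 in \<open>auto simp: sqp_def\<close>)
    then show ?thesis using 1 by simp
  next
    case 2
    have "(sqp has_derivative (\<lambda>h. 0)) (at 0)"
      unfolding has_derivative_at
    proof (intro conjI)
      show "(\<lambda>h. norm (sqp (0 + h) - sqp 0 - 0) / norm h) \<midarrow>0\<rightarrow> 0"
      proof (rule Lim_null_comparison)
        show "\<forall>\<^sub>F h in at 0. norm (norm (sqp (0 + h) - sqp 0 - 0) / norm h) \<le> \<bar>h\<bar>"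
        proof (rule always_eventually, rule allI)
          fix h :: real
          have "(max 0 h)\<^sup>2 \<le> \<bar>h\<bar> * \<bar>h\<bar>" by (auto simp: max_def power2_eq_square)
          then show "norm (norm (sqp (0 + h) - sqp 0 - 0) / norm h) \<le> \<bar>h\<bar>"
            by (cases "h = 0") (auto simp: sqp_def pos_divide_le_eq)
        qed
        show "((\<lambda>h::real. \<bar>h\<bar>) \<longlongrightarrow> 0) (at 0)" by (intro tendsto_eq_intros) auto
      qed
    qed simp
    then show ?thesis using 2 by (simp add: has_field_derivative_def lambda_zero)
  next
    case 3
    have "((\<lambda>z. z\<^sup>2) has_real_derivative 2 * z) (at z)" by (auto intro!: derivative_eq_intros)
    then have "(sqp has_real_derivative 2 * z) (at z)"
      by (rule has_field_derivative_transform_within_open[where S="{0<..}"]) (use 3 in \<open>auto simp: sqp_def\<close>)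
    then show ?thesis using 3 by simp
  qed
qed

text \<open>At the origin the difference quotient is of order |h|^(q-1), and the stated gradient
  vanishes there, so one formula covers both cases.\<close>

lemma norm_powr_deriv:
  fixes x :: "'a::euclidean_space"
  assumes q: "2 < q"
  shows "((\<lambda>x. norm x powr q) has_derivative (\<lambda>y. (q * norm x powr (q - 2)) * (x \<bullet> y))) (at x)"
proof (cases "x = 0")
  case False
  have "((\<lambda>x::'a. norm x) has_derivative (\<lambda>y. y \<bullet> sgn x)) (at x)"
    by (rule has_derivative_norm[OF False])
  moreover have "((\<lambda>r. r powr q) has_real_derivative q * norm x powr (q - 1)) (at (norm x))"
    using False by (auto intro!: derivative_eq_intros)
  ultimately have "((\<lambda>x. norm x powr q) has_derivative (\<lambda>y. (y \<bullet> sgn x) * (q * norm x powr (q - 1)))) (at x)"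
    by (rule DERIV_compose_FDERIV[rotated])
  moreover have "(y \<bullet> sgn x) * (q * norm x powr (q - 1)) = (q * norm x powr (q - 2)) * (x \<bullet> y)" for y
  proof -
    have "norm x powr (q - 1) = norm x powr (q - 2) * norm x"
      using powr_mult_base[of "norm x" "q - 2"] by (simp add: mult.commute)
    then show ?thesis using False by (simp add: sgn_div_norm inner_commute)
  qed
  ultimately show ?thesis by simp
next
  case True
  have "((\<lambda>x::'a. norm x powr q) has_derivative (\<lambda>y. 0)) (at 0)"
    unfolding has_derivative_at
  proof (intro conjI)
    show "(\<lambda>h::'a. norm (norm (0 + h) powr q - norm (0::'a) powr q - 0) / norm h) \<midarrow>0\<rightarrow> 0"
    proof (rule Lim_null_comparison)
      show "\<forall>\<^sub>F h::'a in at 0. norm (norm (norm (0 + h) powr q - norm (0::'a) powr q - 0) / norm h) \<le> norm h powr (q - 1)"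
      proof (rule always_eventually, rule allI)
        fix h :: 'a
        have "norm h powr q = norm h * norm h powr (q - 1)" using powr_mult_base[of "norm h" "q - 1"] by simp
        then show "norm (norm (norm (0 + h) powr q - norm (0::'a) powr q - 0) / norm h) \<le> norm h powr (q - 1)"
          by (cases "h = 0") simp_all
      qed
      have "((\<lambda>h::'a. norm h) \<longlongrightarrow> 0) (at 0)" by (intro tendsto_eq_intros) auto
      then show "((\<lambda>h::'a. norm h powr (q - 1)) \<longlongrightarrow> 0) (at 0)"
        using q by (intro tendsto_zero_powrI[where b="q - 1"]) auto
    qed
  qed simp
  then show ?thesis using True by simp
qed

section \<open>A cutoff between the radii \<delta>/2 and 3\<delta>/4\<close>

locale cutoff =
  fixes \<delta> :: real
  assumes \<delta>: "0 < \<delta>"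
begin

text \<open>Affine in |x|^2, hence differentiable also at 0. It vanishes at radius \<delta>/2 and
  equals 5/4 at radius 3\<delta>/4, so \<open>sqp (\<zeta> x)\<close> exceeds 1 from there
  on.\<close>

definition \<zeta> :: "'a::euclidean_space \<Rightarrow> real" where "\<zeta> x = (4 / \<delta>\<^sup>2) * ((norm x)\<^sup>2 - \<delta>\<^sup>2 / 4)"

definition cut :: "'a::euclidean_space \<Rightarrow> real" where "cut x = sqp (1 - sqp (\<zeta> x))"

text \<open>The gradient of \<open>cut\<close> is \<open>- dcut x\<close> times \<open>x\<close>;
  the sign is chosen to make \<open>dcut\<close> nonnegative.\<close>

definition dcut :: "'a::euclidean_space \<Rightarrow> real" where
  "dcut x = 8 * (4 / \<delta>\<^sup>2) * max 0 (1 - sqp (\<zeta> x)) * max 0 (\<zeta> x)"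

lemma cut_deriv: "(cut has_derivative (\<lambda>y. - dcut x * (x \<bullet> y))) (at (x :: 'a::euclidean_space))"
proof -
  have "((\<lambda>x::'a. (norm x)\<^sup>2) has_derivative (\<lambda>y. 2 * (x \<bullet> y))) (at x)"
    unfolding power2_norm_eq_inner by (auto intro!: derivative_eq_intros simp: inner_commute)
  then have 1: "(\<zeta> has_derivative (\<lambda>y. (4 / \<delta>\<^sup>2) * (2 * (x \<bullet> y)))) (at x)"
    unfolding \<zeta>_def[abs_def]
    using has_derivative_mult_right[OF has_derivative_diff[OF _ has_derivative_const[of "\<delta>\<^sup>2 / 4"]], of _ _ "at x" "4 / \<delta>\<^sup>2"]
    by fastforce
  have 2: "((\<lambda>x. sqp (\<zeta> x)) has_derivative (\<lambda>y. (4 / \<delta>\<^sup>2) * (2 * (x \<bullet> y)) * (2 * max 0 (\<zeta> x)))) (at x)"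
    by (rule DERIV_compose_FDERIV[OF sqp_deriv 1])
  have 3: "((\<lambda>x. 1 - sqp (\<zeta> x)) has_derivative (\<lambda>y. 0 - (4 / \<delta>\<^sup>2) * (2 * (x \<bullet> y)) * (2 * max 0 (\<zeta> x)))) (at x)"
    by (intro has_derivative_diff has_derivative_const 2)
  have "(cut has_derivative (\<lambda>y. (0 - (4 / \<delta>\<^sup>2) * (2 * (x \<bullet> y)) * (2 * max 0 (\<zeta> x))) * (2 * max 0 (1 - sqp (\<zeta> x))))) (at x)"
    unfolding cut_def[abs_def] by (rule DERIV_compose_FDERIV[OF sqp_deriv 3])
  then show ?thesis by (simp add: dcut_def mult_ac)
qed

lemma dcut_cont: "continuous_on UNIV (dcut :: 'a::euclidean_space \<Rightarrow> real)"
  unfolding dcut_def[abs_def] \<zeta>_def[abs_def] sqp_def by (intro continuous_intros)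

lemma cut_cont: "continuous_on UNIV (cut :: 'a::euclidean_space \<Rightarrow> real)"
  unfolding cut_def[abs_def] \<zeta>_def[abs_def] sqp_def by (intro continuous_intros)

lemma cut_range: "0 \<le> cut x" "cut x \<le> 1"
proof -
  have "max 0 (1 - sqp (\<zeta> x)) \<le> 1" by (simp add: sqp_def)
  then have "(max 0 (1 - sqp (\<zeta> x)))\<^sup>2 \<le> 1" by (simp add: power_le_one)
  then show "cut x \<le> 1" by (simp only: cut_def sqp_def[of "1 - _"])
qed (simp add: cut_def sqp_def)

lemma dcut_range: "0 \<le> dcut x" "dcut x \<le> 32 / \<delta>\<^sup>2"
proof -
  show "0 \<le> dcut x" by (simp add: dcut_def)
  have "max 0 (1 - sqp (\<zeta> x)) * max 0 (\<zeta> x) \<le> 1"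
  proof (cases "\<zeta> x \<le> 1")
    case True
    have "max 0 (1 - sqp (\<zeta> x)) * max 0 (\<zeta> x) \<le> 1 * 1"
      using True by (intro mult_mono) (auto simp: sqp_def)
    then show ?thesis by simp
  next
    case False
    then have "1 \<le> (\<zeta> x)\<^sup>2" by (simp add: one_le_power)
    then have "max 0 (1 - sqp (\<zeta> x)) = 0" using False by (simp add: sqp_def)
    then show ?thesis by simp
  qed
  then have "32 / \<delta>\<^sup>2 * (max 0 (1 - sqp (\<zeta> x)) * max 0 (\<zeta> x)) \<le> 32 / \<delta>\<^sup>2 * 1"
    by (intro mult_left_mono) auto
  then show "dcut x \<le> 32 / \<delta>\<^sup>2" by (simp add: dcut_def mult_ac)
qed

lemma cut_inner: assumes "norm x \<le> \<delta> / 2" shows "cut x = 1" "dcut x = 0"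
proof -
  have "(norm x)\<^sup>2 \<le> (\<delta> / 2)\<^sup>2" using assms by (intro power_mono) auto
  then have "\<zeta> x \<le> 0" using \<delta> unfolding \<zeta>_def by (intro mult_nonneg_nonpos) (auto simp: power_divide)
  then show "cut x = 1" "dcut x = 0" by (auto simp: cut_def dcut_def sqp_def)
qed

lemma cut_outer: assumes "3 / 4 * \<delta> \<le> norm x" shows "cut x = 0" "dcut x = 0"
proof -
  have "(3 / 4 * \<delta>)\<^sup>2 \<le> (norm x)\<^sup>2" using assms \<delta> by (intro power_mono) auto
  then have "9 / 16 * \<delta>\<^sup>2 \<le> (norm x)\<^sup>2" by (simp add: power_mult_distrib power_divide)
  moreover have "0 < \<delta>\<^sup>2" using \<delta> by simp
  ultimately have "\<delta>\<^sup>2 / 4 \<le> (norm x)\<^sup>2 - \<delta>\<^sup>2 / 4" by argo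
  then have "4 / \<delta>\<^sup>2 * (\<delta>\<^sup>2 / 4) \<le> \<zeta> x" unfolding \<zeta>_def by (intro mult_left_mono) auto
  then have "1 \<le> \<zeta> x" using \<delta> by simp
  then have "1 \<le> sqp (\<zeta> x)" by (simp add: sqp_def one_le_power)
  then show "cut x = 0" "dcut x = 0" by (auto simp: cut_def dcut_def sqp_def[of "1 - _"])
qed

end

text \<open>F is blended with P(x) = M2 |x|^q2, which dominates it on the ball and satisfies the
  superlinearity condition with exponent q2; hence the minimum with \<beta>. The blend ends at
  3\<delta>/4, strictly inside the ball: the open sets |x| < \<delta> and |x| > 3\<delta>/4 cover
  the space, and one-sided derivatives on the sphere |x| = \<delta> never enter.\<close>

lemma truncation:
  fixes F :: "real \<Rightarrow> 'a::euclidean_space \<Rightarrow> real" and gradF :: "real \<Rightarrow> 'a \<Rightarrow> 'a"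
  assumes T: "0 < T" and \<delta>: "0 < \<delta>"
    and C1: "AE t in lborel. t \<in> {0..T} \<longrightarrow>
        (\<forall>x\<in>cball 0 \<delta>. (F t has_derivative (\<lambda>y. gradF t x \<bullet> y)) (at x within cball 0 \<delta>))
        \<and> continuous_on (cball 0 \<delta>) (gradF t)"
    and meas: "\<forall>x\<in>cball 0 \<delta>. (\<lambda>t. F t x) \<in> borel_measurable (lebesgue_on {0..T})"
    and h_cont: "continuous_on {0..} h"
    and g_L1: "g integrable_on {0..T}" and g_nonneg: "\<forall>t\<in>{0..T}. g t \<ge> 0"
    and bound: "AE t in lborel. t \<in> {0..T} \<longrightarrow>
        (\<forall>x\<in>cball 0 \<delta>. \<bar>F t x\<bar> \<le> h (norm x) * g t \<and> norm (gradF t x) \<le> h (norm x) * g t)"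
    and q2: "2 < q2" and M: "0 < M1" "0 < M2" and \<beta>: "0 < \<beta>"
    and growth: "AE t in lborel. t \<in> {0..T} \<longrightarrow>
        (\<forall>x. norm x \<le> \<delta> \<longrightarrow> M1 * norm x powr q1 \<le> F t x \<and> F t x \<le> M2 * norm x powr q2)"
    and AR: "AE t in lborel. t \<in> {0..T} \<longrightarrow>
        (\<forall>x. norm x \<le> \<delta> \<longrightarrow> 0 \<le> \<beta> * F t x \<and> \<beta> * F t x \<le> gradF t x \<bullet> x)"
  obtains H f where "caratheodory T H f"
    "AE t in lebesgue_on {0..T}. \<forall>x. norm x \<le> \<delta> / 2 \<longrightarrow> f t x = gradF t x"
    "\<And>t x. t \<in> {0..T} \<Longrightarrow> 0 \<le> H t x \<and> H t x \<le> M2 * norm x powr q2"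
    "\<And>t x. t \<in> {0..T} \<Longrightarrow> min \<beta> q2 * H t x \<le> f t x \<bullet> x"
    "AE t in lebesgue_on {0..T}. \<forall>x. norm x \<le> \<delta> \<longrightarrow> M1 * norm x powr q1 \<le> H t x"
proof -
  interpret cutoff \<delta> by standard (rule \<delta>)
  define good where "good t \<longleftrightarrow> ((\<forall>x\<in>cball 0 \<delta>. (F t has_derivative (\<lambda>y. gradF t x \<bullet> y)) (at x within cball 0 \<delta>))
        \<and> continuous_on (cball 0 \<delta>) (gradF t))
      \<and> (\<forall>x\<in>cball 0 \<delta>. \<bar>F t x\<bar> \<le> h (norm x) * g t \<and> norm (gradF t x) \<le> h (norm x) * g t)
      \<and> (\<forall>x. norm x \<le> \<delta> \<longrightarrow> M1 * norm x powr q1 \<le> F t x \<and> F t x \<le> M2 * norm x powr q2)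
      \<and> (\<forall>x. norm x \<le> \<delta> \<longrightarrow> 0 \<le> \<beta> * F t x \<and> \<beta> * F t x \<le> gradF t x \<bullet> x)" for t
  have "AE t in lborel. t \<in> {0..T} \<longrightarrow> good t"
    using C1 bound growth AR by eventually_elim (simp add: good_def)
  then obtain Z where Z: "Z \<in> null_sets lborel" "{t. \<not> (t \<in> {0..T} \<longrightarrow> good t)} \<subseteq> Z"
    unfolding eventually_ae_filter by auto
  have Zl: "Z \<in> sets lebesgue" using Z(1) by (auto simp: null_sets_def)
  have good: "good t" if "t \<in> {0..T}" "t \<notin> Z" for t using Z(2) that by blast
  have notZ: "AE t in lebesgue_on {0..T}. t \<notin> Z"
  proof -
    have "AE t in lebesgue. t \<notin> Z" using Z(1) by (intro AE_not_in null_sets_completionI) simp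
    then show ?thesis by (subst AE_restrict_space_iff) auto
  qed
  define P where "P x = M2 * norm x powr q2" for x :: 'a
  define dP where "dP x = (M2 * (q2 * norm x powr (q2 - 2))) *\<^sub>R x" for x :: 'a
  have P_deriv: "(P has_derivative (\<lambda>y. dP x \<bullet> y)) (at x)" for x
    using has_derivative_mult_right[OF norm_powr_deriv[OF q2, of x], of M2] unfolding P_def[abs_def] dP_def
    by (simp add: mult.assoc)
  have P_cont: "continuous_on UNIV P"
    using P_deriv has_derivative_continuous by (blast intro: continuous_at_imp_continuous_on)
  have dP_cont: "continuous_on UNIV dP"
    unfolding dP_def[abs_def] using q2 by (intro continuous_intros continuous_on_powr') auto
  (* As F \<le> P on the ball and dcut \<ge> 0, the term of f coming from the derivative of the cutoff
     has the right sign for the superlinearity condition. *)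
  define H where "H t x = (if t \<in> Z then 0 else cut x * F t x + (1 - cut x) * P x)" for t x
  define f where "f t x = (if t \<in> Z then 0 else
     cut x *\<^sub>R gradF t x + (1 - cut x) *\<^sub>R dP x - (dcut x * (F t x - P x)) *\<^sub>R x)" for t x
  have powr_inner: "dP x \<bullet> x = q2 * P x" for x
  proof -
    have "norm x powr (q2 - 2) * (x \<bullet> x) = norm x powr q2"
      using q2 by (cases "x = 0") (simp_all add: powr_diff dot_square_norm powr_numeral)
    then show ?thesis by (simp add: dP_def P_def mult.assoc mult.left_commute[of q2])
  qed
  have P0: "0 \<le> P x" for x using M by (simp add: P_def)
  have F0: "0 \<le> F t x" "F t x \<le> P x" if "t \<in> {0..T}" "t \<notin> Z" "norm x \<le> \<delta>" for t x
  proof -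
    have "M1 * norm x powr q1 \<le> F t x" "F t x \<le> P x" using good[OF that(1,2)] that(3) unfolding good_def P_def by blast+
    moreover have "0 \<le> M1 * norm x powr q1" using M by simp
    ultimately show "0 \<le> F t x" "F t x \<le> P x" by linarith+
  qed
  have H_outer: "H t x = P x" "f t x = dP x" if "t \<notin> Z" "3 / 4 * \<delta> \<le> norm x" for t x
    using cut_outer[OF that(2)] that(1) by (auto simp: H_def f_def)
  have range: "0 \<le> H t x \<and> H t x \<le> P x" if t: "t \<in> {0..T}" for t x
  proof (cases "t \<in> Z \<or> \<delta> \<le> norm x")
    case True
    then show ?thesis using H_outer(1)[of t x] P0[of x] \<delta> by (auto simp: H_def)
  next
    case False
    then have F: "0 \<le> F t x" "F t x \<le> P x" using F0[OF t] by auto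
    have "cut x * F t x + (1 - cut x) * P x \<le> cut x * P x + (1 - cut x) * P x"
      using F cut_range[of x] by (intro add_mono mult_left_mono) auto
    moreover have "0 \<le> cut x * F t x + (1 - cut x) * P x" using F cut_range[of x] P0[of x] by simp
    ultimately show ?thesis using False by (simp add: H_def algebra_simps)
  qed
  have ARH: "min \<beta> q2 * H t x \<le> f t x \<bullet> x" if t: "t \<in> {0..T}" for t x
  proof (cases "t \<in> Z \<or> \<delta> \<le> norm x")
    case True
    have "min \<beta> q2 * P x \<le> q2 * P x" using P0 by (intro mult_right_mono) auto
    then show ?thesis using True H_outer[of t x] \<delta> by (auto simp: H_def f_def powr_inner)
  next
    case False
    then have F: "0 \<le> F t x" "F t x \<le> P x" using F0[OF t] by auto
    have gr: "\<beta> * F t x \<le> gradF t x \<bullet> x" using good[OF t] False unfolding good_def by auto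
    have "min \<beta> q2 * H t x = cut x * (min \<beta> q2 * F t x) + (1 - cut x) * (min \<beta> q2 * P x)"
      using False by (simp add: H_def algebra_simps)
    also have "\<dots> \<le> cut x * (gradF t x \<bullet> x) + (1 - cut x) * (q2 * P x)"
    proof (intro add_mono mult_left_mono)
      have "min \<beta> q2 * F t x \<le> \<beta> * F t x" using F by (intro mult_right_mono) auto
      then show "min \<beta> q2 * F t x \<le> gradF t x \<bullet> x" using gr by linarith
      show "min \<beta> q2 * P x \<le> q2 * P x" using P0 by (intro mult_right_mono) auto
    qed (use cut_range in auto)
    also have "\<dots> \<le> cut x * (gradF t x \<bullet> x) + (1 - cut x) * (q2 * P x) - (dcut x * (F t x - P x)) * (x \<bullet> x)"
      using mult_nonneg_nonneg[OF mult_nonneg_nonneg[OF dcut_range(1), of "P x - F t x"] inner_ge_zero, of x x] F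
      by (simp add: algebra_simps)
    also have "\<dots> = f t x \<bullet> x"
      using False by (simp add: f_def inner_diff_left inner_add_left powr_inner)
    finally show ?thesis .
  qed
  have car: "caratheodory T H f"
  proof
    fix x :: 'a
    show "(\<lambda>t. H t x) \<in> borel_measurable (lebesgue_on {0..T})"
    proof -
      have [measurable]: "{t \<in> space (lebesgue_on {0..T}). t \<in> Z} \<in> sets (lebesgue_on {0..T})"
        using Zl by (auto simp: sets_restrict_space image_iff intro!: bexI[of _ Z])
      show ?thesis
      proof (cases "norm x \<le> \<delta>")
        case True
        then have [measurable]: "(\<lambda>t. F t x) \<in> borel_measurable (lebesgue_on {0..T})" using meas by simp
        show ?thesis unfolding H_def by (intro measurable_If) measurable
      next
        case False
        then have "H t x = (if t \<in> Z then 0 else P x)" for t using cut_outer[of x] \<delta> by (simp add: H_def)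
        then show ?thesis by (simp only:) (intro measurable_If; measurable)
      qed
    qed
  next
    fix t x assume t: "t \<in> {0..T}"
    show "(H t has_derivative (\<lambda>y. f t x \<bullet> y)) (at x)"
    proof (cases "t \<in> Z")
      case True
      then have "H t = (\<lambda>x. 0)" "f t x = 0" by (auto simp: H_def f_def)
      then show ?thesis by simp
    next
      case tZ: False
      show ?thesis
      proof (cases "norm x < \<delta>")
        case True
        have "(F t has_derivative (\<lambda>y. gradF t x \<bullet> y)) (at x within cball 0 \<delta>)"
          using good[OF t tZ] True unfolding good_def by auto
        then have "(F t has_derivative (\<lambda>y. gradF t x \<bullet> y)) (at x within ball 0 \<delta>)"
          by (rule has_derivative_subset) auto
        then have Fd: "(F t has_derivative (\<lambda>y. gradF t x \<bullet> y)) (at x)"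
          using at_within_open[of x "ball 0 \<delta>"] True by simp
        have Ht: "H t = (\<lambda>x. cut x * F t x + (1 - cut x) * P x)" using tZ by (auto simp: H_def)
        have "(H t has_derivative (\<lambda>y. (cut x * (gradF t x \<bullet> y) + (- dcut x * (x \<bullet> y)) * F t x) +
             ((1 - cut x) * (dP x \<bullet> y) + (0 - (- dcut x * (x \<bullet> y))) * P x))) (at x)"
          unfolding Ht by (intro has_derivative_add has_derivative_mult has_derivative_diff has_derivative_const cut_deriv Fd P_deriv)
        then show ?thesis using tZ by (simp add: f_def inner_diff_left inner_add_left algebra_simps)
      next
        case False
        have "(P has_derivative (\<lambda>y. dP x \<bullet> y)) (at x)" by (rule P_deriv)
        then have "(H t has_derivative (\<lambda>y. dP x \<bullet> y)) (at x)"
        proof (rule has_derivative_transform_within_open)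
          show "open (- cball (0::'a) (3 / 4 * \<delta>))" by (simp add: open_Compl)
          show "x \<in> - cball 0 (3 / 4 * \<delta>)" using False \<delta> by simp
          show "P y = H t y" if "y \<in> - cball 0 (3 / 4 * \<delta>)" for y using H_outer(1)[OF tZ, of y] that by simp
        qed
        moreover have "f t x = dP x" using H_outer(2)[OF tZ, of x] False \<delta> by simp
        ultimately show ?thesis by simp
      qed
    qed
  next
    fix t assume t: "t \<in> {0..T}"
    show "continuous_on UNIV (f t)"
    proof (cases "t \<in> Z")
      case True
      then have "f t = (\<lambda>_. 0)" by (auto simp: f_def)
      then show ?thesis by simp
    next
      case tZ: False
      have g1: "continuous_on (cball 0 \<delta>) (gradF t)" "continuous_on (cball 0 \<delta>) (F t)"
        using good[OF t tZ] unfolding good_def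
        by (auto simp: continuous_on_eq_continuous_within intro: has_derivative_continuous)
      have "continuous_on (ball 0 \<delta>) (\<lambda>x. cut x *\<^sub>R gradF t x + (1 - cut x) *\<^sub>R dP x - (dcut x * (F t x - P x)) *\<^sub>R x)"
        by (intro continuous_intros continuous_on_subset[OF g1(1)] continuous_on_subset[OF g1(2)]
           continuous_on_subset[OF cut_cont] continuous_on_subset[OF dcut_cont] continuous_on_subset[OF P_cont] continuous_on_subset[OF dP_cont]) auto
      then have c1: "continuous_on (ball 0 \<delta>) (f t)" using tZ by (simp add: f_def[abs_def])
      have c2: "continuous_on (- cball 0 (3 / 4 * \<delta>)) (f t)"
        using continuous_on_subset[OF dP_cont, of "- cball 0 (3 / 4 * \<delta>)"] H_outer(2)[OF tZ]
        by (subst continuous_on_cong[OF refl, of _ _ dP]) auto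
      have "continuous_on (ball 0 \<delta> \<union> - cball 0 (3 / 4 * \<delta>)) (f t)"
        by (rule continuous_on_open_Un[OF _ _ c1 c2]) (auto simp: open_Compl)
      moreover have "ball 0 \<delta> \<union> - cball (0::'a) (3 / 4 * \<delta>) = UNIV" using \<delta> by auto
      ultimately show ?thesis by simp
    qed
  next
    fix R :: real
    define R' where "R' = max R 0"
    have "continuous_on {0..\<delta>} h" by (rule continuous_on_subset[OF h_cont]) auto
    then obtain B where B: "0 \<le> B" "\<And>s. s \<in> {0..\<delta>} \<Longrightarrow> norm (h s) \<le> B"
      using continuous_on_Icc_bounded by metis
    \<comment> \<open>One summand for each term of \<open>f\<close>: the gradient of F, the gradient
      of P, and the cutoff term with \<open>dcut\<close> bounded by 32/\<delta>^2.\<close>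
    define k where "k t = B * g t + M2 * (q2 * R' powr (q2 - 2)) * R' + (32 / \<delta>\<^sup>2) * (B * g t + M2 * R' powr q2) * R'" for t
    have gi: "integrable (lebesgue_on {0..T}) g"
      using nonnegative_absolutely_integrable_1[OF g_L1] g_nonneg
      by (simp add: set_integrable_def integrable_restrict_space)
    have "integrable (lebesgue_on {0..T}) k"
      unfolding k_def using gi finite_measure_lebesgue_on[of "{0..T}"] by (auto simp: finite_measure.integrable_const)
    moreover have "norm (f t x) \<le> k t" if t: "t \<in> {0..T}" and x: "norm x \<le> R" for t x
    proof -
      have R': "norm x \<le> R'" "0 \<le> R'" using x by (auto simp: R'_def)
      have g0: "0 \<le> g t" using g_nonneg t by simp
      have dPb: "norm (dP x) \<le> M2 * (q2 * R' powr (q2 - 2)) * R'"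
        unfolding dP_def using M q2 R' by (auto simp: abs_mult intro!: mult_mono powr_mono2)
      have Pb: "\<bar>P x\<bar> \<le> M2 * R' powr q2"
        unfolding P_def using M q2 R' by (auto simp: abs_mult intro!: mult_mono powr_mono2)
      have nn: "0 \<le> B * g t" "0 \<le> M2 * (q2 * R' powr (q2 - 2)) * R'" "0 \<le> (32 / \<delta>\<^sup>2) * (B * g t + M2 * R' powr q2) * R'"
        using B g0 M q2 R' by auto
      show ?thesis
      proof (cases "t \<in> Z \<or> \<delta> \<le> norm x")
        case True
        then consider "t \<in> Z" | "t \<notin> Z" "3 / 4 * \<delta> \<le> norm x" using \<delta> by force
        then show ?thesis
        proof cases
          case 1
          then show ?thesis using nn by (simp add: f_def k_def)
        next
          case 2
          then show ?thesis using H_outer(2)[of t x] nn dPb by (simp add: k_def)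
        qed
      next
        case False
        have hB: "h (norm x) * g t \<le> B * g t"
          using B(2)[of "norm x"] False g0 by (intro mult_right_mono) auto
        have "\<bar>F t x\<bar> \<le> h (norm x) * g t" "norm (gradF t x) \<le> h (norm x) * g t"
          using good[OF t] False unfolding good_def by auto
        then have Fb: "\<bar>F t x\<bar> \<le> B * g t" "norm (gradF t x) \<le> B * g t" using hB by linarith+
        have "norm (f t x) \<le> norm (cut x *\<^sub>R gradF t x) + norm ((1 - cut x) *\<^sub>R dP x) + norm ((dcut x * (F t x - P x)) *\<^sub>R x)"
        proof -
          have "f t x = cut x *\<^sub>R gradF t x + (1 - cut x) *\<^sub>R dP x - (dcut x * (F t x - P x)) *\<^sub>R x"
            using False by (simp add: f_def)
          then show ?thesis
            by (simp only:) (rule order.trans[OF norm_triangle_ineq4 add_right_mono[OF norm_triangle_ineq]])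
        qed
        also have "\<dots> \<le> B * g t + M2 * (q2 * R' powr (q2 - 2)) * R' + (32 / \<delta>\<^sup>2) * (B * g t + M2 * R' powr q2) * R'"
        proof (intro add_mono)
          have "cut x * norm (gradF t x) \<le> 1 * (B * g t)" using cut_range[of x] Fb by (intro mult_mono) auto
          then show "norm (cut x *\<^sub>R gradF t x) \<le> B * g t" using cut_range[of x] by simp
          have "(1 - cut x) * norm (dP x) \<le> 1 * (M2 * (q2 * R' powr (q2 - 2)) * R')" using cut_range[of x] dPb by (intro mult_mono) auto
          then show "norm ((1 - cut x) *\<^sub>R dP x) \<le> M2 * (q2 * R' powr (q2 - 2)) * R'" using cut_range[of x] by simp
          have "\<bar>F t x - P x\<bar> \<le> B * g t + M2 * R' powr q2" using Fb(1) Pb by linarith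
          then have "dcut x * \<bar>F t x - P x\<bar> * norm x \<le> (32 / \<delta>\<^sup>2) * (B * g t + M2 * R' powr q2) * R'"
            using dcut_range[of x] R' by (intro mult_mono) auto
          then show "norm ((dcut x * (F t x - P x)) *\<^sub>R x) \<le> (32 / \<delta>\<^sup>2) * (B * g t + M2 * R' powr q2) * R'"
            using dcut_range[of x] by (simp add: abs_mult)
        qed
        finally show ?thesis by (simp add: k_def)
      qed
    qed
    ultimately show "\<exists>k. integrable (lebesgue_on {0..T}) k \<and> (\<forall>t\<in>{0..T}. \<forall>x. norm x \<le> R \<longrightarrow> norm (f t x) \<le> k t)" by blast
  next
    fix t assume "t \<in> {0..T}"
    then show "H t 0 = 0" using range[of t 0] by (simp add: P_def)
  qed
  have inner: "AE t in lebesgue_on {0..T}. \<forall>x. norm x \<le> \<delta> / 2 \<longrightarrow> f t x = gradF t x"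
    using notZ by eventually_elim (auto simp: f_def cut_inner)
  have low: "AE t in lebesgue_on {0..T}. \<forall>x. norm x \<le> \<delta> \<longrightarrow> M1 * norm x powr q1 \<le> H t x"
  proof (rule AE_mp[OF notZ], rule AE_I2, intro impI allI)
    fix t :: real and x :: 'a assume t': "t \<in> space (lebesgue_on {0..T})" "t \<notin> Z" "norm x \<le> \<delta>"
    then have t: "t \<in> {0..T}" by simp
    have "F t x \<le> H t x"
      using mult_left_mono[OF F0(2)[OF t t'(2,3)], of "1 - cut x"] cut_range[of x] t'(2) by (simp add: H_def algebra_simps)
    moreover have "M1 * norm x powr q1 \<le> F t x" using good[OF t t'(2)] t'(3) unfolding good_def by blast
    ultimately show "M1 * norm x powr q1 \<le> H t x" by simp
  qed
  show ?thesis by (rule that[OF car inner _ ARH low]) (use range in \<open>auto simp: P_def\<close>)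
qed

section \<open>The Kirchhoff energy\<close>

definition Aw :: "'b measure \<Rightarrow> ('b \<Rightarrow> real) \<Rightarrow> nat \<Rightarrow> ('b \<Rightarrow> 'a::euclidean_space) \<Rightarrow> ('b \<Rightarrow> 'a) \<Rightarrow> real" where
  "Aw M Wt p u v = (\<integral>x. Wt x * (jp p (u x) \<bullet> v x) \<partial>M)"

lemma jp_measurable[measurable]:
  fixes u :: "'b \<Rightarrow> 'a::euclidean_space"
  shows "u \<in> borel_measurable M \<Longrightarrow> (\<lambda>x. jp p (u x)) \<in> borel_measurable M"
  unfolding jp_def by measurable

text \<open>Serves both parts of the norm, with weight 1 for the derivative and weight V for the
  function. \<open>c0\<close> is the monotonicity constant: 1 in the first case, while 0 will do in
  the second because the derivative part alone controls \<open>N\<close>.\<close>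

locale weight =
  fixes M :: "'b measure" and Wt :: "'b \<Rightarrow> real" and p :: nat and c0 c :: real
  assumes p2: "2 \<le> p" and Wt_meas[measurable]: "Wt \<in> borel_measurable M"
    and c0: "0 \<le> c0" and Wt_bound: "\<And>x. x \<in> space M \<Longrightarrow> c0 \<le> Wt x \<and> Wt x \<le> c"
begin

lemma Wt_nonneg: "x \<in> space M \<Longrightarrow> 0 \<le> Wt x"
  using c0 Wt_bound by force

lemma c_nonneg: "space M \<noteq> {} \<Longrightarrow> 0 \<le> c"
  using c0 Wt_bound by force

lemma weighted_integrable:
  fixes f :: "'b \<Rightarrow> real"
  assumes "integrable M f" shows "integrable M (\<lambda>x. Wt x * f x)"
proof (rule Bochner_Integration.integrable_bound)
  show "integrable M (\<lambda>x. c * f x)" using assms by simp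
  show "(\<lambda>x. Wt x * f x) \<in> borel_measurable M"
    using borel_measurable_integrable[OF assms] by measurable
  show "AE x in M. norm (Wt x * f x) \<le> norm (c * f x)"
    using Wt_nonneg Wt_bound by (intro AE_I2) (force simp: abs_mult intro!: mult_right_mono)
qed

lemma Aw_integrable:
  assumes u: "memLp M p u" and v: "memLp M p v"
  shows "integrable M (\<lambda>x. Wt x * (jp p (u x) \<bullet> v x))"
proof (rule weighted_integrable, rule Bochner_Integration.integrable_bound)
  note [measurable] = memLp_meas[OF u] memLp_meas[OF v]
  show "integrable M (\<lambda>x. norm (u x) ^ (p - 2) * norm (u x) * norm (v x))"
    by (rule hoelder3(1)[OF p2 u u v])
  show "(\<lambda>x. jp p (u x) \<bullet> v x) \<in> borel_measurable M" by measurable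
  have "\<bar>jp p (u x) \<bullet> v x\<bar> \<le> norm (u x) ^ (p - 2) * norm (u x) * norm (v x)" for x
    using Cauchy_Schwarz_ineq2[of "jp p (u x)" "v x"] by (simp add: jp_def)
  then show "AE x in M. norm (jp p (u x) \<bullet> v x) \<le> norm (norm (u x) ^ (p - 2) * norm (u x) * norm (v x))"
    by (intro AE_I2) simp
qed

text \<open>The pointwise Lipschitz bound for \<open>jp\<close> is integrated by
  \<open>hoelder3\<close>, with |u| + |u'| as the first function.\<close>

lemma Aw_diff_le:
  assumes u: "memLp M p u" and u': "memLp M p u'" and v: "memLp M p v"
  shows "\<bar>Aw M Wt p u v - Aw M Wt p u' v\<bar>
     \<le> 3 * c * real (p - 1) * (normLp M p u + normLp M p u') ^ (p - 2) * normLp M p (\<lambda>x. u x - u' x) * normLp M p v"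
proof (cases "space M = {}")
  \<comment> \<open>On an empty space \<open>Wt_bound\<close> is vacuous and \<open>c\<close> could
    be negative, but all integrals vanish.\<close>
  case True
  then have "integral\<^sup>L M f = 0" for f :: "'b \<Rightarrow> real" by (rule Bochner_Integration.integral_empty)
  then show ?thesis by (simp add: Aw_def normLp_def real_root_zero)
next
  case False
  define z where "z x = norm (u x) + norm (u' x)" for x
  have z: "memLp M p z" unfolding z_def by (intro memLp_add memLp_norm u u')
  have d: "memLp M p (\<lambda>x. u x - u' x)" by (intro memLp_diff u u')
  note h = hoelder3[OF p2 z d v]
  have "Aw M Wt p u v - Aw M Wt p u' v = (\<integral>x. Wt x * (jp p (u x) \<bullet> v x) - Wt x * (jp p (u' x) \<bullet> v x) \<partial>M)"
    unfolding Aw_def by (intro Bochner_Integration.integral_diff[symmetric] Aw_integrable u u' v)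
  also have "\<bar>\<dots>\<bar> \<le> (\<integral>x. c * real (p - 1) * (norm (z x) ^ (p - 2) * norm (u x - u' x) * norm (v x)) \<partial>M)"
    unfolding real_norm_def[symmetric]
  proof (rule order.trans[OF integral_norm_bound integral_mono])
    show "integrable M (\<lambda>x. norm (Wt x * (jp p (u x) \<bullet> v x) - Wt x * (jp p (u' x) \<bullet> v x)))"
      by (intro integrable_norm Bochner_Integration.integrable_diff Aw_integrable u u' v)
    show "integrable M (\<lambda>x. c * real (p - 1) * (norm (z x) ^ (p - 2) * norm (u x - u' x) * norm (v x)))"
      using h(1) by simp
    fix x assume x: "x \<in> space M"
    have "Wt x * (jp p (u x) \<bullet> v x) - Wt x * (jp p (u' x) \<bullet> v x) = Wt x * ((jp p (u x) - jp p (u' x)) \<bullet> v x)"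
      by (simp add: inner_diff_left algebra_simps)
    then have "norm (Wt x * (jp p (u x) \<bullet> v x) - Wt x * (jp p (u' x) \<bullet> v x)) = Wt x * \<bar>(jp p (u x) - jp p (u' x)) \<bullet> v x\<bar>"
      using Wt_nonneg[OF x] by (simp add: abs_mult)
    also have "\<dots> \<le> c * (norm (jp p (u x) - jp p (u' x)) * norm (v x))"
      using Wt_bound[OF x] Wt_nonneg[OF x] by (intro mult_mono Cauchy_Schwarz_ineq2) auto
    also have "\<dots> \<le> c * ((real (p - 1) * (norm (u x) + norm (u' x)) ^ (p - 2) * norm (u x - u' x)) * norm (v x))"
      using c_nonneg[OF False] by (intro mult_left_mono mult_right_mono jp_lipschitz p2) auto
    finally show "norm (Wt x * (jp p (u x) \<bullet> v x) - Wt x * (jp p (u' x) \<bullet> v x))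
        \<le> c * real (p - 1) * (norm (z x) ^ (p - 2) * norm (u x - u' x) * norm (v x))"
      by (simp add: z_def mult_ac)
  qed
  also have "\<dots> = c * real (p - 1) * (\<integral>x. norm (z x) ^ (p - 2) * norm (u x - u' x) * norm (v x) \<partial>M)" by simp
  also have "\<dots> \<le> c * real (p - 1) * (3 * normLp M p z ^ (p - 2) * normLp M p (\<lambda>x. u x - u' x) * normLp M p v)"
    using c_nonneg[OF False] by (intro mult_left_mono h(2)) auto
  also have "\<dots> \<le> c * real (p - 1) * (3 * (normLp M p u + normLp M p u') ^ (p - 2) * normLp M p (\<lambda>x. u x - u' x) * normLp M p v)"
  proof -
    have "normLp M p z \<le> normLp M p u + normLp M p u'"
      unfolding z_def using minkowski[of p M "\<lambda>x. norm (u x)" "\<lambda>x. norm (u' x)"] p2 memLp_norm[OF u] memLp_norm[OF u']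
      by (simp add: normLp_norm)
    then show ?thesis using c_nonneg[OF False]
      by (intro mult_left_mono mult_right_mono power_mono normLp_nonneg) (auto simp: normLp_nonneg)
  qed
  finally show ?thesis by (simp add: mult_ac)
qed

lemma Aw_le:
  assumes u: "memLp M p u" and v: "memLp M p v"
  shows "\<bar>Aw M Wt p u v\<bar> \<le> 3 * c * real (p - 1) * normLp M p u ^ (p - 2) * normLp M p u * normLp M p v"
proof -
  have z: "memLp M p (\<lambda>x. 0 :: 'a)" using p2 by (simp add: memLp_def power_0_left)
  have "Aw M Wt p (\<lambda>x. 0) v = 0" by (simp add: Aw_def jp_def)
  moreover have "normLp M p (\<lambda>x. 0 :: 'a) = 0" using p2 by (simp add: normLp_def power_0_left)
  ultimately show ?thesis using Aw_diff_le[OF u z v] by simp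
qed

lemma Aw_add: "memLp M p u \<Longrightarrow> memLp M p v \<Longrightarrow> memLp M p v' \<Longrightarrow> Aw M Wt p u (\<lambda>x. v x + v' x) = Aw M Wt p u v + Aw M Wt p u v'"
  unfolding Aw_def inner_add_right distrib_left
  by (intro Bochner_Integration.integral_add Aw_integrable)

lemma Aw_scale: "Aw M Wt p u (\<lambda>x. r *\<^sub>R v x) = r * Aw M Wt p u v"
  unfolding Aw_def by (simp add: mult.left_commute)

lemma Aw_diff: "memLp M p u \<Longrightarrow> memLp M p v \<Longrightarrow> memLp M p v' \<Longrightarrow> Aw M Wt p u (\<lambda>x. v x - v' x) = Aw M Wt p u v - Aw M Wt p u v'"
  unfolding Aw_def inner_diff_right right_diff_distrib
  by (intro Bochner_Integration.integral_diff Aw_integrable)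

lemma Aw_self: "Aw M Wt p u u = (\<integral>x. Wt x * norm (u x) ^ p \<partial>M)"
  unfolding Aw_def by (simp add: jp_inner_self[OF p2])

lemma Aw_monotone:
  assumes u: "memLp M p u" and u': "memLp M p u'"
  shows "c0 * (normLp M p (\<lambda>x. u x - u' x) ^ p / 2 ^ (p - 1)) \<le> Aw M Wt p u (\<lambda>x. u x - u' x) - Aw M Wt p u' (\<lambda>x. u x - u' x)"
proof -
  have d: "memLp M p (\<lambda>x. u x - u' x)" by (intro memLp_diff u u')
  have p0: "0 < p" using p2 by simp
  have "c0 * (normLp M p (\<lambda>x. u x - u' x) ^ p / 2 ^ (p - 1)) = (\<integral>x. c0 / 2 ^ (p - 1) * norm (u x - u' x) ^ p \<partial>M)"
    unfolding normLp_power[OF p0] by simp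
  also have "\<dots> \<le> (\<integral>x. Wt x * (jp p (u x) \<bullet> (u x - u' x)) - Wt x * (jp p (u' x) \<bullet> (u x - u' x)) \<partial>M)"
  proof (rule integral_mono)
    show "integrable M (\<lambda>x. c0 / 2 ^ (p - 1) * norm (u x - u' x) ^ p)" using memLp_int[OF d] by simp
    show "integrable M (\<lambda>x. Wt x * (jp p (u x) \<bullet> (u x - u' x)) - Wt x * (jp p (u' x) \<bullet> (u x - u' x)))"
      by (intro Bochner_Integration.integrable_diff Aw_integrable u u' d)
    fix x assume x: "x \<in> space M"
    have "c0 / 2 ^ (p - 1) * norm (u x - u' x) ^ p = c0 * (norm (u x - u' x) ^ p / 2 ^ (p - 1))" by simp
    also have "\<dots> \<le> Wt x * ((jp p (u x) - jp p (u' x)) \<bullet> (u x - u' x))"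
      using Wt_bound[OF x] Wt_nonneg[OF x] by (intro mult_mono jp_strongly_monotone p2) auto
    finally show "c0 / 2 ^ (p - 1) * norm (u x - u' x) ^ p \<le> Wt x * (jp p (u x) \<bullet> (u x - u' x)) - Wt x * (jp p (u' x) \<bullet> (u x - u' x))"
      by (simp add: inner_diff_left right_diff_distrib)
  qed
  also have "\<dots> = Aw M Wt p u (\<lambda>x. u x - u' x) - Aw M Wt p u' (\<lambda>x. u x - u' x)"
    unfolding Aw_def by (intro Bochner_Integration.integral_diff Aw_integrable u u' d)
  finally show ?thesis .
qed

lemma Aw_tangent:
  assumes u: "memLp M p u" and v: "memLp M p v"
  shows "Aw M Wt p u u + real p * Aw M Wt p u (\<lambda>x. v x - u x) \<le> Aw M Wt p v v"
proof -
  have d: "memLp M p (\<lambda>x. v x - u x)" by (intro memLp_diff u v)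
  have "Aw M Wt p u u + real p * Aw M Wt p u (\<lambda>x. v x - u x)
      = (\<integral>x. Wt x * (jp p (u x) \<bullet> u x) + real p * (Wt x * (jp p (u x) \<bullet> (v x - u x))) \<partial>M)"
    unfolding Aw_def using Aw_integrable[OF u u] Aw_integrable[OF u d] by simp
  also have "\<dots> \<le> Aw M Wt p v v" unfolding Aw_def[of _ _ _ v]
  proof (rule integral_mono)
    show "integrable M (\<lambda>x. Wt x * (jp p (u x) \<bullet> u x) + real p * (Wt x * (jp p (u x) \<bullet> (v x - u x))))"
      using Aw_integrable[OF u u] Aw_integrable[OF u d] by simp
    show "integrable M (\<lambda>x. Wt x * (jp p (v x) \<bullet> v x))" by (rule Aw_integrable[OF v v])
    fix x assume x: "x \<in> space M"
    have "Wt x * (norm (u x) ^ p + real p * (jp p (u x) \<bullet> (v x - u x))) \<le> Wt x * norm (v x) ^ p"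
      using Wt_nonneg[OF x] by (intro mult_left_mono jp_tangent p2)
    then show "Wt x * (jp p (u x) \<bullet> u x) + real p * (Wt x * (jp p (u x) \<bullet> (v x - u x))) \<le> Wt x * (jp p (v x) \<bullet> v x)"
      by (simp add: jp_inner_self[OF p2] algebra_simps)
  qed
  finally show ?thesis .
qed

end

lemma succ_mult_divide: "0 \<le> x \<Longrightarrow> (x + 1) * (y / (x + 1)) = (y :: real)"
  by simp

lemma power_lipschitz:
  fixes x y :: real assumes "0 < a" "a \<le> x" "a \<le> y" "x \<le> B" "y \<le> B"
  shows "\<bar>x ^ n - y ^ n\<bar> \<le> real n * (2 * B) ^ n / a * \<bar>x - y\<bar>"
proof -
  have "\<bar>x ^ n - y ^ n\<bar> * a \<le> \<bar>x ^ n - y ^ n\<bar> * y" using assms by (intro mult_left_mono) auto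
  also have "\<dots> \<le> real n * (x + y) ^ n * \<bar>x - y\<bar>" using assms by (intro abs_power_diff_le) auto
  also have "\<dots> \<le> real n * (2 * B) ^ n * \<bar>x - y\<bar>" using assms by (intro mult_right_mono mult_left_mono power_mono) auto
  finally show ?thesis using assms(1) by (simp add: pos_le_divide_eq)
qed

section \<open>The energy and its derivative on smooth functions\<close>

locale kirchhoff = frac T \<alpha> p + caratheodory T H f
  for T \<alpha> :: real and p :: nat and H :: "real \<Rightarrow> 'a::euclidean_space \<Rightarrow> real" and f +
  fixes a b lam :: real and V :: "real \<Rightarrow> real" and Vs :: real
  assumes ab: "0 < a" "0 < b" and lam: "0 \<le> lam" and V_cont: "continuous_on {0..T} V"
    and V_bound: "\<And>t. t \<in> {0..T} \<Longrightarrow> 0 \<le> V t \<and> V t \<le> Vs"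
begin

sublocale W1: weight M "\<lambda>_. 1" p 1 1
  by standard (use p in auto)

sublocale WV: weight M V p 0 Vs
  by standard (use p V_bound continuous_imp_measurable_on_sets_lebesgue[OF V_cont] in auto)

lemma Vs: "0 \<le> Vs" using V_bound[of 0] T by force

text \<open>Function and derivative are separate arguments, so that the form also makes sense for a
  limit pair whose second component is not given by \<open>D\<close>.\<close>

definition A2 :: "(real \<Rightarrow> 'a) \<Rightarrow> (real \<Rightarrow> 'a) \<Rightarrow> (real \<Rightarrow> 'a) \<Rightarrow> (real \<Rightarrow> 'a) \<Rightarrow> real" where
  "A2 u w v wv = Aw M (\<lambda>_. 1) p w wv + Aw M V p u v"

definition A :: "(real \<Rightarrow> 'a) \<Rightarrow> (real \<Rightarrow> 'a) \<Rightarrow> real" where "A u v = A2 u (D u) v (D v)"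

definition X :: "(real \<Rightarrow> 'a) \<Rightarrow> real" where "X u = A u u"

definition Bd :: "(real \<Rightarrow> 'a) \<Rightarrow> (real \<Rightarrow> 'a) \<Rightarrow> real" where "Bd u v = (\<integral>t. f t (u t) \<bullet> v t \<partial>M)"

definition Bf :: "(real \<Rightarrow> 'a) \<Rightarrow> real" where "Bf u = (\<integral>t. H t (u t) \<partial>M)"

text \<open>Normalised by \<Psi> 0 = 0. Its derivative is (a + b x)^(p-1) / p, and the 1/p cancels
  the factor p from differentiating X; this yields the coefficient in \<open>J'\<close>.\<close>

definition \<Psi> :: "real \<Rightarrow> real" where "\<Psi> x = ((a + b * x) ^ p - a ^ p) / (b * (real p)\<^sup>2)"

definition J :: "(real \<Rightarrow> 'a) \<Rightarrow> real" where "J u = \<Psi> (X u) - lam * Bf u"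

definition J' :: "(real \<Rightarrow> 'a) \<Rightarrow> (real \<Rightarrow> 'a) \<Rightarrow> real" where
  "J' u v = (a + b * X u) ^ (p - 1) * A u v - lam * Bd u v"

abbreviation "SS \<equiv> (S :: (real \<Rightarrow> 'a) set)"

abbreviation "K \<equiv> Kc T p \<alpha>"

lemma S_memLp: "u \<in> SS \<Longrightarrow> memLp M p u" by (intro continuous_memLp S_continuous)

lemmas S_add = subspace_add[OF S_subspace] and S_scale = subspace_scale[OF S_subspace]
  and S_diff = subspace_diff[OF S_subspace] and S_zero = subspace_0[OF S_subspace]

definition K2 :: real where "K2 = root p T * K"

lemma K2: "0 \<le> K2" using Kc_pos T by (simp add: K2_def real_root_ge_zero)

lemma normLp_le: "u \<in> SS \<Longrightarrow> normLp M p u \<le> K2 * N u"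
  using normLp_sup[OF S_memLp sup_bound] by (simp add: K2_def mult.assoc)

lemma Aw_cong: "(\<And>t. t \<in> {0..T} \<Longrightarrow> w t = w' t) \<Longrightarrow> (\<And>t. t \<in> {0..T} \<Longrightarrow> v t = v' t) \<Longrightarrow> Aw M Wt p w v = Aw M Wt p w' v'"
  unfolding Aw_def by (intro Bochner_Integration.integral_cong) auto

lemma A_add: "u \<in> SS \<Longrightarrow> v \<in> SS \<Longrightarrow> v' \<in> SS \<Longrightarrow> A u (v + v') = A u v + A u v'"
  using W1.Aw_add[of "D u" "D v" "D v'"] WV.Aw_add[of u v v'] Aw_cong[OF refl D_add[of v v'], where w="D u"]
  by (simp add: A_def A2_def D_memLp S_memLp plus_fun_def)

lemma A_scale: "u \<in> SS \<Longrightarrow> v \<in> SS \<Longrightarrow> A u (r *\<^sub>R v) = r * A u v"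
  using W1.Aw_scale[of "D u" r "D v"] WV.Aw_scale[of u r v] Aw_cong[OF refl D_scale[of v _ r], where w="D u"]
  by (simp add: A_def A2_def scaleR_fun_def distrib_left)

lemma A_eq_diff: "u \<in> SS \<Longrightarrow> v \<in> SS \<Longrightarrow> v' \<in> SS \<Longrightarrow> A u (v - v') = Aw M (\<lambda>_. 1) p (D u) (\<lambda>t. D v t - D v' t) + Aw M V p u (\<lambda>t. v t - v' t)"
  using Aw_cong[OF refl D_diff[of v v'], where w="D u"] by (simp add: A_def A2_def fun_diff_def)

text \<open>A Lipschitz constant of A on the ball of radius R. The first summand comes from the
  derivative part, the second from the V part, where \<open>K2\<close> converts \<open>L^p\<close>
  norms into \<open>N\<close>.\<close>

definition L0 :: "real \<Rightarrow> real" where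
  "L0 R = 3 * real (p - 1) * (2 * R) ^ (p - 2) + 3 * Vs * real (p - 1) * (2 * K2 * R) ^ (p - 2) * K2 * K2"

lemma L0: "0 \<le> R \<Longrightarrow> 0 \<le> L0 R" using Vs K2 by (simp add: L0_def)

lemma A_lipschitz:
  assumes u: "u \<in> SS" and u': "u' \<in> SS" and v: "v \<in> SS" and R: "N u \<le> R" "N u' \<le> R"
  shows "\<bar>A u v - A u' v\<bar> \<le> L0 R * N (u - u') * N v"
proof -
  have R0: "0 \<le> R" using R N_nonneg order_trans by blast
  have d: "u - u' \<in> SS" using S_diff u u' by blast
  have "\<bar>A u v - A u' v\<bar> \<le> \<bar>Aw M (\<lambda>_. 1) p (D u) (D v) - Aw M (\<lambda>_. 1) p (D u') (D v)\<bar> + \<bar>Aw M V p u v - Aw M V p u' v\<bar>"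
    by (simp add: A_def A2_def)
  also have "\<dots> \<le> 3 * 1 * real (p - 1) * (N u + N u') ^ (p - 2) * N (u - u') * N v
      + 3 * Vs * real (p - 1) * (normLp M p u + normLp M p u') ^ (p - 2) * normLp M p (\<lambda>x. u x - u' x) * normLp M p v"
    unfolding N_diff[OF u u'] unfolding N_def
    by (intro add_mono W1.Aw_diff_le WV.Aw_diff_le D_memLp S_memLp u u' v)
  also have "\<dots> \<le> 3 * real (p - 1) * (2 * R) ^ (p - 2) * N (u - u') * N v
      + 3 * Vs * real (p - 1) * (2 * K2 * R) ^ (p - 2) * (K2 * N (u - u')) * (K2 * N v)"
  proof (intro add_mono)
    show "3 * 1 * real (p - 1) * (N u + N u') ^ (p - 2) * N (u - u') * N v \<le> 3 * real (p - 1) * (2 * R) ^ (p - 2) * N (u - u') * N v"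
      unfolding mult_1_right using R by (intro mult_right_mono mult_left_mono power_mono) (auto simp: N_nonneg)
    have "K2 * N u \<le> K2 * R" "K2 * N u' \<le> K2 * R" using K2 R by (auto intro: mult_left_mono)
    then have 1: "normLp M p u + normLp M p u' \<le> 2 * K2 * R" using normLp_le[OF u] normLp_le[OF u'] by linarith
    have 2: "normLp M p (\<lambda>x. u x - u' x) \<le> K2 * N (u - u')" using normLp_le[OF d] by (simp add: fun_diff_def)
    show "3 * Vs * real (p - 1) * (normLp M p u + normLp M p u') ^ (p - 2) * normLp M p (\<lambda>x. u x - u' x) * normLp M p v
        \<le> 3 * Vs * real (p - 1) * (2 * K2 * R) ^ (p - 2) * (K2 * N (u - u')) * (K2 * N v)"
      using Vs K2 R0 by (intro mult_mono power_mono 1 2 normLp_le[OF v] order_refl) (auto simp: normLp_nonneg N_nonneg)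
  qed
  also have "\<dots> = L0 R * N (u - u') * N v" by (simp add: L0_def algebra_simps)
  finally show ?thesis .
qed

lemma N_zero: "N (0 :: real \<Rightarrow> 'a) = 0" using N_scale[OF S_zero, of 0] by simp

lemma A_zero: "v \<in> SS \<Longrightarrow> A 0 v = 0"
proof -
  have "D (0 :: real \<Rightarrow> 'a) t = 0" if "t \<in> {0..T}" for t using D_scale[OF S_zero that, of 0] by simp
  then have "Aw M (\<lambda>_. 1) p (D (0 :: real \<Rightarrow> 'a)) (D v) = Aw M (\<lambda>_. 1) p (\<lambda>_. 0) (D v)" by (intro Aw_cong) auto
  then show ?thesis by (simp add: A_def A2_def Aw_def jp_def)
qed

lemma A_bound:
  assumes u: "u \<in> SS" and v: "v \<in> SS" and R: "N u \<le> R"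
  shows "\<bar>A u v\<bar> \<le> L0 R * R * N v"
proof -
  have R0: "0 \<le> R" using R N_nonneg order_trans by blast
  have "\<bar>A u v\<bar> \<le> L0 R * N u * N v"
    using A_lipschitz[OF u S_zero v R] N_zero A_zero[OF v] R0 by simp
  also have "\<dots> \<le> L0 R * R * N v" using R L0[OF R0] by (intro mult_right_mono mult_left_mono N_nonneg)
  finally show ?thesis .
qed

text \<open>Convexity of X, used in place of differentiability: applied in both directions it gives
  the Lipschitz bound, and once more the upper estimate for an increment of the energy.\<close>

lemma X_tangent:
  assumes u: "u \<in> SS" and v: "v \<in> SS" shows "X u + real p * A u (v - u) \<le> X v"
  using W1.Aw_tangent[OF D_memLp[OF u] D_memLp[OF v]] WV.Aw_tangent[OF S_memLp[OF u] S_memLp[OF v]]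
  unfolding A_eq_diff[OF u v u] by (simp add: X_def A_def A2_def distrib_left)

lemma A_monotone:
  assumes u: "u \<in> SS" and v: "v \<in> SS" shows "N (u - v) ^ p / 2 ^ (p - 1) \<le> A u (u - v) - A v (u - v)"
  using W1.Aw_monotone[OF D_memLp[OF u] D_memLp[OF v]] WV.Aw_monotone[OF S_memLp[OF u] S_memLp[OF v]]
  unfolding A_eq_diff[OF u u v] A_eq_diff[OF v u v] N_diff[OF u v] by simp

lemma X_eq: "X u = (\<integral>t. norm (D u t) ^ p \<partial>M) + (\<integral>t. V t * norm (u t) ^ p \<partial>M)"
  by (simp add: X_def A_def A2_def W1.Aw_self WV.Aw_self)

lemma X_ge: "N u ^ p \<le> X u"
proof -
  have "0 \<le> (\<integral>t. V t * norm (u t) ^ p \<partial>M)" using V_bound by (intro integral_nonneg_AE AE_I2) auto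
  moreover have "N u ^ p = (\<integral>t. norm (D u t) ^ p \<partial>M)" unfolding N_def using p by (intro normLp_power) auto
  ultimately show ?thesis unfolding X_eq by simp
qed

lemma X_nonneg: "0 \<le> X u" using X_ge[of u] zero_le_power[OF N_nonneg, of u p] by linarith

lemma X_bound: "u \<in> SS \<Longrightarrow> N u \<le> R \<Longrightarrow> X u \<le> L0 R * R * R"
  using A_bound[of u u R] L0[of R] N_nonneg[of u] mult_left_mono[of "N u" R "L0 R * R"] unfolding X_def by force

lemma X_lipschitz:
  assumes u: "u \<in> SS" and v: "v \<in> SS" and R: "N u \<le> R" "N v \<le> R"
  shows "\<bar>X u - X v\<bar> \<le> real p * (L0 R * R) * N (u - v)"
proof -
  have d: "u - v \<in> SS" "v - u \<in> SS" using S_diff u v by auto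
  have "N (v - u) = N (u - v)" using N_scale[OF d(1), of "-1"] by simp
  then have "real p * \<bar>A u (v - u)\<bar> \<le> real p * (L0 R * R * N (u - v))" "real p * \<bar>A v (u - v)\<bar> \<le> real p * (L0 R * R * N (u - v))"
    using A_bound[OF u d(2) R(1)] A_bound[OF v d(1) R(2)] by (auto intro: mult_left_mono)
  moreover have "- (real p * \<bar>A u (v - u)\<bar>) \<le> real p * A u (v - u)" "- (real p * \<bar>A v (u - v)\<bar>) \<le> real p * A v (u - v)"
    by (auto simp: abs_if mult_less_0_iff)
  ultimately show ?thesis using X_tangent[OF u v] X_tangent[OF v u] by (simp add: abs_le_iff mult.assoc)
qed

lemma coeff_pos: "0 < a + b * X u" "a \<le> a + b * X u"
  using ab X_nonneg[of u] by (auto simp: add_pos_nonneg)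

definition CB :: "real \<Rightarrow> real" where "CB R = a + b * (L0 R * R * R)"

lemma coeff_bound: "u \<in> SS \<Longrightarrow> N u \<le> R \<Longrightarrow> a + b * X u \<le> CB R"
  using X_bound[of u R] ab by (simp add: CB_def)

definition L1 :: "nat \<Rightarrow> real \<Rightarrow> real" where "L1 n R = real n * (2 * CB R) ^ n / a * (b * (real p * (L0 R * R)))"

lemma CB_nonneg: "0 \<le> R \<Longrightarrow> 0 \<le> CB R" using L0[of R] ab by (simp add: CB_def)

lemma L1: "0 \<le> R \<Longrightarrow> 0 \<le> L1 n R"
  using L0[of R] ab CB_nonneg[of R] by (simp add: L1_def)

lemma coeff_lipschitz:
  assumes u: "u \<in> SS" and v: "v \<in> SS" and R: "N u \<le> R" "N v \<le> R"
  shows "\<bar>(a + b * X u) ^ n - (a + b * X v) ^ n\<bar> \<le> L1 n R * N (u - v)"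
proof -
  have R0: "0 \<le> R" using R N_nonneg order_trans by blast
  have "\<bar>(a + b * X u) ^ n - (a + b * X v) ^ n\<bar> \<le> real n * (2 * CB R) ^ n / a * \<bar>(a + b * X u) - (a + b * X v)\<bar>"
    using ab coeff_pos coeff_bound u v R by (intro power_lipschitz) auto
  also have "\<bar>(a + b * X u) - (a + b * X v)\<bar> = b * \<bar>X u - X v\<bar>" using ab by (simp add: abs_mult flip: right_diff_distrib)
  also have "real n * (2 * CB R) ^ n / a * (b * \<bar>X u - X v\<bar>) \<le> real n * (2 * CB R) ^ n / a * (b * (real p * (L0 R * R) * N (u - v)))"
    using ab CB_nonneg[OF R0] by (intro mult_left_mono X_lipschitz u v R) auto
  finally show ?thesis by (simp add: L1_def mult_ac)
qed

definition L2 :: "real \<Rightarrow> real" where "L2 R = L1 (p - 1) R * (L0 R * R) + CB R ^ (p - 1) * L0 R"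

lemma L2: "0 \<le> R \<Longrightarrow> 0 \<le> L2 R" using L0[of R] L1[of R] CB_nonneg[of R] by (simp add: L2_def)

lemma coeffA_lipschitz:
  assumes u: "u \<in> SS" and u': "u' \<in> SS" and v: "v \<in> SS" and R: "N u \<le> R" "N u' \<le> R"
  shows "\<bar>(a + b * X u) ^ (p - 1) * A u v - (a + b * X u') ^ (p - 1) * A u' v\<bar> \<le> L2 R * N (u - u') * N v"
proof -
  have R0: "0 \<le> R" using R N_nonneg order_trans by blast
  define c c' where "c = (a + b * X u) ^ (p - 1)" and "c' = (a + b * X u') ^ (p - 1)"
  have c': "0 \<le> c'" "c' \<le> CB R ^ (p - 1)" unfolding c'_def
    using coeff_pos(1)[of u'] coeff_bound[OF u' R(2)] by (auto intro!: power_mono)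
  have "c * A u v - c' * A u' v = (c - c') * A u v + c' * (A u v - A u' v)" by (simp add: algebra_simps)
  then have "\<bar>c * A u v - c' * A u' v\<bar> \<le> \<bar>c - c'\<bar> * \<bar>A u v\<bar> + c' * \<bar>A u v - A u' v\<bar>"
    using c' abs_triangle_ineq[of "(c - c') * A u v" "c' * (A u v - A u' v)"] by (simp add: abs_mult)
  also have "\<dots> \<le> (L1 (p - 1) R * N (u - u')) * (L0 R * R * N v) + CB R ^ (p - 1) * (L0 R * N (u - u') * N v)"
    using c' R0 L0[OF R0] CB_nonneg[OF R0]
    by (intro add_mono mult_mono A_bound A_lipschitz coeff_lipschitz[of u u' R "p - 1", folded c_def c'_def] u u' v R) (auto intro!: mult_nonneg_nonneg L1 N_nonneg)
  also have "\<dots> = L2 R * N (u - u') * N v" by (simp add: L2_def algebra_simps)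
  finally show ?thesis by (simp add: c_def c'_def)
qed

text \<open>The tangent is taken at the end point y, where convexity bounds the increment from
  above. In the energy, the coefficient at the new point is then moved back to the old one by
  \<open>coeffA_lipschitz\<close>.\<close>

lemma \<Psi>_tangent:
  assumes "0 \<le> x" "0 \<le> y" shows "\<Psi> y - \<Psi> x \<le> (a + b * y) ^ (p - 1) / real p * (y - x)"
proof -
  have "(a + b * y) ^ p + real p * (a + b * y) ^ (p - 1) * ((a + b * x) - (a + b * y)) \<le> (a + b * x) ^ p"
    using assms ab p by (intro power_tangent) auto
  then have "(a + b * y) ^ p - (a + b * x) ^ p \<le> real p * b * ((a + b * y) ^ (p - 1) * (y - x))" by (simp add: algebra_simps)
  then have "((a + b * y) ^ p - (a + b * x) ^ p) / (b * (real p)\<^sup>2) \<le> real p * b * ((a + b * y) ^ (p - 1) * (y - x)) / (b * (real p)\<^sup>2)"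
    using ab by (intro divide_right_mono) auto
  then show ?thesis using ab p by (simp add: \<Psi>_def diff_divide_distrib power2_eq_square)
qed

lemma Bd_add: "u \<in> SS \<Longrightarrow> v \<in> SS \<Longrightarrow> v' \<in> SS \<Longrightarrow> Bd u (v + v') = Bd u v + Bd u v'"
  unfolding Bd_def plus_fun_def inner_add_right
  by (intro Bochner_Integration.integral_add f_comp_inner_integrable S_continuous)

lemma Bd_scale: "Bd u (r *\<^sub>R v) = r * Bd u v"
  unfolding Bd_def by simp

text \<open>Both statements rest on the same integrable modulus \<open>\<omega>\<close>: the first
  directly, the second through the mean value theorem. The radius R + 1 leaves room for u +
  v.\<close>

lemma Bd_modulus:
  assumes \<epsilon>: "0 < \<epsilon>"
  obtains \<eta> where "0 < \<eta>"
    "\<And>u u' v. u \<in> SS \<Longrightarrow> u' \<in> SS \<Longrightarrow> v \<in> SS \<Longrightarrow> N u \<le> R \<Longrightarrow> N u' \<le> R \<Longrightarrow> N (u - u') \<le> \<eta> \<Longrightarrow> \<bar>Bd u v - Bd u' v\<bar> \<le> \<epsilon> * N v"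
    "\<And>u v. u \<in> SS \<Longrightarrow> v \<in> SS \<Longrightarrow> N u \<le> R \<Longrightarrow> N v \<le> \<eta> \<Longrightarrow> \<bar>Bf (u + v) - Bf u - Bd u v\<bar> \<le> \<epsilon> * N v"
proof -
  have K0: "0 < K" by (rule Kc_pos)
  obtain \<eta>0 \<omega> where o: "0 < \<eta>0" "integrable M \<omega>" "integral\<^sup>L M \<omega> \<le> \<epsilon> / K"
    "\<And>t x y. t \<in> {0..T} \<Longrightarrow> norm x \<le> K * (R + 1) \<Longrightarrow> norm y \<le> K * (R + 1) \<Longrightarrow> norm (x - y) \<le> \<eta>0 \<Longrightarrow> norm (f t x - f t y) \<le> \<omega> t"
    using modulus[of "\<epsilon> / K" "K * (R + 1)"] \<epsilon> K0 by (metis divide_pos_pos)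
  define \<eta> where "\<eta> = min 1 (\<eta>0 / K)"
  have \<eta>: "0 < \<eta>" "\<eta> \<le> 1" "K * \<eta> \<le> \<eta>0" using o(1) K0 by (auto simp: \<eta>_def min_def field_simps)
  have \<omega>v: "(\<integral>t. \<omega> t * (K * N v) \<partial>M) \<le> \<epsilon> * N v" for v :: "real \<Rightarrow> 'a"
  proof -
    have "(\<integral>t. \<omega> t * (K * N v) \<partial>M) = integral\<^sup>L M \<omega> * (K * N v)" by simp
    also have "\<dots> \<le> \<epsilon> / K * (K * N v)" using o(3) K0 N_nonneg[of v] by (intro mult_right_mono) auto
    also have "\<dots> = \<epsilon> * N v" using K0 by simp
    finally show ?thesis .
  qed
  have i\<omega>: "integrable M (\<lambda>t. \<omega> t * (K * N v))" for v :: "real \<Rightarrow> 'a" using o(2) by simp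
  show ?thesis
  proof (rule that[OF \<eta>(1)])
    fix u u' v assume u: "u \<in> SS" "u' \<in> SS" and v: "v \<in> SS" and R: "N u \<le> R" "N u' \<le> R" and d: "N (u - u') \<le> \<eta>"
    have "Bd u v - Bd u' v = (\<integral>t. f t (u t) \<bullet> v t - f t (u' t) \<bullet> v t \<partial>M)"
      unfolding Bd_def by (intro Bochner_Integration.integral_diff[symmetric] f_comp_inner_integrable S_continuous u v)
    also have "\<bar>\<dots>\<bar> \<le> (\<integral>t. \<omega> t * (K * N v) \<partial>M)"
      unfolding real_norm_def[symmetric]
    proof (rule order.trans[OF integral_norm_bound integral_mono])
      show "integrable M (\<lambda>t. norm (f t (u t) \<bullet> v t - f t (u' t) \<bullet> v t))"
        by (intro integrable_norm Bochner_Integration.integrable_diff f_comp_inner_integrable S_continuous u v)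
      fix t assume "t \<in> space M"
      then have t: "t \<in> {0..T}" by simp
      have "norm ((u - u') t) \<le> K * \<eta>" by (rule sup_bound_le[OF S_diff[OF u] d t])
      then have "norm (f t (u t) - f t (u' t)) \<le> \<omega> t"
        using sup_bound_le[OF u(1) _ t, of "R + 1"] sup_bound_le[OF u(2) _ t, of "R + 1"] R \<eta>(3) by (intro o(4) t) auto
      moreover have "norm (v t) \<le> K * N v" using sup_bound[OF v t] .
      ultimately have "norm (f t (u t) - f t (u' t)) * norm (v t) \<le> \<omega> t * (K * N v)"
        by (intro mult_mono) (auto intro: order_trans[OF norm_ge_zero])
      then show "norm (f t (u t) \<bullet> v t - f t (u' t) \<bullet> v t) \<le> \<omega> t * (K * N v)"
        using Cauchy_Schwarz_ineq2[of "f t (u t) - f t (u' t)" "v t"] by (simp add: inner_diff_left)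
    qed (rule i\<omega>)
    also note \<omega>v
    finally show "\<bar>Bd u v - Bd u' v\<bar> \<le> \<epsilon> * N v" .
  next
    fix u v assume u: "u \<in> SS" and v: "v \<in> SS" and R: "N u \<le> R" and d: "N v \<le> \<eta>"
    have uv: "u + v \<in> SS" using S_add u v by blast
    have "N (u + v) \<le> R + 1" using N_tri[OF u v] R d \<eta>(2) by linarith
    have i: "integrable M (\<lambda>t. H t ((u + v) t) - H t (u t) - f t (u t) \<bullet> v t)"
      by (intro Bochner_Integration.integrable_diff H_comp_integrable f_comp_inner_integrable S_continuous u v uv)
    have "Bf (u + v) - Bf u - Bd u v = (\<integral>t. H t ((u + v) t) - H t (u t) - f t (u t) \<bullet> v t \<partial>M)"
      unfolding Bd_def Bf_def
      by (simp only: Bochner_Integration.integral_diff Bochner_Integration.integrable_diff H_comp_integrable f_comp_inner_integrable S_continuous u v uv)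
    also have "\<bar>\<dots>\<bar> \<le> (\<integral>t. \<omega> t * (K * N v) \<partial>M)"
      unfolding real_norm_def[symmetric]
    proof (rule order.trans[OF integral_norm_bound integral_mono])
      show "integrable M (\<lambda>t. norm (H t ((u + v) t) - H t (u t) - f t (u t) \<bullet> v t))" by (rule integrable_norm[OF i])
      fix t assume "t \<in> space M"
      then have t: "t \<in> {0..T}" by simp
      obtain z where z: "0 < z" "z < 1" "H t (u t + v t) - H t (u t) = f t (u t + z *\<^sub>R v t) \<bullet> v t"
        using H_mvt[OF t] by blast
      have nv: "norm (v t) \<le> K * \<eta>" by (rule sup_bound_le[OF v d t])
      have "norm (z *\<^sub>R v t) \<le> 1 * norm (v t)" using z by (simp add: mult_left_le_one_le)
      then have "norm (f t (u t + z *\<^sub>R v t) - f t (u t)) \<le> \<omega> t"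
        using sup_bound_le[OF u _ t, of "R + 1"] sup_bound_le[OF uv \<open>N (u + v) \<le> R + 1\<close> t] R \<eta>(3) z nv
        by (intro o(4) t norm_segment_le) auto
      moreover have "norm (v t) \<le> K * N v" using sup_bound[OF v t] .
      ultimately have "norm (f t (u t + z *\<^sub>R v t) - f t (u t)) * norm (v t) \<le> \<omega> t * (K * N v)"
        by (intro mult_mono) (auto intro: order_trans[OF norm_ge_zero])
      then show "norm (H t ((u + v) t) - H t (u t) - f t (u t) \<bullet> v t) \<le> \<omega> t * (K * N v)"
        using Cauchy_Schwarz_ineq2[of "f t (u t + z *\<^sub>R v t) - f t (u t)" "v t"] z(3) by (simp add: inner_diff_left)
    qed (rule i\<omega>)
    also note \<omega>v
    finally show "\<bar>Bf (u + v) - Bf u - Bd u v\<bar> \<le> \<epsilon> * N v" .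
  qed
qed

lemma Bf_lipschitz:
  obtains k where "0 \<le> k" "\<And>u u'. u \<in> SS \<Longrightarrow> u' \<in> SS \<Longrightarrow> N u \<le> R \<Longrightarrow> N u' \<le> R \<Longrightarrow> \<bar>Bf u - Bf u'\<bar> \<le> k * N (u - u')"
proof -
  have K0: "0 < K" by (rule Kc_pos)
  obtain k where k: "integrable M k" "\<And>t x. t \<in> {0..T} \<Longrightarrow> norm x \<le> K * R \<Longrightarrow> norm (f t x) \<le> k t"
    using f_bound[of "K * R"] by blast
  have le: "\<bar>Bf u - Bf u'\<bar> \<le> \<bar>integral\<^sup>L M k * K\<bar> * N (u - u')"
    if u: "u \<in> SS" "u' \<in> SS" and R: "N u \<le> R" "N u' \<le> R" for u u'
  proof -
    have "Bf u - Bf u' = (\<integral>t. H t (u t) - H t (u' t) \<partial>M)"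
      unfolding Bf_def by (intro Bochner_Integration.integral_diff[symmetric] H_comp_integrable S_continuous u)
    also have "\<bar>\<dots>\<bar> \<le> (\<integral>t. k t * (K * N (u - u')) \<partial>M)"
      unfolding real_norm_def[symmetric]
    proof (rule order.trans[OF integral_norm_bound integral_mono])
      show "integrable M (\<lambda>t. norm (H t (u t) - H t (u' t)))"
        by (intro integrable_norm Bochner_Integration.integrable_diff H_comp_integrable S_continuous u)
      show "integrable M (\<lambda>t. k t * (K * N (u - u')))" using k(1) by simp
      fix t assume "t \<in> space M"
      then have t: "t \<in> {0..T}" by simp
      have "\<bar>H t (u t) - H t (u' t)\<bar> \<le> k t * norm (u t - u' t)"
        by (rule H_lipschitz[OF k(2)[OF t] t]) (use sup_bound_le u R t in auto)
      also have "\<dots> \<le> k t * (K * N (u - u'))"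
        using sup_bound[OF S_diff[OF u] t] order_trans[OF norm_ge_zero k(2)[OF t sup_bound_le[OF u(1) R(1) t]]]
        by (intro mult_left_mono) auto
      finally show "norm (H t (u t) - H t (u' t)) \<le> k t * (K * N (u - u'))" by simp
    qed
    also have "\<dots> = integral\<^sup>L M k * K * N (u - u')" by simp
    also have "\<dots> \<le> \<bar>integral\<^sup>L M k * K\<bar> * N (u - u')" by (intro mult_right_mono N_nonneg) simp
    finally show ?thesis .
  qed
  show ?thesis by (rule that[OF abs_ge_zero le])
qed

text \<open>Dividing by lam + 1 instead of lam covers lam = 0 by the same argument.\<close>

lemma lam_share:
  assumes "0 < \<epsilon>" "0 \<le> x" shows "lam * (\<epsilon> / (2 * (lam + 1)) * x) \<le> \<epsilon> / 2 * x"
proof -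
  have "lam * (\<epsilon> / (2 * (lam + 1)) * x) = (lam / (lam + 1)) * (\<epsilon> / 2 * x)" by simp
  also have "\<dots> \<le> 1 * (\<epsilon> / 2 * x)" using lam assms by (intro mult_right_mono) auto
  finally show ?thesis by simp
qed

sublocale J: smooth_functional SS N J J'
proof
  show "subspace SS" by (rule S_subspace)
  show "N (x + y) \<le> N x + N y" if "x \<in> SS" "y \<in> SS" for x y using that by (rule N_tri)
  show "N (c *\<^sub>R x) = \<bar>c\<bar> * N x" if "x \<in> SS" for x c using that by (rule N_scale)
  show "J' u (x + y) = J' u x + J' u y" if "u \<in> SS" "x \<in> SS" "y \<in> SS" for u x y
    using A_add[OF that] Bd_add[OF that] by (simp add: J'_def algebra_simps)
  show "J' u (c *\<^sub>R x) = c * J' u x" if "u \<in> SS" "x \<in> SS" for u x c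
    using A_scale[OF that] Bd_scale[of u c x] by (simp add: J'_def algebra_simps)
next
  fix R \<epsilon> :: real assume \<epsilon>: "0 < \<epsilon>"
  define R0 where "R0 = max R 0"
  have R0: "0 \<le> R0" "\<And>x. x \<le> R \<Longrightarrow> x \<le> R0" by (auto simp: R0_def)
  obtain k where k: "0 \<le> k" "\<And>u u'. u \<in> SS \<Longrightarrow> u' \<in> SS \<Longrightarrow> N u \<le> R \<Longrightarrow> N u' \<le> R \<Longrightarrow> \<bar>Bf u - Bf u'\<bar> \<le> k * N (u - u')"
    using Bf_lipschitz by blast
  define L where "L = L1 p R0 / (b * (real p)\<^sup>2) + lam * k"
  have L: "0 \<le> L" unfolding L_def using L1[OF R0(1)] ab lam k(1) by simp
  have le: "\<bar>J u - J u'\<bar> \<le> L * N (u - u')" if u: "u \<in> SS" "u' \<in> SS" and R: "N u \<le> R" "N u' \<le> R" for u u'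
  proof -
    have "J u - J u' = ((a + b * X u) ^ p - (a + b * X u') ^ p) / (b * (real p)\<^sup>2) - lam * (Bf u - Bf u')"
      by (simp add: J_def \<Psi>_def diff_divide_distrib right_diff_distrib)
    then have "\<bar>J u - J u'\<bar> \<le> \<bar>(a + b * X u) ^ p - (a + b * X u') ^ p\<bar> / (b * (real p)\<^sup>2) + lam * \<bar>Bf u - Bf u'\<bar>"
      using abs_triangle_ineq4[of "((a + b * X u) ^ p - (a + b * X u') ^ p) / (b * (real p)\<^sup>2)" "lam * (Bf u - Bf u')"] ab lam
      by (simp add: abs_mult abs_divide)
    also have "\<dots> \<le> (L1 p R0 * N (u - u')) / (b * (real p)\<^sup>2) + lam * (k * N (u - u'))"
      using ab lam R0(2)[OF R(1)] R0(2)[OF R(2)]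
      by (intro add_mono divide_right_mono mult_left_mono coeff_lipschitz k u R) auto
    finally show ?thesis by (simp add: L_def algebra_simps)
  qed
  show "\<exists>\<eta>>0. \<forall>u\<in>SS. \<forall>u'\<in>SS. N u \<le> R \<longrightarrow> N u' \<le> R \<longrightarrow> N (u - u') \<le> \<eta> \<longrightarrow> \<bar>J u - J u'\<bar> \<le> \<epsilon>"
  proof (intro exI[of _ "\<epsilon> / (L + 1)"] conjI ballI impI)
    show "0 < \<epsilon> / (L + 1)" using \<epsilon> L by simp
    fix u u' assume u: "u \<in> SS" "u' \<in> SS" and R: "N u \<le> R" "N u' \<le> R" and d: "N (u - u') \<le> \<epsilon> / (L + 1)"
    have "\<bar>J u - J u'\<bar> \<le> (L + 1) * N (u - u')" using le[OF u R] N_nonneg[of "u - u'"] by (simp add: algebra_simps)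
    also have "\<dots> \<le> (L + 1) * (\<epsilon> / (L + 1))" using d L by (intro mult_left_mono) auto
    finally show "\<bar>J u - J u'\<bar> \<le> \<epsilon>" using L by simp
  qed
next
  fix R \<epsilon> :: real assume \<epsilon>: "0 < \<epsilon>"
  define R0 where "R0 = max R 0"
  have R0: "0 \<le> R0" "\<And>x. x \<le> R \<Longrightarrow> x \<le> R0" by (auto simp: R0_def)
  have e': "0 < \<epsilon> / (2 * (lam + 1))" using \<epsilon> lam by simp
  obtain \<eta>0 where \<eta>0: "0 < \<eta>0"
    "\<And>u u' v. u \<in> SS \<Longrightarrow> u' \<in> SS \<Longrightarrow> v \<in> SS \<Longrightarrow> N u \<le> R \<Longrightarrow> N u' \<le> R \<Longrightarrow> N (u - u') \<le> \<eta>0 \<Longrightarrow> \<bar>Bd u v - Bd u' v\<bar> \<le> \<epsilon> / (2 * (lam + 1)) * N v"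
    using Bd_modulus[OF e'] by metis
  show "\<exists>\<eta>>0. \<forall>u\<in>SS. \<forall>u'\<in>SS. \<forall>v\<in>SS. N u \<le> R \<longrightarrow> N u' \<le> R \<longrightarrow> N (u - u') \<le> \<eta> \<longrightarrow> \<bar>J' u v - J' u' v\<bar> \<le> \<epsilon> * N v"
  proof (intro exI[of _ "min \<eta>0 (\<epsilon> / 2 / (L2 R0 + 1))"] conjI ballI impI)
    show "0 < min \<eta>0 (\<epsilon> / 2 / (L2 R0 + 1))" using \<epsilon> L2[OF R0(1)] \<eta>0 by simp
    fix u u' v assume u: "u \<in> SS" "u' \<in> SS" "v \<in> SS" and R: "N u \<le> R" "N u' \<le> R" and d: "N (u - u') \<le> min \<eta>0 (\<epsilon> / 2 / (L2 R0 + 1))"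
    have "L2 R0 * N (u - u') \<le> (L2 R0 + 1) * (\<epsilon> / 2 / (L2 R0 + 1))"
      using d L2[OF R0(1)] by (intro mult_mono N_nonneg) auto
    also have "\<dots> = \<epsilon> / 2" by (rule succ_mult_divide[OF L2[OF R0(1)]])
    finally have "L2 R0 * N (u - u') * N v \<le> \<epsilon> / 2 * N v" by (intro mult_right_mono N_nonneg)
    moreover have "\<bar>(a + b * X u) ^ (p - 1) * A u v - (a + b * X u') ^ (p - 1) * A u' v\<bar> \<le> L2 R0 * N (u - u') * N v"
      using R0(2) R by (intro coeffA_lipschitz u) auto
    moreover have "lam * \<bar>Bd u v - Bd u' v\<bar> \<le> lam * (\<epsilon> / (2 * (lam + 1)) * N v)"
      using d lam by (intro mult_left_mono \<eta>0 u R) auto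
    moreover have "J' u v - J' u' v = ((a + b * X u) ^ (p - 1) * A u v - (a + b * X u') ^ (p - 1) * A u' v) - lam * (Bd u v - Bd u' v)"
      by (simp add: J'_def algebra_simps)
    moreover have "\<bar>lam * (Bd u v - Bd u' v)\<bar> = lam * \<bar>Bd u v - Bd u' v\<bar>" using lam by (simp add: abs_mult)
    ultimately have "\<bar>J' u v - J' u' v\<bar> \<le> \<epsilon> / 2 * N v + \<epsilon> / 2 * N v"
      using lam_share[OF \<epsilon> N_nonneg[of v]]
        abs_triangle_ineq4[of "(a + b * X u) ^ (p - 1) * A u v - (a + b * X u') ^ (p - 1) * A u' v" "lam * (Bd u v - Bd u' v)"]
      by linarith
    then show "\<bar>J' u v - J' u' v\<bar> \<le> \<epsilon> * N v" by simp
  qed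
next
  fix R \<epsilon> :: real assume \<epsilon>: "0 < \<epsilon>"
  define R0 where "R0 = max R 0 + 1"
  have R0: "0 \<le> R0" "\<And>x. x \<le> R + 1 \<Longrightarrow> x \<le> R0" by (auto simp: R0_def)
  have e': "0 < \<epsilon> / (2 * (lam + 1))" using \<epsilon> lam by simp
  obtain \<eta>0 where \<eta>0: "0 < \<eta>0"
    "\<And>u v. u \<in> SS \<Longrightarrow> v \<in> SS \<Longrightarrow> N u \<le> R \<Longrightarrow> N v \<le> \<eta>0 \<Longrightarrow> \<bar>Bf (u + v) - Bf u - Bd u v\<bar> \<le> \<epsilon> / (2 * (lam + 1)) * N v"
    using Bd_modulus[OF e'] by metis
  show "\<exists>\<eta>>0. \<forall>u\<in>SS. \<forall>v\<in>SS. N u \<le> R \<longrightarrow> N v \<le> \<eta> \<longrightarrow> J (u + v) \<le> J u + J' u v + \<epsilon> * N v"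
  proof (intro exI[of _ "min 1 (min \<eta>0 (\<epsilon> / 2 / (L2 R0 + 1)))"] conjI ballI impI)
    show "0 < min 1 (min \<eta>0 (\<epsilon> / 2 / (L2 R0 + 1)))" using \<epsilon> L2[OF R0(1)] \<eta>0 by simp
    fix u v assume u: "u \<in> SS" and v: "v \<in> SS" and R: "N u \<le> R" and d: "N v \<le> min 1 (min \<eta>0 (\<epsilon> / 2 / (L2 R0 + 1)))"
    have uv: "u + v \<in> SS" using S_add u v by blast
    have "L2 R0 * N v \<le> (L2 R0 + 1) * (\<epsilon> / 2 / (L2 R0 + 1))"
      using d L2[OF R0(1)] by (intro mult_mono N_nonneg) auto
    also have "\<dots> = \<epsilon> / 2" by (rule succ_mult_divide[OF L2[OF R0(1)]])
    finally have 1: "L2 R0 * N v * N v \<le> \<epsilon> / 2 * N v" by (intro mult_right_mono N_nonneg)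
    have Nuv: "N (u + v) \<le> R0" "N u \<le> R0" using N_tri[OF u v] R d R0(2) by auto
    have "X (u + v) - X u \<le> real p * A (u + v) v"
      using X_tangent[OF uv u] A_scale[OF uv v, of "-1"] by simp
    then have "(a + b * X (u + v)) ^ (p - 1) / real p * (X (u + v) - X u) \<le> (a + b * X (u + v)) ^ (p - 1) / real p * (real p * A (u + v) v)"
      using coeff_pos(1)[of "u + v"] by (intro mult_left_mono) auto
    then have 2: "\<Psi> (X (u + v)) - \<Psi> (X u) \<le> (a + b * X (u + v)) ^ (p - 1) * A (u + v) v"
      using \<Psi>_tangent[OF X_nonneg X_nonneg, of "u + v" u] p by simp
    have 3: "(a + b * X (u + v)) ^ (p - 1) * A (u + v) v \<le> (a + b * X u) ^ (p - 1) * A u v + L2 R0 * N v * N v"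
      using coeffA_lipschitz[OF uv u v Nuv] by (simp add: abs_le_iff)
    have "lam * \<bar>Bf (u + v) - Bf u - Bd u v\<bar> \<le> lam * (\<epsilon> / (2 * (lam + 1)) * N v)"
      using d lam by (intro mult_left_mono \<eta>0 u v R) auto
    moreover have "lam * (- (Bf (u + v) - Bf u - Bd u v)) \<le> lam * \<bar>Bf (u + v) - Bf u - Bd u v\<bar>"
      using lam by (intro mult_left_mono) auto
    ultimately have 4: "lam * (- (Bf (u + v) - Bf u - Bd u v)) \<le> \<epsilon> / 2 * N v" using lam_share[OF \<epsilon> N_nonneg[of v]] by linarith
    have "J (u + v) - J u - J' u v = (\<Psi> (X (u + v)) - \<Psi> (X u)) - (a + b * X u) ^ (p - 1) * A u v + lam * (- (Bf (u + v) - Bf u - Bd u v))"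
      by (simp add: J_def J'_def algebra_simps)
    then show "J (u + v) \<le> J u + J' u v + \<epsilon> * N v" using 1 2 3 4 by (simp add: algebra_simps)
  qed
qed

end

section \<open>Limits of almost critical points\<close>

context weight
begin

text \<open>Applied later with both arguments varying and with either one held fixed.\<close>

lemma Aw_tendsto:
  assumes u: "memLp M p u" and un: "\<And>n. memLp M p (un n)" and v: "memLp M p v" and vn: "\<And>n. memLp M p (vn n)"
    and limu: "(\<lambda>n. normLp M p (\<lambda>x. un n x - u x)) \<longlonglongrightarrow> 0"
    and limv: "(\<lambda>n. normLp M p (\<lambda>x. vn n x - v x)) \<longlonglongrightarrow> 0"
  shows "(\<lambda>n. Aw M Wt p (un n) (vn n)) \<longlonglongrightarrow> Aw M Wt p u v"
proof -
  have p0: "0 < p" using p2 by simp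
  have nl: "(\<lambda>n. normLp M p (fn n)) \<longlonglongrightarrow> normLp M p f"
    if f: "memLp M p f" "\<And>n. memLp M p (fn n)" and l: "(\<lambda>n. normLp M p (\<lambda>x. fn n x - f x)) \<longlonglongrightarrow> 0"
    for f :: "'b \<Rightarrow> 'a" and fn
  proof -
    have "(\<lambda>n. normLp M p (fn n) - normLp M p f) \<longlonglongrightarrow> 0"
      by (rule Lim_null_comparison[OF always_eventually l]) (use normLp_triangle3[OF p0 f(2) f(1)] in simp)
    then show ?thesis by (rule LIM_zero_cancel)
  qed
  define C1 where "C1 n = 3 * c * real (p - 1) * (normLp M p (un n) + normLp M p u) ^ (p - 2) * normLp M p (\<lambda>x. un n x - u x) * normLp M p (vn n)" for n
  define C2 where "C2 n = 3 * c * real (p - 1) * normLp M p u ^ (p - 2) * normLp M p u * normLp M p (\<lambda>x. vn n x - v x)" for n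
  have "(\<lambda>n. C1 n + C2 n) \<longlonglongrightarrow>
     3 * c * real (p - 1) * (normLp M p u + normLp M p u) ^ (p - 2) * 0 * normLp M p v + 3 * c * real (p - 1) * normLp M p u ^ (p - 2) * normLp M p u * 0"
    unfolding C1_def C2_def by (intro tendsto_intros nl[OF u un limu] nl[OF v vn limv] limu limv)
  then have lim: "(\<lambda>n. C1 n + C2 n) \<longlonglongrightarrow> 0" by simp
  have "\<bar>Aw M Wt p (un n) (vn n) - Aw M Wt p u v\<bar> \<le> C1 n + C2 n" for n
  proof -
    have "Aw M Wt p (un n) (vn n) - Aw M Wt p u v = (Aw M Wt p (un n) (vn n) - Aw M Wt p u (vn n)) + Aw M Wt p u (\<lambda>x. vn n x - v x)"
      using Aw_diff[OF u vn v] by simp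
    then show ?thesis
      using Aw_diff_le[OF un[of n] u vn[of n]] Aw_le[OF u memLp_diff[OF vn[of n] v]] unfolding C1_def C2_def by linarith
  qed
  then have "(\<lambda>n. Aw M Wt p (un n) (vn n) - Aw M Wt p u v) \<longlonglongrightarrow> 0"
    by (intro Lim_null_comparison[OF always_eventually lim]) simp
  then show ?thesis by (rule LIM_zero_cancel)
qed

end

section \<open>Elements of the completion\<close>

context frac
begin

lemma normLp_uniform_limit:
  fixes u :: "real \<Rightarrow> 'a::euclidean_space"
  assumes ul: "uniform_limit {0..T} un u sequentially" and u: "memLp M p u" and un: "\<And>n. memLp M p (un n)"
  shows "(\<lambda>n. normLp M p (\<lambda>t. un n t - u t)) \<longlonglongrightarrow> 0"
proof (rule LIMSEQ_I)
  fix e :: real assume e: "0 < e"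
  have r: "0 < root p T" using T p by simp
  then have "0 < e / 2 / root p T" using e by simp
  then obtain n0 where n0: "\<And>n t. n \<ge> n0 \<Longrightarrow> t \<in> {0..T} \<Longrightarrow> dist (un n t) (u t) < e / 2 / root p T"
    using ul unfolding uniform_limit_sequentially_iff by meson
  have "norm (normLp M p (\<lambda>t. un n t - u t) - 0) < e" if "n \<ge> n0" for n
  proof -
    have "normLp M p (\<lambda>t. un n t - u t) \<le> root p T * (e / 2 / root p T)"
      by (intro normLp_sup memLp_diff u un) (use n0[OF that] in \<open>force simp: dist_norm\<close>)
    also have "\<dots> = e / 2" using r by simp
    finally show ?thesis using e by (simp add: abs_of_nonneg normLp_nonneg)
  qed
  then show "\<exists>n0. \<forall>n\<ge>n0. norm (normLp M p (\<lambda>t. un n t - u t) - 0) < e" by blast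
qed

lemma integrable_M_nonneg:
  fixes g :: "real \<Rightarrow> real"
  assumes "g integrable_on {0..T}" "\<And>t. t \<in> {0..T} \<Longrightarrow> 0 \<le> g t" shows "integrable M g"
  using nonnegative_absolutely_integrable_1[OF assms] by (simp add: set_integrable_def integrable_restrict_space)

lemma LINT_eq_integral:
  fixes g :: "real \<Rightarrow> real"
  assumes "integrable M g" shows "integral {0..T} g = integral\<^sup>L M g" "g integrable_on {0..T}"
  using lebesgue_integral_eq_integral[OF assms] integrable_on_lebesgue_on[OF assms] by auto

text \<open>Moves from gauge integrals of p-th powers to \<open>normLp\<close>. The integrands are
  nonnegative, so gauge integrability and Lebesgue integrability agree for them.\<close>

lemma in_E_iff:
  "in_E T \<alpha> p u w \<longleftrightarrow> memLp M p u \<and> memLp M p w \<and>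
     (\<exists>\<phi>. (\<forall>k. \<phi> k \<in> S) \<and> (\<lambda>k. normLp M p (\<lambda>t. \<phi> k t - u t)) \<longlonglongrightarrow> 0
        \<and> (\<lambda>k. normLp M p (\<lambda>t. D (\<phi> k) t - w t)) \<longlonglongrightarrow> 0)"
proof -
  have p0: "0 < p" using p by simp
  have lim: "(\<lambda>k. integral {0..T} (\<lambda>t. norm (fn k t) ^ p)) \<longlonglongrightarrow> 0 \<longleftrightarrow> (\<lambda>k. normLp M p (fn k)) \<longlonglongrightarrow> 0"
    if f: "\<And>k. memLp M p (fn k)" for fn :: "nat \<Rightarrow> real \<Rightarrow> 'a"
  proof -
    have eq: "integral {0..T} (\<lambda>t. norm (fn k t) ^ p) = normLp M p (fn k) ^ p" for k
      unfolding normLp_power[OF p0] by (rule LINT_eq_integral[OF memLp_int[OF f]])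
    have eq2: "normLp M p (fn k) = root p (normLp M p (fn k) ^ p)" for k
      using p0 by (simp add: real_root_power_cancel normLp_nonneg)
    show ?thesis unfolding eq
    proof
      assume "(\<lambda>k. normLp M p (fn k) ^ p) \<longlonglongrightarrow> 0"
      from tendsto_real_root[OF this, of p] show "(\<lambda>k. normLp M p (fn k)) \<longlonglongrightarrow> 0" using eq2 by simp
    next
      assume "(\<lambda>k. normLp M p (fn k)) \<longlonglongrightarrow> 0"
      from tendsto_power[OF this, of p] show "(\<lambda>k. normLp M p (fn k) ^ p) \<longlonglongrightarrow> 0" using p0 by (simp add: power_0_left)
    qed
  qed
  have mem: "memLp M p f \<longleftrightarrow> f \<in> borel_measurable M \<and> (\<lambda>t. norm (f t) ^ p) integrable_on {0..T}" for f :: "real \<Rightarrow> 'a"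
    unfolding memLp_def using integrable_M_nonneg[of "\<lambda>t. norm (f t) ^ p"] LINT_eq_integral(2)[of "\<lambda>t. norm (f t) ^ p"] by auto
  have Sm: "memLp M p \<phi>" "memLp M p (D \<phi>)" if "\<phi> \<in> S" for \<phi> :: "real \<Rightarrow> 'a"
    using D_memLp[OF that] continuous_memLp[OF S_continuous[OF that]] by auto
  show ?thesis
  proof
    assume E: "in_E T \<alpha> p u w"
    then obtain \<phi> where \<phi>: "\<And>k. C0inf T (\<phi> k)"
        "(\<lambda>k. integral {0..T} (\<lambda>t. norm (\<phi> k t - u t) ^ p)) \<longlonglongrightarrow> 0"
        "(\<lambda>k. integral {0..T} (\<lambda>t. norm (left_RL T \<alpha> (\<phi> k) t - w t) ^ p)) \<longlonglongrightarrow> 0"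
      unfolding in_E_def by blast
    have m: "memLp M p u" "memLp M p w" using E unfolding in_E_def mem by blast+
    have S: "\<phi> k \<in> S" for k using \<phi>(1) by (simp add: S_def)
    show "memLp M p u \<and> memLp M p w \<and>
     (\<exists>\<phi>. (\<forall>k. \<phi> k \<in> S) \<and> (\<lambda>k. normLp M p (\<lambda>t. \<phi> k t - u t)) \<longlonglongrightarrow> 0
        \<and> (\<lambda>k. normLp M p (\<lambda>t. D (\<phi> k) t - w t)) \<longlonglongrightarrow> 0)"
      by (intro conjI exI[of _ \<phi>] allI m S lim[THEN iffD1] \<phi> memLp_diff Sm)
  next
    assume E: "memLp M p u \<and> memLp M p w \<and>
     (\<exists>\<phi>. (\<forall>k. \<phi> k \<in> S) \<and> (\<lambda>k. normLp M p (\<lambda>t. \<phi> k t - u t)) \<longlonglongrightarrow> 0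
        \<and> (\<lambda>k. normLp M p (\<lambda>t. D (\<phi> k) t - w t)) \<longlonglongrightarrow> 0)"
    then have m: "memLp M p u" "memLp M p w" by auto
    obtain \<phi> where S: "\<And>k. \<phi> k \<in> S" and \<phi>: "(\<lambda>k. normLp M p (\<lambda>t. \<phi> k t - u t)) \<longlonglongrightarrow> 0"
        "(\<lambda>k. normLp M p (\<lambda>t. D (\<phi> k) t - w t)) \<longlonglongrightarrow> 0" using E by blast
    have d: "memLp M p (\<lambda>t. \<phi> k t - u t)" "memLp M p (\<lambda>t. D (\<phi> k) t - w t)" for k
      by (intro memLp_diff Sm S m)+
    show "in_E T \<alpha> p u w" unfolding in_E_def
    proof (intro conjI exI[of _ \<phi>] allI)
      show "C0inf T (\<phi> k)" for k using S by (simp add: S_def)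
      show "(\<lambda>k. integral {0..T} (\<lambda>t. norm (\<phi> k t - u t) ^ p)) \<longlonglongrightarrow> 0" by (rule lim[OF d(1), THEN iffD2, OF \<phi>(1)])
      show "(\<lambda>k. integral {0..T} (\<lambda>t. norm (left_RL T \<alpha> (\<phi> k) t - w t) ^ p)) \<longlonglongrightarrow> 0" by (rule lim[OF d(2), THEN iffD2, OF \<phi>(2)])
      show "(\<lambda>t. norm (\<phi> k t - u t) ^ p) integrable_on {0..T}" "(\<lambda>t. norm (left_RL T \<alpha> (\<phi> k) t - w t) ^ p) integrable_on {0..T}" for k
        using d[of k] unfolding mem by blast+
    qed (use m mem in blast)+
  qed
qed

text \<open>By \<open>sup_bound\<close>, convergence of the derivatives in \<open>L^p\<close> makes
  the approximating functions uniformly Cauchy. As \<open>v\<close> is determined only up to a null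
  set, it is compared with the uniform limit through their \<open>L^p\<close> distance.\<close>

lemma in_E_continuous_representative:
  assumes E: "memLp M p v" "\<And>k. \<phi> k \<in> S" "(\<lambda>k. normLp M p (\<lambda>t. \<phi> k t - v t)) \<longlonglongrightarrow> 0"
      "memLp M p wv" "(\<lambda>k. normLp M p (\<lambda>t. D (\<phi> k) t - wv t)) \<longlonglongrightarrow> 0"
  obtains v' where "continuous_on {0..T} v'" "uniform_limit {0..T} \<phi> v' sequentially" "AE t in M. v t = v' t"
proof -
  have p0: "0 < p" using p by simp
  have "uniformly_Cauchy_on {0..T} \<phi>"
  proof (rule uniformly_Cauchy_onI)
    fix e :: real assume e: "0 < e"
    define e' where "e' = e / (2 * Kc T p \<alpha>)"
    have e': "0 < e'" using e Kc_pos by (simp add: e'_def)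
    obtain n0 where n0: "\<And>n. n \<ge> n0 \<Longrightarrow> normLp M p (\<lambda>t. D (\<phi> n) t - wv t) < e'"
      using order_tendstoD(2)[OF E(5) e'] unfolding eventually_sequentially by blast
    have "dist (\<phi> i t) (\<phi> j t) < e" if t: "t \<in> {0..T}" and ij: "i \<ge> n0" "j \<ge> n0" for t i j
    proof -
      have "N (\<phi> i - \<phi> j) \<le> normLp M p (\<lambda>t. D (\<phi> i) t - wv t) + normLp M p (\<lambda>t. wv t - D (\<phi> j) t)"
        unfolding N_diff[OF E(2) E(2)]
        using minkowski[OF p0 memLp_diff[OF D_memLp[OF E(2)[of i]] E(4)] memLp_diff[OF E(4) D_memLp[OF E(2)[of j]]]] by simp
      also have "\<dots> < e' + e'" using n0[OF ij(1)] n0[OF ij(2)] by (simp add: normLp_minus_commute[of M p wv])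
      finally have "Kc T p \<alpha> * N (\<phi> i - \<phi> j) < Kc T p \<alpha> * (e' + e')" using Kc_pos by (intro mult_strict_left_mono)
      also have "\<dots> = e" using Kc_pos by (simp add: e'_def)
      finally show ?thesis
        using sup_bound[OF subspace_diff[OF S_subspace E(2) E(2)] t, of i j] by (simp add: dist_norm)
    qed
    then show "\<exists>n0. \<forall>t\<in>{0..T}. \<forall>i\<ge>n0. \<forall>j\<ge>n0. dist (\<phi> i t) (\<phi> j t) < e" by blast
  qed
  then obtain v' where ul: "uniform_limit {0..T} \<phi> v' sequentially"
    using Cauchy_uniformly_convergent uniformly_convergent_on_def by blast
  have c: "continuous_on {0..T} v'"
    by (rule uniform_limit_theorem[OF _ ul]) (auto intro!: always_eventually S_continuous E)
  have mv': "memLp M p v'" by (rule continuous_memLp[OF c])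
  have mk: "memLp M p (\<phi> k)" for k by (rule continuous_memLp[OF S_continuous[OF E(2)]])
  have "(\<lambda>k. normLp M p (\<lambda>t. \<phi> k t - v t) + normLp M p (\<lambda>t. \<phi> k t - v' t)) \<longlonglongrightarrow> 0 + 0"
    by (intro tendsto_add E(3) normLp_uniform_limit[OF ul mv' mk])
  moreover have "normLp M p (\<lambda>t. v t - v' t) \<le> normLp M p (\<lambda>t. \<phi> k t - v t) + normLp M p (\<lambda>t. \<phi> k t - v' t)" for k
    using minkowski[OF p0 memLp_diff[OF E(1) mk[of k]] memLp_diff[OF mk[of k] mv']]
    by (simp add: normLp_minus_commute[of M p v])
  ultimately have "normLp M p (\<lambda>t. v t - v' t) \<le> 0 + 0"
    by (intro tendsto_lowerbound[where F=sequentially] always_eventually) auto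
  then have "normLp M p (\<lambda>t. v t - v' t) = 0" using normLp_nonneg[of M p "\<lambda>t. v t - v' t"] by simp
  then have "(\<integral>t. norm (v t - v' t) ^ p \<partial>M) = 0"
    using normLp_power[OF p0, of M "\<lambda>t. v t - v' t"] p0 by (simp add: power_0_left)
  then have "AE t in M. norm (v t - v' t) ^ p = 0"
    using integral_nonneg_eq_0_iff_AE[OF memLp_int[OF memLp_diff[OF E(1) mv']]] by simp
  then have "AE t in M. v t = v' t" by eventually_elim (use p0 in simp)
  with c ul show ?thesis by (rule that)
qed

end

text \<open>Two sequences occur because the limit is taken once along almost critical points with a
  fixed test function, and once along test functions with the critical point fixed. The uniform
  bounds provide the dominating function.\<close>

lemma (in caratheodory) f_comp_tendsto:
  assumes un: "\<And>n. continuous_on {0..T} (un n)" and u: "continuous_on {0..T} u" and ulu: "uniform_limit {0..T} un u sequentially"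
    and vn: "\<And>n. continuous_on {0..T} (vn n)" and v: "continuous_on {0..T} v" and ulv: "uniform_limit {0..T} vn v sequentially"
    and R: "\<And>n t. t \<in> {0..T} \<Longrightarrow> norm (un n t) \<le> R" "\<And>n t. t \<in> {0..T} \<Longrightarrow> norm (vn n t) \<le> R'"
  shows "(\<lambda>n. \<integral>t. f t (un n t) \<bullet> vn n t \<partial>lebesgue_on {0..T}) \<longlonglongrightarrow> (\<integral>t. f t (u t) \<bullet> v t \<partial>lebesgue_on {0..T})"
    and "(\<lambda>n. \<integral>t. H t (un n t) \<partial>lebesgue_on {0..T}) \<longlonglongrightarrow> (\<integral>t. H t (u t) \<partial>lebesgue_on {0..T})"
proof -
  obtain k where k: "integrable (lebesgue_on {0..T}) k" "\<And>t x. t \<in> {0..T} \<Longrightarrow> norm x \<le> R \<Longrightarrow> norm (f t x) \<le> k t"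
    using f_bound[of R] by blast
  show "(\<lambda>n. \<integral>t. f t (un n t) \<bullet> vn n t \<partial>lebesgue_on {0..T}) \<longlonglongrightarrow> (\<integral>t. f t (u t) \<bullet> v t \<partial>lebesgue_on {0..T})"
  proof (rule integral_dominated_convergence[where w="\<lambda>t. k t * R'"])
    show "(\<lambda>t. f t (u t) \<bullet> v t) \<in> borel_measurable (lebesgue_on {0..T})"
      by (rule borel_measurable_integrable[OF f_comp_inner_integrable[OF u v]])
    show "(\<lambda>t. f t (un n t) \<bullet> vn n t) \<in> borel_measurable (lebesgue_on {0..T})" for n
      by (rule borel_measurable_integrable[OF f_comp_inner_integrable[OF un vn]])
    show "integrable (lebesgue_on {0..T}) (\<lambda>t. k t * R')" using k(1) by simp
    show "AE t in lebesgue_on {0..T}. (\<lambda>n. f t (un n t) \<bullet> vn n t) \<longlonglongrightarrow> f t (u t) \<bullet> v t"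
    proof (rule AE_I2)
      fix t assume "t \<in> space (lebesgue_on {0..T})"
      then have t: "t \<in> {0..T}" by simp
      show "(\<lambda>n. f t (un n t) \<bullet> vn n t) \<longlonglongrightarrow> f t (u t) \<bullet> v t"
        by (intro tendsto_inner continuous_on_tendsto_compose[OF f_cont[OF t]] tendsto_uniform_limitI[OF ulu t] tendsto_uniform_limitI[OF ulv t]) auto
    qed
    show "AE t in lebesgue_on {0..T}. norm (f t (un n t) \<bullet> vn n t) \<le> k t * R'" for n
    proof (rule AE_I2)
      fix t assume "t \<in> space (lebesgue_on {0..T})"
      then have t: "t \<in> {0..T}" by simp
      have "norm (f t (un n t) \<bullet> vn n t) \<le> norm (f t (un n t)) * norm (vn n t)" by (simp add: Cauchy_Schwarz_ineq2)
      also have "\<dots> \<le> k t * R'"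
        using k(2)[OF t R(1)[OF t]] R(2)[OF t] by (intro mult_mono) (auto intro: order_trans[OF norm_ge_zero])
      finally show "norm (f t (un n t) \<bullet> vn n t) \<le> k t * R'" .
    qed
  qed
  show "(\<lambda>n. \<integral>t. H t (un n t) \<partial>lebesgue_on {0..T}) \<longlonglongrightarrow> (\<integral>t. H t (u t) \<partial>lebesgue_on {0..T})"
  proof (rule integral_dominated_convergence[where w="\<lambda>t. k t * R"])
    show "(\<lambda>t. H t (u t)) \<in> borel_measurable (lebesgue_on {0..T})" by (rule H_comp_measurable[OF u])
    show "(\<lambda>t. H t (un n t)) \<in> borel_measurable (lebesgue_on {0..T})" for n by (rule H_comp_measurable[OF un])
    show "integrable (lebesgue_on {0..T}) (\<lambda>t. k t * R)" using k(1) by simp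
    show "AE t in lebesgue_on {0..T}. (\<lambda>n. H t (un n t)) \<longlonglongrightarrow> H t (u t)"
    proof (rule AE_I2)
      fix t assume "t \<in> space (lebesgue_on {0..T})"
      then have t: "t \<in> {0..T}" by simp
      show "(\<lambda>n. H t (un n t)) \<longlonglongrightarrow> H t (u t)"
        by (intro continuous_on_tendsto_compose[OF H_cont[OF t]] tendsto_uniform_limitI[OF ulu t]) auto
    qed
    show "AE t in lebesgue_on {0..T}. norm (H t (un n t)) \<le> k t * R" for n
    proof (rule AE_I2)
      fix t assume "t \<in> space (lebesgue_on {0..T})"
      then have t: "t \<in> {0..T}" by simp
      have R0: "0 \<le> R" by (rule order_trans[OF norm_ge_zero R(1)[OF t]])
      have "\<bar>H t (un n t) - H t 0\<bar> \<le> k t * norm (un n t - 0)"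
        by (rule H_lipschitz[OF k(2)[OF t] t]) (use R0 R(1)[OF t] in auto)
      also have "\<dots> \<le> k t * R"
        using R(1)[OF t] order_trans[OF norm_ge_zero k(2)[OF t R(1)[OF t]]] by (intro mult_left_mono) auto
      finally show "norm (H t (un n t)) \<le> k t * R" using H_zero[OF t] by simp
    qed
  qed
qed

locale kirchhoff_AR = kirchhoff T \<alpha> p H f a b lam V Vs
  for T \<alpha> :: real and p :: nat and H :: "real \<Rightarrow> 'a::euclidean_space \<Rightarrow> real" and f a b lam V Vs +
  fixes \<theta> :: real
  assumes \<theta>: "(real p)\<^sup>2 < \<theta>" and AR: "\<And>t x. t \<in> {0..T} \<Longrightarrow> \<theta> * H t x \<le> f t x \<bullet> x"
begin

text \<open>The factor in the energy estimate below; the constant in the final norm bound is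
  \<open>Cstar\<close> divided by it.\<close>

definition \<kappa> :: real where "\<kappa> = (1 / (real p)\<^sup>2 - 1 / \<theta>) * a ^ (p - 1)"

lemma \<theta>_ge: "1 \<le> \<theta>" "0 < (real p)\<^sup>2"
proof -
  have "1 \<le> (real p)\<^sup>2" using p by (simp add: one_le_power)
  then show "1 \<le> \<theta>" "0 < (real p)\<^sup>2" using \<theta> by linarith+
qed

lemma \<kappa>: "0 < \<kappa>"
proof -
  have "1 / \<theta> < 1 / (real p)\<^sup>2" using \<theta> \<theta>_ge by (intro divide_strict_left_mono) auto
  then show ?thesis using ab by (simp add: \<kappa>_def)
qed

text \<open>From a^p <= (a + b x)^(p-1) a, the numerator of \<Psi> x is at least (a + b x)^(p-1) b
  x. The factor 1/p^2 found here is the reason for superlinearity exponents above p^2.\<close>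

lemma \<Psi>_ge: assumes "0 \<le> x" shows "(a + b * x) ^ (p - 1) * x / (real p)\<^sup>2 \<le> \<Psi> x"
proof -
  have "a ^ (p - 1) * a \<le> (a + b * x) ^ (p - 1) * a" using ab assms by (intro mult_right_mono power_mono) auto
  moreover have "a ^ p = a ^ (p - 1) * a" "(a + b * x) ^ p = (a + b * x) ^ (p - 1) * (a + b * x)"
    using p by (metis One_nat_def Suc_1 Suc_leD Suc_pred' less_eq_Suc_le power_Suc2)+
  ultimately have "(a + b * x) ^ (p - 1) * (b * x) \<le> (a + b * x) ^ p - a ^ p" by (simp add: algebra_simps)
  then have "(a + b * x) ^ (p - 1) * (b * x) / (b * (real p)\<^sup>2) \<le> \<Psi> x"
    unfolding \<Psi>_def using ab by (intro divide_right_mono) auto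
  then show ?thesis using ab by simp
qed

text \<open>In J - J'/\<theta> the nonlinear terms combine with a favourable sign by
  \<open>AR\<close>. What remains is at least (1/p^2 - 1/\<theta>) times the Kirchhoff coefficient
  times X, and that coefficient is at least a^(p-1).\<close>

lemma energy_estimate:
  assumes u: "u \<in> SS" shows "\<kappa> * X u \<le> J u - J' u u / \<theta>"
proof -
  define c where "c = (a + b * X u) ^ (p - 1)"
  have c: "a ^ (p - 1) \<le> c" unfolding c_def using ab coeff_pos[of u] by (intro power_mono) auto
  have "\<theta> * Bf u \<le> Bd u u"
    unfolding Bf_def Bd_def using S_continuous[OF u]
    by (subst integral_mult_right_zero[symmetric], intro integral_mono)
      (auto intro!: H_comp_integrable f_comp_inner_integrable AR)
  then have "Bf u \<le> Bd u u / \<theta>" using \<theta>_ge by (simp add: field_simps)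
  then have B: "lam * Bf u \<le> lam * (Bd u u / \<theta>)" using lam by (intro mult_left_mono)
  have pos: "0 \<le> 1 / (real p)\<^sup>2 - 1 / \<theta>" using \<kappa> ab by (simp add: \<kappa>_def zero_less_mult_iff less_imp_le)
  have "\<kappa> * X u \<le> (1 / (real p)\<^sup>2 - 1 / \<theta>) * (c * X u)"
    unfolding \<kappa>_def mult.assoc using pos c X_nonneg[of u] by (intro mult_left_mono mult_right_mono) auto
  also have "\<dots> = c * X u / (real p)\<^sup>2 - c * X u / \<theta>" by (simp add: algebra_simps)
  also have "\<dots> \<le> \<Psi> (X u) - c * X u / \<theta>" using \<Psi>_ge[OF X_nonneg[of u]] by (simp add: c_def)
  also have "\<dots> \<le> J u - J' u u / \<theta>"
    using B by (simp add: J_def J'_def X_def c_def diff_divide_distrib)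
  finally show ?thesis .
qed

text \<open>Testing \<open>J'\<close> at almost critical points \<open>z i\<close>, \<open>z j\<close> with the uniformly small \<open>z i - z j\<close> makes
  \<open>A (z i) (z i - z j)\<close> and \<open>A (z j) (z i - z j)\<close> small, and strong monotonicity turns this into
  smallness of \<open>N (z i - z j)\<close>.\<close>

theorem palais_smale_limit:
  assumes \<rho>: "0 < \<rho>"
    and PS: "\<And>\<epsilon>. 0 < \<epsilon> \<Longrightarrow> \<exists>u\<in>SS. \<rho> \<le> J u \<and> J u \<le> C \<and> (\<forall>v\<in>SS. \<bar>J' u v\<bar> \<le> \<epsilon> * N v)"
  obtains u w where "in_E T \<alpha> p u w" "continuous_on {0..T} u" "memLp M p w"
    "\<kappa> * A2 u w u w \<le> C" "\<exists>t\<in>{0..T}. u t \<noteq> 0" "\<And>t. t \<in> {0..T} \<Longrightarrow> norm (u t) \<le> K * root p (A2 u w u w)"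
    "\<And>v wv. in_E T \<alpha> p v wv \<Longrightarrow> integrable M (\<lambda>t. f t (u t) \<bullet> v t) \<and>
        (a + b * A2 u w u w) ^ (p - 1) * A2 u w v wv = lam * (\<integral>t. f t (u t) \<bullet> v t \<partial>M)"
proof -
  have p0: "0 < p" using p by simp
  have "\<exists>s. \<forall>n. s n \<in> SS \<and> \<rho> \<le> J (s n) \<and> J (s n) \<le> C \<and> (\<forall>v\<in>SS. \<bar>J' (s n) v\<bar> \<le> 1 / real (Suc n) * N v)"
    using PS[of "1 / real (Suc n)" for n] by (intro choice allI) auto
  then obtain s where s: "\<And>n. s n \<in> SS" "\<And>n. \<rho> \<le> J (s n)" "\<And>n. J (s n) \<le> C"
    "\<And>n v. v \<in> SS \<Longrightarrow> \<bar>J' (s n) v\<bar> \<le> 1 / real (Suc n) * N v" by blast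
  have C0: "0 \<le> C" using s(2,3)[of 0] \<rho> by linarith
  have est: "\<kappa> * X (s n) \<le> C + 1 / real (Suc n) * N (s n)" for n
  proof -
    have "- J' (s n) (s n) / \<theta> \<le> \<bar>J' (s n) (s n)\<bar> / \<theta>" using \<theta>_ge by (intro divide_right_mono) auto
    also have "\<dots> \<le> \<bar>J' (s n) (s n)\<bar> / 1" using \<theta>_ge by (intro divide_left_mono) auto
    finally show ?thesis using energy_estimate[OF s(1)[of n]] s(3)[of n] s(4)[OF s(1)[of n], of n] by simp
  qed
  \<comment> \<open>If N > 1 then N^2 <= N^p <= X, and the energy estimate, whose right side grows
    only linearly in N, can be divided by N.\<close>
  define R where "R = max 1 ((C + 1) / \<kappa>)"
  have R: "N (s n) \<le> R" for n
  proof (cases "N (s n) \<le> 1")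
    case False
    then have N1: "1 < N (s n)" by simp
    have "N (s n) * N (s n) \<le> N (s n) ^ p"
      using power_increasing[of 2 p "N (s n)"] p N1 by (simp add: power2_eq_square)
    also have "\<dots> \<le> X (s n)" by (rule X_ge)
    finally have "\<kappa> * (N (s n) * N (s n)) \<le> \<kappa> * X (s n)" using \<kappa> by (intro mult_left_mono) auto
    also have "\<dots> \<le> C + 1 / real (Suc n) * N (s n)" by (rule est)
    also have "\<dots> \<le> C * N (s n) + 1 * N (s n)"
      using N1 C0 by (intro add_mono mult_right_mono) (auto intro: order_trans[OF _ mult_left_mono[of 1]] simp: mult_le_cancel_left1)
    finally have "(\<kappa> * N (s n)) * N (s n) \<le> (C + 1) * N (s n)" by (simp add: algebra_simps)
    then have "\<kappa> * N (s n) \<le> C + 1" using N1 by simp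
    then have "N (s n) \<le> (C + 1) / \<kappa>" using \<kappa> by (simp add: field_simps)
    then show ?thesis by (simp add: R_def)
  qed (simp add: R_def)
  have R0: "0 < R" by (simp add: R_def)
  obtain r u where r: "strict_mono r" and cu: "continuous_on {0..T} u" and ul: "uniform_limit {0..T} (\<lambda>n. s (r n)) u sequentially"
    using compact_embedding[of s R] s(1) R by blast
  define z where "z n = s (r n)" for n
  have zS: "z n \<in> SS" for n by (simp add: z_def s)
  have zc: "continuous_on {0..T} (z n)" for n by (rule S_continuous[OF zS])
  have zR: "N (z n) \<le> R" for n by (simp add: z_def R)
  have zul: "uniform_limit {0..T} z u sequentially" using ul by (simp add: z_def[abs_def])
  have zJ': "\<bar>J' (z n) v\<bar> \<le> 1 / real (Suc n) * N v" if "v \<in> SS" for n v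
  proof -
    have "\<bar>J' (z n) v\<bar> \<le> 1 / real (Suc (r n)) * N v" using s(4)[OF that] by (simp add: z_def)
    also have "\<dots> \<le> 1 / real (Suc n) * N v"
      using seq_suble[OF r, of n] by (intro mult_right_mono N_nonneg divide_left_mono) auto
    finally show ?thesis .
  qed
  have zb: "norm (z n t) \<le> K * R" if "t \<in> {0..T}" for n t
    by (rule sup_bound_le[OF zS zR that])
  obtain k where k: "integrable M k" "\<And>t x. t \<in> {0..T} \<Longrightarrow> norm x \<le> K * R \<Longrightarrow> norm (f t x) \<le> k t"
    using f_bound[of "K * R"] by blast
  define k1 where "k1 = \<bar>integral\<^sup>L M k\<bar>"
  \<comment> \<open>The bound uses the maximum of v and not \<open>N v\<close>: it is small for
    differences of uniformly convergent functions before anything is known about their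
    derivatives.\<close>
  have Bd_le: "\<bar>Bd (z n) v\<bar> \<le> k1 * B" if v: "v \<in> SS" and B: "\<And>t. t \<in> {0..T} \<Longrightarrow> norm (v t) \<le> B" for n v B
  proof -
    have B0: "0 \<le> B" using B[of 0] T by (meson atLeastAtMost_iff less_imp_le norm_ge_zero order_refl order_trans)
    have "\<bar>Bd (z n) v\<bar> \<le> (\<integral>t. k t * B \<partial>M)"
      unfolding Bd_def real_norm_def[symmetric]
    proof (rule order.trans[OF integral_norm_bound integral_mono])
      show "integrable M (\<lambda>t. norm (f t (z n t) \<bullet> v t))"
        by (intro integrable_norm f_comp_inner_integrable zc S_continuous v)
      show "integrable M (\<lambda>t. k t * B)" using k(1) by simp
      fix t assume "t \<in> space M"
      then have t: "t \<in> {0..T}" by simp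
      have "norm (f t (z n t) \<bullet> v t) \<le> norm (f t (z n t)) * norm (v t)" by (simp add: Cauchy_Schwarz_ineq2)
      also have "\<dots> \<le> k t * B" using k(2)[OF t zb[OF t]] B[OF t] by (intro mult_mono) (auto intro: order_trans[OF norm_ge_zero])
      finally show "norm (f t (z n t) \<bullet> v t) \<le> k t * B" .
    qed
    also have "\<dots> \<le> k1 * B" using B0 by (simp add: k1_def mult_right_mono)
    finally show ?thesis .
  qed
  have A_le: "\<bar>A (z n) v\<bar> \<le> (1 / real (Suc n) * N v + lam * (k1 * B)) / a ^ (p - 1)"
    if v: "v \<in> SS" and B: "\<And>t. t \<in> {0..T} \<Longrightarrow> norm (v t) \<le> B" for n v B
  proof -
    define c where "c = (a + b * X (z n)) ^ (p - 1)"
    have c: "a ^ (p - 1) \<le> c" "0 < a ^ (p - 1)" unfolding c_def using ab coeff_pos[of "z n"] by (auto intro!: power_mono)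
    have "a ^ (p - 1) * \<bar>A (z n) v\<bar> \<le> c * \<bar>A (z n) v\<bar>" using c by (intro mult_right_mono) auto
    also have "\<dots> = \<bar>J' (z n) v + lam * Bd (z n) v\<bar>" using c by (simp add: J'_def c_def abs_mult)
    also have "\<dots> \<le> \<bar>J' (z n) v\<bar> + lam * \<bar>Bd (z n) v\<bar>"
      using abs_triangle_ineq[of "J' (z n) v" "lam * Bd (z n) v"] lam by (simp add: abs_mult)
    also have "\<dots> \<le> 1 / real (Suc n) * N v + lam * (k1 * B)"
      using lam by (intro add_mono zJ' v mult_left_mono Bd_le B) auto
    finally show ?thesis using c(2) by (metis mult.commute pos_le_divide_eq)
  qed
  have "\<exists>n0. \<forall>i\<ge>n0. \<forall>j\<ge>n0. normLp M p (\<lambda>x. D (z i) x - D (z j) x) < e" if e: "0 < e" for e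
  proof -
    \<comment> \<open>Chosen so that E / a^(p-1) equals e^p / 2^(p-1), the quantity to stay below;
      the two terms of the monotonicity estimate contribute at most 3E/8 each before division by
      a^(p-1).\<close>
    define E where "E = e ^ p * a ^ (p - 1) / 2 ^ (p - 1)"
    have E: "0 < E" using e ab by (simp add: E_def)
    define B where "B = E / (8 * (lam * k1 + 1))"
    have k1: "0 \<le> lam * k1" using lam by (simp add: k1_def)
    have B: "0 < B" using E k1 by (simp add: B_def)
    have lkB: "lam * (k1 * (2 * B)) \<le> E / 4"
    proof -
      have "lam * (k1 * (2 * B)) \<le> 2 * ((lam * k1 + 1) * B)" using B by (simp add: algebra_simps)
      also have "\<dots> = E / 4" unfolding B_def using k1 by (simp add: field_simps)
      finally show ?thesis .
    qed
    obtain n1 where n1: "\<And>n t. n \<ge> n1 \<Longrightarrow> t \<in> {0..T} \<Longrightarrow> dist (z n t) (u t) < B"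
      using zul B unfolding uniform_limit_sequentially_iff by meson
    obtain n2 where n2: "1 / real (Suc n2) < E / (16 * R)"
      using nat_approx_posE[of "E / (16 * R)"] E R0 by auto
    have "normLp M p (\<lambda>x. D (z i) x - D (z j) x) < e" if i: "i \<ge> max n1 n2" and j: "j \<ge> max n1 n2" for i j
    proof -
      define d where "d = z i - z j"
      have dS: "d \<in> SS" unfolding d_def by (rule S_diff[OF zS zS])
      have dB: "norm (d t) \<le> 2 * B" if "t \<in> {0..T}" for t
        using n1[of i t] n1[of j t] i j that norm_triangle_ineq4[of "z i t - u t" "z j t - u t"]
        by (simp add: d_def dist_norm)
      have Nd: "N d \<le> 2 * R" using N_tri[OF zS S_scale[OF zS], of i "-1" j] N_scale[OF zS, of "-1" j] zR[of i] zR[of j] by (simp add: d_def)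
      have small: "1 / real (Suc m) * N d + lam * (k1 * (2 * B)) \<le> 3 * E / 8" if "m \<ge> max n1 n2" for m
      proof -
        have "1 / real (Suc m) \<le> 1 / real (Suc n2)" using that by (intro divide_left_mono) auto
        then have "1 / real (Suc m) * N d \<le> E / (16 * R) * (2 * R)"
          using n2 Nd by (intro mult_mono N_nonneg) (auto simp: E R0 less_imp_le)
        also have "\<dots> = E / 8" using R0 by simp
        finally show ?thesis using lkB by simp
      qed
      have AA: "\<bar>A (z m) d\<bar> \<le> 3 * E / 8 / a ^ (p - 1)" if "m \<ge> max n1 n2" for m
        using A_le[OF dS dB, of m] small[OF that] ab by (smt (verit) divide_right_mono zero_less_power)
      have "N d ^ p / 2 ^ (p - 1) \<le> A (z i) d - A (z j) d" unfolding d_def by (rule A_monotone[OF zS zS])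
      also have "\<dots> \<le> 3 * E / 8 / a ^ (p - 1) + 3 * E / 8 / a ^ (p - 1)" using AA[OF i] AA[OF j] by linarith
      also have "\<dots> < E / a ^ (p - 1)" using E ab by (simp add: field_simps)
      also have "\<dots> = e ^ p / 2 ^ (p - 1)" using ab by (simp add: E_def)
      finally have "N d ^ p < e ^ p" by (simp add: divide_less_cancel)
      then have "N d < e" using e by (meson power_less_imp_less_base less_imp_le)
      then show ?thesis unfolding d_def N_diff[OF zS zS] .
    qed
    then show ?thesis by blast
  qed
  from Lp_complete[OF finite_M p D_memLp[OF zS] this]
  obtain w where w: "memLp M p w" "(\<lambda>n. normLp M p (\<lambda>x. D (z n) x - w x)) \<longlonglongrightarrow> 0" by blast
  have mu: "memLp M p u" by (rule continuous_memLp[OF cu])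
  have limu: "(\<lambda>n. normLp M p (\<lambda>t. z n t - u t)) \<longlonglongrightarrow> 0" by (rule normLp_uniform_limit[OF zul mu S_memLp[OF zS]])
  have inE: "in_E T \<alpha> p u w" unfolding in_E_iff using mu w limu zS by blast
  define Y where "Y = A2 u w u w"
  have A2_lim: "(\<lambda>n. A2 (z n) (D (z n)) (vn n) (wn n)) \<longlonglongrightarrow> A2 u w v wv"
    if "\<And>n. memLp M p (vn n)" "\<And>n. memLp M p (wn n)" "memLp M p v" "memLp M p wv"
      "(\<lambda>n. normLp M p (\<lambda>t. vn n t - v t)) \<longlonglongrightarrow> 0" "(\<lambda>n. normLp M p (\<lambda>t. wn n t - wv t)) \<longlonglongrightarrow> 0" for vn wn v wv
    unfolding A2_def by (intro tendsto_add W1.Aw_tendsto WV.Aw_tendsto w limu that mu D_memLp S_memLp zS)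
  have A2_lim2: "(\<lambda>n. A2 u w (vn n) (wn n)) \<longlonglongrightarrow> A2 u w v wv"
    if "\<And>n. memLp M p (vn n)" "\<And>n. memLp M p (wn n)" "memLp M p v" "memLp M p wv"
      "(\<lambda>n. normLp M p (\<lambda>t. vn n t - v t)) \<longlonglongrightarrow> 0" "(\<lambda>n. normLp M p (\<lambda>t. wn n t - wv t)) \<longlonglongrightarrow> 0" for vn wn v wv
    unfolding A2_def by (intro tendsto_add W1.Aw_tendsto WV.Aw_tendsto w(1) that mu) (use p0 in \<open>simp_all add: normLp_def power_0_left\<close>)
  have Xlim: "(\<lambda>n. X (z n)) \<longlonglongrightarrow> Y"
    unfolding X_def A_def Y_def by (intro A2_lim S_memLp D_memLp zS mu w limu)
  have coefflim: "(\<lambda>n. (a + b * X (z n)) ^ (p - 1)) \<longlonglongrightarrow> (a + b * Y) ^ (p - 1)" by (intro tendsto_intros Xlim)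
  have Y0: "0 \<le> Y" by (rule LIMSEQ_le_const[OF Xlim]) (auto intro: X_nonneg)
  have J'lim: "(\<lambda>n. J' (z n) (vn n)) \<longlonglongrightarrow> 0" if "\<And>n. vn n \<in> SS" "\<And>n. N (vn n) \<le> B" for vn B
  proof (rule Lim_null_comparison)
    show "(\<lambda>n. 1 / real (Suc n) * B) \<longlonglongrightarrow> 0"
      using tendsto_mult_left_zero[OF LIMSEQ_inverse_real_of_nat] by (simp add: inverse_eq_divide)
    show "\<forall>\<^sub>F n in sequentially. norm (J' (z n) (vn n)) \<le> 1 / real (Suc n) * B"
    proof (intro always_eventually allI)
      fix n
      have "1 / real (Suc n) * N (vn n) \<le> 1 / real (Suc n) * B" using that(2) by (intro mult_left_mono) auto
      then show "norm (J' (z n) (vn n)) \<le> 1 / real (Suc n) * B" using zJ'[OF that(1)[of n], of n] by simp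
    qed
  qed
  \<comment> \<open>The equation is first obtained for smooth test functions, along the sequence z;
    density then extends it to the completion with u fixed.\<close>
  have eqS: "(a + b * Y) ^ (p - 1) * A2 u w \<phi> (D \<phi>) = lam * (\<integral>t. f t (u t) \<bullet> \<phi> t \<partial>M)" if \<phi>: "\<phi> \<in> SS" for \<phi>
  proof -
    have c\<phi>: "continuous_on {0..T} \<phi>" by (rule S_continuous[OF \<phi>])
    have "(\<lambda>n. (a + b * X (z n)) ^ (p - 1) * A2 (z n) (D (z n)) \<phi> (D \<phi>) - lam * (\<integral>t. f t (z n t) \<bullet> \<phi> t \<partial>M))
        \<longlonglongrightarrow> (a + b * Y) ^ (p - 1) * A2 u w \<phi> (D \<phi>) - lam * (\<integral>t. f t (u t) \<bullet> \<phi> t \<partial>M)"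
      by (intro tendsto_diff tendsto_mult coefflim tendsto_const A2_lim f_comp_tendsto(1)[OF zc cu zul c\<phi> c\<phi> _ zb sup_bound[OF \<phi>]] S_memLp D_memLp \<phi>)
        (use p0 in \<open>simp_all add: normLp_def power_0_left uniform_limit_const\<close>)
    moreover have "(\<lambda>n. (a + b * X (z n)) ^ (p - 1) * A2 (z n) (D (z n)) \<phi> (D \<phi>) - lam * (\<integral>t. f t (z n t) \<bullet> \<phi> t \<partial>M)) \<longlonglongrightarrow> 0"
      using J'lim[of "\<lambda>_. \<phi>" "N \<phi>"] \<phi> by (simp add: J'_def A_def Bd_def)
    ultimately show ?thesis using LIMSEQ_unique by fastforce
  qed
  have eqE: "integrable M (\<lambda>t. f t (u t) \<bullet> v t) \<and> (a + b * Y) ^ (p - 1) * A2 u w v wv = lam * (\<integral>t. f t (u t) \<bullet> v t \<partial>M)"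
    if E: "in_E T \<alpha> p v wv" for v wv
  proof -
    obtain \<phi> where mv: "memLp M p v" "memLp M p wv" and \<phi>: "\<And>k. \<phi> k \<in> SS" "(\<lambda>k. normLp M p (\<lambda>t. \<phi> k t - v t)) \<longlonglongrightarrow> 0"
      "(\<lambda>k. normLp M p (\<lambda>t. D (\<phi> k) t - wv t)) \<longlonglongrightarrow> 0"
      using E unfolding in_E_iff by blast
    obtain v' where v': "continuous_on {0..T} v'" "uniform_limit {0..T} \<phi> v' sequentially" "AE t in M. v t = v' t"
      using in_E_continuous_representative[OF mv(1) \<phi>(1,2) mv(2) \<phi>(3)] by blast
    have c\<phi>: "continuous_on {0..T} (\<phi> k)" for k by (rule S_continuous[OF \<phi>(1)])
    have mf: "(\<lambda>t. f t (u t) \<bullet> v t) \<in> borel_measurable M"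
      by (intro borel_measurable_inner f_comp_measurable cu memLp_meas[OF mv(1)])
    have ae: "AE t in M. f t (u t) \<bullet> v' t = f t (u t) \<bullet> v t" using v'(3) by eventually_elim simp
    have int': "integrable M (\<lambda>t. f t (u t) \<bullet> v' t)" by (rule f_comp_inner_integrable[OF cu v'(1)])
    have int: "integrable M (\<lambda>t. f t (u t) \<bullet> v t)"
      using integrable_cong_AE_imp[OF int' mf ae] by simp
    have eq: "(\<integral>t. f t (u t) \<bullet> v t \<partial>M) = (\<integral>t. f t (u t) \<bullet> v' t \<partial>M)"
      by (rule integral_cong_AE[OF mf borel_measurable_integrable[OF int']]) (use ae in \<open>auto elim!: eventually_mono\<close>)
    obtain Ru where Ru: "\<And>t. t \<in> {0..T} \<Longrightarrow> norm (u t) \<le> Ru" using continuous_on_Icc_bounded[OF cu] by blast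
    obtain B where B: "\<And>k t. t \<in> {0..T} \<Longrightarrow> norm (\<phi> k t) \<le> B"
    proof -


      obtain B1 where B1: "\<And>k. norm (normLp M p (\<lambda>t. D (\<phi> k) t - wv t)) \<le> B1"
        using convergent_imp_Bseq[OF convergentI[OF \<phi>(3)]] unfolding Bseq_def by blast
      have "norm (\<phi> k t) \<le> K * (B1 + normLp M p wv)" if "t \<in> {0..T}" for k t
      proof -
        have "N (\<phi> k) \<le> B1 + normLp M p wv"
          unfolding N_def using minkowski[OF p0 memLp_diff[OF D_memLp[OF \<phi>(1)[of k]] mv(2)] mv(2)] B1[of k] by simp
        then have "K * N (\<phi> k) \<le> K * (B1 + normLp M p wv)" using Kc_pos by (intro mult_left_mono) auto
        then show ?thesis using sup_bound[OF \<phi>(1) that, of k] by linarith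
      qed
      then show ?thesis by (rule that)
    qed
    have "(\<lambda>k. lam * (\<integral>t. f t (u t) \<bullet> \<phi> k t \<partial>M)) \<longlonglongrightarrow> lam * (\<integral>t. f t (u t) \<bullet> v' t \<partial>M)"
      by (intro tendsto_mult tendsto_const f_comp_tendsto(1)[OF cu cu uniform_limit_const c\<phi> v'(1,2) Ru B])
    moreover have "(\<lambda>k. (a + b * Y) ^ (p - 1) * A2 u w (\<phi> k) (D (\<phi> k))) \<longlonglongrightarrow> (a + b * Y) ^ (p - 1) * A2 u w v wv"
      by (intro tendsto_mult tendsto_const A2_lim2 S_memLp D_memLp \<phi> mv)
    ultimately have "(a + b * Y) ^ (p - 1) * A2 u w v wv = lam * (\<integral>t. f t (u t) \<bullet> v' t \<partial>M)"
      using eqS[OF \<phi>(1)] LIMSEQ_unique by fastforce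
    then show ?thesis using int eq by simp
  qed
  have "\<kappa> * Y \<le> C"
  proof (rule LIMSEQ_le)
    show "(\<lambda>n. \<kappa> * X (z n)) \<longlonglongrightarrow> \<kappa> * Y" by (intro tendsto_intros Xlim)
    have "(\<lambda>n. C + 1 / real (Suc n) * R) \<longlonglongrightarrow> C + 0"
      using tendsto_mult_left_zero[OF LIMSEQ_inverse_real_of_nat, of R]
      by (intro tendsto_add tendsto_const) (simp add: inverse_eq_divide)
    then show "(\<lambda>n. C + 1 / real (Suc n) * R) \<longlonglongrightarrow> C" by simp
    have "\<kappa> * X (z n) \<le> C + 1 / real (Suc n) * R" for n
    proof -
      have "\<kappa> * X (z n) \<le> C + 1 / real (Suc (r n)) * N (z n)" using est[of "r n"] by (simp add: z_def)
      also have "1 / real (Suc (r n)) * N (z n) \<le> 1 / real (Suc n) * R"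
        using seq_suble[OF r, of n] zR[of n] by (intro mult_mono N_nonneg divide_left_mono) auto
      finally show ?thesis by simp
    qed
    then show "\<exists>n0. \<forall>n\<ge>n0. \<kappa> * X (z n) \<le> C + 1 / real (Suc n) * R" by blast
  qed
  moreover have "norm (u t) \<le> K * root p Y" if t: "t \<in> {0..T}" for t
  proof (rule LIMSEQ_le)
    show "(\<lambda>n. norm (z n t)) \<longlonglongrightarrow> norm (u t)" by (intro tendsto_norm tendsto_uniform_limitI[OF zul t])
    show "(\<lambda>n. K * root p (X (z n))) \<longlonglongrightarrow> K * root p Y" by (intro tendsto_intros Xlim)
    have "norm (z n t) \<le> K * root p (X (z n))" for n
    proof -
      have "N (z n) = root p (N (z n) ^ p)" using p0 by (simp add: real_root_power_cancel N_nonneg)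
      also have "\<dots> \<le> root p (X (z n))" using p0 by (intro real_root_le_mono X_ge) auto
      finally have "K * N (z n) \<le> K * root p (X (z n))" using Kc_pos by (intro mult_left_mono) auto
      then show ?thesis using sup_bound[OF zS t, of n] by linarith
    qed
    then show "\<exists>n0. \<forall>n\<ge>n0. norm (z n t) \<le> K * root p (X (z n))" by blast
  qed
  \<comment> \<open>If u vanished, testing the equation with u itself would give Y = 0, so J (z n)
    would tend to 0, against J >= \<rho>.\<close>
  moreover have "\<exists>t\<in>{0..T}. u t \<noteq> 0"
  proof (rule ccontr)
    assume "\<not> ?thesis"
    then have u0: "u t = 0" if "t \<in> {0..T}" for t using that by blast
    have "(\<integral>t. f t (u t) \<bullet> u t \<partial>M) = (\<integral>t. 0 \<partial>M)" by (intro Bochner_Integration.integral_cong) (auto simp: u0)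
    then have "(a + b * Y) ^ (p - 1) * Y = 0" using eqE[OF inE] by (simp add: Y_def)
    moreover have "0 < a + b * Y" using ab Y0 by (intro add_pos_nonneg) auto
    ultimately have Y: "Y = 0" by auto
    have "(\<integral>t. H t (u t) \<partial>M) = (\<integral>t. 0 \<partial>M)" by (intro Bochner_Integration.integral_cong) (auto simp: u0 H_zero)
    moreover have "(\<lambda>n. \<Psi> (X (z n)) - lam * Bf (z n)) \<longlonglongrightarrow> \<Psi> Y - lam * (\<integral>t. H t (u t) \<partial>M)"
      unfolding \<Psi>_def Bf_def using ab p0
      by (intro tendsto_intros Xlim f_comp_tendsto(2)[OF zc cu zul zc cu zul zb zb]) auto
    ultimately have "(\<lambda>n. J (z n)) \<longlonglongrightarrow> 0" using Y by (simp add: J_def \<Psi>_def)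
    then have "\<rho> \<le> 0" by (rule LIMSEQ_le_const) (use s(2) in \<open>auto simp: z_def\<close>)
    then show False using \<rho> by simp
  qed
  ultimately show ?thesis using inE cu w(1) eqE unfolding Y_def by (rule_tac that[of u w]) blast+
qed

end

section \<open>The sine test function\<close>

text \<open>Closed form of the integral of sin^n over [0,\<pi>]. For n = 0 the truncated n - 1 is 0,
  which gives the correct value \<pi>.\<close>

definition wallis :: "nat \<Rightarrow> real" where
  "wallis n = (if odd n then 2 else pi) * real (dfact (n - 1)) / real (dfact n)"

lemma dfact_pos: "0 < dfact n"
  by (induction n rule: dfact.induct) auto

lemma wallis_Suc_Suc: "real (n + 2) * wallis (n + 2) = real (n + 1) * wallis n"
proof -
  define c A B where "c = (if odd n then 2 else pi)" and "A = real (dfact (n - 1))" and "B = real (dfact n)"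
  have "dfact (Suc n) = (n + 1) * dfact (n - 1)" by (cases n) auto
  then have "wallis (n + 2) = c * (real (n + 1) * A) / (real (n + 2) * B)"
    by (simp add: wallis_def c_def A_def B_def algebra_simps)
  moreover have "wallis n = c * A / B" by (simp add: wallis_def c_def A_def B_def)
  ultimately show ?thesis by simp
qed

text \<open>The derivative of -cos x sin^(n+1) x, a function vanishing at both ends, yields the
  two-step recursion; the induction follows that of \<open>dfact\<close>.\<close>

lemma sin_power_has_integral: "((\<lambda>x. sin x ^ n) has_integral wallis n) {0..pi}"
proof (induction n rule: dfact.induct)
  case 1
  show ?case using has_integral_const_real[of "1::real" 0 pi] by (simp add: wallis_def)
next
  case 2
  have "(sin has_integral (- cos pi - - cos 0)) {0..pi}"
    by (intro fundamental_theorem_of_calculus)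
      (auto intro!: derivative_eq_intros simp flip: has_real_derivative_iff_has_vector_derivative)
  then show ?case by (simp add: wallis_def)
next
  case (3 n)
  have "((\<lambda>x. real (n + 2) * sin x ^ (n + 2) - real (n + 1) * sin x ^ n) has_integral
      (- cos pi * sin pi ^ (n + 1) - - cos 0 * sin 0 ^ (n + 1))) {0..pi}"
  proof (intro fundamental_theorem_of_calculus)
    fix x :: real
    have "((\<lambda>x. - cos x * sin x ^ (n + 1)) has_real_derivative
        sin x * sin x ^ (n + 1) - cos x * (real (n + 1) * sin x ^ n * cos x)) (at x within {0..pi})"
    proof -
      have c: "((\<lambda>x. - cos x) has_real_derivative sin x) (at x within {0..pi})" by (auto intro!: derivative_eq_intros)
      have "(sin has_real_derivative cos x) (at x within {0..pi})" by (auto intro!: derivative_eq_intros)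
      from DERIV_mult'[OF c DERIV_power_Suc[OF this, of n]] show ?thesis by (simp add: algebra_simps)
    qed
    moreover have "sin x * sin x ^ (n + 1) - cos x * (real (n + 1) * sin x ^ n * cos x)
        = real (n + 2) * sin x ^ (n + 2) - real (n + 1) * sin x ^ n"
    proof -
      have "cos x * (real (n + 1) * sin x ^ n * cos x) = real (n + 1) * sin x ^ n * (cos x)\<^sup>2"
        by (simp add: power2_eq_square)
      also have "(cos x)\<^sup>2 = 1 - (sin x)\<^sup>2" by (rule cos_squared_eq)
      finally show ?thesis by (simp add: algebra_simps power2_eq_square)
    qed
    ultimately show "((\<lambda>x. - cos x * sin x ^ (n + 1)) has_vector_derivative
        real (n + 2) * sin x ^ (n + 2) - real (n + 1) * sin x ^ n) (at x within {0..pi})"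
      by (simp add: has_real_derivative_iff_has_vector_derivative)
  qed simp
  from has_integral_add[OF this has_integral_mult_right[OF 3, of "real (n + 1)"]]
  have "((\<lambda>x. real (n + 2) * sin x ^ (n + 2)) has_integral real (n + 1) * wallis n) {0..pi}" by simp
  from has_integral_mult_right[OF this, of "1 / real (n + 2)"]
  have "((\<lambda>x. sin x ^ (n + 2)) has_integral real (n + 1) * wallis n / real (n + 2)) {0..pi}"
    by (simp del: of_nat_add)
  moreover have "real (n + 1) * wallis n / real (n + 2) = wallis (n + 2)"
    using wallis_Suc_Suc[of n] by (simp add: field_simps del: of_nat_add)
  ultimately show ?case by simp
qed

text \<open>Young's inequality for the product of y and c^(r-1). It gives both the Jensen-type bound
  for the sine function and the maximum of a difference of powers.\<close>

lemma powr_tangent: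
  fixes y c r :: real assumes "0 \<le> y" "0 < c" "1 < r"
  shows "c powr r + r * c powr (r - 1) * (y - c) \<le> y powr r"
proof -
  define r' where "r' = r / (r - 1)"
  have r': "1 < r'" "1 / r + 1 / r' = 1" using assms(3) by (auto simp: r'_def field_simps)
  have "y * c powr (r - 1) \<le> y powr r / r + (c powr (r - 1)) powr r' / r'"
    using Youngs_inequality[OF assms(3) r' assms(1)] by simp
  also have "(c powr (r - 1)) powr r' = c powr r" using assms(3) by (simp add: powr_powr r'_def)
  finally have "r * (y * c powr (r - 1)) \<le> r * (y powr r / r + c powr r / r')" using assms(3) by (intro mult_left_mono) auto
  also have "\<dots> = y powr r + c powr r * (r / r')" using assms(3) by (simp add: field_simps)
  also have "r / r' = r - 1" using assms(3) by (simp add: r'_def)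
  finally have "r * (y * c powr (r - 1)) \<le> y powr r + c powr r * (r - 1)" .
  moreover have "c powr (r - 1) * c = c powr r" using powr_mult_base[of c "r - 1"] assms(2) by (simp add: mult.commute)
  then have "r * c powr (r - 1) * (y - c) = r * (y * c powr (r - 1)) - r * c powr r"
    by (simp add: algebra_simps)
  moreover have "c powr r * (r - 1) = r * c powr r - c powr r" by (simp add: algebra_simps)
  ultimately show ?thesis by linarith
qed

lemma powr_inverse_power: "0 < x \<Longrightarrow> 0 < n \<Longrightarrow> (x powr (1 / real n)) ^ n = x"
  by (simp add: powr_realpow[symmetric] powr_powr)

section \<open>The sine function and the constants \<open>Dc\<close> and \<open>Gc\<close>\<close>

context frac
begin

text \<open>Normalised so that \<open>|tf'| \<le> 1\<close>; then \<open>Dc\<close> is its \<open>L^p\<close> norm and \<open>Gc\<close> bounds its norm \<open>N\<close>.\<close>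

definition tf :: "'a::euclidean_space \<Rightarrow> real \<Rightarrow> 'a" where
  "tf b0 t = (T / pi * sin (pi * t / T)) *\<^sub>R b0"

lemma tf_S: "tf b0 \<in> S"
proof -
  \<comment> \<open>Each differentiation shifts the phase by \<pi>/2 and multiplies by
    \<pi>/T.\<close>
  define G where "G k t = (T / pi * (pi / T) ^ k * sin (pi * t / T + real k * (pi / 2))) *\<^sub>R b0" for k t
  have "(G k has_vector_derivative G (Suc k) t) (at t)" for k t
  proof -
    have "((\<lambda>t. T / pi * (pi / T) ^ k * sin (pi * t / T + real k * (pi / 2))) has_real_derivative
        T / pi * (pi / T) ^ k * (cos (pi * t / T + real k * (pi / 2)) * (pi / T))) (at t)"
      using T by (auto intro!: derivative_eq_intros)
    moreover have "sin (pi * t / T + real (Suc k) * (pi / 2)) = cos (pi * t / T + real k * (pi / 2))"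
    proof -
      have "pi * t / T + real (Suc k) * (pi / 2) = (pi * t / T + real k * (pi / 2)) + pi / 2" by (simp add: algebra_simps add_divide_distrib)
      then show ?thesis by (simp only: sin_add) simp
    qed
    moreover have "T / pi * (pi / T) ^ k * (c * (pi / T)) = T / pi * (pi / T) ^ Suc k * c" for c by simp
    ultimately have "((\<lambda>t. T / pi * (pi / T) ^ k * sin (pi * t / T + real k * (pi / 2))) has_vector_derivative
        T / pi * (pi / T) ^ Suc k * sin (pi * t / T + real (Suc k) * (pi / 2))) (at t)"
      by (simp only: has_real_derivative_iff_has_vector_derivative)
    from bounded_linear.has_vector_derivative[OF bounded_linear_scaleR_left this]
    show ?thesis by (simp only: G_def[abs_def])
  qed
  moreover have "G 0 = tf b0" by (simp add: G_def tf_def fun_eq_iff)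
  ultimately have "smooth_fun (tf b0)" unfolding smooth_fun_iff by blast
  then show ?thesis using T by (simp add: S_def C0inf_def tf_def)
qed

lemma pq_pos: "0 < real p * (1 - \<alpha>) + 1"
  using \<alpha> by (simp add: add_nonneg_pos)

text \<open>The derivative is the fractional integral of order 1 - \<alpha> of a cosine, hence at
  most that of the constant 1. The point t = 0 is left out: for \<alpha> = 1 the right side would
  contain \<open>0 powr 0\<close>, which is \<open>0\<close>.\<close>

lemma D_tf:
  assumes b0: "norm b0 = 1" and t: "0 < t" "t \<le> T" shows "norm (D (tf b0) t) \<le> t powr (1 - \<alpha>) / Gamma (2 - \<alpha>)"
proof -
  define \<phi>' where "\<phi>' t = cos (pi * t / T) *\<^sub>R b0" for t
  have d: "(tf b0 has_vector_derivative \<phi>' t) (at t)" for t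
  proof -
    have "((\<lambda>t. T / pi * sin (pi * t / T)) has_real_derivative cos (pi * t / T)) (at t)"
      using T by (auto intro!: derivative_eq_intros)
    then have "((\<lambda>t. T / pi * sin (pi * t / T)) has_vector_derivative cos (pi * t / T)) (at t)"
      by (simp add: has_real_derivative_iff_has_vector_derivative)
    from bounded_linear.has_vector_derivative[OF bounded_linear_scaleR_left this]
    show ?thesis by (simp add: tf_def[abs_def] \<phi>'_def)
  qed
  have c: "continuous_on UNIV \<phi>'" unfolding \<phi>'_def[abs_def] using T by (intro continuous_intros) auto
  have n: "norm (\<phi>' s) \<le> 1" for s using b0 by (simp add: \<phi>'_def)
  have D: "D (tf b0) t = (if \<alpha> = 1 then \<phi>' t else rl (1 - \<alpha>) \<phi>' t)"
    by (rule D_eq(1)[OF d c]) (use t in \<open>auto simp: tf_def\<close>)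
  show ?thesis
  proof (cases "\<alpha> = 1")
    case True
    then show ?thesis using D n[of t] t by simp
  next
    case False
    then have a: "0 < 1 - \<alpha>" using \<alpha> by simp
    have "norm (rlk (1 - \<alpha>) \<phi>' t) \<le> 1 * (t powr (1 - \<alpha>) / (1 - \<alpha>))"
      by (rule rlk_integrable(2)[OF a _ borel_measurable_continuous_onI[OF c] n]) (use t in auto)
    then have "norm (D (tf b0) t) \<le> 1 / Gamma (1 - \<alpha>) * (t powr (1 - \<alpha>) / (1 - \<alpha>))"
      using False D Gamma_real_pos[OF a] divide_right_mono[of "norm (rlk (1 - \<alpha>) \<phi>' t)" "t powr (1 - \<alpha>) / (1 - \<alpha>)" "Gamma (1 - \<alpha>)"]
      by (simp add: rl_def mult.commute)
    also have "\<dots> = t powr (1 - \<alpha>) / Gamma (2 - \<alpha>)"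
      using Gamma_plus1[of "1 - \<alpha>"] a by (simp add: nonpos_Ints_def field_simps)
    finally show ?thesis .
  qed
qed

lemma Gc_power: "Gc T p \<alpha> ^ p = T powr (real p * (1 - \<alpha>) + 1) / (Gamma (2 - \<alpha>) ^ p * (real p * (1 - \<alpha>) + 1))"
proof -
  have g: "0 < Gamma (2 - \<alpha>)" using \<alpha> by (intro Gamma_real_pos) simp
  have e: "real p + 1 - real p * \<alpha> = real p * (1 - \<alpha>) + 1" by (simp add: algebra_simps)
  have "0 < T powr (real p * (1 - \<alpha>) + 1) / (Gamma (2 - \<alpha>) ^ p * (real p * (1 - \<alpha>) + 1))"
    using g T pq_pos by simp
  from powr_inverse_power[OF this, of p] show ?thesis using g p
    by (simp add: Gc_def e powr_realpow add.commute[of 1])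
qed

lemma N_tf: assumes b0: "norm (b0::'a::euclidean_space) = 1" shows "N (tf b0) ^ p \<le> Gc T p \<alpha> ^ p" "N (tf b0) \<le> Gc T p \<alpha>"
proof -
  have p0: "0 < p" using p by simp
  have hi: "((\<lambda>t. t powr (real p * (1 - \<alpha>))) has_integral (T powr (real p * (1 - \<alpha>) + 1) / (real p * (1 - \<alpha>) + 1))) {0..T}"
    using pq_pos T by (intro has_integral_powr_from_0) auto
  have i: "integrable M (\<lambda>t. t powr (real p * (1 - \<alpha>)))"
    by (rule integrable_M_nonneg) (use hi in auto)
  have v: "(\<integral>t. t powr (real p * (1 - \<alpha>)) \<partial>M) = T powr (real p * (1 - \<alpha>) + 1) / (real p * (1 - \<alpha>) + 1)"
    using LINT_eq_integral(1)[OF i] integral_unique[OF hi] by simp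
  \<comment> \<open>The pointwise bound \<open>D_tf\<close> is available only for t > 0.\<close>
  have ae0: "AE t in M. t \<noteq> 0"
    using AE_lborel_singleton[of "0::real"] by (subst AE_restrict_space_iff) (auto intro: AE_completion elim!: eventually_mono)
  have "N (tf b0) ^ p = (\<integral>t. norm (D (tf b0) t) ^ p \<partial>M)" unfolding N_def by (rule normLp_power[OF p0])
  also have "\<dots> \<le> (\<integral>t. t powr (real p * (1 - \<alpha>)) / Gamma (2 - \<alpha>) ^ p \<partial>M)"
  proof (rule integral_mono_AE)
    show "integrable M (\<lambda>t. norm (D (tf b0) t) ^ p)" by (rule memLp_int[OF D_memLp[OF tf_S]])
    show "integrable M (\<lambda>t. t powr (real p * (1 - \<alpha>)) / Gamma (2 - \<alpha>) ^ p)" using i by simp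
    show "AE t in M. norm (D (tf b0) t) ^ p \<le> t powr (real p * (1 - \<alpha>)) / Gamma (2 - \<alpha>) ^ p"
      using ae0 AE_space
    proof eventually_elim
      case (elim t)
      then have t: "0 < t" "t \<le> T" by auto
      have "norm (D (tf b0) t) ^ p \<le> (t powr (1 - \<alpha>) / Gamma (2 - \<alpha>)) ^ p"
        by (intro power_mono D_tf[OF b0 t]) simp
      also have "\<dots> = t powr (real p * (1 - \<alpha>)) / Gamma (2 - \<alpha>) ^ p"
        using t by (simp add: power_divide powr_realpow[symmetric] powr_powr mult.commute)
      finally show ?case .
    qed
  qed
  also have "\<dots> = Gc T p \<alpha> ^ p" unfolding Gc_power using v by simp
  finally show le: "N (tf b0) ^ p \<le> Gc T p \<alpha> ^ p" .
  have "0 \<le> Gc T p \<alpha>" by (simp add: Gc_def)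
  then show "N (tf b0) \<le> Gc T p \<alpha>" using le p0 by (simp add: power_mono_iff N_nonneg)
qed

text \<open>Unifies the two parities in \<open>Dc\<close>: for even p the value
  \<open>wallis p\<close> contains a factor \<pi>, which lowers the power of \<pi> in the
  denominator by one.\<close>

lemma Dc_power: "Dc T p ^ p = (T / pi) ^ (p + 1) * wallis p"
proof -
  have p0: "0 < p" using p by simp
  note * = powr_inverse_power[OF _ p0]
  have T': "T powr (real p + 1) = T ^ (p + 1)" "pi powr (real p + 1) = pi ^ (p + 1)" "pi powr real p = pi ^ p"
    using T powr_realpow[of T "p + 1"] powr_realpow[of pi "p + 1"] powr_realpow[of pi p] by (simp_all add: add.commute)
  have d: "0 < real (dfact p)" "0 < real (dfact (p - 1))" using dfact_pos by auto
  show ?thesis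
  proof (cases "odd p")
    case True
    have "Dc T p = (T powr (real p + 1) / pi powr (real p + 1) * (2 * real (dfact (p - 1)) / real (dfact p))) powr (1 / real p)"
      using True by (simp add: Dc_def)
    then show ?thesis using True T d unfolding T' by (simp add: * wallis_def power_divide)
  next
    case False
    have "Dc T p = (T powr (real p + 1) / pi powr real p * (real (dfact (p - 1)) / real (dfact p))) powr (1 / real p)"
      using False by (simp add: Dc_def)
    then show ?thesis using False T d unfolding T' by (simp add: * wallis_def power_divide field_simps)
  qed
qed

lemma tf_power_integral:
  assumes b0: "norm b0 = 1" shows "(\<integral>t. norm (tf b0 t) ^ p \<partial>M) = Dc T p ^ p"
proof -
  have n: "norm (tf b0 t) ^ p = (T / pi) ^ p * sin (pi / T * t + 0) ^ p" if "t \<in> {0..T}" for t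
  proof -
    have "pi * t / T \<le> pi * 1" using that T by (simp add: field_simps)
    then have "0 \<le> sin (pi * t / T)" using that T by (intro sin_ge_zero) auto
    then show ?thesis using b0 T by (simp add: tf_def abs_mult power_mult_distrib power_divide)
  qed
  have "((\<lambda>t. sin (pi / T * t + 0) ^ p) has_integral (1 / \<bar>pi / T\<bar>) *\<^sub>R wallis p) ((\<lambda>x. (1 / (pi / T)) * x + - ((1 / (pi / T)) * 0)) ` {0..pi})"
    using has_integral_affinity[of "\<lambda>x. sin x ^ p" "wallis p" 0 pi "pi / T" 0] sin_power_has_integral[of p] T
    by simp
  moreover have "(\<lambda>x. (1 / (pi / T)) * x + - ((1 / (pi / T)) * 0)) ` {0..pi} = {0..T}"
  proof -
    have "(\<lambda>x. (1 / (pi / T)) * x + - ((1 / (pi / T)) * 0)) = (*) (T / pi)" by (auto simp: fun_eq_iff)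
    then show ?thesis using T image_mult_atLeastAtMost[of "T / pi" 0 pi] by simp
  qed
  ultimately have "((\<lambda>t. sin (pi / T * t + 0) ^ p) has_integral T / pi * wallis p) {0..T}" using T by simp
  from has_integral_mult_right[OF this, of "(T / pi) ^ p"]
  have hi: "((\<lambda>t. (T / pi) ^ p * sin (pi / T * t + 0) ^ p) has_integral (T / pi) ^ (p + 1) * wallis p) {0..T}" by (simp add: mult_ac)
  have "integral {0..T} (\<lambda>t. norm (tf b0 t) ^ p) = integral {0..T} (\<lambda>t. (T / pi) ^ p * sin (pi / T * t + 0) ^ p)"
    by (intro integral_cong n)
  then show ?thesis
    using integral_unique[OF hi] LINT_eq_integral(1)[OF memLp_int[OF continuous_memLp[OF S_continuous[OF tf_S[of b0]]]]]
    by (simp add: Dc_power)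
qed

lemma Dc_pos: "0 < Dc T p"
proof -
  have "0 < real (dfact p)" "0 < real (dfact (p - 1))" using dfact_pos by auto
  then show ?thesis using T by (auto simp: Dc_def)
qed

lemma Gc_pos: "0 < Gc T p \<alpha>"
proof -
  have g: "0 < Gamma (2 - \<alpha>)" using \<alpha> by (intro Gamma_real_pos) simp
  have "0 < real p + 1 - real p * \<alpha>" using pq_pos by (simp add: algebra_simps)
  then show ?thesis using g T by (simp add: Gc_def)
qed

lemma G0c_pos: "0 < G0c T p \<alpha>" using Kc_pos Gc_pos by (simp add: G0c_def)

lemma tf_sup: assumes "norm (b0::'a::euclidean_space) = 1" "t \<in> {0..T}" shows "norm (tf b0 t) \<le> G0c T p \<alpha>"
  using sup_bound[OF tf_S assms(2), of b0] mult_left_mono[OF N_tf(2)[OF assms(1)] less_imp_le[OF Kc_pos]]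
  unfolding G0c_def by linarith

text \<open>Jensen's inequality for the power r = q/p, obtained by integrating the tangent of y^r at
  the mean c of |tf|^p; its linear term integrates to 0.\<close>

lemma tf_powr_integral:
  assumes b0: "norm b0 = 1" and q: "real p < q"
  shows "T powr (1 - q / real p) * Dc T p powr q \<le> (\<integral>t. norm (tf b0 t) powr q \<partial>M)" "integrable M (\<lambda>t. norm (tf b0 t) powr q)"
proof -
  have p0: "0 < real p" using p by simp
  define r where "r = q / real p"
  have r: "1 < r" using q p0 by (simp add: r_def)
  define c where "c = Dc T p ^ p / T"
  have c: "0 < c" using Dc_pos T by (simp add: c_def)
  have cont: "continuous_on {0..T} (tf b0)" by (rule S_continuous[OF tf_S])
  have "continuous_on {0..T} (\<lambda>t. norm (tf b0 t) powr q)"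
    using q p0 by (intro continuous_on_powr' continuous_intros cont) auto
  then show i: "integrable M (\<lambda>t. norm (tf b0 t) powr q)" by (rule lborel_eq_M(2))
  have ip: "integrable M (\<lambda>t. norm (tf b0 t) ^ p)" by (rule memLp_int[OF continuous_memLp[OF cont]])
  have ic: "integrable M (\<lambda>t. x)" for x :: real by (intro finite_measure.integrable_const finite_M)
  have "T * c powr r = (\<integral>t. c powr r + r * c powr (r - 1) * (norm (tf b0 t) ^ p - c) \<partial>M)"
    using ip ic T tf_power_integral[OF b0] by (simp add: measure_restrict_space c_def)
  also have "\<dots> \<le> (\<integral>t. norm (tf b0 t) powr q \<partial>M)"
  proof (rule integral_mono[OF _ i])
    show "integrable M (\<lambda>t. c powr r + r * c powr (r - 1) * (norm (tf b0 t) ^ p - c))" using ip ic by simp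
    fix t
    have "c powr r + r * c powr (r - 1) * (norm (tf b0 t) ^ p - c) \<le> (norm (tf b0 t) ^ p) powr r"
      by (rule powr_tangent[OF _ c r]) simp
    also have "(norm (tf b0 t) ^ p) powr r = norm (tf b0 t) powr q"
      using p0 by (cases "norm (tf b0 t) = 0") (simp_all add: powr_realpow[symmetric] powr_powr r_def)
    finally show "c powr r + r * c powr (r - 1) * (norm (tf b0 t) ^ p - c) \<le> norm (tf b0 t) powr q" .
  qed
  also have "T * c powr r = T powr (1 - q / real p) * Dc T p powr q"
  proof -
    have "c powr r = Dc T p powr q / T powr r"
      using Dc_pos T p0 by (simp add: c_def powr_divide powr_realpow[symmetric] powr_powr r_def)
    then show ?thesis using T by (simp add: powr_diff r_def)
  qed
  finally show "T powr (1 - q / real p) * Dc T p powr q \<le> (\<integral>t. norm (tf b0 t) powr q \<partial>M)" .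
qed

end

section \<open>Mountain pass geometry of the energy\<close>

text \<open>The maximum is attained at \<open>s^(q-p) = A / (B q)\<close>.\<close>

lemma power_diff_max:
  fixes A B s p q :: real
  assumes AB: "0 < A" "0 < B" and s: "0 \<le> s" and pq: "0 < p" "p < q"
  shows "A * s powr p / p - B * s powr q
    \<le> A powr (q / (q - p)) * ((B * q) powr (- (p / (q - p))) / p - B * (B * q) powr (- (q / (q - p))))"
proof -
  define r where "r = q / p"
  have r: "1 < r" using pq by (simp add: r_def)
  define z where "z = A / (B * q)"
  have z: "0 < z" using AB pq by (simp add: z_def)
  define c where "c = z powr (p / (q - p))"
  have c: "0 < c" using z by (simp add: c_def)
  have "c powr (r - 1) = z"
  proof -
    have "p / (q - p) * (r - 1) = 1" using pq by (simp add: r_def field_simps)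
    then have "c powr (r - 1) = z powr 1" by (simp only: c_def powr_powr)
    then show ?thesis using z by simp
  qed
  then have "B * (r * c powr (r - 1)) = A / p" using AB pq by (simp add: r_def z_def)
  moreover have "B * (c powr r + r * c powr (r - 1) * (s powr p - c)) \<le> B * (s powr p) powr r"
    using AB by (intro mult_left_mono powr_tangent c r) auto
  moreover have "(s powr p) powr r = s powr q" using pq by (simp add: powr_powr r_def)
  moreover have "B * (c powr r + r * c powr (r - 1) * (s powr p - c)) = B * c powr r + B * (r * c powr (r - 1)) * (s powr p - c)"
    by (simp add: algebra_simps)
  ultimately have "B * c powr r + A / p * (s powr p - c) \<le> B * s powr q" by simp
  then have "A * s powr p / p - B * s powr q \<le> A * c / p - B * c powr r" by (simp add: algebra_simps diff_divide_distrib)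
  also have "\<dots> = A powr (q / (q - p)) * ((B * q) powr (- (p / (q - p))) / p - B * (B * q) powr (- (q / (q - p))))"
  proof -
    have e: "q / (q - p) = 1 + p / (q - p)" using pq by (simp add: field_simps)
    have "A * c = A powr (q / (q - p)) * (B * q) powr (- (p / (q - p)))"
      using AB pq unfolding e by (simp add: c_def z_def powr_divide powr_add powr_minus_divide)
    moreover have "c powr r = A powr (q / (q - p)) * (B * q) powr (- (q / (q - p)))"
      using AB pq by (simp add: c_def z_def powr_divide powr_powr powr_minus_divide r_def)
    ultimately show ?thesis by (simp add: algebra_simps)
  qed
  finally show ?thesis .
qed

text \<open>Evaluates the maximum in \<open>power_diff_max\<close> for A = lam^(1/q) X and B = lam
  M1 Y. The powers of lam combine as (1/q) q/(q-p) - p/(q-p) = -(p-1)/(q-p).\<close>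

lemma mountain_level_constant:
  fixes lam X Y M1 p q :: real
  assumes pos: "0 < lam" "0 < X" "0 < Y" "0 < M1" and pq: "0 < p" "p < q"
  shows "(lam powr (1 / q) * X) powr (q / (q - p)) *
      ((lam * M1 * Y * q) powr (- (p / (q - p))) / p - lam * M1 * Y * (lam * M1 * Y * q) powr (- (q / (q - p))))
    = (1 / (p * (M1 * q) powr (p / (q - p))) - M1 / (M1 * q) powr (q / (q - p)))
      * (X powr (1 / p) / Y powr (1 / q)) powr (p * q / (q - p)) * lam powr (- (p - 1) / (q - p))"
proof -
  define e1 where "e1 = p / (q - p)"
  define W where "W = lam * Y"
  have W: "0 < W" using pos by (simp add: W_def)
  have e2: "q / (q - p) = 1 + e1" using pq by (simp add: e1_def field_simps)
  define Z where "Z = M1 * q"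
  have Z: "0 < Z" using pos pq by (simp add: Z_def)
  have eq: "lam * M1 * Y * q = W * Z" by (simp add: W_def Z_def)
  have "(lam * M1 * Y * q) powr (- e1) / p - lam * M1 * Y * (lam * M1 * Y * q) powr (- (1 + e1))
      = W powr (- e1) * (1 / (p * (M1 * q) powr e1) - M1 / (M1 * q) powr (1 + e1))"
  proof -
    have "(lam * M1 * Y * q) powr (- e1) / p = W powr (- e1) * (1 / (p * Z powr e1))"
      unfolding eq using W Z by (simp add: powr_mult powr_minus_divide)
    moreover have w: "W * (W powr (- (1 + e1))) = W powr (- e1)"
      using W powr_mult_base[of W "- (1 + e1)"] by simp
    have "lam * M1 * Y * (lam * M1 * Y * q) powr (- (1 + e1)) = M1 * (W * (W powr (- (1 + e1)))) * Z powr (- (1 + e1))"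
      unfolding eq powr_mult by (simp only: W_def mult_ac)
    then have "lam * M1 * Y * (lam * M1 * Y * q) powr (- (1 + e1)) = W powr (- e1) * (M1 / Z powr (1 + e1))"
      unfolding w powr_minus_divide[of Z] by simp
    ultimately show ?thesis unfolding Z_def[symmetric] by (simp only: right_diff_distrib)
  qed
  moreover have "(lam powr (1 / q) * X) powr (1 + e1) * W powr (- e1)
      = (X powr (1 / p) / Y powr (1 / q)) powr (p * q / (q - p)) * lam powr (- (p - 1) / (q - p))"
  proof -
    have "1 / q * (1 + e1) + - e1 = - (p - 1) / (q - p)"
      using pq by (simp add: e1_def divide_simps)
    then have l: "lam powr (1 / q * (1 + e1)) * lam powr (- e1) = lam powr (- (p - 1) / (q - p))"
      by (simp only: powr_add[symmetric])
    have "1 / p * (p * q / (q - p)) = 1 + e1" "1 / q * (p * q / (q - p)) = e1"       unfolding e2[symmetric] unfolding e1_def using pq by simp_all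
    then have xy: "(X powr (1 / p) / Y powr (1 / q)) powr (p * q / (q - p)) = X powr (1 + e1) * Y powr (- e1)"
      using pos by (simp add: powr_divide powr_powr powr_minus_divide)
    have "(lam powr (1 / q) * X) powr (1 + e1) * W powr (- e1) = (lam powr (1 / q * (1 + e1)) * X powr (1 + e1)) * (lam powr (- e1) * Y powr (- e1))"
      using pos by (simp add: powr_mult powr_powr W_def)
    also have "\<dots> = (X powr (1 + e1) * Y powr (- e1)) * (lam powr (1 / q * (1 + e1)) * lam powr (- e1))" by (simp only: mult_ac)
    finally show ?thesis using l xy by simp
  qed
  ultimately show ?thesis unfolding e2 e1_def[symmetric] by (simp add: mult_ac)
qed

locale kirchhoff_MP = kirchhoff_AR T \<alpha> p H f a b lam V Vs \<theta>
  for T \<alpha> :: real and p :: nat and H :: "real \<Rightarrow> 'a::euclidean_space \<Rightarrow> real" and f a b lam V Vs \<theta> +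
  fixes M1 M2 q1 q2 \<delta> :: real
  assumes M12: "0 < M1" "0 < M2" and q12: "real p < q1" "real p < q2" and \<delta>: "0 < \<delta>"
    and H_range: "\<And>t x. t \<in> {0..T} \<Longrightarrow> 0 \<le> H t x \<and> H t x \<le> M2 * norm x powr q2"
    and H_low: "AE t in lebesgue_on {0..T}. \<forall>x. norm x \<le> \<delta> \<longrightarrow> M1 * norm x powr q1 \<le> H t x"
begin

text \<open>\<open>XB\<close> bounds \<open>X\<close> at the end point \<open>(\<delta> / G0c) tf\<close> of the ray,
  and \<open>M1 * YB\<close> bounds the potential part from below there.\<close>

definition XB :: real where "XB = (\<delta> / G0c T p \<alpha>) ^ p * (max 1 Vs * (Dc T p ^ p + Gc T p \<alpha> ^ p))"

definition YB :: real where "YB = (\<delta> / G0c T p \<alpha>) powr q1 * (T powr (1 - q1 / real p) * Dc T p powr q1)"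

lemma XB_pos: "0 < XB" using \<delta> G0c_pos Dc_pos Gc_pos by (simp add: XB_def add_pos_pos)

lemma YB_pos: "0 < YB" using \<delta> G0c_pos Dc_pos T by (simp add: YB_def)

lemma \<Psi>_mono: "0 \<le> x \<Longrightarrow> x \<le> y \<Longrightarrow> \<Psi> x \<le> \<Psi> y"
  unfolding \<Psi>_def using ab by (intro divide_right_mono diff_right_mono power_mono) auto

lemma \<Psi>_le: assumes "0 \<le> x" shows "\<Psi> x \<le> (a + b * x) ^ (p - 1) * x / real p"
  using \<Psi>_tangent[OF order_refl assms] by (simp add: \<Psi>_def)

lemma J_lower:
  assumes u: "u \<in> SS"
  shows "a ^ (p - 1) * N u ^ p / (real p)\<^sup>2 - lam * (T * (M2 * (K * N u) powr q2)) \<le> J u"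
proof -
  have "a ^ (p - 1) * N u ^ p \<le> (a + b * X u) ^ (p - 1) * X u"
    using ab coeff_pos[of u] X_ge[of u] by (intro mult_mono power_mono) (auto simp: N_nonneg)
  then have "a ^ (p - 1) * N u ^ p / (real p)\<^sup>2 \<le> (a + b * X u) ^ (p - 1) * X u / (real p)\<^sup>2" by (intro divide_right_mono) auto
  also have "\<dots> \<le> \<Psi> (X u)" by (rule \<Psi>_ge[OF X_nonneg])
  finally have 1: "a ^ (p - 1) * N u ^ p / (real p)\<^sup>2 \<le> \<Psi> (X u)" .
  have q2: "0 \<le> q2" using q12 by (meson less_imp_le of_nat_0_le_iff order_trans)
  have "Bf u \<le> (\<integral>t. M2 * (K * N u) powr q2 \<partial>M)"
    unfolding Bf_def
  proof (rule integral_mono[OF H_comp_integrable[OF S_continuous[OF u]]])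
    show "integrable M (\<lambda>t. M2 * (K * N u) powr q2)" by (intro finite_measure.integrable_const finite_M)
    fix t assume "t \<in> space M"
    then have t: "t \<in> {0..T}" by simp
    have "H t (u t) \<le> M2 * norm (u t) powr q2" using H_range[OF t] by blast
    also have "\<dots> \<le> M2 * (K * N u) powr q2" using M12 q2 sup_bound[OF u t] by (intro mult_left_mono powr_mono2) auto
    finally show "H t (u t) \<le> M2 * (K * N u) powr q2" .
  qed
  also have "\<dots> = T * (M2 * (K * N u) powr q2)" using T by (simp add: measure_restrict_space)
  finally have "lam * Bf u \<le> lam * (T * (M2 * (K * N u) powr q2))" using lam by (intro mult_left_mono)
  then show ?thesis using 1 by (simp add: J_def)
qed

lemma small_sphere:
  obtains r0 where "0 < r0" "\<And>u. u \<in> SS \<Longrightarrow> N u \<le> r0 \<Longrightarrow> a ^ (p - 1) / (2 * (real p)\<^sup>2) * N u ^ p \<le> J u"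
proof -
  define c1 where "c1 = a ^ (p - 1) / (real p)\<^sup>2"
  \<comment> \<open>The summand 1 keeps the constant positive when lam = 0. The radius
    \<open>r0\<close> below is where \<open>c2\<close> r^(q2-p) equals half of
    \<open>c1\<close>.\<close>
  define c2 where "c2 = lam * (T * (M2 * K powr q2)) + 1"
  have c1: "0 < c1" using ab p by (simp add: c1_def)
  have c2: "0 < c2" using lam T M12 by (simp add: c2_def add_nonneg_pos)
  define r0 where "r0 = (c1 / 2 / c2) powr (1 / (q2 - real p))"
  have r0: "0 < r0" using c1 c2 by (simp add: r0_def)
  have "c1 / 2 * N u ^ p \<le> J u" if u: "u \<in> SS" and r: "N u \<le> r0" for u
  proof (cases "N u = 0")
    case True
    then show ?thesis using J_lower[OF u] p by (simp add: power_0_left)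
  next
    case False
    then have n: "0 < N u" using N_nonneg[of u] by simp
    have "N u powr (q2 - real p) \<le> r0 powr (q2 - real p)" using n r q12 by (intro powr_mono2) auto
    also have "\<dots> = c1 / 2 / c2" using q12 c1 c2 by (simp add: r0_def powr_powr)
    finally have "c2 * N u powr (q2 - real p) \<le> c1 / 2" using c2 by (simp add: field_simps)
    then have "c2 * N u powr (q2 - real p) * N u ^ p \<le> c1 / 2 * N u ^ p" using n by (intro mult_right_mono) auto
    moreover have "N u powr (q2 - real p) * N u ^ p = N u powr q2"
      using n by (simp add: powr_realpow[symmetric] powr_add[symmetric])
    ultimately have 1: "c2 * N u powr q2 \<le> c1 / 2 * N u ^ p" by (simp add: mult.assoc)
    have "(K * N u) powr q2 = K powr q2 * N u powr q2" using n Kc_pos by (simp add: powr_mult)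
    then have "lam * (T * (M2 * (K * N u) powr q2)) = (c2 - 1) * N u powr q2" by (simp add: c2_def mult_ac)
    also have "\<dots> \<le> c2 * N u powr q2" by (intro mult_right_mono) auto
    also note 1
    finally have "lam * (T * (M2 * (K * N u) powr q2)) \<le> c1 / 2 * N u ^ p" .
    moreover have "c1 * N u ^ p - lam * (T * (M2 * (K * N u) powr q2)) \<le> J u" using J_lower[OF u] by (simp add: c1_def)
    ultimately show ?thesis by linarith
  qed
  moreover have "c1 / 2 = a ^ (p - 1) / (2 * (real p)\<^sup>2)" by (simp add: c1_def)
  ultimately show ?thesis using that[OF r0] by (simp only:)
qed

text \<open>The scaling \<delta> / \<open>G0c\<close> keeps the whole ray in the ball of radius
  \<delta>, because \<open>G0c\<close> bounds the sine function; so the lower growth bound applies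
  along it. The factor \<open>max 1 Vs\<close> covers the derivative part and the V part of X at
  once.\<close>

lemma J_ray:
  fixes b0 :: 'a
  assumes b0: "norm b0 = 1" and s: "s \<in> {0..1}"
  defines "e \<equiv> (\<delta> / G0c T p \<alpha>) *\<^sub>R tf b0"
  shows "J (s *\<^sub>R e) \<le> \<Psi> (s ^ p * XB) - lam * (M1 * YB * s powr q1)"
proof -
  define r where "r = \<delta> / G0c T p \<alpha>"
  have r: "0 < r" using \<delta> G0c_pos by (simp add: r_def)
  have p0: "0 < p" using p by simp
  define u where "u = s *\<^sub>R e"
  have u_eq: "u = (s * r) *\<^sub>R tf b0" by (simp add: u_def e_def r_def)
  have uS: "u \<in> SS" unfolding u_eq by (intro S_scale tf_S)
  have sr: "0 \<le> s * r" "s * r \<le> r" using s r by (auto simp: mult_left_le_one_le)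
  have X1: "X u \<le> s ^ p * XB"
  proof -
    have "(\<integral>t. norm (D u t) ^ p \<partial>M) = N u ^ p" unfolding N_def by (rule normLp_power[OF p0, symmetric])
    also have "N u ^ p = (s * r) ^ p * N (tf b0) ^ p"
      unfolding u_eq N_scale[OF tf_S] using sr by (simp add: power_mult_distrib abs_of_nonneg)
    also have "\<dots> \<le> (s * r) ^ p * (max 1 Vs * Gc T p \<alpha> ^ p)"
    proof (intro mult_left_mono)
      have "1 * Gc T p \<alpha> ^ p \<le> max 1 Vs * Gc T p \<alpha> ^ p" using Gc_pos by (intro mult_right_mono) auto
      then show "N (tf b0) ^ p \<le> max 1 Vs * Gc T p \<alpha> ^ p" using N_tf(1)[OF b0] by linarith
    qed (use sr in simp)
    finally have 1: "(\<integral>t. norm (D u t) ^ p \<partial>M) \<le> (s * r) ^ p * (max 1 Vs * Gc T p \<alpha> ^ p)" .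
    have "(\<integral>t. V t * norm (u t) ^ p \<partial>M) \<le> (\<integral>t. max 1 Vs * ((s * r) ^ p * norm (tf b0 t) ^ p) \<partial>M)"
    proof (rule integral_mono)
      show "integrable M (\<lambda>t. V t * norm (u t) ^ p)" by (intro WV.weighted_integrable memLp_int S_memLp uS)
      show "integrable M (\<lambda>t. max 1 Vs * ((s * r) ^ p * norm (tf b0 t) ^ p))"
        using memLp_int[OF S_memLp[OF tf_S[of b0]]] by simp
      fix t assume "t \<in> space M"
      then have t: "t \<in> {0..T}" by simp
      have "norm (u t) ^ p = (s * r) ^ p * norm (tf b0 t) ^ p" using sr by (simp add: u_eq power_mult_distrib abs_of_nonneg)
      moreover have "V t * norm (u t) ^ p \<le> max 1 Vs * norm (u t) ^ p" using V_bound[OF t] by (intro mult_right_mono) auto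
      ultimately show "V t * norm (u t) ^ p \<le> max 1 Vs * ((s * r) ^ p * norm (tf b0 t) ^ p)" by simp
    qed
    also have "\<dots> = max 1 Vs * ((s * r) ^ p * Dc T p ^ p)" using tf_power_integral[OF b0] by simp
    finally have "X u \<le> (s * r) ^ p * (max 1 Vs * Gc T p \<alpha> ^ p) + max 1 Vs * ((s * r) ^ p * Dc T p ^ p)"
      unfolding X_eq using 1 by linarith
    also have "\<dots> = s ^ p * XB" by (simp add: XB_def r_def[symmetric] power_mult_distrib algebra_simps)
    finally show ?thesis .
  qed
  have "M1 * YB * s powr q1 \<le> Bf u"
  proof -
    have small: "norm (u t) \<le> \<delta>" if "t \<in> {0..T}" for t
    proof -
      have "norm (u t) = s * r * norm (tf b0 t)" using sr by (simp add: u_eq abs_of_nonneg)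
      also have "\<dots> \<le> r * G0c T p \<alpha>" using sr tf_sup[OF b0 that] r by (intro mult_mono) auto
      finally show ?thesis using G0c_pos by (simp add: r_def)
    qed
    have "M1 * YB * s powr q1 = M1 * (s * r) powr q1 * (T powr (1 - q1 / real p) * Dc T p powr q1)"
      using s r by (simp add: YB_def r_def[symmetric] powr_mult)
    also have "\<dots> \<le> M1 * (s * r) powr q1 * (\<integral>t. norm (tf b0 t) powr q1 \<partial>M)"
      using M12 by (intro mult_left_mono tf_powr_integral(1) b0 q12) auto
    also have "\<dots> = (\<integral>t. M1 * (s * r) powr q1 * norm (tf b0 t) powr q1 \<partial>M)" by simp
    also have "\<dots> \<le> Bf u"
      unfolding Bf_def
    proof (rule integral_mono_AE)
      show "integrable M (\<lambda>t. M1 * (s * r) powr q1 * norm (tf b0 t) powr q1)" using tf_powr_integral(2)[OF b0 q12(1)] by simp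
      show "integrable M (\<lambda>t. H t (u t))" by (rule H_comp_integrable[OF S_continuous[OF uS]])
      show "AE t in M. M1 * (s * r) powr q1 * norm (tf b0 t) powr q1 \<le> H t (u t)"
        using H_low AE_space
      proof eventually_elim
        case (elim t)
        have "M1 * norm (u t) powr q1 \<le> H t (u t)" using elim small by simp
        moreover have "norm (u t) powr q1 = (s * r) powr q1 * norm (tf b0 t) powr q1"
          using sr by (simp add: u_eq abs_of_nonneg powr_mult)
        ultimately show ?case by (simp add: mult.assoc)
      qed
    qed
    finally show ?thesis .
  qed
  then have "lam * (M1 * YB * s powr q1) \<le> lam * Bf u" using lam by (intro mult_left_mono)
  moreover have "\<Psi> (X u) \<le> \<Psi> (s ^ p * XB)" by (rule \<Psi>_mono[OF X_nonneg X1])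
  ultimately show ?thesis by (simp add: J_def u_def)
qed

text \<open>The scaling \<delta> / \<open>G0c\<close> enters XB^(1/p) and YB^(1/q1) with the same
  first power and cancels, which is why \<delta> does not occur in \<open>Cstar\<close>.\<close>

lemma Cstar_eq:
  "Cstar T p \<alpha> M1 q1 Vs = (1 / (real p * (M1 * q1) powr (real p / (q1 - real p))) - M1 / (M1 * q1) powr (q1 / (q1 - real p)))
     * (XB powr (1 / real p) / YB powr (1 / q1)) powr (real p * q1 / (q1 - real p))"
proof -
  have p0: "0 < real p" using p by simp
  have r: "0 < \<delta> / G0c T p \<alpha>" using \<delta> G0c_pos by simp
  have DG: "0 < Dc T p ^ p + Gc T p \<alpha> ^ p" using Dc_pos Gc_pos by (simp add: add_pos_pos)
  have "XB powr (1 / real p) = (\<delta> / G0c T p \<alpha>) * ((max 1 Vs) powr (1 / real p) * (Dc T p ^ p + Gc T p \<alpha> ^ p) powr (1 / real p))"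
  proof -
    have "((\<delta> / G0c T p \<alpha>) ^ p) powr (1 / real p) = \<delta> / G0c T p \<alpha>"
    proof -
      have "real p * (1 / real p) = 1" using p0 by simp
      then show ?thesis unfolding powr_realpow[OF r, symmetric] powr_powr using r by (simp only: powr_one less_imp_le)
    qed
    then show ?thesis unfolding XB_def using r DG
      by (simp only: powr_mult zero_le_power less_imp_le mult_nonneg_nonneg max.coboundedI1 zero_le_one)
  qed
  moreover have "YB powr (1 / q1) = (\<delta> / G0c T p \<alpha>) * (T powr (1 / q1 - 1 / real p) * Dc T p)"
  proof -
    have "(1 - q1 / real p) * (1 / q1) = 1 / q1 - 1 / real p" using q12 p0 by (simp add: field_simps)
    moreover define r where "r = \<delta> / G0c T p \<alpha>"
    moreover have "0 < r" "0 < q1" using \<delta> G0c_pos q12 p0 by (auto simp: r_def)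
    ultimately show ?thesis unfolding YB_def r_def[symmetric] using Dc_pos T
      by (simp add: powr_mult powr_powr)
  qed
  ultimately have "XB powr (1 / real p) / YB powr (1 / q1)
      = (max 1 Vs) powr (1 / real p) * (Dc T p ^ p + Gc T p \<alpha> ^ p) powr (1 / real p) / (T powr (1 / q1 - 1 / real p) * Dc T p)"
    using \<delta> G0c_pos by simp
  then show ?thesis unfolding Cstar_def by simp
qed

text \<open>\<open>lam1\<close> makes the energy negative at the end of the ray. \<open>lam2\<close>
  bounds the Kirchhoff coefficient on the ray by lam^(1/q1), so that the energy there lies below a
  difference of two pure powers of s whose maximum is the asserted level.\<close>

theorem mountain_pass_solution:
  assumes lam1: "1 / (b * (real p)\<^sup>2) * (a + b * XB) ^ p / (M1 * YB) < lam"
    and lam2: "(a + b * XB) powr (q1 * (real p - 1)) \<le> lam"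
  obtains u w where "in_E T \<alpha> p u w" "continuous_on {0..T} u" "memLp M p w"
    "\<kappa> * A2 u w u w \<le> Cstar T p \<alpha> M1 q1 Vs * lam powr (- (real p - 1) / (q1 - real p))"
    "\<exists>t\<in>{0..T}. u t \<noteq> 0" "\<And>t. t \<in> {0..T} \<Longrightarrow> norm (u t) \<le> K * root p (A2 u w u w)"
    "\<And>v wv. in_E T \<alpha> p v wv \<Longrightarrow> integrable M (\<lambda>t. f t (u t) \<bullet> v t) \<and>
        (a + b * A2 u w u w) ^ (p - 1) * A2 u w v wv = lam * (\<integral>t. f t (u t) \<bullet> v t \<partial>M)"
proof -
  have p0: "0 < real p" using p by simp
  have q0: "0 < q1" using q12 p0 by linarith
  have aX: "0 < a + b * XB" using ab XB_pos by (simp add: add_pos_pos)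
  have lam_pos: "0 < lam"
  proof -
    have "0 < (a + b * XB) powr (q1 * (real p - 1))" using aX by simp
    then show ?thesis using lam2 by linarith
  qed
  obtain b0 :: 'a where b0: "norm b0 = 1" using norm_Basis nonempty_Basis by blast
  define e where "e = (\<delta> / G0c T p \<alpha>) *\<^sub>R tf b0"
  have eS: "e \<in> SS" unfolding e_def by (intro S_scale tf_S)
  define C where "C = Cstar T p \<alpha> M1 q1 Vs * lam powr (- (real p - 1) / (q1 - real p))"
  have ray: "J (s *\<^sub>R e) \<le> C" if s: "s \<in> {0..1}" for s
  proof -
    have s0: "0 \<le> s" "s \<le> 1" using s by auto
    have sX: "0 \<le> s ^ p * XB" "s ^ p * XB \<le> XB" using s0 XB_pos by (auto simp: mult_left_le_one_le power_le_one)
    have "(a + b * (s ^ p * XB)) ^ (p - 1) \<le> (a + b * XB) ^ (p - 1)"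
      using ab sX by (intro power_mono add_mono mult_left_mono) auto
    also have "\<dots> = ((a + b * XB) powr (q1 * (real p - 1))) powr (1 / q1)"
      using aX q0 p by (simp add: powr_powr powr_realpow[symmetric] of_nat_diff)
    also have "\<dots> \<le> lam powr (1 / q1)" using lam2 q0 by (intro powr_mono2) auto
    finally have coef: "(a + b * (s ^ p * XB)) ^ (p - 1) \<le> lam powr (1 / q1)" .
    have "\<Psi> (s ^ p * XB) \<le> (a + b * (s ^ p * XB)) ^ (p - 1) * (s ^ p * XB) / real p" by (rule \<Psi>_le[OF sX(1)])
    also have "\<dots> \<le> lam powr (1 / q1) * (s ^ p * XB) / real p"
      using coef sX p0 by (intro divide_right_mono mult_right_mono) auto
    finally have "\<Psi> (s ^ p * XB) \<le> lam powr (1 / q1) * (s ^ p * XB) / real p" .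
    moreover have "lam powr (1 / q1) * (s ^ p * XB) / real p = (lam powr (1 / q1) * XB) * s powr real p / real p"
    proof -
      have "s ^ p = s powr real p" using s0 p by (cases "s = 0") (auto simp: powr_realpow power_0_left)
      then show ?thesis by simp
    qed
    moreover have "lam * (M1 * YB * s powr q1) = (lam * M1 * YB) * s powr q1" by simp
    ultimately have "J (s *\<^sub>R e) \<le> (lam powr (1 / q1) * XB) * s powr real p / real p - (lam * M1 * YB) * s powr q1"
      using J_ray[OF b0 s] unfolding e_def by linarith
    also have "\<dots> \<le> (lam powr (1 / q1) * XB) powr (q1 / (q1 - real p)) *
        ((lam * M1 * YB * q1) powr (- (real p / (q1 - real p))) / real p - lam * M1 * YB * (lam * M1 * YB * q1) powr (- (q1 / (q1 - real p))))"
      using lam_pos XB_pos YB_pos M12 s0 q12 p0 by (intro power_diff_max) auto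
    also have "\<dots> = C"
      unfolding C_def Cstar_eq using lam_pos XB_pos YB_pos M12 q12 p0 by (intro mountain_level_constant) auto
    finally show ?thesis .
  qed
  have Je: "J e < 0"
  proof -
    have "J e \<le> \<Psi> XB - lam * (M1 * YB)" using J_ray[OF b0, of 1] by (simp add: e_def)
    moreover have "1 / (b * (real p)\<^sup>2) * (a + b * XB) ^ p < lam * (M1 * YB)"
      using lam1 mult_pos_pos[OF M12(1) YB_pos] by (simp only: pos_divide_less_eq)
    moreover have "\<Psi> XB \<le> 1 / (b * (real p)\<^sup>2) * (a + b * XB) ^ p"
      unfolding \<Psi>_def using ab by (simp add: divide_right_mono)
    ultimately show ?thesis by linarith
  qed
  obtain r0 where r0: "0 < r0" "\<And>u. u \<in> SS \<Longrightarrow> N u \<le> r0 \<Longrightarrow> a ^ (p - 1) / (2 * (real p)\<^sup>2) * N u ^ p \<le> J u"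
    using small_sphere by blast
  \<comment> \<open>The energy is nonnegative on the ball of radius \<open>r0\<close> but negative
    at \<open>e\<close>.\<close>
  have Ne: "r0 < N e"
  proof (rule ccontr)
    assume "\<not> r0 < N e"
    then have "a ^ (p - 1) / (2 * (real p)\<^sup>2) * N e ^ p \<le> J e" using r0(2)[OF eS] by simp
    moreover have "0 \<le> a ^ (p - 1) / (2 * (real p)\<^sup>2) * N e ^ p" using ab by (simp add: N_nonneg)
    ultimately show False using Je by linarith
  qed
  define \<rho> where "\<rho> = a ^ (p - 1) / (2 * (real p)\<^sup>2) * r0 ^ p"
  have \<rho>: "0 < \<rho>" using ab r0(1) p0 by (simp add: \<rho>_def)
  have J0: "J 0 \<le> 0"
  proof -
    have "A 0 0 = 0" by (rule A_zero[OF S_zero])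
    moreover have "Bf 0 = (\<integral>t. 0 \<partial>M)" unfolding Bf_def by (intro Bochner_Integration.integral_cong) (auto simp: H_zero)
    ultimately show ?thesis by (simp add: J_def X_def \<Psi>_def)
  qed
  have PS: "\<exists>u\<in>SS. \<rho> / 3 \<le> J u \<and> J u \<le> C \<and> (\<forall>v\<in>SS. \<bar>J' u v\<bar> \<le> \<epsilon> * N v)" if "0 < \<epsilon>" for \<epsilon>
    by (rule J.mountain_pass[OF eS less_imp_le[OF Je] J0 r0(1) Ne _ \<rho> ray that]) (use r0(2) in \<open>auto simp: \<rho>_def\<close>)
  have "0 < \<rho> / 3" using \<rho> by simp
  then show ?thesis
  proof (rule palais_smale_limit[OF _ PS])
    fix u w
    assume *: "in_E T \<alpha> p u w" "continuous_on {0..T} u" "memLp M p w" "\<kappa> * A2 u w u w \<le> C"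
      "\<exists>t\<in>{0..T}. u t \<noteq> 0" "\<And>t. t \<in> {0..T} \<Longrightarrow> norm (u t) \<le> K * root p (A2 u w u w)"
      "\<And>v wv. in_E T \<alpha> p v wv \<Longrightarrow> integrable M (\<lambda>t. f t (u t) \<bullet> v t) \<and>
        (a + b * A2 u w u w) ^ (p - 1) * A2 u w v wv = lam * (\<integral>t. f t (u t) \<bullet> v t \<partial>M)"
    show thesis by (rule that[OF *(1-3) *(4)[unfolded C_def] *(5-7)])
  qed
qed

end

section \<open>Existence of weak solutions\<close>

context kirchhoff_MP
begin

text \<open>The bracket in \<open>Cstar\<close> equals 1/p - 1/q1 divided by (M1
  q1)^(p/(q1-p)).\<close>

lemma Cstar_pos: "0 < Cstar T p \<alpha> M1 q1 Vs"
proof -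
  have p0: "0 < real p" using p by simp
  have q0: "0 < q1" using q12 p0 by linarith
  have Z: "0 < M1 * q1" using M12 q0 by simp
  have e: "q1 / (q1 - real p) = 1 + real p / (q1 - real p)" using q12 by (simp add: field_simps)
  have "M1 / (M1 * q1) powr (q1 / (q1 - real p)) = 1 / (q1 * (M1 * q1) powr (real p / (q1 - real p)))"
    unfolding e powr_add using M12 q0 by simp
  also have "\<dots> < 1 / (real p * (M1 * q1) powr (real p / (q1 - real p)))"
    using p0 q12 Z M12 q0 by (intro divide_strict_left_mono mult_strict_right_mono mult_pos_pos) auto
  finally show ?thesis unfolding Cstar_eq using XB_pos YB_pos by (intro mult_pos_pos) auto
qed

definition Kst :: real where
  "Kst = (real p)\<^sup>2 * \<theta> / (a ^ (p - 1) * (\<theta> - (real p)\<^sup>2)) * Cstar T p \<alpha> M1 q1 Vs"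

lemma Kst_pos: "0 < Kst"
  unfolding Kst_def using Cstar_pos \<theta> \<theta>_ge ab by (intro mult_pos_pos divide_pos_pos) auto

lemma Kst_eq: "Cstar T p \<alpha> M1 q1 Vs / \<kappa> = Kst"
proof -
  have "\<theta> > 0" using \<theta>_ge by linarith
  then have "1 / (real p)\<^sup>2 - 1 / \<theta> = (\<theta> - (real p)\<^sup>2) / ((real p)\<^sup>2 * \<theta>)"
    using \<theta>_ge by (simp add: diff_frac_eq)
  then show ?thesis unfolding Kst_def \<kappa>_def by (simp add: mult_ac)
qed

lemma Lambda1_ge: "1 / (b * (real p)\<^sup>2) * (a + b * XB) ^ p / (M1 * YB) \<le> Lambda1 T p \<alpha> a b \<delta> M1 M2 q1 q2 Vinf Vs"
proof -
  have "a + b * \<delta> ^ p / G0c T p \<alpha> ^ p * max 1 Vs * (Dc T p ^ p + Gc T p \<alpha> ^ p) = a + b * XB"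
    by (simp add: XB_def power_divide)
  moreover have "M1 * (\<delta> powr q1 / G0c T p \<alpha> powr q1) * T powr (1 - q1 / real p) * Dc T p powr q1 = M1 * YB"
    using \<delta> G0c_pos by (simp add: YB_def powr_divide)
  ultimately show ?thesis unfolding Lambda1_def by simp
qed

text \<open>In \<open>Lambda2\<close> the maximum carries the exponent p, which only enlarges it
  because max 1 Vs >= 1.\<close>

lemma Lambda2_ge: "(a + b * XB) powr (q1 * (real p - 1)) \<le> Lambda2 T p \<alpha> a b \<delta> q1 Vs"
proof -
  have q0: "0 < q1" using q12 p by (smt (verit) of_nat_0_le_iff)
  have "max 1 Vs \<le> max 1 Vs ^ p" using p power_increasing[of 1 p "max 1 Vs"] by simp
  then have "(\<delta> / G0c T p \<alpha>) ^ p * (max 1 Vs * (Dc T p ^ p + Gc T p \<alpha> ^ p)) \<le> (\<delta> / G0c T p \<alpha>) ^ p * (max 1 Vs ^ p * (Dc T p ^ p + Gc T p \<alpha> ^ p))"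
    using \<delta> G0c_pos Dc_pos Gc_pos by (intro mult_left_mono mult_right_mono) (auto simp: less_imp_le)
  then have "a + b * XB \<le> a + b * ((\<delta> / G0c T p \<alpha>) ^ p * (max 1 Vs ^ p * (Dc T p ^ p + Gc T p \<alpha> ^ p)))"
    unfolding XB_def using ab by simp
  also have "\<dots> = a + b * (max 1 Vs) ^ p * (\<delta> ^ p / G0c T p \<alpha> ^ p) * (Dc T p ^ p + Gc T p \<alpha> ^ p)"
    by (simp add: power_divide mult_ac)
  finally have "(a + b * XB) powr (q1 * (real p - 1)) \<le> (a + b * (max 1 Vs) ^ p * (\<delta> ^ p / G0c T p \<alpha> ^ p) * (Dc T p ^ p + Gc T p \<alpha> ^ p)) powr (q1 * (real p - 1))"
    using p q0 ab XB_pos by (intro powr_mono2) auto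
  then show ?thesis unfolding Lambda2_def using p by (simp add: of_nat_diff)
qed

text \<open>With e = (p-1)/(q1-p), \<open>Lambda3\<close> is the value of lam at which K times the
  p-th root of \<open>Kst\<close> lam^(-e) equals \<delta>/2. The cutoff demands \<delta>/2 in place
  of \<delta>, which explains the factor 2^p.\<close>

lemma Lambda3_small:
  assumes "Lambda3 T p \<alpha> a \<delta> q1 \<theta> (Cstar T p \<alpha> M1 q1 Vs) < lam"
  shows "K * root p (Kst * lam powr (- (real p - 1) / (q1 - real p))) \<le> \<delta> / 2"
proof -
  have p1: "1 < real p" using p by simp
  have p0: "0 < p" using p by simp
  define e where "e = (real p - 1) / (q1 - real p)"
  have e: "0 < e" using p1 q12 by (simp add: e_def)
  define B where "B = K ^ p * Kst * (2 / \<delta>) ^ p"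
  have B: "0 < B" using Kc_pos Kst_pos \<delta> by (simp add: B_def)
  have Kp: "T powr (real p * \<alpha> - 1) / (Gamma \<alpha> * (\<alpha> * q_conj p - q_conj p + 1) powr (1 / q_conj p)) ^ p = K ^ p"
  proof -
    have "(\<alpha> - 1 / real p) * real p = real p * \<alpha> - 1" using p0 by (simp add: field_simps)
    then have "(T powr (\<alpha> - 1 / real p)) ^ p = T powr (real p * \<alpha> - 1)"
      using T by (simp add: powr_realpow[symmetric] powr_powr)
    then show ?thesis unfolding Kc_def power_divide by simp
  qed
  have L: "Lambda3 T p \<alpha> a \<delta> q1 \<theta> (Cstar T p \<alpha> M1 q1 Vs) = B powr (1 / e)"
  proof -
    have "(real p)\<^sup>2 * \<theta> * Cstar T p \<alpha> M1 q1 Vs / (a ^ (p - 1) * (\<theta> - (real p)\<^sup>2)) = Kst" by (simp add: Kst_def)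
    moreover have "(2 / \<delta>) ^ p = 2 ^ p / \<delta> ^ p" by (simp add: power_divide)
    moreover have "(q1 - real p) / (real p - 1) = 1 / e" by (simp add: e_def)
    ultimately show ?thesis unfolding Lambda3_def B_def using Kp p by (simp add: of_nat_diff)
  qed
  have "B = (B powr (1 / e)) powr e" using B e by (simp add: powr_powr)
  also have "\<dots> \<le> lam powr e" using assms e unfolding L by (intro powr_mono2) auto
  finally have le: "B \<le> lam powr e" .
  have "Kst * lam powr (- e) = Kst / lam powr e" by (simp add: powr_minus_divide)
  also have "\<dots> \<le> Kst / B"
    using le B Kst_pos less_le_trans[OF B le] by (intro divide_left_mono mult_pos_pos) auto
  also have "\<dots> = (\<delta> / 2 / K) ^ p"
    using Kst_pos Kc_pos \<delta> by (simp add: B_def power_divide power_mult_distrib)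
  finally have "root p (Kst * lam powr (- e)) \<le> \<delta> / 2 / K"
    using p0 \<delta> Kc_pos real_root_le_mono[OF p0, of "Kst * lam powr (- e)" "(\<delta> / 2 / K) ^ p"] by (simp add: real_root_power_cancel)
  then have "K * root p (Kst * lam powr (- e)) \<le> K * (\<delta> / 2 / K)" using Kc_pos by (intro mult_left_mono) auto
  moreover have "- e = - (real p - 1) / (q1 - real p)" by (simp only: e_def minus_divide_left)
  ultimately show ?thesis using Kc_pos by simp
qed

lemma normVp_eq:
  assumes "memLp M p w" "memLp M p u" shows "normVp T V p u w = A2 u w u w"
  using LINT_eq_integral(1)[OF memLp_int[OF assms(1)]] LINT_eq_integral(1)[OF WV.weighted_integrable[OF memLp_int[OF assms(2)]]]
  by (simp add: normVp_def A2_def W1.Aw_self WV.Aw_self)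

lemma A2_eq_integral:
  assumes "memLp M p w" "memLp M p wv" "memLp M p u" "memLp M p v"
  shows "integral {0..T} (\<lambda>t. norm (w t) ^ (p - 2) * (w t \<bullet> wv t) + V t * norm (u t) ^ (p - 2) * (u t \<bullet> v t)) = A2 u w v wv"
proof -
  note i = W1.Aw_integrable[OF assms(1,2)] WV.Aw_integrable[OF assms(3,4)]
  have eq: "norm (w t) ^ (p - 2) * (w t \<bullet> wv t) + V t * norm (u t) ^ (p - 2) * (u t \<bullet> v t)
     = 1 * (jp p (w t) \<bullet> wv t) + V t * (jp p (u t) \<bullet> v t)" for t by (simp add: jp_def)
  show ?thesis unfolding eq LINT_eq_integral(1)[OF Bochner_Integration.integrable_add[OF i]]
    unfolding A2_def Aw_def by (rule Bochner_Integration.integral_add[OF i])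
qed

lemma weak_solution_exists:
  assumes grad: "AE t in M. \<forall>x. norm x \<le> \<delta> / 2 \<longrightarrow> f t x = gradF t x"
    and lam: "max (Lambda1 T p \<alpha> a b \<delta> M1 M2 q1 q2 Vinf Vs)
      (max (Lambda2 T p \<alpha> a b \<delta> q1 Vs) (Lambda3 T p \<alpha> a \<delta> q1 \<theta> (Cstar T p \<alpha> M1 q1 Vs))) < lam"
  shows "\<exists>u w. weak_sol T \<alpha> p a b V gradF \<delta> lam u w \<and> continuous_on {0..T} u \<and> (\<exists>t\<in>{0..T}. u t \<noteq> 0)
     \<and> 0 \<le> normVp T V p u w
     \<and> normVp T V p u w \<le> Kst * lam powr (- (real p - 1) / (q1 - real p))
     \<and> sup_norm T u \<le> K * (Kst * lam powr (- (real p - 1) / (q1 - real p))) powr (1 / real p)"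
proof -
  have p0: "0 < p" using p by simp
  have lam0: "0 < lam"
  proof -
    have "0 \<le> (a + b * XB) powr (q1 * (real p - 1))" by simp
    then show ?thesis using Lambda2_ge lam by linarith
  qed
  define C where "C = lam powr (- (real p - 1) / (q1 - real p))"
  have C: "0 < C" using lam0 by (simp add: C_def)
  have l1: "1 / (b * (real p)\<^sup>2) * (a + b * XB) ^ p / (M1 * YB) < lam" using Lambda1_ge lam by (meson le_less_trans max_less_iff_conj)
  have l2: "(a + b * XB) powr (q1 * (real p - 1)) \<le> lam" using Lambda2_ge lam by (meson le_less_trans max_less_iff_conj less_imp_le)
  have l3: "Lambda3 T p \<alpha> a \<delta> q1 \<theta> (Cstar T p \<alpha> M1 q1 Vs) < lam" using lam by simp
  obtain u w where u: "in_E T \<alpha> p u w" "continuous_on {0..T} u" "memLp M p w"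
    "\<kappa> * A2 u w u w \<le> Cstar T p \<alpha> M1 q1 Vs * C"
    "\<exists>t\<in>{0..T}. u t \<noteq> 0" "\<And>t. t \<in> {0..T} \<Longrightarrow> norm (u t) \<le> K * root p (A2 u w u w)"
    "\<And>v wv. in_E T \<alpha> p v wv \<Longrightarrow> integrable M (\<lambda>t. f t (u t) \<bullet> v t) \<and>
        (a + b * A2 u w u w) ^ (p - 1) * A2 u w v wv = lam * (\<integral>t. f t (u t) \<bullet> v t \<partial>M)"
  proof (rule mountain_pass_solution[OF l1 l2])
    fix u w
    assume *: "in_E T \<alpha> p u w" "continuous_on {0..T} u" "memLp M p w"
      "\<kappa> * A2 u w u w \<le> Cstar T p \<alpha> M1 q1 Vs * lam powr (- (real p - 1) / (q1 - real p))"
      "\<exists>t\<in>{0..T}. u t \<noteq> 0" "\<And>t. t \<in> {0..T} \<Longrightarrow> norm (u t) \<le> K * root p (A2 u w u w)"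
      "\<And>v wv. in_E T \<alpha> p v wv \<Longrightarrow> integrable M (\<lambda>t. f t (u t) \<bullet> v t) \<and>
        (a + b * A2 u w u w) ^ (p - 1) * A2 u w v wv = lam * (\<integral>t. f t (u t) \<bullet> v t \<partial>M)"
    show thesis by (rule that[OF *(1-3) *(4)[folded C_def] *(5-7)])
  qed
  have mu: "memLp M p u" by (rule continuous_memLp[OF u(2)])
  note nV = normVp_eq[OF u(3) mu]
  have Y0: "0 \<le> A2 u w u w"
    unfolding A2_def W1.Aw_self WV.Aw_self
    by (intro add_nonneg_nonneg integral_nonneg_AE AE_I2) (use WV.Wt_nonneg in auto)
  have "A2 u w u w \<le> Cstar T p \<alpha> M1 q1 Vs * C / \<kappa>" using u(4) \<kappa> by (simp add: pos_le_divide_eq mult.commute)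
  also have "\<dots> = Kst * C" unfolding Kst_eq[symmetric] by simp
  finally have YK: "A2 u w u w \<le> Kst * C" .
  have bound: "norm (u t) \<le> K * root p (Kst * C)" if "t \<in> {0..T}" for t
    using u(6)[OF that] mult_left_mono[OF real_root_le_mono[OF p0 YK] less_imp_le[OF Kc_pos]] by linarith
  have half: "norm (u t) \<le> \<delta> / 2" if "t \<in> {0..T}" for t
    using bound[OF that] Lambda3_small[OF l3] unfolding C_def by linarith
  \<comment> \<open>The two nonlinearities agree along u off a null set, so the integral with
    \<open>gradF\<close> takes over the value of the one with \<open>f\<close>.\<close>
  obtain Z where Z: "negligible Z" "\<And>t x. t \<in> {0..T} - Z \<Longrightarrow> norm x \<le> \<delta> / 2 \<Longrightarrow> f t x = gradF t x"
  proof -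
    have "AE t in lebesgue. t \<in> {0..T} \<longrightarrow> (\<forall>x. norm x \<le> \<delta> / 2 \<longrightarrow> f t x = gradF t x)"
      using grad by (subst (asm) AE_restrict_space_iff) auto
    then obtain Z where Z: "negligible Z" "{t. \<not> (t \<in> {0..T} \<longrightarrow> (\<forall>x. norm x \<le> \<delta> / 2 \<longrightarrow> f t x = gradF t x))} \<subseteq> Z"
      unfolding eventually_ae_filter_negligible by auto
    show ?thesis by (rule that[OF Z(1)]) (use Z(2) in blast)
  qed
  have "weak_sol T \<alpha> p a b V gradF \<delta> lam u w"
    unfolding weak_sol_def
  proof (intro conjI ballI allI impI)
    show "in_E T \<alpha> p u w" by (rule u(1))
    show "norm (u t) \<le> \<delta>" if "t \<in> {0..T}" for t using half[OF that] \<delta> by linarith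
    fix v wv :: "real \<Rightarrow> 'a" assume v: "in_E T \<alpha> p v wv"
    then have mv: "memLp M p v" "memLp M p wv" unfolding in_E_iff by auto
    have "integral {0..T} (\<lambda>t. gradF t (u t) \<bullet> v t) = integral {0..T} (\<lambda>t. f t (u t) \<bullet> v t)"
      by (rule integral_spike[OF Z(1)]) (use Z(2) half in auto)
    also have "\<dots> = (\<integral>t. f t (u t) \<bullet> v t \<partial>M)" using u(7)[OF v] by (intro LINT_eq_integral(1)) blast
    finally show "(a + b * normVp T V p u w) ^ (p - 1) *
          integral {0..T} (\<lambda>t. norm (w t) ^ (p - 2) * (w t \<bullet> wv t) + V t * norm (u t) ^ (p - 2) * (u t \<bullet> v t))
        = lam * integral {0..T} (\<lambda>t. gradF t (u t) \<bullet> v t)"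
      unfolding nV A2_eq_integral[OF u(3) mv(2) mu mv(1)] using u(7)[OF v] by simp
  qed
  moreover have "sup_norm T u \<le> K * (Kst * C) powr (1 / real p)"
  proof -
    have "root p (Kst * C) = (Kst * C) powr (1 / real p)" using Kst_pos C p0 by (intro root_powr_inverse) auto
    then show ?thesis unfolding sup_norm_def using bound T by (intro cSUP_least) auto
  qed
  ultimately show ?thesis using u(2,5) YK Y0 unfolding nV[symmetric] C_def by blast
qed

end

theorem theorem1p1:
  fixes T \<alpha> a b \<delta> q1 q2 M1 M2 \<beta> :: real
    and p :: nat
    and V :: "real \<Rightarrow> real"
    and F :: "real \<Rightarrow> 'a::euclidean_space \<Rightarrow> real"
    and gradF :: "real \<Rightarrow> 'a \<Rightarrow> 'a"
    and h g :: "real \<Rightarrow> real"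
  assumes T: "T > 0"
    and p: "p > 1"
    and alpha: "1 / real p < \<alpha>" "\<alpha> \<le> 1"
    and ab: "a > 0" "b > 0"
    and V_cont: "continuous_on {0..T} V"
    and V_pos: "Inf (V ` {0..T}) > 0"
    \<comment> \<open>(H0)\<close>
    and delta: "\<delta> > 0"
    and H0_C1: "AE t in lborel. t \<in> {0..T} \<longrightarrow>
        (\<forall>x\<in>cball 0 \<delta>. (F t has_derivative (\<lambda>y. gradF t x \<bullet> y)) (at x within cball 0 \<delta>))
        \<and> continuous_on (cball 0 \<delta>) (gradF t)"
    and H0_meas: "\<forall>x\<in>cball 0 \<delta>. (\<lambda>t. F t x) \<in> borel_measurable (lebesgue_on {0..T})"
    and h_cont: "continuous_on {0..} h" and h_nonneg: "\<forall>s\<ge>0. h s \<ge> 0"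
    and g_L1: "g integrable_on {0..T}" and g_nonneg: "\<forall>t\<in>{0..T}. g t \<ge> 0"
    and H0_bound: "AE t in lborel. t \<in> {0..T} \<longrightarrow>
        (\<forall>x\<in>cball 0 \<delta>. \<bar>F t x\<bar> \<le> h (norm x) * g t \<and> norm (gradF t x) \<le> h (norm x) * g t)"
    \<comment> \<open>(H1)\<close>
    and q1: "q1 > real p ^ 2" and q2: "real p ^ 2 < q2" "q2 < q1"
    and M: "M1 > 0" "M2 > 0"
    and H1: "AE t in lborel. t \<in> {0..T} \<longrightarrow>
        (\<forall>x. norm x \<le> \<delta> \<longrightarrow> M1 * norm x powr q1 \<le> F t x \<and> F t x \<le> M2 * norm x powr q2)"
    \<comment> \<open>(H2)\<close>
    and beta: "\<beta> > real p ^ 2"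
    and H2: "AE t in lborel. t \<in> {0..T} \<longrightarrow>
        (\<forall>x. norm x \<le> \<delta> \<longrightarrow> 0 \<le> \<beta> * F t x \<and> \<beta> * F t x \<le> gradF t x \<bullet> x)"
  defines "Vinf \<equiv> Inf (V ` {0..T})"
    and "Vsup \<equiv> Sup (V ` {0..T})"
    and "\<theta> \<equiv> min \<beta> q2"
    and "lam_star \<equiv> max (Lambda1 T p \<alpha> a b \<delta> M1 M2 q1 q2 (Inf (V ` {0..T})) (Sup (V ` {0..T})))
          (max (Lambda2 T p \<alpha> a b \<delta> q1 (Sup (V ` {0..T})))
               (Lambda3 T p \<alpha> a \<delta> q1 (min \<beta> q2) (Cstar T p \<alpha> M1 q1 (Sup (V ` {0..T})))))"
    and "K \<equiv> real p ^ 2 * min \<beta> q2 / (a ^ (p - 1) * (min \<beta> q2 - real p ^ 2))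
              * Cstar T p \<alpha> M1 q1 (Sup (V ` {0..T}))"
  shows "\<exists>U W :: real \<Rightarrow> real \<Rightarrow> 'a.
     (\<forall>lam>lam_star.
        weak_sol T \<alpha> p a b V gradF \<delta> lam (U lam) (W lam)
        \<and> continuous_on {0..T} (U lam)
        \<and> (\<exists>t\<in>{0..T}. U lam t \<noteq> 0)
        \<and> normVp T V p (U lam) (W lam) \<le> K * lam powr (- (real p - 1) / (q1 - real p))
        \<and> K * lam powr (- (real p - 1) / (q1 - real p)) \<le> K * lam_star powr (- (real p - 1) / (q1 - real p))
        \<and> sup_norm T (U lam) \<le> Kc T p \<alpha> * (K * lam powr (- (real p - 1) / (q1 - real p))) powr (1 / real p)
        \<and> Kc T p \<alpha> * (K * lam powr (- (real p - 1) / (q1 - real p))) powr (1 / real p)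
            \<le> Kc T p \<alpha> * (K * lam_star powr (- (real p - 1) / (q1 - real p))) powr (1 / real p))
     \<and> ((\<lambda>lam. normV T V p (U lam) (W lam)) \<longlongrightarrow> 0) at_top
     \<and> ((\<lambda>lam. sup_norm T (U lam)) \<longlongrightarrow> 0) at_top"
proof -
  have p2: "2 \<le> p" "1 < real p" using p by auto
  have psq: "2 * real p \<le> real p ^ 2" using p2 by (simp add: power2_eq_square)
  have pp: "real p < real p ^ 2" "2 < real p ^ 2" using psq p2 by linarith+
  have pq: "real p < q1" "real p < q2" "real p ^ 2 < min \<beta> q2" using pp q1 q2 beta by linarith+
  have bddV: "bdd_above (V ` {0..T})" "bdd_below (V ` {0..T})"
    using compact_imp_bounded[OF compact_continuous_image[OF V_cont compact_Icc]]
    by (auto intro: bounded_imp_bdd_above bounded_imp_bdd_below)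
  have Vb: "0 \<le> V t \<and> V t \<le> Vsup" if "t \<in> {0..T}" for t
    using cINF_lower[OF bddV(2) that] cSUP_upper[OF that bddV(1)] V_pos unfolding Vsup_def by linarith
  \<comment> \<open>The truncation does not involve lam, so a single one serves all
    parameters.\<close>
  obtain H f where Hf: "caratheodory T H f"
    "AE t in lebesgue_on {0..T}. \<forall>x. norm x \<le> \<delta> / 2 \<longrightarrow> f t x = gradF t x"
    "\<And>t x. t \<in> {0..T} \<Longrightarrow> 0 \<le> H t x \<and> H t x \<le> M2 * norm x powr q2"
    "\<And>t x. t \<in> {0..T} \<Longrightarrow> \<theta> * H t x \<le> f t x \<bullet> x"
    "AE t in lebesgue_on {0..T}. \<forall>x. norm x \<le> \<delta> \<longrightarrow> M1 * norm x powr q1 \<le> H t x"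
  proof (rule truncation[OF T delta H0_C1 H0_meas h_cont g_L1 g_nonneg H0_bound _ M _ H1 H2])
    show "2 < q2" using pp q2 by linarith
    show "0 < \<beta>" using pp beta by linarith
  qed (use that in \<open>auto simp: \<theta>_def\<close>)
  have MP: "kirchhoff_MP T \<alpha> p H f a b lam V Vsup \<theta> M1 M2 q1 q2 \<delta>" if "0 \<le> lam" for lam
  proof -
    interpret caratheodory T H f by (rule Hf(1))
    show ?thesis
      by unfold_locales (use T p2 alpha ab that V_cont Vb pq M delta Hf(3-5) in \<open>auto simp: \<theta>_def\<close>)
  qed
  \<comment> \<open>The instance lam = 0 gives access to constants such as \<open>Kst\<close> and
    \<open>XB\<close>, which do not depend on lam.\<close>
  interpret Q: kirchhoff_MP T \<alpha> p H f a b 0 V Vsup \<theta> M1 M2 q1 q2 \<delta> by (rule MP) simp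
  have K_eq: "K = Q.Kst" unfolding Q.Kst_def unfolding K_def \<theta>_def Vsup_def by simp
  have K0: "0 < K" unfolding K_eq by (rule Q.Kst_pos)
  \<comment> \<open>The negative power of lam decreases only on positive arguments, so
    \<open>lam_star\<close> must be positive; \<open>Lambda2\<close> ensures it.\<close>
  have ls0: "0 < lam_star"
  proof -
    have "0 < a + b * Q.XB" using ab Q.XB_pos by (intro add_pos_pos mult_pos_pos)
    then have "0 < (a + b * Q.XB) powr (q1 * (real p - 1))" by simp
    also note Q.Lambda2_ge
    finally show ?thesis unfolding lam_star_def Vsup_def by (simp add: less_max_iff_disj)
  qed
  define e where "e = - (real p - 1) / (q1 - real p)"
  have e: "e < 0" unfolding e_def using p2 pq by (intro divide_neg_pos) auto
  define Good where "Good lam u w \<longleftrightarrow> weak_sol T \<alpha> p a b V gradF \<delta> lam u w \<and> continuous_on {0..T} u \<and> (\<exists>t\<in>{0..T}. u t \<noteq> 0)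
     \<and> 0 \<le> normVp T V p u w \<and> normVp T V p u w \<le> K * lam powr e
     \<and> sup_norm T u \<le> Kc T p \<alpha> * (K * lam powr e) powr (1 / real p)" for lam and u w :: "real \<Rightarrow> 'a"
  have "\<exists>u w. Good lam u w" if "lam_star < lam" for lam
  proof -
    interpret L: kirchhoff_MP T \<alpha> p H f a b lam V Vsup \<theta> M1 M2 q1 q2 \<delta> by (rule MP) (use that ls0 in simp)
    have "K = L.Kst" unfolding L.Kst_def unfolding K_def \<theta>_def Vsup_def by simp
    then show ?thesis
      using L.weak_solution_exists[OF Hf(2), of "Inf (V ` {0..T})"] that
      unfolding Good_def e_def lam_star_def \<theta>_def Vsup_def by simp
  qed
  then obtain U W where UW: "\<And>lam. lam_star < lam \<Longrightarrow> Good lam (U lam) (W lam)" by metis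
  have mono: "K * lam powr e \<le> K * lam_star powr e" if "lam_star < lam" for lam
    using that ls0 e K0 by (intro mult_left_mono powr_mono2') auto
  have mono2: "Kc T p \<alpha> * (K * lam powr e) powr (1 / real p) \<le> Kc T p \<alpha> * (K * lam_star powr e) powr (1 / real p)" if "lam_star < lam" for lam
    using K0 Q.Kc_pos by (intro mult_left_mono powr_mono2[OF _ _ mono[OF that]]) auto
  have lim: "((\<lambda>lam. (K * lam powr e) powr (1 / real p)) \<longlongrightarrow> 0) at_top"
  proof (rule tendsto_zero_powrI[where b="1 / real p"])
    show "((\<lambda>lam. K * lam powr e) \<longlongrightarrow> 0) at_top"
      by (rule tendsto_mult_right_zero[OF tendsto_neg_powr[OF e filterlim_ident]])
  qed (use K0 p2 in \<open>auto intro!: always_eventually\<close>)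
  have ev: "eventually (\<lambda>lam. lam_star < lam) at_top" by (rule eventually_gt_at_top)
  have lim1: "((\<lambda>lam. normV T V p (U lam) (W lam)) \<longlongrightarrow> 0) at_top"
  proof (rule tendsto_sandwich[OF _ _ tendsto_const lim])
    show "eventually (\<lambda>lam. 0 \<le> normV T V p (U lam) (W lam)) at_top" by (simp add: normV_def)
    show "eventually (\<lambda>lam. normV T V p (U lam) (W lam) \<le> (K * lam powr e) powr (1 / real p)) at_top"
      using ev by eventually_elim (use UW in \<open>auto simp: normV_def Good_def intro!: powr_mono2\<close>)
  qed
  have lim2: "((\<lambda>lam. sup_norm T (U lam)) \<longlongrightarrow> 0) at_top"
  proof (rule tendsto_sandwich[OF _ _ tendsto_const tendsto_mult_right_zero[OF lim]])
    \<comment> \<open>A supremum dominates its members only if the set is bounded above; continuity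
      of \<open>U lam\<close> provides this.\<close>
    show "eventually (\<lambda>lam. 0 \<le> sup_norm T (U lam)) at_top"
      using ev
    proof eventually_elim
      case (elim lam)
      then have "continuous_on {0..T} (\<lambda>t. norm (U lam t))" using UW unfolding Good_def by (intro continuous_intros) blast
      then have "bdd_above ((\<lambda>t. norm (U lam t)) ` {0..T})"
        by (intro bounded_imp_bdd_above compact_imp_bounded compact_continuous_image) auto
      from cSUP_upper[OF _ this, of 0] show ?case using T unfolding sup_norm_def
        by (meson atLeastAtMost_iff less_imp_le norm_ge_zero order_refl order_trans)
    qed
    show "eventually (\<lambda>lam. sup_norm T (U lam) \<le> Kc T p \<alpha> * (K * lam powr e) powr (1 / real p)) at_top"
      using ev by eventually_elim (use UW in \<open>auto simp: Good_def\<close>)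
  qed
  show ?thesis
    unfolding e_def[symmetric]
    by (rule exI[of _ U], rule exI[of _ W]) (use UW mono mono2 lim1 lim2 in \<open>auto simp: Good_def\<close>)
qed

end
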